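(* Let $\rho\in(0,\infty)$, let $W$ be a standard Brownian motion and let $X^\rho=(X^\rho_t)_{t\in[0,1]}$ be the Riemann-Liouville process \[X^\rho_t:=\int_0^t (t-s)^{\rho-\frac12}\,dW_s,\qquad t\in[0,1],\] taken in a pathwise continuous modification and regarded as a centered Gaussian random vector with values in $H=L^2([0,1],dt)$. Then \[ e_n(X^\rho)\sim \pi^{-(\rho+\frac12)}(\rho+1/2)^{\rho}\Big(\frac{2\rho+1}{2\rho}\Big)^{1/2}\Gamma(\rho+1/2)\,(\log n)^{-\rho}\quad\text{as } n\to\infty.\]
   Context: For a random vector $X$ with values in a separable Hilbert space $(H,\|\cdot\|)$ with ${\mathbb E}\|X\|^2<\infty$, the minimal $n$th $L^2$-quantization error is $e_n(X):=\inf\{({\mathbb E}\min_{a\in\alpha}\|X-a\|^2)^{1/2}:\alpha\subset H,\ \mathrm{card}(\alpha)\le n\}$. Here $H=L^2([0,1],dt)$ with its usual norm. The notation $a_n\sim b_n$ means $a_n/b_n\to1$. *)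

theory Defs
  imports "HOL-Probability.Probability" "HOL-Library.Landau_Symbols"
begin

definition brownian_motion :: "'a measure \<Rightarrow> (real \<Rightarrow> 'a \<Rightarrow> real) \<Rightarrow> bool" where
  "brownian_motion M W \<longleftrightarrow>
     prob_space M \<and>
     (\<forall>t\<in>{0..1}. W t \<in> borel_measurable M) \<and>
     (AE \<omega> in M. W 0 \<omega> = 0) \<and>
     (\<forall>\<omega>\<in>space M. continuous_on {0..1} (\<lambda>t. W t \<omega>)) \<and>
     (\<forall>s t. 0 \<le> s \<longrightarrow> s < t \<longrightarrow> t \<le> 1 \<longrightarrow>
        distributed M lborel (\<lambda>\<omega>. W t \<omega> - W s \<omega>)
          (\<lambda>x. ennreal (normal_density 0 (sqrt (t - s)) x))) \<and>
     (\<forall>ts :: real list. sorted_wrt (<) ts \<longrightarrow> set ts \<subseteq> {0..1} \<longrightarrow>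
        prob_space.indep_vars M (\<lambda>_. borel)
          (\<lambda>i \<omega>. W (ts ! Suc i) \<omega> - W (ts ! i) \<omega>) {..<length ts - 1})"

definition is_partition :: "real \<Rightarrow> real \<Rightarrow> real list \<Rightarrow> bool" where
  "is_partition a b p \<longleftrightarrow> sorted p \<and> length p \<ge> 2 \<and> hd p = a \<and> last p = b"

definition step_fun :: "real list \<Rightarrow> (nat \<Rightarrow> real) \<Rightarrow> real \<Rightarrow> real" where
  "step_fun p c s = (\<Sum>i<length p - 1. if p ! i \<le> s \<and> s < p ! Suc i then c i else 0)"

definition simple_wiener :: "(real \<Rightarrow> 'a \<Rightarrow> real) \<Rightarrow> real list \<Rightarrow> (nat \<Rightarrow> real) \<Rightarrow> 'a \<Rightarrow> real" where
  "simple_wiener W p c \<omega> = (\<Sum>i<length p - 1. c i * (W (p ! Suc i) \<omega> - W (p ! i) \<omega>))"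

definition wiener_integral ::
  "'a measure \<Rightarrow> (real \<Rightarrow> 'a \<Rightarrow> real) \<Rightarrow> (real \<Rightarrow> real) \<Rightarrow> real \<Rightarrow> real \<Rightarrow> ('a \<Rightarrow> real) \<Rightarrow> bool" where
  "wiener_integral M W f a b Y \<longleftrightarrow>
     Y \<in> borel_measurable M \<and> integrable M (\<lambda>\<omega>. (Y \<omega>)\<^sup>2) \<and>
     (\<forall>(P :: nat \<Rightarrow> real list) (C :: nat \<Rightarrow> nat \<Rightarrow> real).
        (\<forall>k. is_partition a b (P k)) \<longrightarrow>
        (\<forall>k. set_integrable lborel {a..b} (\<lambda>s. (f s - step_fun (P k) (C k) s)\<^sup>2)) \<longrightarrow>
        (\<lambda>k. LINT s:{a..b}|lborel. (f s - step_fun (P k) (C k) s)\<^sup>2) \<longlonglongrightarrow> 0 \<longrightarrow>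
        (\<lambda>k. \<integral>\<omega>. (Y \<omega> - simple_wiener W (P k) (C k) \<omega>)\<^sup>2 \<partial>M) \<longlonglongrightarrow> 0)"

definition L2_01 :: "(real \<Rightarrow> real) set" where
  "L2_01 = {a. a \<in> borel_measurable lborel \<and> set_integrable lborel {0..1} (\<lambda>t. (a t)\<^sup>2)}"

definition L2_dist_sq :: "(real \<Rightarrow> real) \<Rightarrow> (real \<Rightarrow> real) \<Rightarrow> real" where
  "L2_dist_sq x a = (LINT t:{0..1}|lborel. (x t - a t)\<^sup>2)"

definition quant_error :: "'a measure \<Rightarrow> (real \<Rightarrow> 'a \<Rightarrow> real) \<Rightarrow> nat \<Rightarrow> real" where
  "quant_error M X n = sqrt (enn2real
     (INF \<alpha> \<in> {\<alpha>. finite \<alpha> \<and> \<alpha> \<noteq> {} \<and> card \<alpha> \<le> n \<and> \<alpha> \<subseteq> L2_01}.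
        \<integral>\<^sup>+ \<omega>. ennreal (Min ((\<lambda>a. L2_dist_sq (\<lambda>t. X t \<omega>) a) ` \<alpha>)) \<partial>M))"

end

theory Submission
  imports Defs "HOL-Complex_Analysis.Complex_Analysis" "HOL-Real_Asymp.Real_Asymp"
begin

text \<open>
  Put \<open>\<alpha> = \<rho> + 1/2\<close>. Expanding the white noise in the trigonometric basis of \<open>L\<^sup>2[0,1]\<close>, with independent
  standard normal coordinates \<open>\<zeta>\<^sub>j\<close>, gives \<open>X = \<Sum>\<^sub>j c\<^sub>j \<zeta>\<^sub>j\<close>, where \<open>c\<^sub>j\<close> is the image of the \<open>j\<close>th basis function under
  the kernel \<open>(t - s)\<^sub>+\<^bsup>\<alpha>-1\<^esup>\<close>. Replacing this kernel by the 1-periodisation of \<open>x\<^bsup>\<alpha>-1\<^esup> e\<^bsup>-x\<^esup>\<close>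
  yields a process \<open>Y\<close> which is diagonal up to a phase shift of the basis, with the explicit eigenvalues
  \<open>\<Gamma>(\<alpha>)\<^sup>2 (1 + 4 \<pi>\<^sup>2 l\<^sup>2)\<^bsup>-\<alpha>\<^esup>\<close>, each of multiplicity two for \<open>l \<ge> 1\<close>. So no spectral asymptotics are needed.

  The difference \<open>Y - X\<close> has a kernel made of holomorphic functions with a power singularity at a corner or
  along the diagonal boundary; piecewise Taylor polynomials give low-rank approximations, and quantising
  the resulting coefficients on a grid shows that \<open>Y - X\<close> can be coded at a rate \<open>o(log n)\<close> with a
  distortion of smaller order. Hence \<open>X\<close> and \<open>Y\<close> have the same quantisation asymptotics.

  For \<open>Y\<close> the squared error is the reverse water-filling distortion. The lower bound tests the codebook
  against Gaussian weights and uses \<open>ln F \<le> F/n - 1 + ln n\<close>; the upper bound chooses codewords at random with the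
  law of the optimal test channel. Since the \<open>j\<close>th eigenvalue is \<open>\<sim> \<Gamma>(\<alpha>)\<^sup>2 (\<pi> j)\<^bsup>-2\<alpha>\<^esup>\<close>, keeping \<open>d\<close> coordinates
  costs \<open>\<alpha> d + o(d)\<close> nats and leaves the distortion \<open>\<Gamma>(\<alpha>)\<^sup>2 \<pi>\<^bsup>-2\<alpha>\<^esup> (2\<alpha>/(2\<alpha>-1)) d\<^bsup>1-2\<alpha>\<^esup>\<close>; put \<open>d = log n / \<alpha>\<close>.
\<close>

section \<open>Square-integrable processes and their codebooks\<close>

text \<open>The factor e^(-x) is there because the bare power cannot be periodised; it leaves the
  diagonal singularity intact to first order, x^(\<alpha> - 1) (1 - e^(-x)) being of order
  x^\<alpha>. The first translate is singular only at the corner t = 0, s = 1, which costs less than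
  a line. So a rank-b approximation of the difference has squared error of order b^(1/2 - 2
  \<alpha>) against the main distortion d^(1 - 2 \<alpha>), and b may be taken as a power of d below
  the first. All coding is done for sums over j < N with bounds uniform in N; the truncation is
  chosen only after the rate is fixed. The hypothesis on X speaks only of L2 limits of simple
  integrals. The coordinates are therefore built separately, as almost sure limits of dyadic sums of
  W, and X is compared with them at dyadic times, where both are limits of sums over the same
  increments. Completeness of the trigonometric system is required only for the functions (t -
  s)^(\<alpha> - 1) cut off at t, and is obtained from the sawtooth wave and the value \<pi>^2 / 6
  of Euler's series.\<close>

definition sq_int :: "'b measure \<Rightarrow> ('b \<Rightarrow> real) \<Rightarrow> bool" where
  "sq_int M f \<longleftrightarrow> f \<in> borel_measurable M \<and> integrable M (\<lambda>x. (f x)\<^sup>2)"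

lemma sq_int_sq: "sq_int M f \<Longrightarrow> integrable M (\<lambda>x. (f x)\<^sup>2)"
  by (simp add: sq_int_def)

lemma sq_int_mult:
  assumes "sq_int M f" "sq_int M g"
  shows "integrable M (\<lambda>x. f x * g x)"
proof (rule Bochner_Integration.integrable_bound)
  show "integrable M (\<lambda>x. (f x)\<^sup>2 + (g x)\<^sup>2)"
    using assms by (auto simp: sq_int_def)
  show "(\<lambda>x. f x * g x) \<in> borel_measurable M"
    using assms by (auto simp: sq_int_def)
  show "AE x in M. norm (f x * g x) \<le> norm ((f x)\<^sup>2 + (g x)\<^sup>2)"
  proof (rule AE_I2)
    fix x
    have "2 * \<bar>f x\<bar> * \<bar>g x\<bar> \<le> (f x)\<^sup>2 + (g x)\<^sup>2"
      using sum_squares_bound[of "\<bar>f x\<bar>" "\<bar>g x\<bar>"] by simp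
    moreover have "0 \<le> \<bar>f x\<bar> * \<bar>g x\<bar>" by simp
    ultimately have "\<bar>f x\<bar> * \<bar>g x\<bar> \<le> (f x)\<^sup>2 + (g x)\<^sup>2" by linarith
    then show "norm (f x * g x) \<le> norm ((f x)\<^sup>2 + (g x)\<^sup>2)"
      by (simp add: abs_mult)
  qed
qed

lemma sq_int_add:
  assumes "sq_int M f" "sq_int M g"
  shows "sq_int M (\<lambda>x. f x + g x)"
proof -
  have "integrable M (\<lambda>x. (f x)\<^sup>2 + (g x)\<^sup>2 + 2 * (f x * g x))"
    using assms sq_int_mult[OF assms] by (auto simp: sq_int_def)
  then show ?thesis
    using assms by (auto simp: sq_int_def power2_sum mult.assoc)
qed

lemma sq_int_cmult: "sq_int M f \<Longrightarrow> sq_int M (\<lambda>x. c * f x)"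
  by (auto simp: sq_int_def power_mult_distrib)

lemma sq_int_multc: "sq_int M f \<Longrightarrow> sq_int M (\<lambda>x. f x * c)"
  by (auto simp: sq_int_def power_mult_distrib)

lemma sq_int_diff:
  assumes "sq_int M f" "sq_int M g"
  shows "sq_int M (\<lambda>x. f x - g x)"
  using sq_int_add[OF assms(1) sq_int_cmult[OF assms(2), of "-1"]] by simp

lemma sq_int_zero: "sq_int M (\<lambda>x. 0)"
  by (simp add: sq_int_def)

lemma sq_int_sum: "(\<And>i. i \<in> I \<Longrightarrow> sq_int M (f i)) \<Longrightarrow> sq_int M (\<lambda>x. \<Sum>i\<in>I. f i x)"
  by (induction I rule: infinite_finite_induct) (auto simp: sq_int_zero intro: sq_int_add)

lemma (in finite_measure) sq_int_bounded:
  assumes "f \<in> borel_measurable M" "\<And>x. x \<in> space M \<Longrightarrow> \<bar>f x\<bar> \<le> B"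
  shows "sq_int M f"
proof -
  have "integrable M (\<lambda>x. (f x)\<^sup>2)"
  proof (rule integrable_const_bound[where B = "B\<^sup>2"])
    show "AE x in M. norm ((f x)\<^sup>2) \<le> B\<^sup>2"
    proof (rule AE_I2)
      fix x assume "x \<in> space M"
      then have "\<bar>f x\<bar>^2 \<le> B^2" using assms(2)[of x] by (intro power_mono) auto
      then show "norm ((f x)\<^sup>2) \<le> B\<^sup>2" by simp
    qed
  qed (use assms in auto)
  with assms show ?thesis by (auto simp: sq_int_def)
qed

lemma (in finite_measure) sq_int_integrable:
  assumes "sq_int M f" shows "integrable M f"
  using sq_int_mult[OF assms, of "\<lambda>_. 1"] sq_int_bounded[of "\<lambda>_. 1" 1] by simp

lemma integral_cauchy_schwarz:
  assumes "sq_int M f" "sq_int M g"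
  shows "(\<integral>x. f x * g x \<partial>M)\<^sup>2 \<le> (\<integral>x. (f x)\<^sup>2 \<partial>M) * (\<integral>x. (g x)\<^sup>2 \<partial>M)"
proof -
  let ?a = "\<integral>x. (f x)\<^sup>2 \<partial>M" and ?b = "\<integral>x. f x * g x \<partial>M" and ?c = "\<integral>x. (g x)\<^sup>2 \<partial>M"
  have q: "0 \<le> ?a * s\<^sup>2 + 2 * ?b * s * t + ?c * t\<^sup>2" for s t
  proof -
    have "0 \<le> (\<integral>x. (s * f x + t * g x)\<^sup>2 \<partial>M)" by simp
    also have "\<dots> = (\<integral>x. s\<^sup>2 * (f x)\<^sup>2 + (2 * s * t) * (f x * g x) + t\<^sup>2 * (g x)\<^sup>2 \<partial>M)"
      by (simp add: power2_sum power_mult_distrib algebra_simps)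
    also have "\<dots> = s\<^sup>2 * ?a + (2 * s * t) * ?b + t\<^sup>2 * ?c"
      using sq_int_sq[OF assms(1)] sq_int_sq[OF assms(2)] sq_int_mult[OF assms] by simp
    finally show ?thesis by (simp add: algebra_simps)
  qed
  have "?a \<ge> 0" "?c \<ge> 0" by simp_all
  show ?thesis
  proof (cases "?c = 0")
    case True
    have "?b = 0"
    proof (rule ccontr)
      assume "?b \<noteq> 0"
      \<comment> \<open>The last argument is chosen to make the form equal to a - (a + 1) =
        -1.\<close>
      have "0 \<le> ?a * 1\<^sup>2 + 2 * ?b * 1 * (-(?a + 1) / (2 * ?b)) + ?c * (-(?a + 1) / (2 * ?b))\<^sup>2"
        by (rule q)
      with True \<open>?b \<noteq> 0\<close> show False by simp
    qed
    with True show ?thesis by simp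
  next
    case False
    have "0 \<le> ?a * ?c\<^sup>2 + 2 * ?b * ?c * (- ?b) + ?c * (- ?b)\<^sup>2" by (rule q)
    also have "\<dots> = ?c * (?a * ?c - ?b\<^sup>2)" by (simp add: power2_eq_square algebra_simps)
    finally show ?thesis using False \<open>?c \<ge> 0\<close> by (simp add: zero_le_mult_iff)
  qed
qed

section \<open>Orthonormal systems and Bessel's inequality\<close>

definition orthonormal_on :: "'b measure \<Rightarrow> (nat \<Rightarrow> 'b \<Rightarrow> real) \<Rightarrow> nat set \<Rightarrow> bool" where
  "orthonormal_on M e J \<longleftrightarrow> (\<forall>j\<in>J. sq_int M (e j)) \<and>
     (\<forall>i\<in>J. \<forall>j\<in>J. (\<integral>x. e i x * e j x \<partial>M) = (if i = j then 1 else 0))"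

lemma orthonormal_inner_sum:
  assumes "orthonormal_on M e J" "finite J" "i \<in> J"
  shows "(\<integral>x. (\<Sum>j\<in>J. a j * e j x) * e i x \<partial>M) = a i"
proof -
  have "(\<integral>x. (\<Sum>j\<in>J. a j * e j x) * e i x \<partial>M) = (\<integral>x. (\<Sum>j\<in>J. a j * (e j x * e i x)) \<partial>M)"
    by (simp add: sum_distrib_right mult.assoc)
  also have "\<dots> = (\<Sum>j\<in>J. a j * (\<integral>x. e j x * e i x \<partial>M))"
    using assms by (subst Bochner_Integration.integral_sum) (auto simp: orthonormal_on_def intro!: sq_int_mult)
  also have "\<dots> = (\<Sum>j\<in>J. if j = i then a j else 0)"
    using assms by (intro sum.cong) (auto simp: orthonormal_on_def)
  finally show ?thesis using assms by simp
qed

text \<open>Pythagoras with arbitrary coefficients \<open>a\<close>, not only the Fourier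
  coefficients. It serves in three ways: with the optimal \<open>a\<close> it gives Bessel's
  inequality, with \<open>f = 0\<close> the norm of a finite combination, and with \<open>a\<close>
  free the exact distance between a codeword and a source point.\<close>

lemma orthonormal_expand:
  assumes e: "orthonormal_on M e J" "finite J" and f: "sq_int M f"
  shows "(\<integral>x. (f x - (\<Sum>j\<in>J. a j * e j x))\<^sup>2 \<partial>M) =
    (\<integral>x. (f x)\<^sup>2 \<partial>M) - (\<Sum>j\<in>J. (\<integral>x. f x * e j x \<partial>M)\<^sup>2) + (\<Sum>j\<in>J. ((\<integral>x. f x * e j x \<partial>M) - a j)\<^sup>2)"
proof -
  let ?S = "\<lambda>x. \<Sum>j\<in>J. a j * e j x"
  have S: "sq_int M ?S"
    using e by (intro sq_int_sum sq_int_cmult) (auto simp: orthonormal_on_def)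
  have ej: "\<And>j. j \<in> J \<Longrightarrow> sq_int M (e j)" using e by (auto simp: orthonormal_on_def)
  have fS: "(\<integral>x. f x * ?S x \<partial>M) = (\<Sum>j\<in>J. a j * (\<integral>x. f x * e j x \<partial>M))"
  proof -
    have "(\<integral>x. f x * ?S x \<partial>M) = (\<integral>x. (\<Sum>j\<in>J. a j * (f x * e j x)) \<partial>M)"
      by (simp add: sum_distrib_left algebra_simps)
    also have "\<dots> = (\<Sum>j\<in>J. a j * (\<integral>x. f x * e j x \<partial>M))"
      using ej f by (subst Bochner_Integration.integral_sum) (auto intro!: sq_int_mult)
    finally show ?thesis .
  qed
  have SS: "(\<integral>x. (?S x)\<^sup>2 \<partial>M) = (\<Sum>j\<in>J. (a j)\<^sup>2)"
  proof -
    have "(\<integral>x. (?S x)\<^sup>2 \<partial>M) = (\<integral>x. (\<Sum>i\<in>J. a i * (?S x * e i x)) \<partial>M)"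
      by (simp add: power2_eq_square sum_distrib_left algebra_simps)
    also have "\<dots> = (\<Sum>i\<in>J. a i * (\<integral>x. ?S x * e i x \<partial>M))"
      using ej S by (subst Bochner_Integration.integral_sum) (auto intro!: sq_int_mult)
    also have "\<dots> = (\<Sum>i\<in>J. a i * a i)"
      using orthonormal_inner_sum[OF e] by (intro sum.cong) auto
    finally show ?thesis by (simp add: power2_eq_square)
  qed
  have "(\<integral>x. (f x - ?S x)\<^sup>2 \<partial>M) = (\<integral>x. (f x)\<^sup>2 - 2 * (f x * ?S x) + (?S x)\<^sup>2 \<partial>M)"
    by (simp add: power2_diff algebra_simps)
  also have "\<dots> = (\<integral>x. (f x)\<^sup>2 \<partial>M) - 2 * (\<integral>x. f x * ?S x \<partial>M) + (\<integral>x. (?S x)\<^sup>2 \<partial>M)"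
    using sq_int_sq[OF f] sq_int_sq[OF S] sq_int_mult[OF f S] by simp
  also have "\<dots> = (\<integral>x. (f x)\<^sup>2 \<partial>M) - (\<Sum>j\<in>J. (\<integral>x. f x * e j x \<partial>M)\<^sup>2) + (\<Sum>j\<in>J. ((\<integral>x. f x * e j x \<partial>M) - a j)\<^sup>2)"
    unfolding fS SS by (simp add: power2_diff sum.distrib sum_subtractf sum_distrib_left algebra_simps)
  finally show ?thesis .
qed

lemma bessel_inequality:
  assumes "orthonormal_on M e J" "finite J" "sq_int M f"
  shows "(\<Sum>j\<in>J. (\<integral>x. f x * e j x \<partial>M)\<^sup>2) \<le> (\<integral>x. (f x)\<^sup>2 \<partial>M)"
proof -
  have "0 \<le> (\<integral>x. (f x - (\<Sum>j\<in>J. (\<integral>x. f x * e j x \<partial>M) * e j x))\<^sup>2 \<partial>M)" by simp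
  then show ?thesis using orthonormal_expand[OF assms, of "\<lambda>j. (\<integral>x. f x * e j x \<partial>M)"] by simp
qed

section \<open>The unit interval as a probability space, processes and codebooks\<close>

abbreviation U01 :: "real measure" where "U01 \<equiv> restrict_space lborel {0..1}"

lemma prob_space_U01: "prob_space U01"
  by (rule prob_space_restrict_space) auto

lemma L2_dist_sq_U01: "L2_dist_sq x a = (\<integral>t. (x t - a t)\<^sup>2 \<partial>U01)"
  unfolding L2_dist_sq_def set_lebesgue_integral_def by (subst integral_restrict_space) auto

lemma L2_01_sq_int: "a \<in> L2_01 \<longleftrightarrow> a \<in> borel_measurable lborel \<and> sq_int U01 a"
  unfolding L2_01_def sq_int_def set_integrable_def
  by (auto simp: integrable_restrict_space intro!: measurable_restrict_space1)

text \<open>Joint measurability is part of the notion because distances to codewords must be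
  measurable in the random point and because the order of integration is exchanged later. The random
  point is the first argument, unlike in \<open>X\<close>.\<close>

definition L2_process :: "'a measure \<Rightarrow> ('a \<Rightarrow> real \<Rightarrow> real) \<Rightarrow> bool" where
  "L2_process M Z \<longleftrightarrow> (\<lambda>(w, t). Z w t) \<in> borel_measurable (M \<Otimes>\<^sub>M U01) \<and> (\<forall>w\<in>space M. sq_int U01 (Z w))"

lemma L2_process_add:
  "L2_process M Z \<Longrightarrow> L2_process M Z' \<Longrightarrow> L2_process M (\<lambda>w t. Z w t + Z' w t)"
  unfolding L2_process_def by (auto simp: case_prod_unfold intro!: sq_int_add)

lemma L2_process_diff:
  "L2_process M Z \<Longrightarrow> L2_process M Z' \<Longrightarrow> L2_process M (\<lambda>w t. Z w t - Z' w t)"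
  unfolding L2_process_def by (auto simp: case_prod_unfold intro!: sq_int_diff)

lemma L2_process_linear:
  assumes "\<And>j. j \<in> J \<Longrightarrow> \<xi> j \<in> borel_measurable M" "\<And>j. j \<in> J \<Longrightarrow> sq_int U01 (c j)"
  shows "L2_process M (\<lambda>w t. \<Sum>j\<in>J. c j t * \<xi> j w)"
proof -
  have "(\<lambda>p. c j (snd p) * \<xi> j (fst p)) \<in> borel_measurable (M \<Otimes>\<^sub>M U01)" if "j \<in> J" for j
  proof -
    have [measurable]: "\<xi> j \<in> borel_measurable M" "c j \<in> borel_measurable U01"
      using assms that by (auto simp: sq_int_def)
    show ?thesis by measurable
  qed
  then show ?thesis
    unfolding L2_process_def case_prod_unfold
    using assms by (auto intro!: sq_int_sum sq_int_multc borel_measurable_sum)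
qed

lemma L2_process_dist_measurable:
  assumes "L2_process M Z" "a \<in> L2_01"
  shows "(\<lambda>w. L2_dist_sq (Z w) a) \<in> borel_measurable M"
proof -
  interpret prob_space U01 by (rule prob_space_U01)
  have [measurable]: "a \<in> borel_measurable U01" using assms(2) by (auto simp: L2_01_sq_int sq_int_def)
  have [measurable]: "(\<lambda>p. Z (fst p) (snd p)) \<in> borel_measurable (M \<Otimes>\<^sub>M U01)"
    using assms(1) by (auto simp: L2_process_def case_prod_unfold)
  have "(\<lambda>p. (Z (fst p) (snd p) - a (snd p))\<^sup>2) \<in> borel_measurable (M \<Otimes>\<^sub>M U01)"
    by measurable
  then have "(\<lambda>w. \<integral>t. (Z w t - a t)\<^sup>2 \<partial>U01) \<in> borel_measurable M"
    by (intro borel_measurable_lebesgue_integral) (simp add: case_prod_unfold)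
  then show ?thesis by (simp add: L2_dist_sq_U01)
qed

definition quant_dist :: "(real \<Rightarrow> real) set \<Rightarrow> (real \<Rightarrow> real) \<Rightarrow> real" where
  "quant_dist A x = Min ((\<lambda>a. L2_dist_sq x a) ` A)"

definition codebook :: "(real \<Rightarrow> real) set \<Rightarrow> bool" where
  "codebook A \<longleftrightarrow> finite A \<and> A \<noteq> {} \<and> A \<subseteq> L2_01"

lemma quant_dist_nonneg: "codebook A \<Longrightarrow> quant_dist A x \<ge> 0"
  unfolding quant_dist_def codebook_def by (auto simp: L2_dist_sq_U01)

lemma quant_dist_le: "codebook A \<Longrightarrow> a \<in> A \<Longrightarrow> quant_dist A x \<le> L2_dist_sq x a"
  unfolding quant_dist_def codebook_def by auto

lemma quant_dist_attained: "codebook A \<Longrightarrow> \<exists>a\<in>A. quant_dist A x = L2_dist_sq x a"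
  unfolding quant_dist_def codebook_def using Min_in[of "(\<lambda>a. L2_dist_sq x a) ` A"] by fastforce

lemma quant_dist_measurable:
  assumes "L2_process M Z" "codebook A"
  shows "(\<lambda>w. quant_dist A (Z w)) \<in> borel_measurable M"
  unfolding quant_dist_def using assms
  by (intro borel_measurable_Min) (auto simp: codebook_def intro!: L2_process_dist_measurable)

text \<open>The size bound is real, so that sizes such as
  \<open>exp ((\<alpha> + \<kappa>) * real m)\<close> need no rounding. A negative \<open>v\<close>
  is read by \<open>ennreal\<close> as 0, which explains the side conditions
  \<open>v \<ge> 0\<close> below.\<close>

definition codeable :: "'a measure \<Rightarrow> ('a \<Rightarrow> real \<Rightarrow> real) \<Rightarrow> real \<Rightarrow> real \<Rightarrow> bool" where
  "codeable M Z n v \<longleftrightarrow> (\<exists>A. codebook A \<and> real (card A) \<le> n \<and>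
     (\<integral>\<^sup>+w. ennreal (quant_dist A (Z w)) \<partial>M) \<le> ennreal v)"

lemma codeable_mono: "codeable M Z n v \<Longrightarrow> n \<le> n' \<Longrightarrow> v \<le> v' \<Longrightarrow> codeable M Z n' v'"
  unfolding codeable_def by (meson order_trans ennreal_leI)

lemma square_sum_le:
  fixes x y \<epsilon> :: real
  assumes "\<epsilon> > 0"
  shows "(x + y)\<^sup>2 \<le> (1 + \<epsilon>) * x\<^sup>2 + (1 + 1/\<epsilon>) * y\<^sup>2"
proof -
  have "0 \<le> (\<epsilon> * x - y)\<^sup>2 / \<epsilon>" using assms by simp
  also have "\<dots> = \<epsilon> * x\<^sup>2 + y\<^sup>2 / \<epsilon> - 2 * x * y"
    using assms by (simp add: field_simps power2_eq_square)
  finally show ?thesis by (simp add: power2_eq_square algebra_simps)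
qed

lemma L2_dist_sq_add_le:
  assumes "\<epsilon> > 0" "sq_int U01 x" "sq_int U01 y" "sq_int U01 a" "sq_int U01 b"
  shows "L2_dist_sq (\<lambda>t. x t + y t) (\<lambda>t. a t + b t) \<le> (1 + \<epsilon>) * L2_dist_sq x a + (1 + 1/\<epsilon>) * L2_dist_sq y b"
proof -
  have xa: "integrable U01 (\<lambda>t. (x t - a t)\<^sup>2)" and yb: "integrable U01 (\<lambda>t. (y t - b t)\<^sup>2)"
    using assms by (auto intro!: sq_int_sq sq_int_diff)
  have "(\<integral>t. ((x t + y t) - (a t + b t))\<^sup>2 \<partial>U01) \<le> (\<integral>t. (1 + \<epsilon>) * (x t - a t)\<^sup>2 + (1 + 1/\<epsilon>) * (y t - b t)\<^sup>2 \<partial>U01)"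
  proof (rule integral_mono)
    show "integrable U01 (\<lambda>t. ((x t + y t) - (a t + b t))\<^sup>2)"
      using assms by (auto intro!: sq_int_sq sq_int_diff sq_int_add)
    show "integrable U01 (\<lambda>t. (1 + \<epsilon>) * (x t - a t)\<^sup>2 + (1 + 1/\<epsilon>) * (y t - b t)\<^sup>2)"
      using xa yb by auto
    fix t
    have "((x t + y t) - (a t + b t))\<^sup>2 = ((x t - a t) + (y t - b t))\<^sup>2" by (simp add: algebra_simps)
    then show "((x t + y t) - (a t + b t))\<^sup>2 \<le> (1 + \<epsilon>) * (x t - a t)\<^sup>2 + (1 + 1/\<epsilon>) * (y t - b t)\<^sup>2"
      using square_sum_le[OF assms(1)] by simp
  qed
  also have "\<dots> = (1 + \<epsilon>) * (\<integral>t. (x t - a t)\<^sup>2 \<partial>U01) + (1 + 1/\<epsilon>) * (\<integral>t. (y t - b t)\<^sup>2 \<partial>U01)"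
    using xa yb by simp
  finally show ?thesis by (simp add: L2_dist_sq_U01)
qed

text \<open>The Minkowski sum of two codebooks codes the sum of the processes. Sizes multiply, so
  rates add, and the weight \<epsilon> lets a summand of negligible rate and distortion be added at
  almost no cost. This is how the asymptotics pass from one process to another.\<close>

lemma codeable_add:
  assumes Z: "L2_process M Z" "L2_process M Z'"
    and c: "codeable M Z n v" "codeable M Z' n' v'"
    and \<epsilon>: "\<epsilon> > 0" and v: "v \<ge> 0" "v' \<ge> 0"
  shows "codeable M (\<lambda>z t. Z z t + Z' z t) (n * n') ((1 + \<epsilon>) * v + (1 + 1/\<epsilon>) * v')"
proof -
  obtain A where A: "codebook A" "real (card A) \<le> n" "(\<integral>\<^sup>+z. ennreal (quant_dist A (Z z)) \<partial>M) \<le> ennreal v"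
    using c(1) unfolding codeable_def by blast
  obtain B where B: "codebook B" "real (card B) \<le> n'" "(\<integral>\<^sup>+z. ennreal (quant_dist B (Z' z)) \<partial>M) \<le> ennreal v'"
    using c(2) unfolding codeable_def by blast
  define C where "C = (\<lambda>(a, b) t. a t + b t) ` (A \<times> B)"
  have sqA: "\<And>a. a \<in> A \<Longrightarrow> sq_int U01 a" and sqB: "\<And>a. a \<in> B \<Longrightarrow> sq_int U01 a"
    using A(1) B(1) by (auto simp: codebook_def L2_01_sq_int)
  have C: "codebook C"
    using A(1) B(1) by (auto simp: C_def codebook_def L2_01_sq_int intro!: sq_int_add borel_measurable_add dest!: subsetD)
  have "card C \<le> card (A \<times> B)" unfolding C_def using A(1) B(1) by (intro card_image_le) (auto simp: codebook_def)
  then have "real (card C) \<le> real (card A) * real (card B)"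
    by (simp add: card_cartesian_product flip: of_nat_mult)
  also have "\<dots> \<le> n * n'" using A(2) B(2) by (intro mult_mono) (auto intro: order_trans[OF _ A(2)])
  finally have card: "real (card C) \<le> n * n'" .
  have le: "quant_dist C (\<lambda>t. Z z t + Z' z t) \<le> (1 + \<epsilon>) * quant_dist A (Z z) + (1 + 1/\<epsilon>) * quant_dist B (Z' z)"
    if w: "z \<in> space M" for z
  proof -
    obtain a where a: "a \<in> A" "quant_dist A (Z z) = L2_dist_sq (Z z) a" using quant_dist_attained[OF A(1)] by blast
    obtain b where b: "b \<in> B" "quant_dist B (Z' z) = L2_dist_sq (Z' z) b" using quant_dist_attained[OF B(1)] by blast
    have "(\<lambda>t. a t + b t) \<in> C" using a b unfolding C_def by (auto intro!: image_eqI[of _ _ "(a, b)"])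
    then have "quant_dist C (\<lambda>t. Z z t + Z' z t) \<le> L2_dist_sq (\<lambda>t. Z z t + Z' z t) (\<lambda>t. a t + b t)"
      by (rule quant_dist_le[OF C])
    also have "\<dots> \<le> (1 + \<epsilon>) * L2_dist_sq (Z z) a + (1 + 1/\<epsilon>) * L2_dist_sq (Z' z) b"
      using Z w a b sqA sqB by (intro L2_dist_sq_add_le \<epsilon>) (auto simp: L2_process_def)
    finally show ?thesis using a b by simp
  qed
  have [measurable]: "(\<lambda>z. quant_dist A (Z z)) \<in> borel_measurable M" "(\<lambda>z. quant_dist B (Z' z)) \<in> borel_measurable M"
    using quant_dist_measurable Z A(1) B(1) by auto
  have "(\<integral>\<^sup>+z. ennreal (quant_dist C (\<lambda>t. Z z t + Z' z t)) \<partial>M) \<le>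
    (\<integral>\<^sup>+z. ennreal (1 + \<epsilon>) * ennreal (quant_dist A (Z z)) + ennreal (1 + 1/\<epsilon>) * ennreal (quant_dist B (Z' z)) \<partial>M)"
  proof (rule nn_integral_mono)
    fix z assume "z \<in> space M"
    have "ennreal (quant_dist C (\<lambda>t. Z z t + Z' z t)) \<le> ennreal ((1 + \<epsilon>) * quant_dist A (Z z) + (1 + 1/\<epsilon>) * quant_dist B (Z' z))"
      using le[OF \<open>z \<in> space M\<close>] by (rule ennreal_leI)
    then show "ennreal (quant_dist C (\<lambda>t. Z z t + Z' z t)) \<le> ennreal (1 + \<epsilon>) * ennreal (quant_dist A (Z z)) + ennreal (1 + 1/\<epsilon>) * ennreal (quant_dist B (Z' z))"
      using \<epsilon> quant_dist_nonneg[OF A(1)] quant_dist_nonneg[OF B(1)] by (simp add: ennreal_mult ennreal_plus)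
  qed
  also have "\<dots> = ennreal (1 + \<epsilon>) * (\<integral>\<^sup>+z. ennreal (quant_dist A (Z z)) \<partial>M) + ennreal (1 + 1/\<epsilon>) * (\<integral>\<^sup>+z. ennreal (quant_dist B (Z' z)) \<partial>M)"
    by (simp add: nn_integral_add nn_integral_cmult)
  also have "\<dots> \<le> ennreal (1 + \<epsilon>) * ennreal v + ennreal (1 + 1/\<epsilon>) * ennreal v'"
    using A(3) B(3) by (intro add_mono mult_left_mono) auto
  also have "\<dots> = ennreal ((1 + \<epsilon>) * v + (1 + 1/\<epsilon>) * v')"
    using \<epsilon> v by (simp add: ennreal_mult ennreal_plus)
  finally show ?thesis using C card unfolding codeable_def by blast
qed

text \<open>The single codeword 0 costs no rate; this disposes of truncation errors.\<close>

lemma codeable_zero: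
  assumes "(\<integral>\<^sup>+w. ennreal (\<integral>t. (Z w t)\<^sup>2 \<partial>U01) \<partial>M) \<le> ennreal v"
  shows "codeable M Z 1 v"
proof -
  have "codebook {\<lambda>t. 0}" by (auto simp: codebook_def L2_01_sq_int sq_int_zero)
  moreover have "quant_dist {\<lambda>t. 0} (Z w) = (\<integral>t. (Z w t)\<^sup>2 \<partial>U01)" for w
    by (simp add: quant_dist_def L2_dist_sq_U01)
  ultimately show ?thesis using assms unfolding codeable_def by (intro exI[of _ "{\<lambda>t. 0}"]) auto
qed

section \<open>The entropy lower bound for diagonal Gaussian vectors\<close>

lemma nn_integral_std_normal:
  assumes [measurable]: "f \<in> borel_measurable borel"
  shows "(\<integral>\<^sup>+z. f z \<partial>std_normal_distribution) = (\<integral>\<^sup>+z. ennreal (std_normal_density z) * f z \<partial>lborel)"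
  by (subst nn_integral_density) auto

lemma nn_integral_normal_density: "\<sigma> > 0 \<Longrightarrow> (\<integral>\<^sup>+x. ennreal (normal_density \<mu> \<sigma> x) \<partial>lborel) = 1"
  using prob_space.emeasure_space_1[OF prob_space_normal_density, of \<sigma> \<mu>]
  by (simp add: emeasure_density)

text \<open>The Gaussian exponential integrals below are found by completing the square: once the
  integrand times the standard density is recognised as \<open>c\<close> times a normal density, the
  value is \<open>c\<close>.\<close>

lemma nn_integral_std_normal_eq:
  assumes "\<sigma> > 0" "c \<ge> 0" and [measurable]: "f \<in> borel_measurable borel"
    and "\<And>z. std_normal_density z * f z = c * normal_density \<mu> \<sigma> z" "\<And>z. f z \<ge> 0"
  shows "(\<integral>\<^sup>+z. ennreal (f z) \<partial>std_normal_distribution) = ennreal c"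
proof -
  have "(\<integral>\<^sup>+z. ennreal (f z) \<partial>std_normal_distribution) = (\<integral>\<^sup>+z. ennreal c * ennreal (normal_density \<mu> \<sigma> z) \<partial>lborel)"
    using assms by (subst nn_integral_std_normal) (auto simp flip: ennreal_mult intro!: nn_integral_cong)
  also have "\<dots> = ennreal c" using assms by (simp add: nn_integral_cmult nn_integral_normal_density)
  finally show ?thesis .
qed

lemma std_normal_exp_linear:
  "(\<integral>\<^sup>+z. ennreal (exp (c * z)) \<partial>std_normal_distribution) = ennreal (exp (c\<^sup>2 / 2))"
proof (rule nn_integral_std_normal_eq[where \<mu> = c and \<sigma> = 1])
  fix z
  have "- z\<^sup>2 / 2 + c * z = c\<^sup>2 / 2 - (z - c)\<^sup>2 / 2" by (simp add: power2_eq_square field_simps)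
  then have "exp (- z\<^sup>2 / 2) * exp (c * z) = exp (c\<^sup>2/2) * exp (- (z - c)\<^sup>2 / 2)"
    by (simp flip: exp_add)
  then show "std_normal_density z * exp (c * z) = exp (c\<^sup>2 / 2) * normal_density c 1 z"
    by (simp add: std_normal_density_def normal_density_def)
qed auto

text \<open>The density of a pair of standard normals
  with correlation \<open>r\<close> with respect to an independent pair.\<close>

definition mehler :: "real \<Rightarrow> real \<Rightarrow> real \<Rightarrow> real" where
  "mehler r x y = exp (- ln (1 - r\<^sup>2) / 2 - (x - r * y)\<^sup>2 / (2 * (1 - r\<^sup>2)) + x\<^sup>2 / 2)"

lemma mehler_commute:
  assumes "r\<^sup>2 < 1" shows "mehler r x y = mehler r y x"
proof -
  have "1 - r\<^sup>2 \<noteq> 0" using assms by simp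
  then have "- (x - r * y)\<^sup>2 / (2 * (1 - r\<^sup>2)) + x\<^sup>2 / 2 = - (y - r * x)\<^sup>2 / (2 * (1 - r\<^sup>2)) + y\<^sup>2 / 2"
    by (simp add: divide_simps) (simp add: power2_eq_square algebra_simps)
  then show ?thesis unfolding mehler_def by simp
qed

text \<open>Given y, the weight \<open>mehler r x y\<close> turns the standard normal law of x into
  the one with mean r y and variance 1 - r^2, so the exponent is s times a chi-square variable with
  one degree of freedom. With s = 0 this says that \<open>mehler\<close> has total mass 1; with r =
  0 it is the plain chi-square transform.\<close>

lemma mehler_exp_integral:
  assumes r: "r\<^sup>2 < 1" and s: "s < 1/2"
  shows "(\<integral>\<^sup>+x. ennreal (mehler r x y * exp (s * ((x - r * y)\<^sup>2 / (1 - r\<^sup>2)))) \<partial>std_normal_distribution)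
    = ennreal ((1 - 2 * s) powr (-1/2))"
proof -
  define v where "v = 1 - r\<^sup>2"
  define q where "q = 1 - 2 * s"
  have v: "v > 0" and q: "q > 0" using assms by (auto simp: v_def q_def)
  show ?thesis
  proof (rule nn_integral_std_normal_eq[where \<mu> = "r * y" and \<sigma> = "sqrt (v / q)"])
    fix x
    have "exp (- x\<^sup>2 / 2) * (mehler r x y * exp (s * ((x - r * y)\<^sup>2 / v)))
      = exp (- ln v / 2) * exp (- (x - r * y)\<^sup>2 / (2 * (v / q)))"
    proof -
      have "- x\<^sup>2 / 2 + (- ln v / 2 - (x - r * y)\<^sup>2 / (2 * v) + x\<^sup>2 / 2) + s * ((x - r * y)\<^sup>2 / v)
        = - ln v / 2 + (- (x - r * y)\<^sup>2 / (2 * (v / q)))"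
        using v q by (simp add: q_def field_simps)
      then show ?thesis
        unfolding mehler_def v_def[symmetric] by (simp flip: exp_add)
    qed
    moreover have "exp (- ln v / 2) = v powr (-1/2)" using v by (simp add: powr_def)
    moreover have "1 / sqrt (2 * pi * (sqrt (v / q))\<^sup>2) = 1 / sqrt (2 * pi) * (v powr (-1/2)) / (q powr (-1/2))"
      using v q by (simp add: real_sqrt_mult real_sqrt_divide powr_minus powr_half_sqrt field_simps)
    ultimately show "std_normal_density x * (mehler r x y * exp (s * ((x - r * y)\<^sup>2 / (1 - r\<^sup>2))))
      = (1 - 2 * s) powr (-1/2) * normal_density (r * y) (sqrt (v / q)) x"
      using v q unfolding std_normal_density_def normal_density_def v_def[symmetric] q_def[symmetric]
      by (simp add: field_simps)
  qed (use v q in \<open>auto simp: mehler_def q_def\<close>)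
qed

lemma std_normal_exp_square:
  assumes "s < 1/2"
  shows "(\<integral>\<^sup>+x. ennreal (exp (s * x\<^sup>2)) \<partial>std_normal_distribution) = ennreal ((1 - 2 * s) powr (-1/2))"
  using mehler_exp_integral[of 0 s 0] assms by (simp add: mehler_def)

lemma power4_le_exp: "x ^ 4 / 24 \<le> exp x + exp (- x)" for x :: real
proof -
  have "\<bar>x\<bar> ^ 4 / fact 4 \<le> exp \<bar>x\<bar>"
  proof -
    have "(\<Sum>n\<in>{4}. \<bar>x\<bar> ^ n /\<^sub>R fact n) \<le> (\<Sum>n. \<bar>x\<bar> ^ n /\<^sub>R fact n)"
      by (rule sum_le_suminf[OF summable_exp_generic]) auto
    then show ?thesis by (simp add: exp_def divide_inverse mult.commute)
  qed
  then have "x ^ 4 / 24 \<le> exp \<bar>x\<bar>" by (simp add: fact_numeral power_even_abs)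
  also have "\<dots> \<le> exp x + exp (- x)" by (cases "x \<ge> 0") auto
  finally show ?thesis .
qed

section \<open>Independent standard normal coordinates\<close>

locale iid_normal = prob_space M for M :: "'a measure" +
  fixes \<zeta> :: "nat \<Rightarrow> 'a \<Rightarrow> real"
  assumes indep: "indep_vars (\<lambda>_. borel) \<zeta> {..<m}"
    and distr_\<zeta>: "distr M borel (\<zeta> j) = std_normal_distribution"
    and meas[measurable]: "\<zeta> j \<in> borel_measurable M"
begin

lemma nn_integral_\<zeta>:
  assumes [measurable]: "f \<in> borel_measurable borel"
  shows "(\<integral>\<^sup>+w. f (\<zeta> j w) \<partial>M) = (\<integral>\<^sup>+z. f z \<partial>std_normal_distribution)"
  unfolding distr_\<zeta>[of j, symmetric] by (subst nn_integral_distr) auto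

lemma indep_finite: "finite J \<Longrightarrow> indep_vars (\<lambda>_. borel) \<zeta> J"
  by (rule indep_vars_subset[OF indep[of "Suc (Max J)"]]) (auto simp: less_Suc_eq_le)

lemma nn_integral_prod:
  assumes "finite J" and [measurable]: "\<And>j. j \<in> J \<Longrightarrow> f j \<in> borel_measurable borel"
  shows "(\<integral>\<^sup>+w. (\<Prod>j\<in>J. f j (\<zeta> j w)) \<partial>M) = (\<Prod>j\<in>J. \<integral>\<^sup>+z. f j z \<partial>std_normal_distribution)"
proof -
  have "(\<integral>\<^sup>+w. (\<Prod>j\<in>J. f j (\<zeta> j w)) \<partial>M) = (\<Prod>j\<in>J. \<integral>\<^sup>+w. f j (\<zeta> j w) \<partial>M)"
    using assms by (intro indep_vars_nn_integral indep_vars_compose2[OF indep_finite]) auto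
  also have "\<dots> = (\<Prod>j\<in>J. \<integral>\<^sup>+z. f j z \<partial>std_normal_distribution)"
    using assms by (intro prod.cong refl nn_integral_\<zeta>) auto
  finally show ?thesis .
qed

lemma integrable_power: "integrable M (\<lambda>w. \<zeta> j w ^ k)"
proof -
  have "integrable (distr M borel (\<zeta> j)) (\<lambda>x. x ^ k)"
    unfolding distr_\<zeta> by (rule integrable_std_normal_distribution_moment)
  then show ?thesis by (subst (asm) integrable_distr_eq) auto
qed

lemma expectation_power:
  "expectation (\<lambda>w. \<zeta> j w ^ k) = (\<integral>x. x ^ k \<partial>std_normal_distribution)"
  unfolding distr_\<zeta>[of j, symmetric] by (subst integral_distr) auto

lemma expectation_square: "expectation (\<lambda>w. (\<zeta> j w)\<^sup>2) = 1"
  using expectation_power[of j 2] std_normal_distribution_even_moments(1)[of 1] by simp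

lemma expectation_power4: "expectation (\<lambda>w. (\<zeta> j w) ^ 4) = 3"
  using expectation_power[of j 4] std_normal_distribution_even_moments(1)[of 2] by (simp add: fact_numeral)

lemma sq_int_\<zeta>: "sq_int M (\<zeta> j)"
  using integrable_power[of j 2] by (simp add: sq_int_def)

lemma expectation_mult: "i \<noteq> j \<Longrightarrow> expectation (\<lambda>w. \<zeta> i w * \<zeta> j w) = 0"
proof -
  assume "i \<noteq> j"
  have "expectation (\<lambda>w. \<Prod>k\<in>{i, j}. \<zeta> k w) = (\<Prod>k\<in>{i, j}. expectation (\<zeta> k))"
    using sq_int_integrable[OF sq_int_\<zeta>] by (intro indep_vars_lebesgue_integral indep_finite) auto
  moreover have "expectation (\<zeta> k) = 0" for k
    using expectation_power[of k 1] integral_std_normal_distribution_moment_odd[of 1] by simp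
  ultimately show ?thesis using \<open>i \<noteq> j\<close> by simp
qed

lemma orthonormal_\<zeta>: "orthonormal_on M \<zeta> J"
  using expectation_square expectation_mult by (auto simp: orthonormal_on_def sq_int_\<zeta> power2_eq_square)

lemma expectation_linear_square:
  assumes "finite J"
  shows "expectation (\<lambda>w. (\<Sum>j\<in>J. a j * \<zeta> j w)\<^sup>2) = (\<Sum>j\<in>J. (a j)\<^sup>2)"
  using orthonormal_expand[OF orthonormal_\<zeta> assms sq_int_zero, of a] by simp

lemma nn_integral_exp_linear:
  assumes "finite J"
  shows "(\<integral>\<^sup>+w. ennreal (exp (\<Sum>j\<in>J. a j * \<zeta> j w)) \<partial>M) = ennreal (exp ((\<Sum>j\<in>J. (a j)\<^sup>2) / 2))"
proof -
  have "(\<integral>\<^sup>+w. ennreal (exp (\<Sum>j\<in>J. a j * \<zeta> j w)) \<partial>M) = (\<integral>\<^sup>+w. (\<Prod>j\<in>J. ennreal (exp (a j * \<zeta> j w))) \<partial>M)"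
    by (simp add: exp_sum[OF assms] prod_ennreal)
  also have "\<dots> = (\<Prod>j\<in>J. ennreal (exp ((a j)\<^sup>2 / 2)))"
    using assms by (subst nn_integral_prod) (auto simp: std_normal_exp_linear)
  also have "\<dots> = ennreal (exp ((\<Sum>j\<in>J. (a j)\<^sup>2) / 2))"
    by (simp add: prod_ennreal exp_sum[OF assms] sum_divide_distrib)
  finally show ?thesis .
qed

text \<open>After scaling to unit variance, x^4 \<le> 24 (e^x + e^(-x)), and each exponential moment
  is e^(1/2) \<le> 2, whence 96 = 24 * 4. The exact constant is 3, but this route uses only the
  exponential moments just computed.\<close>

lemma nn_integral_linear_power4:
  assumes "finite J"
  shows "(\<integral>\<^sup>+w. ennreal ((\<Sum>j\<in>J. a j * \<zeta> j w) ^ 4) \<partial>M) \<le> ennreal (96 * (\<Sum>j\<in>J. (a j)\<^sup>2)\<^sup>2)"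
proof (cases "(\<Sum>j\<in>J. (a j)\<^sup>2) = 0")
  case True
  then have "\<And>j. j \<in> J \<Longrightarrow> a j = 0" using assms by (subst (asm) sum_nonneg_eq_0_iff) auto
  then show ?thesis using True by simp
next
  case False
  define s where "s = sqrt (\<Sum>j\<in>J. (a j)\<^sup>2)"
  have "(\<Sum>j\<in>J. (a j)\<^sup>2) > 0" using False by (simp add: order_le_neq_trans sum_nonneg)
  then have s: "s > 0" "s\<^sup>2 = (\<Sum>j\<in>J. (a j)\<^sup>2)" by (auto simp: s_def sum_nonneg)
  let ?L = "\<lambda>b w. exp (\<Sum>j\<in>J. b * a j / s * \<zeta> j w)"
  have one: "(\<integral>\<^sup>+w. ennreal (?L b w) \<partial>M) \<le> 2" if "b\<^sup>2 = 1" for b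
  proof -
    have "(\<Sum>j\<in>J. (b * a j / s)\<^sup>2) = 1"
      using s that False by (simp add: power_mult_distrib power_divide flip: sum_divide_distrib)
    moreover have "exp (1/2 :: real) \<le> 2" using exp_half_le2 by simp
    ultimately show ?thesis
      unfolding nn_integral_exp_linear[OF assms] using ennreal_leI[of "exp (1/2)" 2] by simp
  qed
  have "(\<integral>\<^sup>+w. ennreal ((\<Sum>j\<in>J. a j * \<zeta> j w) ^ 4) \<partial>M)
     \<le> (\<integral>\<^sup>+w. ennreal (24 * s ^ 4) * (ennreal (?L 1 w) + ennreal (?L (-1) w)) \<partial>M)"
  proof (rule nn_integral_mono)
    fix w
    let ?x = "\<Sum>j\<in>J. a j / s * \<zeta> j w"
    have x: "(\<Sum>j\<in>J. a j * \<zeta> j w) = s * ?x" using s by (simp add: sum_distrib_left)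
    have "(\<Sum>j\<in>J. a j * \<zeta> j w) ^ 4 = 24 * s ^ 4 * (?x ^ 4 / 24)" unfolding x by (simp add: power_mult_distrib)
    also have "\<dots> \<le> 24 * s ^ 4 * (exp ?x + exp (- ?x))" using s power4_le_exp by (intro mult_left_mono) auto
    also have "exp (- ?x) = ?L (-1) w" by (simp add: sum_negf)
    finally show "ennreal ((\<Sum>j\<in>J. a j * \<zeta> j w) ^ 4) \<le> ennreal (24 * s ^ 4) * (ennreal (?L 1 w) + ennreal (?L (-1) w))"
      using s by (simp flip: ennreal_plus ennreal_mult)
  qed
  also have "\<dots> = ennreal (24 * s ^ 4) * ((\<integral>\<^sup>+w. ennreal (?L 1 w) \<partial>M) + (\<integral>\<^sup>+w. ennreal (?L (-1) w) \<partial>M))"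
    by (simp add: nn_integral_cmult nn_integral_add)
  also have "\<dots> \<le> ennreal (24 * s ^ 4) * (2 + 2)" by (intro mult_left_mono add_mono one) auto
  also have "\<dots> = ennreal (96 * (s\<^sup>2)\<^sup>2)"
  proof -
    have "ennreal (24 * s ^ 4) * (2 + 2) = ennreal (24 * s ^ 4) * ennreal 4" by simp
    also have "\<dots> = ennreal (24 * s ^ 4 * 4)" by (rule ennreal_mult'[symmetric]) simp
    finally show ?thesis by (simp flip: power_mult)
  qed
  finally show ?thesis using s by simp
qed

text \<open>The dual side of reverse water-filling at level \<theta>. Each codeword gets a product
  weight whose Gaussian mean is at most 1, so the sum \<open>F\<close> over the codebook has mean at
  most its size. The codeword nearest to the source point alone makes \<open>F\<close> at least exp
  (\<Sum> G - D / (2 \<theta>)). Logarithms and then means turn this into a lower bound for the mean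
  distortion.\<close>

lemma water_filling_lower:
  assumes e: "orthonormal_on U01 e {..<N}" and \<sigma>: "\<And>j. \<sigma> j > 0" and d: "d \<le> N" and \<theta>: "\<theta> > 0"
    and tail: "\<And>j. d \<le> j \<Longrightarrow> j < N \<Longrightarrow> (\<sigma> j)\<^sup>2 \<le> \<theta>"
    and c: "codeable M (\<lambda>p t. \<Sum>j<N. \<sigma> j * e j t * \<zeta> j p) n v" and v: "v \<ge> 0"
  shows "real d * \<theta> + (\<Sum>j\<in>{d..<N}. (\<sigma> j)\<^sup>2) + 2 * \<theta> * ((\<Sum>j<d. ln ((\<sigma> j)\<^sup>2 / \<theta>)) / 2 - ln n) \<le> v"
proof -
  define Y where "Y = (\<lambda>p t. \<Sum>j<N. \<sigma> j * e j t * \<zeta> j p)"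
  obtain A where A: "codebook A" "real (card A) \<le> n" "(\<integral>\<^sup>+p. ennreal (quant_dist A (Y p)) \<partial>M) \<le> ennreal v"
    using c unfolding codeable_def Y_def by blast
  define D where "D = (\<lambda>p. quant_dist A (Y p))"
  define K where "K = real (card A)"
  have K: "K \<ge> 1" using A(1) by (auto simp: K_def codebook_def Suc_le_eq card_gt_0_iff)
  have sqe: "\<And>j. j < N \<Longrightarrow> sq_int U01 (e j)" using e by (auto simp: orthonormal_on_def)
  have "L2_process M (\<lambda>p t. \<Sum>j\<in>{..<N}. (\<sigma> j * e j t) * \<zeta> j p)"
    using sqe by (intro L2_process_linear sq_int_cmult) auto
  then have Y: "L2_process M Y" by (simp add: Y_def)
  have Dm[measurable]: "D \<in> borel_measurable M" unfolding D_def using quant_dist_measurable[OF Y A(1)] .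
  have D0: "D p \<ge> 0" for p unfolding D_def using quant_dist_nonneg[OF A(1)] .
  have A3: "(\<integral>\<^sup>+p. ennreal (D p) \<partial>M) \<le> ennreal v" using A(3) by (simp add: D_def)
  have Di: "integrable M D"
    using A3 D0 by (intro integrableI_nonneg) (auto intro: le_less_trans)
  have Dv: "expectation D \<le> v"
    using A3 v by (subst (asm) nn_integral_eq_integral) (use Di D0 in auto)
  define co where "co = (\<lambda>a j. \<integral>t. a t * e j t \<partial>U01)"
  \<comment> \<open>Chosen so that the weight has mean at most 1 for every shift a. For j < d the
    term z^2 / 2 cancels the standard density and leaves a normal density of variance \<theta> /
    \<sigma>^2. For j \<ge> d the quadratic term in the exponent is cancelled instead, leaving the
    exponential of a linear function, whose mean is at most 1 because \<sigma>^2 \<le>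
    \<theta>.\<close>
  define G where "G = (\<lambda>j z. if j < d then ln ((\<sigma> j)\<^sup>2 / \<theta>) / 2 + z\<^sup>2 / 2 else (\<sigma> j)\<^sup>2 * z\<^sup>2 / (2 * \<theta>))"
  define h where "h = (\<lambda>j a z. exp (G j z - (\<sigma> j * z - a)\<^sup>2 / (2 * \<theta>)))"
  have [measurable]: "h j a \<in> borel_measurable borel" for j a
    unfolding h_def G_def by measurable
  define F where "F = (\<lambda>p. \<Sum>a\<in>A. \<Prod>j<N. h j (co a j) (\<zeta> j p))"
  have h1: "(\<integral>\<^sup>+z. ennreal (h j a z) \<partial>std_normal_distribution) \<le> 1" if "j < N" for j a
  proof (cases "j < d")
    case True
    have s: "\<sigma> j > 0" by (rule \<sigma>)
    have "(\<integral>\<^sup>+z. ennreal (h j a z) \<partial>std_normal_distribution) = ennreal 1"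
    proof (rule nn_integral_std_normal_eq[where \<mu> = "a / \<sigma> j" and \<sigma> = "sqrt \<theta> / \<sigma> j"])
      fix z
      have hz: "h j a z = (\<sigma> j / sqrt \<theta>) * (exp (z\<^sup>2/2) * exp (- (\<sigma> j * z - a)\<^sup>2 / (2 * \<theta>)))"
      proof -
        have "ln ((\<sigma> j)\<^sup>2 / \<theta>) / 2 = ln (\<sigma> j / sqrt \<theta>)"
          using s \<theta> by (simp add: ln_div ln_realpow ln_sqrt)
        then have "h j a z = exp (ln (\<sigma> j / sqrt \<theta>) + (z\<^sup>2/2 + - (\<sigma> j * z - a)\<^sup>2 / (2 * \<theta>)))"
          using True unfolding h_def G_def by simp
        then show ?thesis using s \<theta> by (simp only: exp_add) (simp add: exp_ln)
      qed
      have q: "(\<sigma> j * z - a)\<^sup>2 / (2 * \<theta>) = (z - a / \<sigma> j)\<^sup>2 / (2 * (sqrt \<theta> / \<sigma> j)\<^sup>2)"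
        using s \<theta> by (simp add: power_divide field_simps power2_eq_square)
      have "exp (- z\<^sup>2 / 2) * exp (z\<^sup>2/2) = 1" by (simp flip: exp_add)
      then show "std_normal_density z * h j a z = 1 * normal_density (a / \<sigma> j) (sqrt \<theta> / \<sigma> j) z"
        unfolding hz std_normal_density_def normal_density_def minus_divide_left[symmetric] q
        using s \<theta> by (simp add: real_sqrt_mult real_sqrt_divide power_divide)
    qed (use s \<theta> in \<open>auto simp: h_def G_def\<close>)
    then show ?thesis by simp
  next
    case False
    define b where "b = a / \<theta> * \<sigma> j"
    have hz: "h j a z = exp (- a\<^sup>2 / (2 * \<theta>)) * exp (b * z)" for z
    proof -
      have "G j z - (\<sigma> j * z - a)\<^sup>2 / (2 * \<theta>) = - a\<^sup>2 / (2 * \<theta>) + b * z"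
        using False \<theta> unfolding G_def b_def by (simp add: field_simps power2_eq_square)
      then show ?thesis unfolding h_def by (simp flip: exp_add)
    qed
    have "(\<integral>\<^sup>+z. ennreal (h j a z) \<partial>std_normal_distribution) = ennreal (exp (- a\<^sup>2 / (2 * \<theta>)) * exp (b\<^sup>2 / 2))"
      unfolding hz by (subst ennreal_mult'', simp, subst nn_integral_cmult, simp) (simp add: std_normal_exp_linear ennreal_mult'')
    also have "\<dots> \<le> ennreal 1"
    proof (rule ennreal_leI)
      have "b\<^sup>2 / 2 = a\<^sup>2 / (2 * \<theta>) * ((\<sigma> j)\<^sup>2 / \<theta>)" using \<theta> by (simp add: b_def power2_eq_square field_simps)
      also have "\<dots> \<le> a\<^sup>2 / (2 * \<theta>) * 1" using tail[of j] False that \<theta> by (intro mult_left_mono) auto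
      finally show "exp (- a\<^sup>2 / (2 * \<theta>)) * exp (b\<^sup>2 / 2) \<le> 1" by (simp flip: exp_add)
    qed
    finally show ?thesis by simp
  qed
  have F0: "F p \<ge> 0" for p unfolding F_def by (intro sum_nonneg prod_nonneg) (auto simp: h_def)
  have Fm[measurable]: "F \<in> borel_measurable M" unfolding F_def by measurable
  have Fn: "(\<integral>\<^sup>+p. ennreal (F p) \<partial>M) \<le> ennreal K"
  proof -
    have "(\<integral>\<^sup>+p. ennreal (F p) \<partial>M) = (\<integral>\<^sup>+p. (\<Sum>a\<in>A. \<Prod>j<N. ennreal (h j (co a j) (\<zeta> j p))) \<partial>M)"
      unfolding F_def by (intro nn_integral_cong) (simp add: prod_ennreal sum_ennreal h_def prod_nonneg)
    also have "\<dots> = (\<Sum>a\<in>A. \<Prod>j<N. (\<integral>\<^sup>+z. ennreal (h j (co a j) z) \<partial>std_normal_distribution))"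
      by (subst nn_integral_sum) (auto intro!: sum.cong nn_integral_prod)
    also have "\<dots> \<le> (\<Sum>a\<in>A. 1)" by (intro sum_mono prod_le_1) (auto simp: h1)
    finally show ?thesis by (simp add: K_def ennreal_of_nat_eq_real_of_nat)
  qed
  have Fi: "integrable M F" using Fn F0 by (intro integrableI_nonneg) (auto intro: le_less_trans)
  have FK: "expectation F \<le> K" using Fn K by (subst (asm) nn_integral_eq_integral) (use Fi F0 in auto)
  have pt: "(\<Sum>j<N. G j (\<zeta> j p)) - D p / (2 * \<theta>) - ln K \<le> F p / K - 1" if w: "p \<in> space M" for p
  proof -
    obtain a where a: "a \<in> A" "D p = L2_dist_sq (Y p) a" using quant_dist_attained[OF A(1)] unfolding D_def by blast
    have sqa: "sq_int U01 a" using a(1) A(1) by (auto simp: codebook_def L2_01_sq_int)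
    \<comment> \<open>A codeword may have a component outside the span of the \<open>e j\<close>;
      Bessel's inequality discards it.\<close>
    have sum: "(\<Sum>j<N. (\<sigma> j * \<zeta> j p - co a j)\<^sup>2) \<le> D p"
    proof -
      have "(\<integral>t. (a t - (\<Sum>j<N. (\<sigma> j * \<zeta> j p) * e j t))\<^sup>2 \<partial>U01) = (\<integral>t. (a t)\<^sup>2 \<partial>U01) - (\<Sum>j<N. (co a j)\<^sup>2) + (\<Sum>j<N. (co a j - \<sigma> j * \<zeta> j p)\<^sup>2)"
        using orthonormal_expand[OF e _ sqa, of "\<lambda>j. \<sigma> j * \<zeta> j p"] by (simp add: co_def)
      moreover have "(\<Sum>j<N. (co a j)\<^sup>2) \<le> (\<integral>t. (a t)\<^sup>2 \<partial>U01)"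
        using bessel_inequality[OF e _ sqa] by (simp add: co_def)
      moreover have "D p = (\<integral>t. (a t - (\<Sum>j<N. (\<sigma> j * \<zeta> j p) * e j t))\<^sup>2 \<partial>U01)"
        unfolding a(2) L2_dist_sq_U01 Y_def by (simp add: power2_commute algebra_simps)
      ultimately show ?thesis by (simp add: power2_commute)
    qed
    have "exp ((\<Sum>j<N. G j (\<zeta> j p)) - D p / (2 * \<theta>)) \<le> exp (\<Sum>j<N. G j (\<zeta> j p) - (\<sigma> j * \<zeta> j p - co a j)\<^sup>2 / (2 * \<theta>))"
      using sum \<theta> by (simp add: sum_subtractf divide_right_mono flip: sum_divide_distrib)
    also have "\<dots> = (\<Prod>j<N. h j (co a j) (\<zeta> j p))" by (simp add: h_def exp_sum)
    also have "\<dots> \<le> F p" unfolding F_def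
      using a(1) A(1) by (intro member_le_sum) (auto simp: codebook_def h_def prod_nonneg)
    finally have le: "exp ((\<Sum>j<N. G j (\<zeta> j p)) - D p / (2 * \<theta>)) \<le> F p" .
    then have Fp: "F p > 0" using exp_gt_zero less_le_trans by blast
    have "(\<Sum>j<N. G j (\<zeta> j p)) - D p / (2 * \<theta>) \<le> ln (F p)" using le Fp by (simp add: ln_ge_iff)
    \<comment> \<open>The logarithm is replaced by its tangent at \<open>K\<close>, so that only the
      mean of \<open>F\<close> enters.\<close>
    moreover have "ln (F p) - ln K \<le> F p / K - 1" using ln_le_minus_one[of "F p / K"] Fp K by (simp add: ln_div)
    ultimately show ?thesis by linarith
  qed
  have sqi: "integrable M (\<lambda>p. (\<zeta> j p)\<^sup>2)" for j using integrable_power[of j 2] .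
  have Gi: "integrable M (\<lambda>p. G j (\<zeta> j p))" for j unfolding G_def using sqi by (cases "j < d") auto
  have EG: "expectation (\<lambda>p. G j (\<zeta> j p)) = (if j < d then ln ((\<sigma> j)\<^sup>2 / \<theta>) / 2 + 1/2 else (\<sigma> j)\<^sup>2 / (2 * \<theta>))" for j
    unfolding G_def using sqi[of j] by (simp add: prob_space expectation_square)
  have "expectation (\<lambda>p. (\<Sum>j<N. G j (\<zeta> j p)) - D p / (2 * \<theta>) - ln K) \<le> expectation (\<lambda>p. F p / K - 1)"
    using Gi Di Fi pt by (intro integral_mono) auto
  then have "(\<Sum>j<N. expectation (\<lambda>p. G j (\<zeta> j p))) - expectation D / (2 * \<theta>) - ln K \<le> expectation F / K - 1"
    using Gi Di Fi by (simp add: prob_space)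
  moreover have "expectation F / K \<le> 1" using FK K by simp
  moreover have "(\<Sum>j<N. expectation (\<lambda>p. G j (\<zeta> j p))) = (\<Sum>j<d. ln ((\<sigma> j)\<^sup>2 / \<theta>)) / 2 + real d / 2 + (\<Sum>j\<in>{d..<N}. (\<sigma> j)\<^sup>2) / (2 * \<theta>)"
  proof -
    have "{..<N} = {..<d} \<union> {d..<N}" using d by auto
    then have "(\<Sum>j<N. expectation (\<lambda>p. G j (\<zeta> j p))) = (\<Sum>j<d. expectation (\<lambda>p. G j (\<zeta> j p))) + (\<Sum>j\<in>{d..<N}. expectation (\<lambda>p. G j (\<zeta> j p)))"
      by (simp add: sum.union_disjoint ivl_disj_int)
    then show ?thesis by (simp add: EG sum.distrib sum_divide_distrib)
  qed
  moreover have "expectation D / (2 * \<theta>) \<le> v / (2 * \<theta>)" using Dv \<theta> by (simp add: divide_right_mono)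
  moreover have "ln K \<le> ln n" using K A(2) by (simp add: K_def)
  ultimately have le: "(\<Sum>j<d. ln ((\<sigma> j)\<^sup>2 / \<theta>)) / 2 + real d / 2 + (\<Sum>j\<in>{d..<N}. (\<sigma> j)\<^sup>2) / (2 * \<theta>) - ln n \<le> v / (2 * \<theta>)"
    by linarith
  have "real d * \<theta> + T + 2 * \<theta> * (B / 2 - l) = 2 * \<theta> * (B / 2 + real d / 2 + T / (2 * \<theta>) - l)" for B T l
    using \<theta> by (simp add: distrib_left right_diff_distrib)
  then show ?thesis using mult_left_mono[OF le, of "2 * \<theta>"] \<theta> by simp
qed

end

section \<open>Random coding for diagonal Gaussian vectors\<close>

text \<open>A function cannot exceed its mean everywhere. If it did, the mean would be finite, the
  difference \<open>f y - ?c\<close> would have integral 0, and f could exceed its mean only on a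
  null set.\<close>

lemma (in prob_space) exists_le_nn_integral:
  assumes [measurable]: "f \<in> borel_measurable M"
  shows "\<exists>y\<in>space M. f y \<le> (\<integral>\<^sup>+y. f y \<partial>M)"
proof (rule ccontr)
  assume "\<not> ?thesis"
  then have gt: "\<And>y. y \<in> space M \<Longrightarrow> (\<integral>\<^sup>+y. f y \<partial>M) < f y" by auto
  let ?c = "\<integral>\<^sup>+y. f y \<partial>M"
  obtain y0 where "y0 \<in> space M" using not_empty by blast
  with gt have fin: "?c < \<top>" using less_le_trans top_greatest by blast
  have "(\<integral>\<^sup>+y. f y - ?c \<partial>M) = ?c - (\<integral>\<^sup>+y. ?c \<partial>M)"
    using fin gt by (intro nn_integral_diff) (auto simp: emeasure_space_1 intro!: AE_I2 less_imp_le)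
  also have "\<dots> = 0" using fin by (simp add: emeasure_space_1 top.not_eq_extremum)
  finally have "AE y in M. f y - ?c = 0" by (subst (asm) nn_integral_0_iff_AE) auto
  then have "AE y in M. False"
    by (rule AE_mp) (use gt in \<open>auto simp: diff_eq_0_iff_ennreal not_less[symmetric] intro!: AE_I2\<close>)
  then show False using AE_const[of False] by simp
qed

text \<open>Random coding, derandomised one codeword at a time by conditional expectations.\<close>

lemma random_covering:
  assumes "sigma_finite_measure M" "prob_space P"
    and [measurable]: "Measurable.pred (M \<Otimes>\<^sub>M P) (\<lambda>p. G (fst p) (snd p))"
    and "w \<in> borel_measurable M"
  shows "\<exists>ys. length ys = n \<and> set ys \<subseteq> space P \<and>
    (\<integral>\<^sup>+z. w z * (if \<exists>y\<in>set ys. G z y then 0 else 1) \<partial>M) \<le>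
    (\<integral>\<^sup>+z. w z * (\<integral>\<^sup>+y. (if G z y then 0 else 1) \<partial>P) ^ n \<partial>M)"
  using assms(4)
proof (induction n arbitrary: w)
  case 0
  then show ?case by (intro exI[of _ "[]"]) auto
next
  case (Suc n)
  interpret M: sigma_finite_measure M by fact
  interpret P: prob_space P by fact
  interpret MP: pair_sigma_finite M P ..
  note [measurable] = Suc.prems
  define r where "r = (\<lambda>z. \<integral>\<^sup>+y. (if G z y then 0 else 1 :: ennreal) \<partial>P)"
  have gm[measurable]: "(\<lambda>p. if G (fst p) (snd p) then 0 else 1 :: ennreal) \<in> borel_measurable (M \<Otimes>\<^sub>M P)" by measurable
  have [measurable]: "r \<in> borel_measurable M" unfolding r_def
    using P.borel_measurable_nn_integral_fst[OF gm] by simp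
  \<comment> \<open>The expected weighted miss when one codeword is y and n further ones are still
    random. Its mean over y is the fully random bound, so some y does no worse.\<close>
  define f where "f = (\<lambda>y. \<integral>\<^sup>+z. w z * r z ^ n * (if G z y then 0 else 1) \<partial>M)"
  have m2: "(\<lambda>p. w (fst p) * r (fst p) ^ n * (if G (fst p) (snd p) then 0 else 1)) \<in> borel_measurable (M \<Otimes>\<^sub>M P)"
    by measurable
  have "f \<in> borel_measurable P" unfolding f_def
    using M.borel_measurable_nn_integral[of "\<lambda>y z. w z * r z ^ n * (if G z y then 0 else 1)" P]
      measurable_compose[OF measurable_pair_swap' m2] by (simp add: case_prod_unfold)
  then obtain y where y: "y \<in> space P" "f y \<le> (\<integral>\<^sup>+y. f y \<partial>P)" using P.exists_le_nn_integral by blast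
  have "(\<integral>\<^sup>+y. f y \<partial>P) = (\<integral>\<^sup>+z. \<integral>\<^sup>+y. w z * r z ^ n * (if G z y then 0 else 1) \<partial>P \<partial>M)"
    unfolding f_def using MP.Fubini'[of "\<lambda>z y. w z * r z ^ n * (if G z y then 0 else 1)"] m2 by (simp add: case_prod_unfold)
  also have "\<dots> = (\<integral>\<^sup>+z. w z * r z ^ Suc n \<partial>M)"
  proof (rule nn_integral_cong)
    fix z assume "z \<in> space M"
    then have "(\<lambda>y. if G z y then 0 else 1 :: ennreal) \<in> borel_measurable P"
      using measurable_compose[OF measurable_Pair1' gm] by simp
    then show "(\<integral>\<^sup>+y. w z * r z ^ n * (if G z y then 0 else 1) \<partial>P) = w z * r z ^ Suc n"
      by (subst nn_integral_cmult) (auto simp: r_def mult_ac)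
  qed
  finally have fy: "f y \<le> (\<integral>\<^sup>+z. w z * r z ^ Suc n \<partial>M)" using y by simp
  \<comment> \<open>The remaining codewords only have to serve the points that y has missed, so the
    miss indicator is absorbed into the weight and the induction goes on.\<close>
  define w' where "w' = (\<lambda>z. w z * (if G z y then 0 else 1))"
  have "w' \<in> borel_measurable M" unfolding w'_def
    using measurable_compose[OF measurable_Pair2'[OF y(1)] gm] by simp
  from Suc.IH[OF this] obtain ys where ys: "length ys = n" "set ys \<subseteq> space P"
    "(\<integral>\<^sup>+z. w' z * (if \<exists>y\<in>set ys. G z y then 0 else 1) \<partial>M) \<le> (\<integral>\<^sup>+z. w' z * r z ^ n \<partial>M)"
    unfolding r_def by blast
  have "(\<integral>\<^sup>+z. w z * (if \<exists>y\<in>set (y # ys). G z y then 0 else 1) \<partial>M) = (\<integral>\<^sup>+z. w' z * (if \<exists>y\<in>set ys. G z y then 0 else 1) \<partial>M)"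
    by (intro nn_integral_cong) (auto simp: w'_def)
  also have "\<dots> \<le> f y" using ys(3) by (simp add: f_def w'_def mult_ac)
  also note fy
  finally show ?case using ys y by (intro exI[of _ "y # ys"]) (auto simp: r_def)
qed

text \<open>The usual covering inequality. The left side is convex in b, equals 1 at b = 0 and (1 -
  a)^n at b = 1, and so lies below its chord; the induction proves the chord bound directly.\<close>

lemma one_minus_mult_power_le:
  fixes a b :: real
  assumes "0 \<le> a" "a \<le> 1" "0 \<le> b" "b \<le> 1"
  shows "(1 - a * b) ^ n \<le> 1 - b + exp (- (real n * a))"
proof -
  have "(1 - a * b) ^ n \<le> 1 - b + b * (1 - a) ^ n"
  proof (induction n)
    case (Suc n)
    let ?c = "(1 - a) ^ n"
    have c: "?c \<le> 1" using assms by (intro power_le_one) auto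
    have "a * b \<le> 1" using mult_mono[of a 1 b 1] assms by simp
    then have "(1 - a * b) ^ Suc n \<le> (1 - a * b) * (1 - b + b * ?c)"
      using Suc by (simp add: mult_left_mono)
    also have "\<dots> = 1 - b + b * (1 - a) ^ Suc n - a * b * (1 - b) * (1 - ?c)" by (simp add: algebra_simps)
    also have "\<dots> \<le> 1 - b + b * (1 - a) ^ Suc n" using assms c by simp
    finally show ?case .
  qed simp
  moreover have "(1 - a) ^ n \<le> exp (- (real n * a))"
  proof -
    have "(1 - a) ^ n \<le> exp (- a) ^ n" using assms exp_ge_add_one_self[of "-a"] by (intro power_mono) auto
    then show ?thesis by (simp flip: exp_of_nat_mult)
  qed
  moreover have "b * (1 - a) ^ n \<le> 1 * (1 - a) ^ n" using assms by (intro mult_right_mono) auto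
  ultimately show ?thesis by simp
qed

text \<open>Both Chernoff bounds for a normalised chi-square sum, per coordinate. The parameter
  \<epsilon> / 8 is a simple rather than an optimal choice that serves both tails.\<close>

lemma chernoff_exponents:
  fixes \<epsilon> :: real
  assumes "0 < \<epsilon>" "\<epsilon> \<le> 1"
  shows "exp (- (\<epsilon>/8) * (1 + \<epsilon>)) * (1 - 2 * (\<epsilon>/8)) powr (-1/2) \<le> exp (- \<epsilon>\<^sup>2 / 16)"
    and "exp ((\<epsilon>/8) * (1 - \<epsilon>)) * (1 - 2 * (-(\<epsilon>/8))) powr (-1/2) \<le> exp (- \<epsilon>\<^sup>2 / 16)"
proof -
  have "- (\<epsilon>/4) - 2 * (\<epsilon>/4)\<^sup>2 \<le> ln (1 - \<epsilon>/4)"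
    using assms by (intro ln_one_minus_pos_lower_bound) auto
  then have "- (\<epsilon>/8) * (1 + \<epsilon>) + (-1/2) * ln (1 - \<epsilon>/4) \<le> - \<epsilon>\<^sup>2 / 16"
    by (simp add: power2_eq_square field_simps)
  then show "exp (- (\<epsilon>/8) * (1 + \<epsilon>)) * (1 - 2 * (\<epsilon>/8)) powr (-1/2) \<le> exp (- \<epsilon>\<^sup>2 / 16)"
    using assms by (simp add: powr_def flip: exp_add)
  have "\<epsilon>/4 - (\<epsilon>/4)\<^sup>2 \<le> ln (1 + \<epsilon>/4)"
    using assms by (intro ln_one_plus_pos_lower_bound) auto
  moreover have "(\<epsilon>/8) * (1 - \<epsilon>) = \<epsilon>/8 - \<epsilon>\<^sup>2/8" "(\<epsilon>/4)\<^sup>2 = \<epsilon>\<^sup>2/16" "\<epsilon>\<^sup>2 \<ge> 0"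
    by (simp_all add: power2_eq_square field_simps)
  ultimately have "(\<epsilon>/8) * (1 - \<epsilon>) + (-1/2) * ln (1 + \<epsilon>/4) \<le> - \<epsilon>\<^sup>2 / 16"
    by linarith
  then show "exp ((\<epsilon>/8) * (1 - \<epsilon>)) * (1 - 2 * (-(\<epsilon>/8))) powr (-1/2) \<le> exp (- \<epsilon>\<^sup>2 / 16)"
    using assms by (simp add: powr_def flip: exp_add)
qed


context iid_normal
begin

text \<open>Random coding in standardised coordinates. On the jointly typical set the likelihood
  ratio of the correlated pair against the independent pair is at most exp R, so an independent
  codeword lands there with probability at least exp (- R) times the conditional probability under
  the test channel. Missed points are weighted by their energy, since they will be coded by 0;
  \<eta> trades the second moment of that energy against the miss probability.\<close>

lemma random_coding_covering:
  fixes m n :: nat and r \<sigma> :: "nat \<Rightarrow> real" and \<epsilon> \<eta> R \<Lambda> :: real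
  assumes r: "\<And>j. j < m \<Longrightarrow> (r j)\<^sup>2 < 1" and \<epsilon>: "0 < \<epsilon>" "\<epsilon> \<le> 1" and \<eta>: "\<eta> > 0"
    and \<Lambda>: "\<Lambda> = (\<Sum>j<m. (\<sigma> j)\<^sup>2)"
    and R: "R = (\<Sum>j<m. - ln (1 - (r j)\<^sup>2) / 2) + \<epsilon> * m"
  shows "\<exists>ys. length ys = n \<and>
    (\<integral>\<^sup>+x. ennreal (\<Sum>j<m. (\<sigma> j)\<^sup>2 * (\<zeta> j x)\<^sup>2) *
      (if \<exists>y\<in>set ys. (\<Sum>j<m. (\<zeta> j x - r j * y j)\<^sup>2 / (1 - (r j)\<^sup>2)) \<le> m * (1 + \<epsilon>) then 0 else 1) \<partial>M)
    \<le> ennreal (3 / 2 * \<eta> * \<Lambda>\<^sup>2 + (3 * exp (- \<epsilon>\<^sup>2 / 16 * m) + exp (- (real n * exp (- R)))) / (2 * \<eta>))"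
proof -
  define P where "P = PiM {..<m} (\<lambda>_. std_normal_distribution)"
  interpret N: prob_space std_normal_distribution using real_dist_normal_dist real_distribution_def by blast
  interpret PP: product_prob_space "\<lambda>_::nat. std_normal_distribution" "{..<m}" ..
  interpret P: prob_space P unfolding P_def by (rule prob_space_PiM) unfold_locales
  interpret MP: pair_sigma_finite M P ..
  have prodP: "(\<integral>\<^sup>+y. (\<Prod>j<m. f j (y j)) \<partial>P) = (\<Prod>j<m. \<integral>\<^sup>+z. f j z \<partial>std_normal_distribution)"
    if "\<And>j. j < m \<Longrightarrow> f j \<in> borel_measurable borel" for f :: "nat \<Rightarrow> real \<Rightarrow> ennreal"
    unfolding P_def using that by (intro PP.product_nn_integral_prod) auto
  have comp: "(\<lambda>p. snd p j) \<in> borel_measurable (M \<Otimes>\<^sub>M P)" if "j < m" for j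
    using that unfolding P_def
    by (intro measurable_compose[OF measurable_snd measurable_component_singleton[THEN measurable_cong_sets[OF refl, THEN equalityD1, THEN subsetD, rotated]]]) auto
  define T where "T = (\<lambda>x y. \<Sum>j<m. (\<zeta> j x - r j * y j)\<^sup>2 / (1 - (r j)\<^sup>2))"
  define Q where "Q = (\<lambda>x. \<Sum>j<m. (\<zeta> j x)\<^sup>2)"
  define L where "L = (\<lambda>x y. \<Prod>j<m. mehler (r j) (\<zeta> j x) (y j))"
  \<comment> \<open>Joint typicality: \<open>T\<close> is the normalised error of the test channel,
    \<open>Q\<close> the energy of the source. The lower bound on \<open>T\<close> and the upper
    bound on \<open>Q\<close> control the likelihood ratio; the upper bound on \<open>T\<close> is
    the covering that is wanted.\<close>
  define G where "G = (\<lambda>x y. T x y \<le> m * (1 + \<epsilon>) \<and> T x y \<ge> m * (1 - \<epsilon>) \<and> Q x \<le> m * (1 + \<epsilon>))"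
  have Tm[measurable]: "(\<lambda>p. T (fst p) (snd p)) \<in> borel_measurable (M \<Otimes>\<^sub>M P)"
    unfolding T_def using comp
    by (intro borel_measurable_sum borel_measurable_divide borel_measurable_power borel_measurable_diff borel_measurable_times) auto
  have Qm[measurable]: "Q \<in> borel_measurable M" unfolding Q_def by measurable
  have Lm[measurable]: "(\<lambda>p. L (fst p) (snd p)) \<in> borel_measurable (M \<Otimes>\<^sub>M P)"
    unfolding L_def mehler_def using comp
    by (intro borel_measurable_prod borel_measurable_exp borel_measurable_add borel_measurable_divide borel_measurable_power borel_measurable_diff borel_measurable_times) auto
  have Gm[measurable]: "Measurable.pred (M \<Otimes>\<^sub>M P) (\<lambda>p. G (fst p) (snd p))"
    unfolding G_def by measurable
  have L0: "L x y \<ge> 0" for x y unfolding L_def mehler_def by (intro prod_nonneg) auto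
  have LG: "L x y \<le> exp R" if "G x y" for x y
  proof -
    have "L x y = exp (\<Sum>j<m. - ln (1 - (r j)\<^sup>2) / 2 - (\<zeta> j x - r j * y j)\<^sup>2 / (2 * (1 - (r j)\<^sup>2)) + (\<zeta> j x)\<^sup>2 / 2)"
      by (simp add: L_def mehler_def exp_sum)
    also have "(\<Sum>j<m. - ln (1 - (r j)\<^sup>2) / 2 - (\<zeta> j x - r j * y j)\<^sup>2 / (2 * (1 - (r j)\<^sup>2)) + (\<zeta> j x)\<^sup>2 / 2)
      = (\<Sum>j<m. - ln (1 - (r j)\<^sup>2) / 2) - T x y / 2 + Q x / 2"
      unfolding T_def Q_def by (simp add: sum.distrib sum_subtractf sum_divide_distrib mult.commute)
    \<comment> \<open>The slack \<epsilon> m in \<open>R\<close> is exactly - m (1 - \<epsilon>) / 2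
      + m (1 + \<epsilon>) / 2.\<close>
    also have "\<dots> \<le> R" using that unfolding G_def R by (simp add: algebra_simps)
    finally show ?thesis by simp
  qed
  have sec: "(\<lambda>y. f (x, y)) \<in> borel_measurable P" if "f \<in> borel_measurable (M \<Otimes>\<^sub>M P)" "x \<in> space M" for f :: "_ \<Rightarrow> ennreal" and x
    using measurable_compose[OF measurable_Pair1'[OF that(2)] that(1)] by simp
  have Lint: "(\<integral>\<^sup>+y. ennreal (L x y) \<partial>P) = 1" for x
  proof -
    have "(\<integral>\<^sup>+y. ennreal (L x y) \<partial>P) = (\<integral>\<^sup>+y. (\<Prod>j<m. ennreal (mehler (r j) (\<zeta> j x) (y j))) \<partial>P)"
      by (simp add: L_def prod_ennreal mehler_def)
    also have "\<dots> = (\<Prod>j<m. \<integral>\<^sup>+z. ennreal (mehler (r j) (\<zeta> j x) z) \<partial>std_normal_distribution)"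
      by (rule prodP) (simp add: mehler_def)
    also have "\<dots> = (\<Prod>j<m. 1)"
    proof (rule prod.cong)
      fix j assume "j \<in> {..<m}"
      then have "(r j)\<^sup>2 < 1" using r by simp
      then show "(\<integral>\<^sup>+z. ennreal (mehler (r j) (\<zeta> j x) z) \<partial>std_normal_distribution) = 1"
        using mehler_exp_integral[of "r j" 0 "\<zeta> j x"] mehler_commute[of "r j" "\<zeta> j x"] by simp
    qed simp
    finally show ?thesis by simp
  qed
  \<comment> \<open>At a fixed source point, \<open>q\<close> is the miss probability of one
    independent codeword, and \<open>b\<close> below is the probability of leaving \<open>G\<close>
    under the test channel.\<close>
  define q where "q = (\<lambda>x. \<integral>\<^sup>+y. (if G x y then 0 else 1 :: ennreal) \<partial>P)"
  define b where "b = (\<lambda>x. \<integral>\<^sup>+y. (if G x y then 0 else ennreal (L x y)) \<partial>P)"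
  have bm0: "(\<lambda>p. if G (fst p) (snd p) then 0 else ennreal (L (fst p) (snd p))) \<in> borel_measurable (M \<Otimes>\<^sub>M P)"
    by measurable
  have qm0: "(\<lambda>p. if G (fst p) (snd p) then 0 else 1 :: ennreal) \<in> borel_measurable (M \<Otimes>\<^sub>M P)"
    by measurable
  have qm[measurable]: "q \<in> borel_measurable M" unfolding q_def
    using P.borel_measurable_nn_integral_fst[OF qm0] by simp
  have bm[measurable]: "b \<in> borel_measurable M" unfolding b_def
    using P.borel_measurable_nn_integral_fst[OF bm0] by simp
  have q1: "q x \<le> 1" for x
  proof -
    have "q x \<le> (\<integral>\<^sup>+y. 1 \<partial>P)" unfolding q_def by (intro nn_integral_mono) auto
    then show ?thesis by (simp add: P.emeasure_space_1)
  qed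
  have qb: "q x ^ n \<le> b x + ennreal (exp (- (real n * exp (- R))))" if w: "x \<in> space M" for x
  proof -
    define g where "g = (\<integral>\<^sup>+y. (if G x y then ennreal (L x y) else 0) \<partial>P)"
    define p where "p = (\<integral>\<^sup>+y. (if G x y then 1 else 0 :: ennreal) \<partial>P)"
    have ms: "(\<lambda>y. if G x y then 0 else ennreal (L x y)) \<in> borel_measurable P"
      "(\<lambda>y. if G x y then 0 else 1 :: ennreal) \<in> borel_measurable P"
      "(\<lambda>y. if G x y then ennreal (L x y) else 0) \<in> borel_measurable P"
      "(\<lambda>y. if G x y then 1 else 0 :: ennreal) \<in> borel_measurable P"
      using sec[OF bm0 w] sec[OF qm0 w]
        sec[of "\<lambda>p. if G (fst p) (snd p) then ennreal (L (fst p) (snd p)) else 0", OF _ w]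
        sec[of "\<lambda>p. if G (fst p) (snd p) then 1 else 0", OF _ w] by (simp_all cong: if_cong)
    have "g + b x = (\<integral>\<^sup>+y. ennreal (L x y) \<partial>P)"
      unfolding g_def b_def nn_integral_add[OF ms(3) ms(1), symmetric] by (intro nn_integral_cong) auto
    then have gb: "g + b x = 1" by (simp add: Lint)
    have "p + q x = (\<integral>\<^sup>+y. 1 \<partial>P)"
      unfolding p_def q_def nn_integral_add[OF ms(4) ms(2), symmetric] by (intro nn_integral_cong) auto
    then have pq: "p + q x = 1" by (simp add: P.emeasure_space_1)
    have "g \<le> (\<integral>\<^sup>+y. ennreal (exp R) * (if G x y then 1 else 0) \<partial>P)"
      unfolding g_def using LG by (intro nn_integral_mono) (auto intro: ennreal_leI)
    also have "\<dots> = ennreal (exp R) * p" unfolding p_def using ms by (intro nn_integral_cmult) auto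
    finally have gp: "g \<le> ennreal (exp R) * p" .
    have le: "g \<le> 1" "p \<le> 1" "b x \<le> 1" using gb pq
      by (metis le_iff_add, metis le_iff_add, metis add.commute le_iff_add)
    obtain g' where g': "g = ennreal g'" "g' \<ge> 0" using le by (cases g) (auto simp: top_unique)
    obtain p' where p': "p = ennreal p'" "p' \<ge> 0" using le by (cases p) (auto simp: top_unique)
    obtain b' where b': "b x = ennreal b'" "b' \<ge> 0" using le by (cases "b x") (auto simp: top_unique)
    obtain q' where q': "q x = ennreal q'" "q' \<ge> 0" using q1[of x] by (cases "q x") (auto simp: top_unique)
    have eqs: "g' + b' = 1" "p' + q' = 1" "g' \<le> exp R * p'"
      using gb pq gp g' p' b' q' by (simp_all flip: ennreal_plus ennreal_mult' add: ennreal_eq_1 ennreal_le_iff)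
    have a0: "exp (- R) * g' \<le> p'" using eqs(3) by (simp add: exp_minus field_simps)
    \<comment> \<open>The covering inequality wants a factor in [0, 1]; the minimum with 1 is
      removed afterwards because R \<ge> 0.\<close>
    have "q' ^ n \<le> (1 - min 1 (exp (- R)) * g') ^ n"
    proof (rule power_mono)
      have "min 1 (exp (- R)) * g' \<le> exp (- R) * g'" using g' by (intro mult_right_mono) auto
      then show "q' \<le> 1 - min 1 (exp (- R)) * g'" using a0 eqs by linarith
    qed (rule q')
    also have "\<dots> \<le> 1 - g' + exp (- (real n * min 1 (exp (- R))))"
      using g' b' eqs by (intro one_minus_mult_power_le) auto
    finally have fin: "q' ^ n \<le> b' + exp (- (real n * min 1 (exp (- R))))" using eqs by simp
    show ?thesis
    proof (cases "R \<ge> 0")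
      case True
      then have "min 1 (exp (- R)) = exp (- R)" by simp
      then show ?thesis using fin unfolding b' q'
        using b' q' by (simp flip: ennreal_plus add: ennreal_le_iff ennreal_power)
    next
      case False
      have "R \<ge> 0" unfolding R using r \<epsilon>
        by (intro add_nonneg_nonneg sum_nonneg) (auto simp: ln_le_zero_iff)
      with False show ?thesis by simp
    qed
  qed
  define \<beta> where "\<beta> = exp (- \<epsilon>\<^sup>2 / 16)"
  define s where "s = \<epsilon> / 8"
  have s: "0 < s" "s < 1/2" "- s < 1/2" using \<epsilon> by (auto simp: s_def)
  have \<beta>m: "\<beta> ^ m = exp (- \<epsilon>\<^sup>2 / 16 * m)" unfolding \<beta>_def by (simp flip: exp_of_nat_mult add: mult.commute)
  define E1 where "E1 = (\<lambda>x y. exp (s * (T x y - m * (1 + \<epsilon>))))"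
  define E2 where "E2 = (\<lambda>x y. exp (- s * (T x y - m * (1 - \<epsilon>))))"
  define E3 where "E3 = (\<lambda>x. exp (s * (Q x - m * (1 + \<epsilon>))))"
  have [measurable]: "(\<lambda>p. E1 (fst p) (snd p)) \<in> borel_measurable (M \<Otimes>\<^sub>M P)"
     "(\<lambda>p. E2 (fst p) (snd p)) \<in> borel_measurable (M \<Otimes>\<^sub>M P)" "E3 \<in> borel_measurable M"
    unfolding E1_def E2_def E3_def by measurable
  have TL: "(\<integral>\<^sup>+x. ennreal (L x y * exp (u * (T x y - m * c))) \<partial>M) \<le> ennreal (\<beta> ^ m)"
    if u: "u < 1/2" and cb: "exp (- u * c) * (1 - 2 * u) powr (-1/2) \<le> \<beta>" for u c :: real and y
  proof -
    have "(\<integral>\<^sup>+x. ennreal (L x y * exp (u * (T x y - m * c))) \<partial>M)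
      = (\<integral>\<^sup>+x. ennreal (exp (- u * c) ^ m) * (\<Prod>j<m. ennreal (mehler (r j) (\<zeta> j x) (y j) * exp (u * ((\<zeta> j x - r j * y j)\<^sup>2 / (1 - (r j)\<^sup>2))))) \<partial>M)"
    proof (rule nn_integral_cong)
      fix x
      have "exp (u * (T x y - m * c)) = exp (real m * (- u * c)) * exp (\<Sum>j<m. u * ((\<zeta> j x - r j * y j)\<^sup>2 / (1 - (r j)\<^sup>2)))"
        unfolding T_def by (simp add: sum_distrib_left algebra_simps flip: exp_add)
      also have "\<dots> = exp (- u * c) ^ m * (\<Prod>j<m. exp (u * ((\<zeta> j x - r j * y j)\<^sup>2 / (1 - (r j)\<^sup>2))))"
        by (simp only: exp_of_nat_mult exp_sum[OF finite_lessThan])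
      finally show "ennreal (L x y * exp (u * (T x y - m * c))) = ennreal (exp (- u * c) ^ m) * (\<Prod>j<m. ennreal (mehler (r j) (\<zeta> j x) (y j) * exp (u * ((\<zeta> j x - r j * y j)\<^sup>2 / (1 - (r j)\<^sup>2)))))"
        by (simp add: L_def prod_ennreal mehler_def prod.distrib prod_nonneg mult_ac flip: ennreal_mult')
    qed
    also have "\<dots> = ennreal (exp (- u * c) ^ m) * (\<Prod>j<m. \<integral>\<^sup>+z. ennreal (mehler (r j) z (y j) * exp (u * ((z - r j * y j)\<^sup>2 / (1 - (r j)\<^sup>2)))) \<partial>std_normal_distribution)"
      by (subst nn_integral_cmult, simp add: mehler_def, subst nn_integral_prod) (auto simp: mehler_def)
    also have "\<dots> = ennreal (exp (- u * c) ^ m) * (\<Prod>j<m. ennreal ((1 - 2 * u) powr (-1/2)))"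
      using r u by (intro arg_cong2[where f = "(*)"] prod.cong refl mehler_exp_integral) auto
    also have "\<dots> = ennreal ((exp (- u * c) * (1 - 2 * u) powr (-1/2)) ^ m)"
      by (simp add: power_mult_distrib ennreal_mult' ennreal_power)
    also have "\<dots> \<le> ennreal (\<beta> ^ m)" using cb by (intro ennreal_leI power_mono) auto
    finally show ?thesis .
  qed
  have I1: "(\<integral>\<^sup>+y. \<integral>\<^sup>+x. ennreal (L x y * E1 x y) \<partial>M \<partial>P) \<le> ennreal (\<beta> ^ m)"
  proof -
    have "(\<integral>\<^sup>+y. \<integral>\<^sup>+x. ennreal (L x y * E1 x y) \<partial>M \<partial>P) \<le> (\<integral>\<^sup>+y. ennreal (\<beta> ^ m) \<partial>P)"
      unfolding E1_def using chernoff_exponents(1)[OF \<epsilon>] s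
      by (intro nn_integral_mono TL) (auto simp: s_def \<beta>_def)
    then show ?thesis by (simp add: P.emeasure_space_1)
  qed
  have I2: "(\<integral>\<^sup>+y. \<integral>\<^sup>+x. ennreal (L x y * E2 x y) \<partial>M \<partial>P) \<le> ennreal (\<beta> ^ m)"
  proof -
    have "(\<integral>\<^sup>+y. \<integral>\<^sup>+x. ennreal (L x y * E2 x y) \<partial>M \<partial>P) \<le> (\<integral>\<^sup>+y. ennreal (\<beta> ^ m) \<partial>P)"
      unfolding E2_def using chernoff_exponents(2)[OF \<epsilon>] s
      by (intro nn_integral_mono TL) (auto simp: s_def \<beta>_def)
    then show ?thesis by (simp add: P.emeasure_space_1)
  qed
  have I3: "(\<integral>\<^sup>+x. ennreal (E3 x) \<partial>M) \<le> ennreal (\<beta> ^ m)"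
  proof -
    have "(\<integral>\<^sup>+x. ennreal (E3 x) \<partial>M) = (\<integral>\<^sup>+x. ennreal (exp (- s * (1 + \<epsilon>)) ^ m) * (\<Prod>j<m. ennreal (exp (s * (\<zeta> j x)\<^sup>2))) \<partial>M)"
    proof (rule nn_integral_cong)
      fix x
      have "E3 x = exp (real m * (- s * (1 + \<epsilon>))) * exp (\<Sum>j<m. s * (\<zeta> j x)\<^sup>2)"
        unfolding E3_def Q_def by (simp add: sum_distrib_left algebra_simps flip: exp_add)
      then show "ennreal (E3 x) = ennreal (exp (- s * (1 + \<epsilon>)) ^ m) * (\<Prod>j<m. ennreal (exp (s * (\<zeta> j x)\<^sup>2)))"
        by (simp only: exp_of_nat_mult exp_sum finite_lessThan) (simp add: prod_ennreal prod_nonneg flip: ennreal_mult')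
    qed
    also have "\<dots> = ennreal (exp (- s * (1 + \<epsilon>)) ^ m) * (\<Prod>j<m. ennreal ((1 - 2 * s) powr (-1/2)))"
      by (subst nn_integral_cmult, simp, subst nn_integral_prod) (auto simp: std_normal_exp_square[OF s(2)])
    also have "\<dots> = ennreal ((exp (- s * (1 + \<epsilon>)) * (1 - 2 * s) powr (-1/2)) ^ m)"
      by (simp add: power_mult_distrib ennreal_mult' ennreal_power)
    also have "\<dots> \<le> ennreal (\<beta> ^ m)"
      using chernoff_exponents(1)[OF \<epsilon>] by (intro ennreal_leI power_mono) (auto simp: s_def \<beta>_def)
    finally show ?thesis .
  qed
  have Eb: "(\<integral>\<^sup>+x. b x \<partial>M) \<le> ennreal (3 * \<beta> ^ m)"
  proof -
    have bound: "(if G x y then 0 else ennreal (L x y)) \<le> ennreal (L x y * E1 x y) + ennreal (L x y * E2 x y) + ennreal (L x y) * ennreal (E3 x)" for x y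
    proof (cases "G x y")
      case False
      \<comment> \<open>Union bound in exponential form: each way of leaving \<open>G\<close> makes
        one of the three exponentials at least 1.\<close>
      have "1 \<le> E1 x y + E2 x y + E3 x"
      proof -
        have pos: "E1 x y > 0" "E2 x y > 0" "E3 x > 0" by (auto simp: E1_def E2_def E3_def)
        from False consider "T x y > m * (1 + \<epsilon>)" | "T x y < m * (1 - \<epsilon>)" | "Q x > m * (1 + \<epsilon>)"
          unfolding G_def by linarith
        then show ?thesis
        proof cases
          case 1 then have "E1 x y \<ge> 1" using s unfolding E1_def by simp
          then show ?thesis using pos by linarith
        next
          case 2 then have "E2 x y \<ge> 1" using s unfolding E2_def by (simp add: mult_nonneg_nonpos)
          then show ?thesis using pos by linarith
        next
          case 3 then have "E3 x \<ge> 1" using s unfolding E3_def by simp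
          then show ?thesis using pos by linarith
        qed
      qed
      from mult_left_mono[OF this L0[of x y]]
      have "ennreal (L x y) \<le> ennreal (L x y * E1 x y + L x y * E2 x y + L x y * E3 x)"
        by (intro ennreal_leI) (simp add: algebra_simps)
      then show ?thesis using False L0[of x y]
        by (simp add: ennreal_plus ennreal_mult' E1_def E2_def E3_def)
    qed simp
    have "(\<integral>\<^sup>+x. b x \<partial>M) \<le> (\<integral>\<^sup>+x. \<integral>\<^sup>+y. ennreal (L x y * E1 x y) + ennreal (L x y * E2 x y) + ennreal (L x y) * ennreal (E3 x) \<partial>P \<partial>M)"
      unfolding b_def using bound by (intro nn_integral_mono)
    also have "\<dots> = (\<integral>\<^sup>+x. (\<integral>\<^sup>+y. ennreal (L x y * E1 x y) \<partial>P) + (\<integral>\<^sup>+y. ennreal (L x y * E2 x y) \<partial>P) + (\<integral>\<^sup>+y. ennreal (L x y) \<partial>P) * ennreal (E3 x) \<partial>M)"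
    proof (rule nn_integral_cong)
      fix x assume w: "x \<in> space M"
      have ms: "(\<lambda>y. ennreal (L x y * E1 x y)) \<in> borel_measurable P" "(\<lambda>y. ennreal (L x y * E2 x y)) \<in> borel_measurable P"
         "(\<lambda>y. ennreal (L x y)) \<in> borel_measurable P"
        using sec[of "\<lambda>p. ennreal (L (fst p) (snd p) * E1 (fst p) (snd p))", OF _ w]
          sec[of "\<lambda>p. ennreal (L (fst p) (snd p) * E2 (fst p) (snd p))", OF _ w]
          sec[of "\<lambda>p. ennreal (L (fst p) (snd p))", OF _ w] by simp_all
      then show "(\<integral>\<^sup>+y. ennreal (L x y * E1 x y) + ennreal (L x y * E2 x y) + ennreal (L x y) * ennreal (E3 x) \<partial>P)
        = (\<integral>\<^sup>+y. ennreal (L x y * E1 x y) \<partial>P) + (\<integral>\<^sup>+y. ennreal (L x y * E2 x y) \<partial>P) + (\<integral>\<^sup>+y. ennreal (L x y) \<partial>P) * ennreal (E3 x)"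
        by (simp add: nn_integral_add nn_integral_multc)
    qed
    also have "\<dots> = (\<integral>\<^sup>+x. \<integral>\<^sup>+y. ennreal (L x y * E1 x y) \<partial>P \<partial>M) + (\<integral>\<^sup>+x. \<integral>\<^sup>+y. ennreal (L x y * E2 x y) \<partial>P \<partial>M) + (\<integral>\<^sup>+x. ennreal (E3 x) \<partial>M)"
    proof -
      have "(\<lambda>x. \<integral>\<^sup>+y. ennreal (L x y * E1 x y) \<partial>P) \<in> borel_measurable M"
        using P.borel_measurable_nn_integral_fst[of "\<lambda>p. ennreal (L (fst p) (snd p) * E1 (fst p) (snd p))" M] by simp
      moreover have "(\<lambda>x. \<integral>\<^sup>+y. ennreal (L x y * E2 x y) \<partial>P) \<in> borel_measurable M"
        using P.borel_measurable_nn_integral_fst[of "\<lambda>p. ennreal (L (fst p) (snd p) * E2 (fst p) (snd p))" M] by simp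
      ultimately show ?thesis by (simp add: Lint nn_integral_add)
    qed
    \<comment> \<open>Given the codeword, the normalised error is a chi-square sum in the source
      variable, so that variable is integrated first.\<close>
    also have "\<dots> = (\<integral>\<^sup>+y. \<integral>\<^sup>+x. ennreal (L x y * E1 x y) \<partial>M \<partial>P) + (\<integral>\<^sup>+y. \<integral>\<^sup>+x. ennreal (L x y * E2 x y) \<partial>M \<partial>P) + (\<integral>\<^sup>+x. ennreal (E3 x) \<partial>M)"
      by (subst (1 2) MP.Fubini') (auto simp: case_prod_unfold)
    also have "\<dots> \<le> ennreal (\<beta> ^ m) + ennreal (\<beta> ^ m) + ennreal (\<beta> ^ m)"
      by (intro add_mono I1 I2 I3)
    also have "\<dots> = ennreal (3 * \<beta> ^ m)" by (simp add: \<beta>_def flip: ennreal_plus)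
    finally show ?thesis .
  qed
  define w where "w = (\<lambda>x. \<Sum>j<m. (\<sigma> j)\<^sup>2 * (\<zeta> j x)\<^sup>2)"
  have w0: "w x \<ge> 0" for x unfolding w_def by (intro sum_nonneg) auto
  have [measurable]: "w \<in> borel_measurable M" unfolding w_def by measurable
  have w2: "(\<integral>\<^sup>+x. ennreal ((w x)\<^sup>2) \<partial>M) \<le> ennreal (3 * \<Lambda>\<^sup>2)"
  proof -
    have le: "(w x)\<^sup>2 \<le> \<Lambda> * (\<Sum>j<m. (\<sigma> j)\<^sup>2 * (\<zeta> j x) ^ 4)" for x
    proof -
      \<comment> \<open>Splitting off one factor \<open>\<sigma> j\<close> makes the first sum
        \<Lambda> and leaves the weights \<sigma>^2 on the fourth powers, whose means are 3.\<close>
      have "(\<Sum>j<m. \<sigma> j * (\<sigma> j * (\<zeta> j x)\<^sup>2))\<^sup>2 \<le> (\<Sum>j<m. (\<sigma> j)\<^sup>2) * (\<Sum>j<m. (\<sigma> j * (\<zeta> j x)\<^sup>2)\<^sup>2)"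
        by (rule Cauchy_Schwarz_ineq_sum)
      then show ?thesis unfolding w_def \<Lambda> by (simp add: power2_eq_square power4_eq_xxxx mult_ac)
    qed
    have int: "integrable M (\<lambda>x. \<Lambda> * (\<Sum>j<m. (\<sigma> j)\<^sup>2 * (\<zeta> j x) ^ 4))"
      using integrable_power[of _ 4] by auto
    have "\<Lambda> \<ge> 0" unfolding \<Lambda> by (intro sum_nonneg) auto
    have "(\<integral>\<^sup>+x. ennreal ((w x)\<^sup>2) \<partial>M) \<le> (\<integral>\<^sup>+x. ennreal (\<Lambda> * (\<Sum>j<m. (\<sigma> j)\<^sup>2 * (\<zeta> j x) ^ 4)) \<partial>M)"
      using le by (intro nn_integral_mono ennreal_leI)
    also have "\<dots> = ennreal (expectation (\<lambda>x. \<Lambda> * (\<Sum>j<m. (\<sigma> j)\<^sup>2 * (\<zeta> j x) ^ 4)))"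
      using int \<open>\<Lambda> \<ge> 0\<close> by (intro nn_integral_eq_integral) (auto intro!: AE_I2 mult_nonneg_nonneg sum_nonneg)
    also have "expectation (\<lambda>x. \<Lambda> * (\<Sum>j<m. (\<sigma> j)\<^sup>2 * (\<zeta> j x) ^ 4)) = 3 * \<Lambda>\<^sup>2"
      using integrable_power[of _ 4] by (simp add: expectation_power4 \<Lambda> power2_eq_square flip: sum_distrib_right)
    finally show ?thesis .
  qed
  obtain ys where ys: "length ys = n" and cov:
     "(\<integral>\<^sup>+x. ennreal (w x) * (if \<exists>y\<in>set ys. G x y then 0 else 1) \<partial>M) \<le> (\<integral>\<^sup>+x. ennreal (w x) * q x ^ n \<partial>M)"
    using random_covering[of M P G "\<lambda>x. ennreal (w x)" n] P.prob_space_axioms sigma_finite_measure_axioms Gm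
    unfolding q_def by auto
  have "(\<integral>\<^sup>+x. ennreal (w x) * (if \<exists>y\<in>set ys. T x y \<le> m * (1 + \<epsilon>) then 0 else 1) \<partial>M)
     \<le> (\<integral>\<^sup>+x. ennreal (w x) * (if \<exists>y\<in>set ys. G x y then 0 else 1) \<partial>M)"
    by (intro nn_integral_mono) (auto simp: G_def)
  also note cov
  also have "(\<integral>\<^sup>+x. ennreal (w x) * q x ^ n \<partial>M) \<le> (\<integral>\<^sup>+x. ennreal (\<eta> / 2) * ennreal ((w x)\<^sup>2) + ennreal (1 / (2 * \<eta>)) * (b x + ennreal (exp (- (real n * exp (- R))))) \<partial>M)"
  proof (rule nn_integral_mono)
    fix x assume o: "x \<in> space M"
    obtain q' where q': "q x = ennreal q'" "q' \<ge> 0" using q1[of x] by (cases "q x") (auto simp: top_unique)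
    have "q' \<le> 1" using q1[of x] q' by simp
    \<comment> \<open>Arithmetic-geometric mean with parameter \<eta>, followed by q'^(2n) \<le>
      q'^n, so that the miss probability enters to the first power only.\<close>
    have "w x * q' ^ n \<le> \<eta> / 2 * (w x)\<^sup>2 + 1 / (2 * \<eta>) * q' ^ n"
    proof -
      have "0 \<le> (\<eta> * w x - q' ^ n)\<^sup>2 / (2 * \<eta>)" using \<eta> by simp
      also have "\<dots> = \<eta> / 2 * (w x)\<^sup>2 - w x * q' ^ n + 1 / (2 * \<eta>) * (q' ^ n * q' ^ n)"
        using \<eta> by (simp add: power2_eq_square field_simps)
      also have "1 / (2 * \<eta>) * (q' ^ n * q' ^ n) \<le> 1 / (2 * \<eta>) * (q' ^ n * 1)"
        using \<eta> q' \<open>q' \<le> 1\<close> by (intro mult_left_mono power_le_one) auto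
      finally show ?thesis by simp
    qed
    then have "ennreal (w x * q' ^ n) \<le> ennreal (\<eta> / 2 * (w x)\<^sup>2 + 1 / (2 * \<eta>) * q' ^ n)" by (rule ennreal_leI)
    also have "\<dots> = ennreal (\<eta> / 2) * ennreal ((w x)\<^sup>2) + ennreal (1 / (2 * \<eta>)) * ennreal (q' ^ n)"
    proof -
      have "ennreal (\<eta> / 2 * (w x)\<^sup>2) = ennreal (\<eta> / 2) * ennreal ((w x)\<^sup>2)"
        "ennreal (1 / (2 * \<eta>) * q' ^ n) = ennreal (1 / (2 * \<eta>)) * ennreal (q' ^ n)"
        by (rule ennreal_mult', use \<eta> in simp)+
      then show ?thesis using \<eta> q' by (subst ennreal_plus) auto
    qed
    finally have "ennreal (w x) * q x ^ n \<le> ennreal (\<eta> / 2) * ennreal ((w x)\<^sup>2) + ennreal (1 / (2 * \<eta>)) * q x ^ n"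
      using q' w0 by (simp add: ennreal_mult' ennreal_power)
    also have "\<dots> \<le> ennreal (\<eta> / 2) * ennreal ((w x)\<^sup>2) + ennreal (1 / (2 * \<eta>)) * (b x + ennreal (exp (- (real n * exp (- R)))))"
      using qb[OF o] by (intro add_mono mult_left_mono) auto
    finally show "ennreal (w x) * q x ^ n \<le> ennreal (\<eta> / 2) * ennreal ((w x)\<^sup>2) + ennreal (1 / (2 * \<eta>)) * (b x + ennreal (exp (- (real n * exp (- R)))))" .
  qed
  also have "\<dots> = ennreal (\<eta> / 2) * (\<integral>\<^sup>+x. ennreal ((w x)\<^sup>2) \<partial>M) + ennreal (1 / (2 * \<eta>)) * ((\<integral>\<^sup>+x. b x \<partial>M) + ennreal (exp (- (real n * exp (- R)))))"
    by (simp add: nn_integral_add nn_integral_cmult emeasure_space_1)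
  also have "\<dots> \<le> ennreal (\<eta> / 2) * ennreal (3 * \<Lambda>\<^sup>2) + ennreal (1 / (2 * \<eta>)) * (ennreal (3 * \<beta> ^ m) + ennreal (exp (- (real n * exp (- R)))))"
    by (intro add_mono mult_left_mono w2 Eb) auto
  also have "\<dots> = ennreal (\<eta> / 2 * (3 * \<Lambda>\<^sup>2) + 1 / (2 * \<eta>) * (3 * \<beta> ^ m + exp (- (real n * exp (- R)))))"
  proof -
    have "ennreal (3 * \<beta> ^ m) + ennreal (exp (- (real n * exp (- R)))) = ennreal (3 * \<beta> ^ m + exp (- (real n * exp (- R))))"
      by (rule ennreal_plus[symmetric]) (auto simp: \<beta>_def)
    moreover have "ennreal (\<eta> / 2) * ennreal (3 * \<Lambda>\<^sup>2) = ennreal (\<eta> / 2 * (3 * \<Lambda>\<^sup>2))"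
       "ennreal (1 / (2 * \<eta>)) * ennreal (3 * \<beta> ^ m + exp (- (real n * exp (- R)))) = ennreal (1 / (2 * \<eta>) * (3 * \<beta> ^ m + exp (- (real n * exp (- R)))))"
      by (rule ennreal_mult'[symmetric], use \<eta> in simp)+
    ultimately show ?thesis using \<eta> by (subst ennreal_plus) (auto simp: \<beta>_def)
  qed
  also have "\<eta> / 2 * (3 * \<Lambda>\<^sup>2) + 1 / (2 * \<eta>) * (3 * \<beta> ^ m + exp (- (real n * exp (- R)))) = 3 / 2 * \<eta> * \<Lambda>\<^sup>2 + (3 * exp (- \<epsilon>\<^sup>2 / 16 * m) + exp (- (real n * exp (- R)))) / (2 * \<eta>)"
    unfolding \<beta>m by (simp add: field_simps)
  finally show ?thesis using ys unfolding w_def T_def by blast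
qed

text \<open>The test channel at water level \<theta>: with r^2 = 1 - \<theta> / \<sigma>^2 each of
  the first m coordinates keeps the error variance \<sigma>^2 (1 - r^2) = \<theta>, and - ln (1 -
  r^2) / 2 becomes the rate ln (\<sigma>^2 / \<theta>) / 2. Coordinates from m on are dropped. The
  additional codeword 0 serves the points missed by the random code, hence
  \<open>real n + 1\<close>.\<close>

lemma random_coding:
  fixes m n N :: nat and \<sigma> :: "nat \<Rightarrow> real" and \<theta> \<epsilon> \<eta> :: real
  assumes e: "orthonormal_on U01 e {..<N}" "\<And>j. e j \<in> borel_measurable borel" and m: "m \<le> N"
    and \<theta>: "\<theta> > 0" and \<sigma>: "\<And>j. j < m \<Longrightarrow> \<theta> < (\<sigma> j)\<^sup>2" and \<epsilon>: "0 < \<epsilon>" "\<epsilon> \<le> 1" and \<eta>: "\<eta> > 0"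
  shows "codeable M (\<lambda>z t. \<Sum>j<N. \<sigma> j * e j t * \<zeta> j z) (real n + 1)
    (m * \<theta> * (1 + \<epsilon>) + (\<Sum>j\<in>{m..<N}. (\<sigma> j)\<^sup>2) + (3 / 2 * \<eta> * (\<Sum>j<m. (\<sigma> j)\<^sup>2)\<^sup>2 + (3 * exp (- \<epsilon>\<^sup>2 / 16 * m) +
      exp (- (real n * exp (- ((\<Sum>j<m. ln ((\<sigma> j)\<^sup>2 / \<theta>) / 2) + \<epsilon> * m))))) / (2 * \<eta>)))"
proof -
  define r where "r = (\<lambda>j. sqrt (1 - \<theta> / (\<sigma> j)\<^sup>2))"
  have r2: "(r j)\<^sup>2 = 1 - \<theta> / (\<sigma> j)\<^sup>2" if "j < m" for j
    using \<sigma>[OF that] \<theta> by (simp add: r_def divide_le_eq_1)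
  have r1: "(r j)\<^sup>2 < 1" if "j < m" for j
    using \<sigma>[OF that] \<theta> r2[OF that] divide_pos_pos[of \<theta> "(\<sigma> j)\<^sup>2"] by linarith
  define R where "R = (\<Sum>j<m. ln ((\<sigma> j)\<^sup>2 / \<theta>) / 2) + \<epsilon> * m"
  have R: "R = (\<Sum>j<m. - ln (1 - (r j)\<^sup>2) / 2) + \<epsilon> * m"
  proof -
    have "ln ((\<sigma> j)\<^sup>2 / \<theta>) = - ln (1 - (r j)\<^sup>2)" if "j < m" for j
      using less_trans[OF \<theta> \<sigma>[OF that]] \<theta> r2[OF that] by (simp add: ln_div)
    then show ?thesis by (simp add: R_def)
  qed
  define B where "B = 3 / 2 * \<eta> * (\<Sum>j<m. (\<sigma> j)\<^sup>2)\<^sup>2 + (3 * exp (- \<epsilon>\<^sup>2 / 16 * m) + exp (- (real n * exp (- R)))) / (2 * \<eta>)"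
  obtain ys where ys: "length ys = n" and cov: "(\<integral>\<^sup>+z. ennreal (\<Sum>j<m. (\<sigma> j)\<^sup>2 * (\<zeta> j z)\<^sup>2) *
      (if \<exists>y\<in>set ys. (\<Sum>j<m. (\<zeta> j z - r j * y j)\<^sup>2 / (1 - (r j)\<^sup>2)) \<le> m * (1 + \<epsilon>) then 0 else 1) \<partial>M) \<le> ennreal B"
    using random_coding_covering[OF r1 \<epsilon> \<eta> refl R, of n \<sigma>] unfolding B_def by auto
  define w where "w = (\<lambda>z. \<Sum>j<m. (\<sigma> j)\<^sup>2 * (\<zeta> j z)\<^sup>2)"
  define T where "T = (\<lambda>z y. \<Sum>j<m. (\<zeta> j z - r j * y j)\<^sup>2 / (1 - (r j)\<^sup>2))"
  define H where "H = (\<lambda>z. \<exists>y\<in>set ys. T z y \<le> m * (1 + \<epsilon>))"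
  define tl where "tl = (\<lambda>z. \<Sum>j\<in>{m..<N}. (\<sigma> j)\<^sup>2 * (\<zeta> j z)\<^sup>2)"
  define f where "f = (\<lambda>y t. \<Sum>j<m. \<sigma> j * r j * y j * e j t)"
  define A where "A = insert (\<lambda>t. 0) (f ` set ys)"
  have sqe: "\<And>j. j < N \<Longrightarrow> sq_int U01 (e j)" using e by (auto simp: orthonormal_on_def)
  have fL: "f y \<in> L2_01" for y
    unfolding f_def L2_01_sq_int using e(2) m sqe
    by (auto intro!: sq_int_sum sq_int_cmult)
  have A: "codebook A" using fL by (auto simp: codebook_def A_def L2_01_sq_int sq_int_zero)
  have "card A \<le> Suc (card (f ` set ys))" unfolding A_def by (simp add: card_insert_if)
  also have "card (f ` set ys) \<le> n" using card_image_le[of "set ys" f] card_length[of ys] ys by simp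
  finally have card: "real (card A) \<le> real n + 1" by simp
  define Y where "Y = (\<lambda>z t. \<Sum>j<N. \<sigma> j * e j t * \<zeta> j z)"
  have dist: "L2_dist_sq (Y z) (\<lambda>t. \<Sum>j<m. a j * e j t) = (\<Sum>j<m. (\<sigma> j * \<zeta> j z - a j)\<^sup>2) + tl z" for z a
  proof -
    define c where "c = (\<lambda>j. if j < m then a j - \<sigma> j * \<zeta> j z else - \<sigma> j * \<zeta> j z)"
    have un: "{..<N} = {..<m} \<union> {m..<N}" using m by auto
    have split: "(\<Sum>j<N. g j) = (\<Sum>j<m. g j) + (\<Sum>j\<in>{m..<N}. g j)" for g :: "nat \<Rightarrow> real"
      unfolding un by (rule sum.union_disjoint) auto
    have "Y z t - (\<Sum>j<m. a j * e j t) = 0 - (\<Sum>j<N. c j * e j t)" for t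
      unfolding Y_def split[of "\<lambda>j. c j * e j t"] split[of "\<lambda>j. \<sigma> j * e j t * \<zeta> j z"]
      by (simp add: c_def left_diff_distrib sum_subtractf sum_negf algebra_simps)
    then have "L2_dist_sq (Y z) (\<lambda>t. \<Sum>j<m. a j * e j t) = (\<integral>t. (0 - (\<Sum>j<N. c j * e j t))\<^sup>2 \<partial>U01)"
      unfolding L2_dist_sq_U01 by simp
    also have "\<dots> = (\<Sum>j<N. (c j)\<^sup>2)"
      using orthonormal_expand[OF e(1) _ sq_int_zero, of c] by simp
    also have "\<dots> = (\<Sum>j<m. (\<sigma> j * \<zeta> j z - a j)\<^sup>2) + tl z"
      unfolding split by (simp add: c_def tl_def power_mult_distrib power2_commute)
    finally show ?thesis .
  qed
  have le: "quant_dist A (Y z) \<le> m * \<theta> * (1 + \<epsilon>) + tl z + w z * (if H z then 0 else 1)" for z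
  proof (cases "H z")
    case True
    then obtain y where y: "y \<in> set ys" "T z y \<le> m * (1 + \<epsilon>)" unfolding H_def by blast
    have "quant_dist A (Y z) \<le> L2_dist_sq (Y z) (f y)" using y by (intro quant_dist_le[OF A]) (auto simp: A_def)
    also have "\<dots> = (\<Sum>j<m. (\<sigma> j * \<zeta> j z - \<sigma> j * r j * y j)\<^sup>2) + tl z"
      unfolding f_def using dist[of z "\<lambda>j. \<sigma> j * r j * y j"] by simp
    also have "(\<Sum>j<m. (\<sigma> j * \<zeta> j z - \<sigma> j * r j * y j)\<^sup>2) = \<theta> * T z y"
      unfolding T_def sum_distrib_left
    proof (rule sum.cong)
      fix j assume "j \<in> {..<m}"
      then have "1 - (r j)\<^sup>2 = \<theta> / (\<sigma> j)\<^sup>2" using r2[of j] by simp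
      moreover have "(\<sigma> j * \<zeta> j z - \<sigma> j * r j * y j)\<^sup>2 = (\<sigma> j)\<^sup>2 * (\<zeta> j z - r j * y j)\<^sup>2"
        by (simp add: algebra_simps flip: power_mult_distrib)
      ultimately show "(\<sigma> j * \<zeta> j z - \<sigma> j * r j * y j)\<^sup>2 = \<theta> * ((\<zeta> j z - r j * y j)\<^sup>2 / (1 - (r j)\<^sup>2))"
        using \<theta> by simp
    qed simp
    also have "\<theta> * T z y \<le> \<theta> * (m * (1 + \<epsilon>))" using y \<theta> by (intro mult_left_mono) auto
    finally show ?thesis using True by (simp add: mult_ac)
  next
    case False
    have "quant_dist A (Y z) \<le> L2_dist_sq (Y z) (\<lambda>t. 0)" by (intro quant_dist_le[OF A]) (auto simp: A_def)
    also have "\<dots> = w z + tl z"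
      using dist[of z "\<lambda>j. 0"] by (simp add: w_def power_mult_distrib)
    finally have "quant_dist A (Y z) \<le> w z + tl z" .
    moreover have "0 \<le> m * \<theta> * (1 + \<epsilon>)" using \<theta> \<epsilon> by simp
    ultimately show ?thesis using False by simp
  qed
  have w0: "w z \<ge> 0" and tl0: "tl z \<ge> 0" for z unfolding w_def tl_def by (intro sum_nonneg; simp)+
  have [measurable]: "w \<in> borel_measurable M" "tl \<in> borel_measurable M" unfolding w_def tl_def by measurable
  have [measurable]: "Measurable.pred M H" unfolding H_def T_def by measurable
  have tli: "(\<integral>\<^sup>+z. ennreal (tl z) \<partial>M) = ennreal (\<Sum>j\<in>{m..<N}. (\<sigma> j)\<^sup>2)"
  proof -
    have i2: "integrable M (\<lambda>z. (\<zeta> j z)\<^sup>2)" for j using integrable_power[of j 2] .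
    have "(\<integral>\<^sup>+z. ennreal (tl z) \<partial>M) = ennreal (expectation tl)"
      using tl0 i2 by (intro nn_integral_eq_integral) (auto simp: tl_def)
    also have "expectation tl = (\<Sum>j\<in>{m..<N}. (\<sigma> j)\<^sup>2)" unfolding tl_def using i2 by (simp add: expectation_square)
    finally show ?thesis .
  qed
  have "(\<integral>\<^sup>+z. ennreal (quant_dist A (Y z)) \<partial>M) \<le> (\<integral>\<^sup>+z. ennreal (m * \<theta> * (1 + \<epsilon>)) + ennreal (tl z) + ennreal (w z) * (if H z then 0 else 1) \<partial>M)"
  proof (rule nn_integral_mono)
    fix z
    have "ennreal (quant_dist A (Y z)) \<le> ennreal (m * \<theta> * (1 + \<epsilon>) + tl z + w z * (if H z then 0 else 1))"
      using le by (rule ennreal_leI)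
    also have "\<dots> = ennreal (m * \<theta> * (1 + \<epsilon>)) + ennreal (tl z) + ennreal (w z) * (if H z then 0 else 1)"
      using \<theta> \<epsilon> w0[of z] tl0[of z] by (cases "H z") (simp_all add: ennreal_plus)
    finally show "ennreal (quant_dist A (Y z)) \<le> ennreal (m * \<theta> * (1 + \<epsilon>)) + ennreal (tl z) + ennreal (w z) * (if H z then 0 else 1)" .
  qed
  also have "\<dots> = ennreal (m * \<theta> * (1 + \<epsilon>)) + (\<integral>\<^sup>+z. ennreal (tl z) \<partial>M) + (\<integral>\<^sup>+z. ennreal (w z) * (if H z then 0 else 1) \<partial>M)"
    by (simp add: nn_integral_add emeasure_space_1)
  also have "\<dots> \<le> ennreal (m * \<theta> * (1 + \<epsilon>)) + ennreal (\<Sum>j\<in>{m..<N}. (\<sigma> j)\<^sup>2) + ennreal B"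
    unfolding tli using cov unfolding w_def H_def T_def by (intro add_left_mono) simp
  also have "\<dots> = ennreal (m * \<theta> * (1 + \<epsilon>) + (\<Sum>j\<in>{m..<N}. (\<sigma> j)\<^sup>2) + B)"
    using \<theta> \<epsilon> \<eta> by (simp add: ennreal_plus sum_nonneg B_def add_nonneg_nonneg)
  finally show ?thesis unfolding codeable_def using A card unfolding Y_def B_def R_def by blast
qed

end

section \<open>Coding the analytic remainder\<close>

context iid_normal
begin

text \<open>Tonelli, then orthonormality of the coordinates at each fixed t.\<close>

lemma nn_integral_linear_process:
  assumes c: "\<And>j. j < N \<Longrightarrow> sq_int U01 (c j)"
  shows "(\<integral>\<^sup>+w. ennreal (\<integral>t. (\<Sum>j<N. c j t * \<zeta> j w)\<^sup>2 \<partial>U01) \<partial>M) = ennreal (\<Sum>j<N. \<integral>t. (c j t)\<^sup>2 \<partial>U01)"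
proof -
  interpret U: prob_space U01 by (rule prob_space_U01)
  interpret MU: pair_sigma_finite M U01 ..
  let ?Z = "\<lambda>w t. \<Sum>j<N. c j t * \<zeta> j w"
  have Z: "L2_process M ?Z" using c by (intro L2_process_linear) auto
  then have Zm: "(\<lambda>p. ?Z (fst p) (snd p)) \<in> borel_measurable (M \<Otimes>\<^sub>M U01)"
    by (simp add: L2_process_def case_prod_unfold)
  have "(\<integral>\<^sup>+w. ennreal (\<integral>t. (?Z w t)\<^sup>2 \<partial>U01) \<partial>M) = (\<integral>\<^sup>+w. \<integral>\<^sup>+t. ennreal ((?Z w t)\<^sup>2) \<partial>U01 \<partial>M)"
    using Z by (intro nn_integral_cong nn_integral_eq_integral[symmetric]) (auto simp: L2_process_def sq_int_def)
  also have "\<dots> = (\<integral>\<^sup>+t. \<integral>\<^sup>+w. ennreal ((?Z w t)\<^sup>2) \<partial>M \<partial>U01)"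
    using Zm by (intro MU.Fubini'[symmetric]) (simp add: case_prod_unfold)
  also have "\<dots> = (\<integral>\<^sup>+t. ennreal (\<Sum>j<N. (c j t)\<^sup>2) \<partial>U01)"
  proof (rule nn_integral_cong)
    fix t
    have "sq_int M (\<lambda>w. ?Z w t)" by (intro sq_int_sum sq_int_cmult sq_int_\<zeta>)
    then have "(\<integral>\<^sup>+w. ennreal ((?Z w t)\<^sup>2) \<partial>M) = ennreal (expectation (\<lambda>w. (?Z w t)\<^sup>2))"
      by (intro nn_integral_eq_integral) (auto simp: sq_int_def)
    then show "(\<integral>\<^sup>+w. ennreal ((?Z w t)\<^sup>2) \<partial>M) = ennreal (\<Sum>j<N. (c j t)\<^sup>2)"
      by (simp add: expectation_linear_square)
  qed
  also have "\<dots> = ennreal (\<integral>t. (\<Sum>j<N. (c j t)\<^sup>2) \<partial>U01)"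
    using c by (intro nn_integral_eq_integral) (auto intro!: sum_nonneg simp: sq_int_def)
  also have "(\<integral>t. (\<Sum>j<N. (c j t)\<^sup>2) \<partial>U01) = (\<Sum>j<N. \<integral>t. (c j t)\<^sup>2 \<partial>U01)"
    using c by (intro Bochner_Integration.integral_sum) (auto simp: sq_int_def)
  finally show ?thesis .
qed

text \<open>The grid has step V / T on [- V T, V T]. Inside, the error is at most one step; outside,
  the point 0 is used and x^2 is at most x^4 / (V^2 T^2). A bound valid in both cases lets a fourth
  moment take care of the Gaussian tail.\<close>

lemma exists_grid_point:
  fixes V x :: real and T :: nat
  assumes "V > 0" "T \<ge> 1"
  shows "\<exists>l\<in>{- int (T\<^sup>2)..int (T\<^sup>2)}. (x - V * of_int l / T)\<^sup>2 \<le> V\<^sup>2 / T\<^sup>2 + x ^ 4 / (V\<^sup>2 * T\<^sup>2)"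
proof (cases "\<bar>x\<bar> \<le> V * T")
  case True
  define l where "l = \<lfloor>x * T / V\<rfloor>"
  have fl: "of_int l \<le> x * T / V" "x * T / V < of_int l + 1" unfolding l_def by linarith+
  have "\<bar>x * T / V\<bar> \<le> T\<^sup>2" using True assms by (simp add: abs_mult field_simps power2_eq_square)
  then have "- real (T\<^sup>2) \<le> x * T / V" "x * T / V \<le> real (T\<^sup>2)" by linarith+
  then have "l \<in> {- int (T\<^sup>2)..int (T\<^sup>2)}"
    unfolding l_def by (auto simp: le_floor_iff floor_le_iff)
  moreover have "(x - V * of_int l / T)\<^sup>2 \<le> V\<^sup>2 / T\<^sup>2"
  proof -
    have "x - V * of_int l / T = V / T * (x * T / V - of_int l)" using assms by (simp add: field_simps)
    then have "(x - V * of_int l / T)\<^sup>2 = V\<^sup>2 / T\<^sup>2 * (x * T / V - of_int l)\<^sup>2" by (simp add: power_mult_distrib power_divide)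
    also have "\<dots> \<le> V\<^sup>2 / T\<^sup>2 * 1" using fl by (intro mult_left_mono) (auto simp: power_le_one abs_square_le_1)
    finally show ?thesis by simp
  qed
  moreover have "0 \<le> x ^ 4 / (V\<^sup>2 * T\<^sup>2)" by simp
  ultimately have "(x - V * of_int l / T)\<^sup>2 \<le> V\<^sup>2 / T\<^sup>2 + x ^ 4 / (V\<^sup>2 * T\<^sup>2)" "l \<in> {- int (T\<^sup>2)..int (T\<^sup>2)}"
    by linarith+
  then show ?thesis by blast
next
  case False
  have "V * T > 0" using assms by simp
  then have "(V * T)\<^sup>2 \<le> x\<^sup>2" using False by (metis abs_le_square_iff abs_of_pos less_imp_le not_le)
  then have "x\<^sup>2 * (V * T)\<^sup>2 \<le> x\<^sup>2 * x\<^sup>2" by (intro mult_left_mono) auto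
  then have "x\<^sup>2 \<le> x ^ 4 / (V\<^sup>2 * T\<^sup>2)" using assms by (simp add: field_simps power_mult_distrib flip: power_add)
  moreover have "0 \<le> V\<^sup>2 / T\<^sup>2" by simp
  ultimately have "x\<^sup>2 \<le> V\<^sup>2 / T\<^sup>2 + x ^ 4 / (V\<^sup>2 * T\<^sup>2)" by linarith
  then show ?thesis by (intro bexI[of _ 0]) auto
qed

text \<open>If the coefficient functions are nearly of finite rank, the process is nearly a
  combination of \<open>card I\<close> Gaussian variables of variance at most V^2. Rounding each of
  them on the same grid is wasteful, but the rank will be of smaller order than the rate, so a grid
  of polynomial size is cheap enough. In the constant, 194 = 2 * 97 and 97 = 1 + 96 from the grid
  step and the fourth moment.\<close>

lemma crude_coding:
  fixes I :: "'i set" and T N :: nat and V D :: real and h :: "'i \<Rightarrow> nat \<Rightarrow> real"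
  assumes I: "finite I" and s: "\<And>j. j < N \<Longrightarrow> sq_int U01 (s j)"
    and u: "\<And>i. i \<in> I \<Longrightarrow> u i \<in> borel_measurable borel" "\<And>i t. i \<in> I \<Longrightarrow> t \<in> {0..1} \<Longrightarrow> \<bar>u i t\<bar> \<le> 1"
    and V: "V > 0" "\<And>i. i \<in> I \<Longrightarrow> (\<Sum>j<N. (h i j)\<^sup>2) \<le> V\<^sup>2" and T: "T \<ge> 1"
    and D: "(\<Sum>j<N. \<integral>t. (s j t - (\<Sum>i\<in>I. u i t * h i j))\<^sup>2 \<partial>U01) \<le> D"
  shows "codeable M (\<lambda>z t. \<Sum>j<N. s j t * \<zeta> j z) ((2 * T\<^sup>2 + 1) ^ card I) (2 * D + 194 * (card I)\<^sup>2 * V\<^sup>2 / T\<^sup>2)"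
proof -
  interpret U: prob_space U01 by (rule prob_space_U01)
  define \<Gamma> where "\<Gamma> = (\<lambda>l::int. V * of_int l / T) ` {- int (T\<^sup>2)..int (T\<^sup>2)}"
  have \<Gamma>: "finite \<Gamma>" "\<Gamma> \<noteq> {}" "card \<Gamma> \<le> 2 * T\<^sup>2 + 1"
    using card_image_le[of "{- int (T\<^sup>2)..int (T\<^sup>2)}" "\<lambda>l::int. V * of_int l / T"]
    by (simp_all add: \<Gamma>_def nat_add_distrib nat_mult_distrib nat_power_eq)
  define f where "f = (\<lambda>g t. \<Sum>i\<in>I. u i t * g i)"
  define A where "A = f ` (PiE I (\<lambda>_. \<Gamma>))"
  have squ: "sq_int U01 (u i)" if "i \<in> I" for i
    using u[OF that] by (intro U.sq_int_bounded[where B = 1]) (auto intro!: measurable_restrict_space1)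
  have "f g \<in> L2_01" for g
    unfolding f_def L2_01_sq_int using u squ by (auto intro!: sq_int_sum sq_int_multc)
  then have A: "codebook A"
    using \<Gamma> I unfolding codebook_def A_def by (auto simp: PiE_eq_empty_iff intro!: finite_PiE)
  have "card A \<le> card (PiE I (\<lambda>_. \<Gamma>))" unfolding A_def using \<Gamma> I by (intro card_image_le finite_PiE) auto
  also have "\<dots> = card \<Gamma> ^ card I" using I by (simp add: card_PiE)
  also have "\<dots> \<le> (2 * T\<^sup>2 + 1) ^ card I" using \<Gamma> by (intro power_mono) auto
  finally have card: "real (card A) \<le> (2 * T\<^sup>2 + 1) ^ card I" by (simp flip: of_nat_le_iff[where 'a = real])
  define \<eta> where "\<eta> = (\<lambda>i z. \<Sum>j<N. h i j * \<zeta> j z)"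
  define dd where "dd = (\<lambda>j t. s j t - (\<Sum>i\<in>I. u i t * h i j))"
  have sqd: "sq_int U01 (dd j)" if "j < N" for j
    unfolding dd_def using s[OF that] squ by (intro sq_int_diff sq_int_sum sq_int_multc) auto
  define S where "S = (\<lambda>z t. \<Sum>j<N. s j t * \<zeta> j z)"
  define F where "F = (\<lambda>z. \<integral>t. (\<Sum>j<N. dd j t * \<zeta> j z)\<^sup>2 \<partial>U01)"
  define E where "E = (\<lambda>i z. V\<^sup>2 / T\<^sup>2 + (\<eta> i z) ^ 4 / (V\<^sup>2 * T\<^sup>2))"
  have le: "quant_dist A (S z) \<le> 2 * F z + 2 * card I * (\<Sum>i\<in>I. E i z)" if w: "z \<in> space M" for z
  proof -
    have "\<forall>i\<in>I. \<exists>g\<in>\<Gamma>. (\<eta> i z - g)\<^sup>2 \<le> E i z"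
      using exists_grid_point[OF V(1) T] unfolding \<Gamma>_def E_def by (metis imageI)
    then obtain g0 where g0: "\<And>i. i \<in> I \<Longrightarrow> g0 i \<in> \<Gamma>" "\<And>i. i \<in> I \<Longrightarrow> (\<eta> i z - g0 i)\<^sup>2 \<le> E i z" by metis
    define g where "g = restrict g0 I"
    have g: "g \<in> PiE I (\<lambda>_. \<Gamma>)" "\<And>i. i \<in> I \<Longrightarrow> (\<eta> i z - g i)\<^sup>2 \<le> E i z" using g0 by (auto simp: g_def)
    have "quant_dist A (S z) \<le> L2_dist_sq (S z) (f g)" using g by (intro quant_dist_le[OF A]) (auto simp: A_def)
    \<comment> \<open>The error splits into the rank defect \<open>dd\<close> and the rounding
      errors of the variables \<open>\<eta> i\<close>.\<close>
    also have "\<dots> = L2_dist_sq (\<lambda>t. (\<Sum>j<N. dd j t * \<zeta> j z) + (\<Sum>i\<in>I. u i t * (\<eta> i z - g i))) (\<lambda>t. 0 + 0)"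
    proof -
      have "S z t - f g t = (\<Sum>j<N. dd j t * \<zeta> j z) + (\<Sum>i\<in>I. u i t * (\<eta> i z - g i)) - (0 + 0)" for t
      proof -
        have "(\<Sum>i\<in>I. u i t * \<eta> i z) = (\<Sum>j<N. (\<Sum>i\<in>I. u i t * h i j) * \<zeta> j z)"
          unfolding \<eta>_def by (simp add: sum_distrib_left sum_distrib_right mult.assoc) (rule sum.swap)
        then show ?thesis
          by (simp add: S_def f_def dd_def left_diff_distrib right_diff_distrib sum_subtractf)
      qed
      then show ?thesis unfolding L2_dist_sq_U01 by presburger
    qed
    also have "\<dots> \<le> (1 + 1) * L2_dist_sq (\<lambda>t. \<Sum>j<N. dd j t * \<zeta> j z) (\<lambda>t. 0) + (1 + 1/1) * L2_dist_sq (\<lambda>t. \<Sum>i\<in>I. u i t * (\<eta> i z - g i)) (\<lambda>t. 0)"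
      using sqd squ by (intro L2_dist_sq_add_le sq_int_sum sq_int_multc sq_int_zero) auto
    also have "L2_dist_sq (\<lambda>t. \<Sum>i\<in>I. u i t * (\<eta> i z - g i)) (\<lambda>t. 0) \<le> card I * (\<Sum>i\<in>I. E i z)"
    proof -
      have "(\<integral>t. (\<Sum>i\<in>I. u i t * (\<eta> i z - g i))\<^sup>2 \<partial>U01) \<le> (\<integral>t. card I * (\<Sum>i\<in>I. E i z) \<partial>U01)"
      proof (rule integral_mono)
        show "integrable U01 (\<lambda>t. (\<Sum>i\<in>I. u i t * (\<eta> i z - g i))\<^sup>2)"
          using squ by (intro sq_int_sq sq_int_sum sq_int_multc) auto
        fix t assume "t \<in> space U01"
        then have t: "t \<in> {0..1}" by simp
        have "(\<Sum>i\<in>I. 1 * (u i t * (\<eta> i z - g i)))\<^sup>2 \<le> (\<Sum>i\<in>I. 1\<^sup>2) * (\<Sum>i\<in>I. (u i t * (\<eta> i z - g i))\<^sup>2)"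
          by (rule Cauchy_Schwarz_ineq_sum)
        also have "(\<Sum>i\<in>I. (u i t * (\<eta> i z - g i))\<^sup>2) \<le> (\<Sum>i\<in>I. E i z)"
        proof (rule sum_mono)
          fix i assume i: "i \<in> I"
          have "(u i t)\<^sup>2 \<le> 1" using u(2)[OF i t] by (simp add: abs_square_le_1)
          then have "(u i t * (\<eta> i z - g i))\<^sup>2 \<le> 1 * (\<eta> i z - g i)\<^sup>2"
            unfolding power_mult_distrib by (rule mult_right_mono) simp
          then show "(u i t * (\<eta> i z - g i))\<^sup>2 \<le> E i z" using g(2)[OF i] by simp
        qed
        finally show "(\<Sum>i\<in>I. u i t * (\<eta> i z - g i))\<^sup>2 \<le> card I * (\<Sum>i\<in>I. E i z)"
          by (simp add: mult_left_mono)
      qed simp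
      then show ?thesis using U.prob_space by (simp add: L2_dist_sq_U01)
    qed
    finally show ?thesis by (simp add: F_def L2_dist_sq_U01)
  qed
  have E0: "E i z \<ge> 0" for i z unfolding E_def by simp
  have F0: "F z \<ge> 0" for z unfolding F_def by simp
  have [measurable]: "E i \<in> borel_measurable M" for i unfolding E_def \<eta>_def by measurable
  have "L2_process M (\<lambda>z t. \<Sum>j<N. dd j t * \<zeta> j z)" using sqd by (intro L2_process_linear) auto
  from L2_process_dist_measurable[OF this, of "\<lambda>t. 0"]
  have [measurable]: "F \<in> borel_measurable M" unfolding F_def
    by (simp add: L2_dist_sq_U01 L2_01_sq_int sq_int_zero)
  have D0: "D \<ge> 0" using D by (rule order_trans[rotated]) (intro sum_nonneg, simp)
  have EF: "(\<integral>\<^sup>+z. ennreal (F z) \<partial>M) \<le> ennreal D"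
    unfolding F_def using nn_integral_linear_process[OF sqd] D by (simp add: dd_def ennreal_leI)
  have EE: "(\<integral>\<^sup>+z. ennreal (E i z) \<partial>M) \<le> ennreal (97 * V\<^sup>2 / T\<^sup>2)" if i: "i \<in> I" for i
  proof -
    have "(\<integral>\<^sup>+z. ennreal (E i z) \<partial>M) = (\<integral>\<^sup>+z. ennreal (V\<^sup>2 / T\<^sup>2) + ennreal (1 / (V\<^sup>2 * T\<^sup>2)) * ennreal ((\<eta> i z) ^ 4) \<partial>M)"
      unfolding E_def by (intro nn_integral_cong) (simp add: ennreal_plus flip: ennreal_mult')
    also have "\<dots> = ennreal (V\<^sup>2 / T\<^sup>2) + ennreal (1 / (V\<^sup>2 * T\<^sup>2)) * (\<integral>\<^sup>+z. ennreal ((\<eta> i z) ^ 4) \<partial>M)"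
      unfolding \<eta>_def by (simp add: nn_integral_add nn_integral_cmult emeasure_space_1)
    also have "\<dots> \<le> ennreal (V\<^sup>2 / T\<^sup>2) + ennreal (1 / (V\<^sup>2 * T\<^sup>2)) * ennreal (96 * (V\<^sup>2)\<^sup>2)"
    proof -
      have "(\<integral>\<^sup>+z. ennreal ((\<eta> i z) ^ 4) \<partial>M) \<le> ennreal (96 * (\<Sum>j<N. (h i j)\<^sup>2)\<^sup>2)"
        unfolding \<eta>_def by (rule nn_integral_linear_power4) simp
      also have "\<dots> \<le> ennreal (96 * (V\<^sup>2)\<^sup>2)"
        using V(2)[OF i] by (intro ennreal_leI mult_left_mono power_mono sum_nonneg) auto
      finally show ?thesis by (intro add_mono mult_left_mono) auto
    qed
    also have "\<dots> = ennreal (97 * V\<^sup>2 / T\<^sup>2)"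
      using V T by (simp add: power2_eq_square field_simps flip: ennreal_mult' ennreal_plus)
    finally show ?thesis .
  qed
  have "(\<integral>\<^sup>+z. ennreal (quant_dist A (S z)) \<partial>M) \<le> (\<integral>\<^sup>+z. ennreal 2 * ennreal (F z) + ennreal (2 * card I) * (\<Sum>i\<in>I. ennreal (E i z)) \<partial>M)"
  proof (rule nn_integral_mono)
    fix z assume "z \<in> space M"
    have "ennreal (quant_dist A (S z)) \<le> ennreal (2 * F z + 2 * card I * (\<Sum>i\<in>I. E i z))"
      using le[OF \<open>z \<in> space M\<close>] by (rule ennreal_leI)
    also have "\<dots> = ennreal (2 * F z) + ennreal (2 * card I * (\<Sum>i\<in>I. E i z))"
      using F0 E0 by (intro ennreal_plus mult_nonneg_nonneg sum_nonneg) auto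
    also have "ennreal (2 * F z) = ennreal 2 * ennreal (F z)" by (rule ennreal_mult') simp
    also have "ennreal (2 * card I * (\<Sum>i\<in>I. E i z)) = ennreal (2 * card I) * ennreal (\<Sum>i\<in>I. E i z)" by (rule ennreal_mult') simp
    also have "ennreal (\<Sum>i\<in>I. E i z) = (\<Sum>i\<in>I. ennreal (E i z))" using E0 by (simp add: sum_ennreal)
    finally show "ennreal (quant_dist A (S z)) \<le> ennreal 2 * ennreal (F z) + ennreal (2 * card I) * (\<Sum>i\<in>I. ennreal (E i z))" .
  qed
  also have "\<dots> = ennreal 2 * (\<integral>\<^sup>+z. ennreal (F z) \<partial>M) + ennreal (2 * card I) * (\<Sum>i\<in>I. \<integral>\<^sup>+z. ennreal (E i z) \<partial>M)"
    by (subst nn_integral_add, simp, simp, subst (1 2) nn_integral_cmult, simp, simp, subst nn_integral_sum) auto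
  also have "\<dots> \<le> ennreal 2 * ennreal D + ennreal (2 * card I) * (\<Sum>i\<in>I. ennreal (97 * V\<^sup>2 / T\<^sup>2))"
    by (intro add_mono mult_left_mono EF sum_mono EE) auto
  also have "(\<Sum>i\<in>I. ennreal (97 * V\<^sup>2 / T\<^sup>2)) = ennreal (card I * (97 * V\<^sup>2 / T\<^sup>2))"
    by (subst sum_ennreal) auto
  also have "ennreal 2 * ennreal D = ennreal (2 * D)" by (rule ennreal_mult'[symmetric]) simp
  also have "ennreal (2 * card I) * ennreal (card I * (97 * V\<^sup>2 / T\<^sup>2)) = ennreal (2 * card I * (card I * (97 * V\<^sup>2 / T\<^sup>2)))"
    by (rule ennreal_mult'[symmetric]) simp
  also have "ennreal (2 * D) + ennreal (2 * card I * (card I * (97 * V\<^sup>2 / T\<^sup>2))) = ennreal (2 * D + 2 * card I * (card I * (97 * V\<^sup>2 / T\<^sup>2)))"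
    using D0 by (intro ennreal_plus[symmetric]) auto
  also have "2 * D + 2 * card I * (card I * (97 * V\<^sup>2 / T\<^sup>2)) = 2 * D + 194 * (card I)\<^sup>2 * V\<^sup>2 / T\<^sup>2"
    by (simp add: power2_eq_square)
  finally show ?thesis unfolding codeable_def S_def using A card by blast
qed

end

section \<open>Low-rank approximation of kernels holomorphic in the right half-plane\<close>

lemma powr_comparable:
  fixes x y \<gamma> K :: real
  assumes "0 < x" "0 < y" "x \<le> K * y" "y \<le> K * x" "K \<ge> 1"
  shows "x powr \<gamma> \<le> K powr \<bar>\<gamma>\<bar> * y powr \<gamma>"
proof (cases "\<gamma> \<ge> 0")
  case True
  have "x powr \<gamma> \<le> (K * y) powr \<gamma>" using assms True by (intro powr_mono2) auto
  then show ?thesis using assms True by (simp add: powr_mult)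
next
  case False
  have "x powr \<gamma> \<le> (y / K) powr \<gamma>" using assms False by (intro powr_mono2') (auto simp: field_simps)
  also have "\<dots> = K powr (- \<gamma>) * y powr \<gamma>" using assms by (simp add: powr_divide powr_minus field_simps)
  finally show ?thesis using False by simp
qed

text \<open>Cauchy's estimate on the circle of radius 3/4 x0 about x0. The circle stays in the right
  half-plane and on it norm z lies between x0 / 4 and 7/4 x0, so the growth hypothesis costs a
  factor 4^|\<beta>|; x0 \<le> 3 keeps norm z below 6. For \<delta> \<le> x0 / 2 the Taylor ratio is
  at most 2/3, whence the factor 3.\<close>

lemma taylor_bounds:
  fixes h :: "complex \<Rightarrow> complex" and x0 \<delta> \<beta> C :: real
  assumes h: "h holomorphic_on {z. Re z > 0}"
    and C: "C \<ge> 0" "\<And>z. Re z > 0 \<Longrightarrow> norm z \<le> 6 \<Longrightarrow> norm (h z) \<le> C * norm z powr \<beta>"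
    and x0: "0 < x0" "x0 \<le> 3"
  defines "Mx \<equiv> C * 4 powr \<bar>\<beta>\<bar> * x0 powr \<beta>"
  shows "norm ((deriv ^^ l) h (of_real x0) / fact l) \<le> Mx / (3/4 * x0) ^ l"
    and "0 \<le> \<delta> \<Longrightarrow> \<delta> \<le> x0 / 2 \<Longrightarrow>
      norm (h (of_real (x0 + \<delta>)) - (\<Sum>l<d. (deriv ^^ l) h (of_real x0) / fact l * of_real \<delta> ^ l)) \<le> 3 * Mx * (\<delta> / (3/4 * x0)) ^ d"
proof -
  define r where "r = 3/4 * x0"
  have r: "r > 0" using x0 by (simp add: r_def)
  have Re: "Re z > x0 / 8" if "norm (of_real x0 - z) \<le> r" for z
  proof -
    have "\<bar>Re (of_real x0 - z)\<bar> \<le> r" using that abs_Re_le_cmod order_trans by blast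
    then have "\<bar>x0 - Re z\<bar> \<le> 3/4 * x0" by (simp add: r_def)
    then show ?thesis using x0 by linarith
  qed
  have sub: "cball (of_real x0) r \<subseteq> {z. Re z > 0}" using Re x0 by (fastforce simp: dist_norm)
  have hol: "h holomorphic_on cball (of_real x0) r" using h sub by (rule holomorphic_on_subset)
  have bd: "norm (h z) \<le> Mx" if "norm (of_real x0 - z) = r" for z
  proof -
    have "norm z \<le> norm (of_real x0 :: complex) + norm (of_real x0 - z)"
      using norm_triangle_ineq4[of "of_real x0 :: complex" "of_real x0 - z"] by simp
    then have up: "norm z \<le> x0 + r" using that x0 by simp
    have "norm (of_real x0 :: complex) - norm (of_real x0 - z) \<le> norm z"
      using norm_triangle_ineq2[of "of_real x0 :: complex" "of_real x0 - z"] by simp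
    then have lo: "x0 - r \<le> norm z" using that x0 by simp
    have "norm (h z) \<le> C * norm z powr \<beta>" using Re[of z] that up x0 by (intro C) (auto simp: r_def)
    also have "norm z powr \<beta> \<le> 4 powr \<bar>\<beta>\<bar> * x0 powr \<beta>"
      using up lo x0 by (intro powr_comparable) (auto simp: r_def)
    finally show ?thesis using C by (simp add: Mx_def mult_left_mono mult.assoc)
  qed
  have co: "norm ((deriv ^^ l) h (of_real x0) / fact l) \<le> Mx / r ^ l" for l
  proof -
    have "norm ((deriv ^^ l) h (of_real x0)) \<le> fact l * Mx / r ^ l"
      using hol r bd by (intro Cauchy_inequality holomorphic_on_imp_continuous_on)
        (auto intro: holomorphic_on_subset)
    then show ?thesis by (simp add: norm_divide field_simps)
  qed
  then show "norm ((deriv ^^ l) h (of_real x0) / fact l) \<le> Mx / (3/4 * x0) ^ l" by (simp add: r_def)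
  assume \<delta>: "0 \<le> \<delta>" "\<delta> \<le> x0 / 2"
  define q where "q = \<delta> / r"
  have q: "0 \<le> q" "q \<le> 2/3" using \<delta> x0 by (auto simp: q_def r_def field_simps)
  define a where "a = (\<lambda>l. (deriv ^^ l) h (of_real x0) / fact l * of_real \<delta> ^ l)"
  have "(\<lambda>n. (deriv ^^ n) h (of_real x0) / fact n * (of_real (x0 + \<delta>) - of_real x0) ^ n) sums h (of_real (x0 + \<delta>))"
    using hol \<delta> x0 by (intro holomorphic_power_series[where r = r])
      (auto simp: dist_norm r_def simp flip: of_real_diff intro: holomorphic_on_subset)
  then have sums: "a sums h (of_real (x0 + \<delta>))" by (simp add: a_def)
  have an: "norm (a l) \<le> Mx * q ^ l" for l
  proof -
    have "norm (a l) = norm ((deriv ^^ l) h (of_real x0) / fact l) * \<delta> ^ l"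
      using \<delta> unfolding a_def norm_mult norm_power by simp
    also have "\<dots> \<le> Mx / r ^ l * \<delta> ^ l" using co \<delta> by (intro mult_right_mono) auto
    finally show ?thesis by (simp add: q_def power_divide)
  qed
  have gs: "(\<lambda>l. Mx * q ^ (l + d)) sums (Mx * q ^ d * (1 / (1 - q)))"
    using sums_mult[OF geometric_sums[of q], of "Mx * q ^ d"] q by (simp add: power_add mult_ac)
  have "norm (\<Sum>l. a (l + d)) \<le> (\<Sum>l. Mx * q ^ (l + d))"
    using an gs by (intro norm_suminf_le) (auto simp: sums_iff)
  also have "\<dots> = Mx * q ^ d * (1 / (1 - q))" using gs by (simp add: sums_iff)
  also have "\<dots> \<le> Mx * q ^ d * 3"
    using q C by (intro mult_left_mono) (auto simp: Mx_def field_simps)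
  finally have "norm (\<Sum>l. a (l + d)) \<le> 3 * Mx * q ^ d" by simp
  moreover have "h (of_real (x0 + \<delta>)) - (\<Sum>l<d. a l) = (\<Sum>l. a (l + d))"
    using suminf_split_initial_segment[of a d] sums by (simp add: sums_iff)
  ultimately show "norm (h (of_real (x0 + \<delta>)) - (\<Sum>l<d. (deriv ^^ l) h (of_real x0) / fact l * of_real \<delta> ^ l)) \<le> 3 * Mx * (\<delta> / (3/4 * x0)) ^ d"
    by (simp add: a_def q_def r_def)
qed

text \<open>Taylor expansion in t about the left ends of b equal cells; s enters only through the
  coefficients, so the variables separate with rank b d. Uniform cells suffice: near the singularity
  the approximation is 0 and the error is absorbed by the factor
  \<open>(t - s + \<tau>) powr (\<beta> - p)\<close>. The exponent p may be anything up to d and is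
  used later to keep that factor square integrable.\<close>

lemma kernel_approx:
  fixes h :: "complex \<Rightarrow> complex" and \<tau> \<beta> p C :: real and d :: nat
  assumes h: "h holomorphic_on {z. Re z > 0}"
    and C: "C \<ge> 0" "\<And>z. Re z > 0 \<Longrightarrow> norm z \<le> 6 \<Longrightarrow> norm (h z) \<le> C * norm z powr \<beta>"
    and p: "0 \<le> p" "p \<le> real d" and \<tau>: "0 \<le> \<tau>" "\<tau> \<le> 2"
  shows "\<exists>K\<ge>0. \<forall>b\<ge>1. \<exists>u v :: nat \<times> nat \<Rightarrow> real \<Rightarrow> real.
    (\<forall>i\<in>{..<b} \<times> {..<d}. u i \<in> borel_measurable borel \<and> (\<forall>t. \<bar>u i t\<bar> \<le> 1) \<and>
       v i \<in> borel_measurable borel \<and> (\<forall>s\<in>{0..1}. \<bar>v i s\<bar> \<le> K * real b powr \<bar>\<beta>\<bar>)) \<and>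
    (\<forall>t\<in>{0..<1}. \<forall>s\<in>{0..1}.
       \<bar>(if t - s + \<tau> > 0 then Re (h (of_real (t - s + \<tau>))) else 0) - (\<Sum>i\<in>{..<b} \<times> {..<d}. u i t * v i s)\<bar>
       \<le> (if t - s + \<tau> > 0 then K * real b powr (- p) * (t - s + \<tau>) powr (\<beta> - p) else 0))"
proof -
  define K1 where "K1 = 3 * C * 4 powr \<bar>\<beta>\<bar> * (4/3) powr p * (3/2) powr \<bar>\<beta> - p\<bar>"
  define K2 where "K2 = C * 3 powr p"
  define K3 where "K3 = C * 4 powr \<bar>\<beta>\<bar> * 3 powr \<bar>\<beta>\<bar>"
  have K: "K1 \<ge> 0" "K2 \<ge> 0" "K3 \<ge> 0" using C by (auto simp: K1_def K2_def K3_def)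
  define K where "K = K1 + K2 + K3"
  have K0: "K \<ge> 0" using K by (simp add: K_def)
  show ?thesis
  proof (intro exI[of _ K] conjI allI impI K0)
    fix b :: nat assume b: "b \<ge> 1"
    define D where "D = (\<lambda>l x. Re ((deriv ^^ l) h (of_real x) / fact l))"
    \<comment> \<open>The powers are rescaled by b to be bounded by 1; the compensating
      \<open>b ^ l\<close> sits in \<open>v\<close>.\<close>
    define u where "u = (\<lambda>(c::nat, l::nat) t. if t \<in> {c / b..<(c + 1) / b} then (b * (t - c / b)) ^ l else (0::real))"
    define x0 where "x0 = (\<lambda>(c::nat) s. c / b - s + \<tau>)"
    \<comment> \<open>The threshold 2 / b guarantees that the cell length 1 / b is at most x0 / 2,
      the range in which the Taylor bound holds.\<close>
    define v where "v = (\<lambda>(c::nat, l::nat) s. if s \<in> {s. x0 c s \<ge> 2 / b} then D l (x0 c s) / b ^ l else (0::real))"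
    have hl: "(deriv ^^ l) h holomorphic_on {z. Re z > 0}" for l
      by (rule holomorphic_higher_deriv[OF h]) (simp add: open_halfspace_Re_gt)
    have um: "u i \<in> borel_measurable borel" for i
      unfolding u_def by (cases i) auto
    have u1: "\<bar>u i t\<bar> \<le> 1" for i t
    proof (cases i)
      case (Pair c l)
      show ?thesis
      proof (cases "t \<in> {c / b..<(c + 1) / b}")
        case True
        then have "real c \<le> b * t" "b * t < real c + 1" using b by (auto simp: field_simps)
        moreover have "b * (t - c / b) = b * t - c" using b by (simp add: field_simps)
        ultimately have "0 \<le> b * (t - c / b)" "b * (t - c / b) \<le> 1" by linarith+
        then show ?thesis using True by (simp add: u_def Pair power_le_one)
      qed (auto simp: u_def Pair)
    qed
    have vm: "v i \<in> borel_measurable borel" for i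
    proof (cases i)
      case (Pair c l)
      let ?A = "{s. x0 c s \<ge> 2 / b}"
      have c1: "continuous_on ?A (\<lambda>s. D l (x0 c s) / b ^ l)"
      proof -
        have "continuous_on ?A (\<lambda>s. (deriv ^^ l) h (of_real (x0 c s)))"
          using b by (intro continuous_on_compose2[OF holomorphic_on_imp_continuous_on[OF hl]] continuous_intros)
            (auto simp: x0_def intro!: continuous_intros intro: less_le_trans[of _ "2 / b"])
        then show ?thesis unfolding D_def by (intro continuous_intros) (use b in auto)
      qed
      have c2: "?A \<in> sets borel" unfolding x0_def by measurable
      show ?thesis unfolding v_def Pair prod.case
        by (rule borel_measurable_continuous_on_if[OF c2 c1 continuous_on_const])
    qed
    have x03: "x0 c s \<le> 3" if "c < b" "s \<in> {0..1}" for c s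
    proof -
      have "c / b \<le> 1" using that b by simp
      moreover have "0 \<le> s" using that by simp
      ultimately show ?thesis using \<tau> unfolding x0_def by linarith
    qed
    have vb: "\<bar>v i s\<bar> \<le> K * real b powr \<bar>\<beta>\<bar>" if i: "i \<in> {..<b} \<times> {..<d}" and s: "s \<in> {0..1}" for i s
    proof -
      obtain c l where cl: "i = (c, l)" "c < b" "l < d" using i by auto
      show ?thesis
      proof (cases "x0 c s \<ge> 2 / b")
        case True
        define x where "x = x0 c s"
        have x: "x > 0" "x \<le> 3" "2 / b \<le> x" "2 \<le> b * x"
          using True b x03[OF cl(2) s] by (auto simp: x_def field_simps intro: less_le_trans[of _ "2 / b"])
        have "\<bar>v i s\<bar> = \<bar>D l x\<bar> / b ^ l" using True cl by (simp add: v_def x_def)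
        also have "\<bar>D l x\<bar> \<le> (C * 4 powr \<bar>\<beta>\<bar> * x powr \<beta>) / (3/4 * x) ^ l"
          unfolding D_def using taylor_bounds(1)[OF h C x(1,2), of l] abs_Re_le_cmod order_trans by blast
        also have "(C * 4 powr \<bar>\<beta>\<bar> * x powr \<beta>) / (3/4 * x) ^ l / b ^ l = C * 4 powr \<bar>\<beta>\<bar> * x powr \<beta> / (3/4 * (b * x)) ^ l"
        proof -
          have "(3/4 * x) ^ l * real b ^ l = (3/4 * (b * x)) ^ l" by (simp add: mult_ac flip: power_mult_distrib)
          then show ?thesis by (simp add: divide_divide_eq_left)
        qed
        also have "\<dots> \<le> C * 4 powr \<bar>\<beta>\<bar> * x powr \<beta> / 1"
          using C x by (intro divide_left_mono mult_nonneg_nonneg) (auto intro!: one_le_power)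
        also have "\<dots> \<le> C * 4 powr \<bar>\<beta>\<bar> * (3 powr \<bar>\<beta>\<bar> * b powr \<bar>\<beta>\<bar>)"
        proof -
          have "x powr \<beta> \<le> 3 powr \<bar>\<beta>\<bar> * b powr \<bar>\<beta>\<bar>"
          proof -
            \<comment> \<open>Since x \<le> 3 and b x \<ge> 2, the numbers x and 1 differ by a
              factor of at most 3 b, which covers both signs of \<beta>.\<close>
            have "x powr \<beta> \<le> (3 * b) powr \<bar>\<beta>\<bar> * 1 powr \<beta>"
              using x b by (intro powr_comparable) (auto intro: order_trans[of _ 3] order_trans[of _ "b * x"])
            then show ?thesis using b by (simp add: powr_mult)
          qed
          then show ?thesis using C by (simp add: mult_left_mono)
        qed
        also have "\<dots> = K3 * b powr \<bar>\<beta>\<bar>" by (simp add: K3_def)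
        also have "\<dots> \<le> K * b powr \<bar>\<beta>\<bar>" using K by (intro mult_right_mono) (auto simp: K_def)
        finally show ?thesis by (simp add: divide_right_mono)
      next
        case False
        then show ?thesis using cl K0 by (simp add: v_def)
      qed
    qed
    have approx: "\<bar>(if t - s + \<tau> > 0 then Re (h (of_real (t - s + \<tau>))) else 0) - (\<Sum>i\<in>{..<b} \<times> {..<d}. u i t * v i s)\<bar>
       \<le> (if t - s + \<tau> > 0 then K * real b powr (- p) * (t - s + \<tau>) powr (\<beta> - p) else 0)"
      if t: "t \<in> {0..<1}" and s: "s \<in> {0..1}" for t s
    proof -
      define c where "c = nat \<lfloor>b * t\<rfloor>"
      have c0: "real c = of_int \<lfloor>b * t\<rfloor>" using t by (simp add: c_def)
      have c: "real c \<le> b * t" "b * t < real c + 1" unfolding c0 by linarith+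
      have "real b * t < real b * 1" using t b by (intro mult_strict_left_mono) auto
      then have "real c < b" using c(1) by linarith
      then have cb: "c < b" by simp
      have cell: "t \<in> {real c' / b..<(real c' + 1) / b} \<longleftrightarrow> c' = c" for c' :: nat
      proof
        assume "t \<in> {real c' / b..<(real c' + 1) / b}"
        then have "real c' \<le> b * t" "b * t < real c' + 1" using b by (auto simp: field_simps)
        then show "c' = c" using c by linarith
      qed (use c b in \<open>auto simp: field_simps\<close>)
      define \<delta> where "\<delta> = t - c / b"
      have \<delta>: "0 \<le> \<delta>" "\<delta> \<le> 1 / b" using iffD2[OF cell refl] by (auto simp: \<delta>_def add_divide_distrib)
      have sum: "(\<Sum>i\<in>{..<b} \<times> {..<d}. u i t * v i s) = (\<Sum>l<d. (b * \<delta>) ^ l * v (c, l) s)"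
      proof -
        have "(\<Sum>i\<in>{..<b} \<times> {..<d}. u i t * v i s) = (\<Sum>c'<b. \<Sum>l<d. u (c', l) t * v (c', l) s)"
          by (simp add: sum.cartesian_product)
        also have "\<dots> = (\<Sum>c'<b. if c' = c then (\<Sum>l<d. (b * \<delta>) ^ l * v (c, l) s) else 0)"
        proof (rule sum.cong[OF refl])
          fix c'
          have "u (c', l) t = (if c' = c then (b * \<delta>) ^ l else 0)" for l
            unfolding u_def prod.case of_nat_add of_nat_1 cell by (simp add: \<delta>_def)
          then show "(\<Sum>l<d. u (c', l) t * v (c', l) s) = (if c' = c then (\<Sum>l<d. (b * \<delta>) ^ l * v (c, l) s) else 0)"
            by (cases "c' = c") simp_all
        qed
        also have "\<dots> = (\<Sum>l<d. (b * \<delta>) ^ l * v (c, l) s)" using cb by simp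
        finally show ?thesis .
      qed
      define x where "x = t - s + \<tau>"
      have xx: "x = x0 c s + \<delta>" by (simp add: x_def x0_def \<delta>_def)
      have x6: "x \<le> 3" using t s \<tau> unfolding x_def atLeastAtMost_iff atLeastLessThan_iff by linarith
      show ?thesis
      proof (cases "x0 c s \<ge> 2 / b")
        case True
        define y where "y = x0 c s"
        have y: "y > 0" "y \<le> 3" "2 / b \<le> y" "2 \<le> b * y"
          using True b x03[OF cb s] by (auto simp: y_def field_simps intro: less_le_trans[of _ "2 / b"])
        have dy: "\<delta> \<le> y / 2" using \<delta> y by linarith
        have x0: "x > 0" using y \<delta> xx by (simp add: y_def)
        have "(\<Sum>l<d. (b * \<delta>) ^ l * v (c, l) s) = (\<Sum>l<d. Re ((deriv ^^ l) h (of_real y) / fact l * of_real \<delta> ^ l))"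
        proof (rule sum.cong[OF refl])
          fix l
          have re: "Re (w * of_real \<delta> ^ l) = Re w * \<delta> ^ l" for w by (simp flip: of_real_power)
          show "(b * \<delta>) ^ l * v (c, l) s = Re ((deriv ^^ l) h (of_real y) / fact l * of_real \<delta> ^ l)"
            unfolding re using True b by (simp add: v_def D_def y_def power_mult_distrib)
        qed
        then have eq: "Re (h (of_real x)) - (\<Sum>l<d. (b * \<delta>) ^ l * v (c, l) s) = Re (h (of_real (y + \<delta>)) - (\<Sum>l<d. (deriv ^^ l) h (of_real y) / fact l * of_real \<delta> ^ l))"
          by (simp add: xx y_def)
        have "\<bar>Re (h (of_real x)) - (\<Sum>l<d. (b * \<delta>) ^ l * v (c, l) s)\<bar> \<le> 3 * (C * 4 powr \<bar>\<beta>\<bar> * y powr \<beta>) * (\<delta> / (3/4 * y)) ^ d"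
          unfolding eq by (rule order_trans[OF abs_Re_le_cmod taylor_bounds(2)[OF h C y(1,2) \<delta>(1) dy]])
        also have "\<dots> \<le> 3 * (C * 4 powr \<bar>\<beta>\<bar> * y powr \<beta>) * ((4/3) powr p * (b powr (- p) * y powr (- p)))"
        proof (rule mult_left_mono)
          define q where "q = 1 / (3/4 * (b * y))"
          have q: "0 < q" "q \<le> 1" using y b by (auto simp: q_def field_simps)
          have "(\<delta> / (3/4 * y)) ^ d \<le> q ^ d"
          proof (rule power_mono)
            have "\<delta> / (3/4 * y) \<le> (1 / b) / (3/4 * y)" using \<delta> y by (intro divide_right_mono) auto
            then show "\<delta> / (3/4 * y) \<le> q" by (simp add: q_def)
          qed (use \<delta> y in auto)
          also have "\<dots> = q powr d" using q by (simp add: powr_realpow)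
          \<comment> \<open>As q \<le> 1, part of the Taylor order d is given up for the real
            exponent p.\<close>
          also have "\<dots> \<le> q powr p" using q p by (intro powr_mono') auto
          also have "\<dots> = (4/3) powr p * (b powr (- p) * y powr (- p))"
          proof -
            have "q = (4/3) * (inverse b * inverse y)" by (simp add: q_def field_simps)
            then have "q powr p = (4/3) powr p * ((inverse b) powr p * (inverse y) powr p)"
              by (simp only: powr_mult)
            then show ?thesis using y b by (simp add: powr_minus inverse_powr)
          qed
          finally show "(\<delta> / (3/4 * y)) ^ d \<le> (4/3) powr p * (b powr (- p) * y powr (- p))" .
        qed (use C in simp)
        also have "\<dots> = 3 * C * 4 powr \<bar>\<beta>\<bar> * (4/3) powr p * b powr (- p) * y powr (\<beta> - p)"
          using y by (simp add: powr_diff powr_minus field_simps)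
        also have "\<dots> \<le> 3 * C * 4 powr \<bar>\<beta>\<bar> * (4/3) powr p * b powr (- p) * ((3/2) powr \<bar>\<beta> - p\<bar> * x powr (\<beta> - p))"
          using y x0 dy \<delta> C xx by (intro mult_left_mono powr_comparable) (auto simp: y_def)
        also have "\<dots> = K1 * b powr (- p) * x powr (\<beta> - p)" by (simp add: K1_def)
        also have "\<dots> \<le> K * b powr (- p) * x powr (\<beta> - p)" using K by (intro mult_right_mono) (auto simp: K_def)
        finally show ?thesis using x0 unfolding sum x_def[symmetric] by simp
      next
        case False
        then have "(\<Sum>l<d. (b * \<delta>) ^ l * v (c, l) s) = 0" by (simp add: v_def)
        \<comment> \<open>Nothing is approximated here, but x \<le> 3 / b, so the factor (3 / (b
          x))^p \<ge> 1 can be inserted.\<close>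
        moreover have "\<bar>Re (h (of_real x))\<bar> \<le> K * b powr (- p) * x powr (\<beta> - p)" if x0: "x > 0"
        proof -
          have bx: "b * x \<le> 3"
          proof -
            have "b * x0 c s < 2" using False b by (simp add: field_simps)
            moreover have "b * \<delta> \<le> 1" using \<delta> b by (simp add: field_simps)
            ultimately show ?thesis unfolding xx by (simp add: distrib_left)
          qed
          have "\<bar>Re (h (of_real x))\<bar> \<le> norm (h (of_real x))" by (rule abs_Re_le_cmod)
          also have "\<dots> \<le> C * x powr \<beta>" using C(2)[of "of_real x"] x0 x6 by simp
          also have "\<dots> \<le> C * x powr \<beta> * (3 powr p * (b * x) powr (- p))"
          proof -
            have "(b * x) powr p \<le> 3 powr p" using bx x0 b p by (intro powr_mono2) auto
            then have "1 \<le> 3 powr p * (b * x) powr (- p)" using x0 b by (simp add: powr_minus field_simps)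
            then show ?thesis using mult_left_mono[of 1 "3 powr p * (b * x) powr (- p)" "C * x powr \<beta>"] C by simp
          qed
          also have "\<dots> = K2 * b powr (- p) * x powr (\<beta> - p)"
            using x0 b by (simp add: K2_def powr_mult powr_diff powr_minus field_simps)
          also have "\<dots> \<le> K * b powr (- p) * x powr (\<beta> - p)" using K by (intro mult_right_mono) (auto simp: K_def)
          finally show ?thesis .
        qed
        ultimately show ?thesis unfolding sum x_def[symmetric] by simp
      qed
    qed
    show "\<exists>u v :: nat \<times> nat \<Rightarrow> real \<Rightarrow> real.
      (\<forall>i\<in>{..<b} \<times> {..<d}. u i \<in> borel_measurable borel \<and> (\<forall>t. \<bar>u i t\<bar> \<le> 1) \<and>
       v i \<in> borel_measurable borel \<and> (\<forall>s\<in>{0..1}. \<bar>v i s\<bar> \<le> K * real b powr \<bar>\<beta>\<bar>)) \<and>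
      (\<forall>t\<in>{0..<1}. \<forall>s\<in>{0..1}.
       \<bar>(if t - s + \<tau> > 0 then Re (h (of_real (t - s + \<tau>))) else 0) - (\<Sum>i\<in>{..<b} \<times> {..<d}. u i t * v i s)\<bar>
       \<le> (if t - s + \<tau> > 0 then K * real b powr (- p) * (t - s + \<tau>) powr (\<beta> - p) else 0))"
      using um u1 vm vb approx by (intro exI[of _ u] exI[of _ v]) blast
  qed
qed

section \<open>Power integrals on the unit interval\<close>

lemma U01_integral_eq_nn:
  fixes f :: "real \<Rightarrow> real" and I :: real
  assumes [measurable]: "f \<in> borel_measurable borel" and nn: "\<And>x. x \<in> {0..1} \<Longrightarrow> 0 \<le> f x"
    and I: "(f has_integral I) {0..1}"
  shows "integrable U01 f" "(\<integral>x. f x \<partial>U01) = I"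
proof -
  have I0: "I \<ge> 0" using has_integral_nonneg[OF I] nn by auto
  have "(\<integral>\<^sup>+x. ennreal (f x) \<partial>U01) = (\<integral>\<^sup>+x. ennreal (f x * indicator {0..1} x) \<partial>lborel)"
    by (subst nn_integral_restrict_space) (auto intro!: nn_integral_cong simp: indicator_def)
  also have "\<dots> = ennreal I"
  proof (rule nn_integral_has_integral_lborel)
    have "(\<lambda>x. f x * indicator {0..1} x) = (\<lambda>x. if x \<in> {0..1} then f x else 0)" by (auto simp: indicator_def)
    then show "((\<lambda>x. f x * indicator {0..1} x) has_integral I) UNIV" using I by (simp only: has_integral_restrict_UNIV)
  qed (use nn in \<open>auto simp: indicator_def\<close>)
  finally have e: "(\<integral>\<^sup>+x. ennreal (f x) \<partial>U01) = ennreal I" .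
  have m: "f \<in> borel_measurable U01" by (rule measurable_restrict_space1) simp
  then show i: "integrable U01 f" using e nn by (intro integrableI_nonneg) auto
  have "ennreal (\<integral>x. f x \<partial>U01) = ennreal I"
    using nn_integral_eq_integral[OF i] AE_I2[of U01 "\<lambda>x. 0 \<le> f x"] nn e by simp
  moreover have "(\<integral>x. f x \<partial>U01) \<ge> 0" using nn by (intro Bochner_Integration.integral_nonneg) auto
  ultimately show "(\<integral>x. f x \<partial>U01) = I" using I0 by simp
qed

lemma U01_powr:
  assumes "a > -1"
  shows "integrable U01 (\<lambda>x. x powr a)" "(\<integral>x. x powr a \<partial>U01) = 1 / (a + 1)"
proof -
  have I: "((\<lambda>x. x powr a) has_integral 1 / (a + 1)) {0..1}" using has_integral_powr_from_0[OF assms, of 1] by simp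
  show "integrable U01 (\<lambda>x. x powr a)" "(\<integral>x. x powr a \<partial>U01) = 1 / (a + 1)"
    by (rule U01_integral_eq_nn[OF _ _ I]; simp)+
qed

lemma U01_powr_reflect:
  assumes "a > -1"
  shows "integrable U01 (\<lambda>x. (1 - x) powr a)" "(\<integral>x. (1 - x) powr a \<partial>U01) = 1 / (a + 1)"
proof -
  have "((\<lambda>x. x powr a) has_integral 1 / (a + 1)) (cbox 0 1)" using has_integral_powr_from_0[OF assms, of 1] by simp
  from has_integral_affinity[OF this, of "-1" 1]
  have "((\<lambda>x. (1 - x) powr a) has_integral 1 / (a + 1)) {0..1}" by (simp add: image_affinity_atLeastAtMost)
  note I = this
  show "integrable U01 (\<lambda>x. (1 - x) powr a)" "(\<integral>x. (1 - x) powr a \<partial>U01) = 1 / (a + 1)"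
    by (rule U01_integral_eq_nn[OF _ _ I]; simp)+
qed

lemma AE_U01_ne: "AE x in U01. x \<noteq> c"
proof -
  have "AE x in lborel. x \<noteq> c" by (rule AE_lborel_singleton)
  then have "AE x in lborel. x \<in> {0..1} \<longrightarrow> x \<noteq> c" by eventually_elim simp
  then show ?thesis by (subst AE_restrict_space_iff) auto
qed

lemma norm_powr_of_real_exponent: "z \<noteq> 0 \<Longrightarrow> norm (z powr of_real a :: complex) = norm z powr a"
  by (simp add: powr_def norm_exp_eq_Re)

section \<open>The remainder kernel and its holomorphic pieces\<close>

definition gk :: "real \<Rightarrow> real \<Rightarrow> real" where "gk \<alpha> x = x powr (\<alpha> - 1) * exp (- x)"

text \<open>The periodised kernel minus the Riemann-Liouville kernel, arranged by singularity. The
  first translate is singular only at the corner t = 0, s = 1; the later ones have arguments at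
  least 1 on the unit square; the last term is the original kernel minus the unshifted copy and
  vanishes to order \<alpha> at the diagonal.\<close>

definition rem_kernel :: "real \<Rightarrow> real \<Rightarrow> real \<Rightarrow> real" where
  "rem_kernel \<alpha> t s = gk \<alpha> (t - s + 1) + (\<Sum>n. gk \<alpha> (t - s + 2 + real n))
     - (if s < t then (t - s) powr (\<alpha> - 1) * (1 - exp (- (t - s))) else 0)"

definition cgk :: "real \<Rightarrow> complex \<Rightarrow> complex" where "cgk \<alpha> z = z powr of_real (\<alpha> - 1) * exp (- z)"

lemma exp_minus_of_real: "exp (- of_real x) = (of_real (exp (- x)) :: complex)"
  by (metis exp_of_real of_real_minus)

lemma cgk_of_real: "x > 0 \<Longrightarrow> cgk \<alpha> (of_real x) = of_real (gk \<alpha> x)"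
  unfolding cgk_def gk_def exp_minus_of_real by (subst powr_of_real) auto

lemma cgk_holomorphic: "cgk \<alpha> holomorphic_on {z. Re z > 0}"
  unfolding cgk_def by (intro holomorphic_intros) (auto simp: complex_nonpos_Reals_iff)

lemma norm_cgk: "Re z > 0 \<Longrightarrow> norm (cgk \<alpha> z) = norm z powr (\<alpha> - 1) * exp (- Re z)"
  unfolding cgk_def norm_mult by (subst norm_powr_of_real_exponent) (auto simp: norm_exp_eq_Re)

lemma power_div_fact_le_exp:
  assumes "(x::real) \<ge> 0" shows "x ^ k / fact k \<le> exp x"
proof -
  have "(\<Sum>n\<in>{k}. x ^ n /\<^sub>R fact n) \<le> (\<Sum>n. x ^ n /\<^sub>R fact n)"
    using assms by (intro sum_le_suminf[OF summable_exp_generic]) auto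
  then show ?thesis by (simp add: exp_def divide_inverse mult.commute)
qed

text \<open>Half of the exponential decay pays for the power, by y^k / k! \<le> e^y at y /
  2.\<close>

lemma summable_gk_bound:
  assumes R: "R \<ge> 1"
  shows "summable (\<lambda>n. (real n + R) powr c * exp (- real n))"
proof (rule summable_comparison_test')
  define k where "k = nat \<lceil>\<bar>c\<bar>\<rceil>"
  have kc: "c \<le> real k" unfolding k_def by linarith
  show "summable (\<lambda>n. (2 ^ k * fact k * exp (R / 2)) * exp (- 1 / 2 :: real) ^ n)"
    by (intro summable_mult summable_geometric) simp
  fix n
  define y where "y = real n + R"
  have y: "y \<ge> 1" using R by (simp add: y_def)
  have "y powr c \<le> y powr k" using y kc by (intro powr_mono) auto
  also have "\<dots> = 2 ^ k * fact k * ((y / 2) ^ k / fact k)" using y by (simp add: powr_realpow power_divide)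
  also have "\<dots> \<le> 2 ^ k * fact k * exp (y / 2)" using y by (intro mult_left_mono power_div_fact_le_exp) auto
  finally have "y powr c * exp (- real n) \<le> 2 ^ k * fact k * exp (y / 2) * exp (- real n)" by simp
  also have "\<dots> = 2 ^ k * fact k * (exp (R / 2) * exp (- 1 / 2) ^ n)"
    by (simp add: y_def field_simps flip: exp_of_nat_mult exp_add)
  finally show "norm ((real n + R) powr c * exp (- real n)) \<le> (2 ^ k * fact k * exp (R / 2)) * exp (- 1 / 2) ^ n"
    by (simp add: y_def)
qed

lemma norm_cgk_shift:
  assumes "Re z > 0" "norm z \<le> R"
  shows "norm (cgk \<alpha> (z + of_nat (Suc n))) \<le> (real n + (1 + R)) powr \<bar>\<alpha> - 1\<bar> * exp (- real n)"
proof -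
  let ?w = "z + of_nat (Suc n)"
  have re: "Re ?w \<ge> real n + 1" using assms by simp
  have lo: "norm ?w \<ge> 1" using complex_Re_le_cmod[of ?w] re by linarith
  have up: "norm ?w \<le> real n + (1 + R)"
    using norm_triangle_ineq[of z "of_nat (Suc n)"] assms unfolding norm_of_nat by simp
  have "norm (cgk \<alpha> ?w) = norm ?w powr (\<alpha> - 1) * exp (- Re ?w)" using re by (intro norm_cgk) linarith
  moreover have "norm ?w powr (\<alpha> - 1) \<le> (real n + (1 + R)) powr \<bar>\<alpha> - 1\<bar>"
  proof -
    have "norm ?w powr (\<alpha> - 1) \<le> norm ?w powr \<bar>\<alpha> - 1\<bar>" using lo by (intro powr_mono) auto
    also have "\<dots> \<le> (real n + (1 + R)) powr \<bar>\<alpha> - 1\<bar>" using lo up by (intro powr_mono2) auto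
    finally show ?thesis .
  qed
  moreover have "exp (- Re ?w) \<le> exp (- real n)" using re by simp
  ultimately show ?thesis by (simp only:) (rule mult_mono; simp)
qed

text \<open>The unshifted term is kept apart: it alone can blow up at 0, while the shifted terms are
  bounded there.\<close>

definition cgk_sum :: "real \<Rightarrow> complex \<Rightarrow> complex" where
  "cgk_sum \<alpha> z = cgk \<alpha> z + (\<Sum>n. cgk \<alpha> (z + of_nat (Suc n)))"

lemma cgk_sum_holomorphic: "cgk_sum \<alpha> holomorphic_on {z. Re z > 0}"
proof -
  let ?S = "{z. Re z > 0}"
  have "(\<lambda>z. \<Sum>n. cgk \<alpha> (z + of_nat (Suc n))) holomorphic_on ?S"
  proof (rule holomorphic_uniform_sequence)
    show "open ?S" by (rule open_halfspace_Re_gt)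
    show "(\<lambda>z. \<Sum>n<k. cgk \<alpha> (z + of_nat (Suc n))) holomorphic_on ?S" for k
    proof (intro holomorphic_on_sum)
      fix n
      show "(\<lambda>z. cgk \<alpha> (z + of_nat (Suc n))) holomorphic_on ?S"
        unfolding cgk_def by (intro holomorphic_intros) (auto simp: complex_nonpos_Reals_iff)
    qed
    fix x assume x: "x \<in> ?S"
    then obtain d where d: "d > 0" "cball x d \<subseteq> ?S"
      using x open_contains_cball[of ?S] open_halfspace_Re_gt[of 0] by auto
    have "uniform_limit (cball x d) (\<lambda>k z. \<Sum>n<k. cgk \<alpha> (z + of_nat (Suc n))) (\<lambda>z. \<Sum>n. cgk \<alpha> (z + of_nat (Suc n))) sequentially"
    proof (rule Weierstrass_m_test[where M = "\<lambda>n. (real n + (1 + (norm x + d))) powr \<bar>\<alpha> - 1\<bar> * exp (- real n)"])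
      fix n z assume z: "z \<in> cball x d"
      have "norm z \<le> norm x + norm (z - x)" using norm_triangle_ineq[of x "z - x"] by simp
      then have "norm z \<le> norm x + d" using z by (simp add: dist_norm norm_minus_commute)
      then show "norm (cgk \<alpha> (z + of_nat (Suc n))) \<le> (real n + (1 + (norm x + d))) powr \<bar>\<alpha> - 1\<bar> * exp (- real n)"
        using d z by (intro norm_cgk_shift) auto
    qed (rule summable_gk_bound, use d in simp)
    then show "\<exists>d>0. cball x d \<subseteq> ?S \<and> uniform_limit (cball x d) (\<lambda>k z. \<Sum>n<k. cgk \<alpha> (z + of_nat (Suc n))) (\<lambda>z. \<Sum>n. cgk \<alpha> (z + of_nat (Suc n))) sequentially"
      using d by blast
  qed
  then show ?thesis unfolding cgk_sum_def using cgk_holomorphic by (intro holomorphic_on_add)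
qed

lemma cgk_sum_bound:
  "\<exists>C\<ge>0. \<forall>z. Re z > 0 \<longrightarrow> norm z \<le> 6 \<longrightarrow> norm (cgk_sum \<alpha> z) \<le> C * norm z powr (min (\<alpha> - 1) 0)"
proof -
  define M where "M = (\<Sum>n. (real n + (1 + 6)) powr \<bar>\<alpha> - 1\<bar> * exp (- real n))"
  define \<gamma> where "\<gamma> = min (\<alpha> - 1) 0"
  have M0: "M \<ge> 0" unfolding M_def by (intro suminf_nonneg summable_gk_bound) auto
  define C where "C = 6 powr \<bar>\<alpha>-1\<bar> + M * 6 powr (- \<gamma>)"
  have b: "norm (cgk_sum \<alpha> z) \<le> C * norm z powr \<gamma>" if z: "Re z > 0" "norm z \<le> 6" for z
  proof -
    have z0: "norm z > 0" using z by auto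
    have "norm (\<Sum>n. cgk \<alpha> (z + of_nat (Suc n))) \<le> M"
      unfolding M_def using norm_cgk_shift[OF z] by (intro norm_suminf_le summable_gk_bound) auto
    moreover have "1 \<le> 6 powr (- \<gamma>) * norm z powr \<gamma>"
    proof -
      have "6 powr \<gamma> \<le> norm z powr \<gamma>" using z z0 by (intro powr_mono2') (auto simp: \<gamma>_def)
      then show ?thesis by (simp add: powr_minus field_simps)
    qed
    then have "M \<le> M * (6 powr (- \<gamma>) * norm z powr \<gamma>)" using mult_left_mono[OF _ M0, of 1] by simp
    moreover have "norm (cgk \<alpha> z) \<le> 6 powr \<bar>\<alpha>-1\<bar> * norm z powr \<gamma>"
    proof -
      have "norm (cgk \<alpha> z) \<le> norm z powr (\<alpha> - 1)" using norm_cgk[OF z(1)] z by (simp add: mult_left_le)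
      also have "\<dots> \<le> 6 powr \<bar>\<alpha>-1\<bar> * norm z powr \<gamma>"
      proof (cases "\<alpha> \<ge> 1")
        case True
        have "norm z powr (\<alpha> - 1) \<le> 6 powr (\<alpha> - 1)" using True z z0 by (intro powr_mono2) auto
        then show ?thesis using True z0 by (simp add: \<gamma>_def)
      next
        case False
        then have "\<gamma> = \<alpha> - 1" by (simp add: \<gamma>_def)
        moreover have "(1::real) \<le> 6 powr \<bar>\<alpha>-1\<bar>" by (rule ge_one_powr_ge_zero) auto
        ultimately show ?thesis by (simp add: mult_le_cancel_right1)
      qed
      finally show ?thesis .
    qed
    moreover have "norm (cgk_sum \<alpha> z) \<le> norm (cgk \<alpha> z) + norm (\<Sum>n. cgk \<alpha> (z + of_nat (Suc n)))"
      unfolding cgk_sum_def by (rule norm_triangle_ineq)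
    ultimately show ?thesis by (simp add: C_def distrib_right mult.assoc)
  qed
  have "C \<ge> 0" using M0 by (simp add: C_def)
  then show ?thesis using b unfolding \<gamma>_def by blast
qed

lemma summable_gk: "x > 0 \<Longrightarrow> summable (\<lambda>n. gk \<alpha> (x + real (Suc n)))"
proof -
  assume x: "x > 0"
  have "norm (gk \<alpha> (x + real (Suc n))) \<le> (real n + (1 + x)) powr \<bar>\<alpha> - 1\<bar> * exp (- real n)" for n
    using norm_cgk_shift[of "of_real x" x \<alpha> n] cgk_of_real[of "x + real (Suc n)" \<alpha>] x by simp
  then show ?thesis by (intro summable_comparison_test'[OF summable_gk_bound[of "1 + x"]]) (use x in auto)
qed

lemma cgk_sum_of_real:
  assumes "x > 0" shows "cgk_sum \<alpha> (of_real x) = of_real (\<Sum>n. gk \<alpha> (x + real n))"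
proof -
  have "cgk \<alpha> (of_real x + of_nat (Suc n)) = of_real (gk \<alpha> (x + real (Suc n)))" for n
    using assms cgk_of_real[of "x + real (Suc n)" \<alpha>] by simp
  then have "(\<Sum>n. cgk \<alpha> (of_real x + of_nat (Suc n))) = of_real (\<Sum>n. gk \<alpha> (x + real (Suc n)))"
    unfolding suminf_of_real[OF summable_gk[OF assms]] by (intro suminf_cong)
  moreover have "(\<Sum>n. gk \<alpha> (x + real n)) = gk \<alpha> x + (\<Sum>n. gk \<alpha> (x + real (Suc n)))"
    using suminf_split_head[of "\<lambda>n. gk \<alpha> (x + real n)"] summable_gk[OF assms, of \<alpha>]
      summable_Suc_iff[of "\<lambda>n. gk \<alpha> (x + real n)"] by simp
  ultimately show ?thesis using assms by (simp add: cgk_sum_def cgk_of_real)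
qed

text \<open>The holomorphic form of x^(\<alpha> - 1) minus \<open>gk \<alpha> x\<close>.\<close>

definition ca :: "real \<Rightarrow> complex \<Rightarrow> complex" where
  "ca \<alpha> z = z powr of_real (\<alpha> - 1) * (1 - exp (- z))"

lemma ca_holomorphic: "ca \<alpha> holomorphic_on {z. Re z > 0}"
  unfolding ca_def by (intro holomorphic_intros) (auto simp: complex_nonpos_Reals_iff)

lemma ca_of_real: "x > 0 \<Longrightarrow> ca \<alpha> (of_real x) = of_real (x powr (\<alpha> - 1) * (1 - exp (- x)))"
  unfolding ca_def exp_minus_of_real by (subst powr_of_real) auto

text \<open>One order better than \<open>cgk\<close>, because 1 - e^(-z) contributes a factor of
  size |z|. This is the gain from matching the diagonal singularity.\<close>

lemma ca_bound:
  assumes "Re z > 0" "norm z \<le> 6"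
  shows "norm (ca \<alpha> z) \<le> exp 6 * norm z powr \<alpha>"
proof -
  have z0: "z \<noteq> 0" using assms by auto
  have "norm (1 - exp (- z)) \<le> exp 6 * norm z"
  proof -
    have "norm (exp (- z) - (\<Sum>k\<le>0. (- z) ^ k / fact k)) \<le> exp \<bar>Re (- z)\<bar> * (norm (- z) ^ Suc 0) / fact 0"
      by (rule Taylor_exp)
    then have "norm (1 - exp (- z)) \<le> exp (Re z) * norm z" using assms by (simp add: norm_minus_commute)
    also have "\<dots> \<le> exp 6 * norm z" using complex_Re_le_cmod[of z] assms by (intro mult_right_mono) auto
    finally show ?thesis .
  qed
  then have "norm (ca \<alpha> z) \<le> norm z powr (\<alpha> - 1) * (exp 6 * norm z)"
    unfolding ca_def norm_mult norm_powr_of_real_exponent[OF z0] by (rule mult_left_mono) simp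
  also have "\<dots> = exp 6 * norm z powr \<alpha>" using z0 by (simp add: powr_diff)
  finally show ?thesis .
qed

lemma rem_kernel_measurable[measurable]: "(\<lambda>p. rem_kernel \<alpha> (fst p) (snd p)) \<in> borel_measurable (borel \<Otimes>\<^sub>M borel)"
  unfolding rem_kernel_def gk_def by measurable

lemma sum_triple:
  fixes f :: "nat \<times> 'i \<Rightarrow> real"
  shows "(\<Sum>i\<in>{..<3} \<times> J. f i) = (\<Sum>i\<in>J. f (0, i)) + (\<Sum>i\<in>J. f (1, i)) + (\<Sum>i\<in>J. f (2, i))"
proof -
  have "(\<Sum>i\<in>{..<3} \<times> J. f i) = (\<Sum>k<3. \<Sum>i\<in>J. f (k, i))" by (simp add: sum.cartesian_product)
  then show ?thesis by (simp add: numeral_3_eq_3 numeral_2_eq_2)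
qed

text \<open>Names the conclusion of \<open>kernel_approx\<close>, so that instances for three
  different kernels can be opened side by side.\<close>

definition kernel_family :: "nat \<Rightarrow> nat \<Rightarrow> real \<Rightarrow> (real \<Rightarrow> real \<Rightarrow> real) \<Rightarrow> (real \<Rightarrow> real \<Rightarrow> real)
    \<Rightarrow> (nat \<times> nat \<Rightarrow> real \<Rightarrow> real) \<Rightarrow> (nat \<times> nat \<Rightarrow> real \<Rightarrow> real) \<Rightarrow> bool" where
  "kernel_family b d V \<kappa> E u v \<longleftrightarrow>
    (\<forall>i\<in>{..<b} \<times> {..<d}. u i \<in> borel_measurable borel \<and> (\<forall>t. \<bar>u i t\<bar> \<le> 1) \<and>
       v i \<in> borel_measurable borel \<and> (\<forall>s\<in>{0..1}. \<bar>v i s\<bar> \<le> V)) \<and>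
    (\<forall>t\<in>{0..<1}. \<forall>s\<in>{0..1}. \<bar>\<kappa> t s - (\<Sum>i\<in>{..<b} \<times> {..<d}. u i t * v i s)\<bar> \<le> E t s)"

lemma kernel_familyD:
  assumes "kernel_family b d V \<kappa> E u v"
  shows "i \<in> {..<b} \<times> {..<d} \<Longrightarrow> u i \<in> borel_measurable borel" "i \<in> {..<b} \<times> {..<d} \<Longrightarrow> \<bar>u i t\<bar> \<le> 1"
    "i \<in> {..<b} \<times> {..<d} \<Longrightarrow> v i \<in> borel_measurable borel" "i \<in> {..<b} \<times> {..<d} \<Longrightarrow> s \<in> {0..1} \<Longrightarrow> \<bar>v i s\<bar> \<le> V"
    "t \<in> {0..<1} \<Longrightarrow> s \<in> {0..1} \<Longrightarrow> \<bar>\<kappa> t s - (\<Sum>i\<in>{..<b} \<times> {..<d}. u i t * v i s)\<bar> \<le> E t s"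
  using assms unfolding kernel_family_def by blast+

lemma rem_kernel_approx:
  fixes \<alpha> :: real
  assumes \<alpha>: "\<alpha> > 1/2"
  shows "\<exists>K>0. \<exists>d\<ge>1. \<forall>b\<ge>1. \<exists>u v :: nat \<times> nat \<times> nat \<Rightarrow> real \<Rightarrow> real.
    (\<forall>i\<in>{..<3} \<times> {..<b} \<times> {..<d}. u i \<in> borel_measurable borel \<and> (\<forall>t. \<bar>u i t\<bar> \<le> 1) \<and>
       v i \<in> borel_measurable borel \<and> (\<forall>s\<in>{0..1}. \<bar>v i s\<bar> \<le> K * real b powr (\<alpha> + 1))) \<and>
    (\<forall>t\<in>{0<..<1}. \<forall>s\<in>{0..<1}. (rem_kernel \<alpha> t s - (\<Sum>i\<in>{..<3} \<times> {..<b} \<times> {..<d}. u i t * v i s))\<^sup>2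
       \<le> K * real b powr (- (2 * \<alpha> - 1/2)) * (t powr (-3/4) * (1 - s) powr (-3/4)))"
proof -
  \<comment> \<open>Any exponent strictly between \<alpha> - 1/2 and \<alpha> would do. Above
    \<alpha> - 1/2 the order 2 p beats the exponent 2 \<alpha> - 1 of the main distortion; below
    \<alpha> the corner singularity (t - s + 1)^(\<alpha> - 1 - p) stays square integrable on the
    unit square. The midpoint gives the exponent -3/4.\<close>
  define p where "p = \<alpha> - 1/4"
  define d where "d = nat \<lceil>\<alpha>\<rceil> + 1"
  have p: "0 \<le> p" "p \<le> real d" using \<alpha> unfolding p_def d_def by linarith+
  obtain C where C: "C \<ge> 0" "\<And>z. Re z > 0 \<Longrightarrow> norm z \<le> 6 \<Longrightarrow> norm (cgk_sum \<alpha> z) \<le> C * norm z powr (min (\<alpha> - 1) 0)"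
    using cgk_sum_bound[of \<alpha>] by blast
  have cb: "norm (cgk \<alpha> z) \<le> 1 * norm z powr (\<alpha> - 1)" if "Re z > 0" "norm z \<le> 6" for z
    using norm_cgk[OF that(1), of \<alpha>] that by (simp add: mult_left_le)
  obtain KA where KA: "KA \<ge> 0" "\<And>b. b \<ge> 1 \<Longrightarrow> \<exists>u v. kernel_family b d (KA * real b powr \<bar>\<alpha>\<bar>)
      (\<lambda>t s. if t - s + 0 > 0 then Re (ca \<alpha> (of_real (t - s + 0))) else 0)
      (\<lambda>t s. if t - s + 0 > 0 then KA * real b powr (- p) * (t - s + 0) powr (\<alpha> - p) else 0) u v"
    unfolding kernel_family_def
    using kernel_approx[OF ca_holomorphic exp_ge_zero ca_bound p order.refl zero_le_numeral, of \<alpha>] by blast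
  obtain KB where KB: "KB \<ge> 0" "\<And>b. b \<ge> 1 \<Longrightarrow> \<exists>u v. kernel_family b d (KB * real b powr \<bar>\<alpha> - 1\<bar>)
      (\<lambda>t s. if t - s + 1 > 0 then Re (cgk \<alpha> (of_real (t - s + 1))) else 0)
      (\<lambda>t s. if t - s + 1 > 0 then KB * real b powr (- p) * (t - s + 1) powr (\<alpha> - 1 - p) else 0) u v"
    unfolding kernel_family_def
    using kernel_approx[OF cgk_holomorphic zero_le_one cb p zero_le_one one_le_numeral] by blast
  obtain KC where KC: "KC \<ge> 0" "\<And>b. b \<ge> 1 \<Longrightarrow> \<exists>u v. kernel_family b d (KC * real b powr \<bar>min (\<alpha> - 1) 0\<bar>)
      (\<lambda>t s. if t - s + 2 > 0 then Re (cgk_sum \<alpha> (of_real (t - s + 2))) else 0)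
      (\<lambda>t s. if t - s + 2 > 0 then KC * real b powr (- p) * (t - s + 2) powr (min (\<alpha> - 1) 0 - p) else 0) u v"
    unfolding kernel_family_def
    using kernel_approx[OF cgk_sum_holomorphic C p zero_le_numeral order.refl] by blast
  define K0 where "K0 = 1 + KA + KB + KC"
  have K0: "K0 \<ge> 1" "KA \<le> K0" "KB \<le> K0" "KC \<le> K0" "KA + KB + KC \<le> K0" using KA KB KC by (auto simp: K0_def)
  define K where "K = K0\<^sup>2"
  have K: "K > 0" "K0 \<le> K" using K0 self_le_power[of K0 2] by (auto simp: K_def)
  have main: "\<exists>u v :: nat \<times> nat \<times> nat \<Rightarrow> real \<Rightarrow> real.
    (\<forall>i\<in>{..<3} \<times> {..<b} \<times> {..<d}. u i \<in> borel_measurable borel \<and> (\<forall>t. \<bar>u i t\<bar> \<le> 1) \<and>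
       v i \<in> borel_measurable borel \<and> (\<forall>s\<in>{0..1}. \<bar>v i s\<bar> \<le> K * real b powr (\<alpha> + 1))) \<and>
    (\<forall>t\<in>{0<..<1}. \<forall>s\<in>{0..<1}. (rem_kernel \<alpha> t s - (\<Sum>i\<in>{..<3} \<times> {..<b} \<times> {..<d}. u i t * v i s))\<^sup>2
       \<le> K * real b powr (- (2 * \<alpha> - 1/2)) * (t powr (-3/4) * (1 - s) powr (-3/4)))" if b: "b \<ge> 1" for b :: nat
  proof -
    let ?J = "{..<b} \<times> {..<d}"
    obtain uA vA where "kernel_family b d (KA * real b powr \<bar>\<alpha>\<bar>)
      (\<lambda>t s. if t - s + 0 > 0 then Re (ca \<alpha> (of_real (t - s + 0))) else 0)
      (\<lambda>t s. if t - s + 0 > 0 then KA * real b powr (- p) * (t - s + 0) powr (\<alpha> - p) else 0) uA vA"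
      using KA(2)[OF b] by blast
    note A = kernel_familyD[OF this]
    obtain uB vB where "kernel_family b d (KB * real b powr \<bar>\<alpha> - 1\<bar>)
      (\<lambda>t s. if t - s + 1 > 0 then Re (cgk \<alpha> (of_real (t - s + 1))) else 0)
      (\<lambda>t s. if t - s + 1 > 0 then KB * real b powr (- p) * (t - s + 1) powr (\<alpha> - 1 - p) else 0) uB vB"
      using KB(2)[OF b] by blast
    note B = kernel_familyD[OF this]
    obtain uC vC where "kernel_family b d (KC * real b powr \<bar>min (\<alpha> - 1) 0\<bar>)
      (\<lambda>t s. if t - s + 2 > 0 then Re (cgk_sum \<alpha> (of_real (t - s + 2))) else 0)
      (\<lambda>t s. if t - s + 2 > 0 then KC * real b powr (- p) * (t - s + 2) powr (min (\<alpha> - 1) 0 - p) else 0) uC vC"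
      using KC(2)[OF b] by blast
    note Cc = kernel_familyD[OF this]
    define u where "u = (\<lambda>(k::nat, i) t. if k = 0 then uA i t else if k = 1 then uB i t else uC i t)"
    \<comment> \<open>The diagonal piece enters \<open>rem_kernel\<close> with a minus sign, which
      is put into \<open>v\<close>.\<close>
    define v where "v = (\<lambda>(k::nat, i) s. if k = 0 then - vA i s else if k = 1 then vB i s else vC i s)"
    have bK: "K' * real b powr \<gamma> \<le> K * real b powr (\<alpha> + 1)" if "0 \<le> K'" "K' \<le> K0" "\<gamma> \<le> \<alpha> + 1" for K' \<gamma>
      using that K b by (intro mult_mono powr_mono) auto
    have vb: "\<bar>v i s\<bar> \<le> K * real b powr (\<alpha> + 1)" if ii: "i \<in> {..<3} \<times> ?J" and s: "s \<in> {0..1}" for i s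
    proof -
      obtain k i' where i: "i = (k, i')" "i' \<in> ?J" 
        using that[of "fst i" "snd i"] ii by (simp only: mem_Times_iff prod.collapse)
      have "\<bar>vA i' s\<bar> \<le> K * real b powr (\<alpha> + 1)"
        using A(4)[OF i(2) s] bK[OF KA(1) K0(2), of "\<bar>\<alpha>\<bar>"] \<alpha> by linarith
      moreover have "\<bar>vB i' s\<bar> \<le> K * real b powr (\<alpha> + 1)"
        using B(4)[OF i(2) s] bK[OF KB(1) K0(3), of "\<bar>\<alpha> - 1\<bar>"] \<alpha> by linarith
      moreover have "\<bar>vC i' s\<bar> \<le> K * real b powr (\<alpha> + 1)"
        using Cc(4)[OF i(2) s] bK[OF KC(1) K0(4), of "\<bar>min (\<alpha> - 1) 0\<bar>"] \<alpha> by (auto simp: min_def split: if_splits)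
      ultimately show ?thesis unfolding i v_def by simp
    qed
    have um: "u i \<in> borel_measurable borel \<and> (\<forall>t. \<bar>u i t\<bar> \<le> 1) \<and> v i \<in> borel_measurable borel" if ii: "i \<in> {..<3} \<times> ?J" for i
    proof -
      obtain k i' where i: "i = (k, i')" "i' \<in> ?J" 
        using that[of "fst i" "snd i"] ii by (simp only: mem_Times_iff prod.collapse)
      then show ?thesis unfolding i u_def v_def using A(1-3)[OF i(2)] B(1-3)[OF i(2)] Cc(1-3)[OF i(2)] by auto
    qed
    have err: "(rem_kernel \<alpha> t s - (\<Sum>i\<in>{..<3} \<times> ?J. u i t * v i s))\<^sup>2
       \<le> K * real b powr (- (2 * \<alpha> - 1/2)) * (t powr (-3/4) * (1 - s) powr (-3/4))" if t: "t \<in> {0<..<1}" and s: "s \<in> {0..<1}" for t s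
    proof -
      define c where "c = 1 - s"
      define E where "E = t powr (-3/8) * c powr (-3/8)"
      have c: "0 < c" "c \<le> 1" and t': "0 < t" "t < 1" using s t by (auto simp: c_def)
      have E1: "E \<ge> 1"
      proof -
        have "1 \<le> t powr (-3/8)" using t' powr_mono2'[of "-3/8" t 1] by simp
        moreover have "1 \<le> c powr (-3/8)" using c powr_mono2'[of "-3/8" c 1] by simp
        ultimately show ?thesis unfolding E_def using mult_mono[of 1 "t powr (-3/8)" 1 "c powr (-3/8)"] by simp
      qed
      have tt: "t \<in> {0..<1}" "s \<in> {0..1}" using t s by auto
      define eA where "eA = (if s < t then (t - s) powr (\<alpha> - 1) * (1 - exp (- (t - s))) else 0) - (\<Sum>i\<in>?J. uA i t * vA i s)"
      define eB where "eB = gk \<alpha> (t - s + 1) - (\<Sum>i\<in>?J. uB i t * vB i s)"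
      define eC where "eC = (\<Sum>n. gk \<alpha> (t - s + 2 + real n)) - (\<Sum>i\<in>?J. uC i t * vC i s)"
      have x1: "t - s + 1 > 0" "t - s + 2 \<ge> 1" "t - s + 2 > 0" using t s by auto
      have "\<bar>eA\<bar> \<le> KA * real b powr (- p) * E"
      proof -
        have "\<bar>eA\<bar> \<le> (if t - s > 0 then KA * real b powr (- p) * (t - s) powr (\<alpha> - p) else 0)"
          using A(5)[OF tt] ca_of_real[of "t - s" \<alpha>] unfolding eA_def by (auto split: if_splits)
        also have "\<dots> \<le> KA * real b powr (- p) * E"
        proof (cases "t - s > 0")
          case True
          have "(t - s) powr (\<alpha> - p) \<le> 1 powr (\<alpha> - p)" using True t s by (intro powr_mono2) (auto simp: p_def)
          then show ?thesis using True E1 KA by (auto intro!: mult_left_mono)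
        qed (use KA E1 in auto)
        finally show ?thesis .
      qed
      moreover have "\<bar>eB\<bar> \<le> KB * real b powr (- p) * E"
      proof -
        have "\<bar>eB\<bar> \<le> KB * real b powr (- p) * (t - s + 1) powr (\<alpha> - 1 - p)"
          using B(5)[OF tt] cgk_of_real[OF x1(1), of \<alpha>] x1 unfolding eB_def by simp
        also have "(t - s + 1) powr (\<alpha> - 1 - p) \<le> E"
        proof -
          \<comment> \<open>The corner singularity (t + c)^(-3/4) is dominated by the product (t
            c)^(-3/8), so that the integrals over t and s will separate.\<close>
          have "t * c \<le> (t + c)\<^sup>2" using t' c by (simp add: power2_eq_square algebra_simps)
          then have "((t + c)\<^sup>2) powr (-3/8) \<le> (t * c) powr (-3/8)" using t' c by (intro powr_mono2') auto
          also have "\<dots> = E" using t' c by (simp add: E_def powr_mult)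
          also have "((t + c)\<^sup>2) powr (-3/8) = (t + c) powr (-3/4)"
            using t' c powr_powr[of "t + c" 2 "-3/8"] by simp
          finally show ?thesis by (simp add: p_def c_def algebra_simps)
        qed
        finally show ?thesis using KB(1) by (simp add: mult_left_mono)
      qed
      moreover have "\<bar>eC\<bar> \<le> KC * real b powr (- p) * E"
      proof -
        have "\<bar>eC\<bar> \<le> KC * real b powr (- p) * (t - s + 2) powr (min (\<alpha> - 1) 0 - p)"
          using Cc(5)[OF tt] cgk_sum_of_real[OF x1(3), of \<alpha>] x1 unfolding eC_def by simp
        also have "(t - s + 2) powr (min (\<alpha> - 1) 0 - p) \<le> E"
        proof -
          have "(t - s + 2) powr (min (\<alpha> - 1) 0 - p) \<le> (t - s + 2) powr 0"
            using x1 p by (intro powr_mono) auto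
          also have "\<dots> \<le> E" using x1 E1 by simp
          finally show ?thesis .
        qed
        finally show ?thesis using KC(1) by (simp add: mult_left_mono)
      qed
      moreover have "rem_kernel \<alpha> t s - (\<Sum>i\<in>{..<3} \<times> ?J. u i t * v i s) = eB + eC - eA"
        unfolding sum_triple rem_kernel_def eA_def eB_def eC_def u_def v_def by (simp add: sum_negf)
      ultimately have "\<bar>rem_kernel \<alpha> t s - (\<Sum>i\<in>{..<3} \<times> ?J. u i t * v i s)\<bar> \<le> (KA + KB + KC) * real b powr (- p) * E"
        by (simp add: distrib_right)
      also have "\<dots> \<le> K0 * real b powr (- p) * E" using K0 E1 by (intro mult_right_mono) auto
      finally have "\<bar>rem_kernel \<alpha> t s - (\<Sum>i\<in>{..<3} \<times> ?J. u i t * v i s)\<bar>\<^sup>2 \<le> (K0 * real b powr (- p) * E)\<^sup>2"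
        by (intro power_mono) auto
      also have "(K0 * real b powr (- p) * E)\<^sup>2 = K * real b powr (- (2 * \<alpha> - 1/2)) * (t powr (-3/4) * (1 - s) powr (-3/4))"
      proof -
        have "(x powr a)\<^sup>2 = x powr (2 * a)" if "x > 0" for x a :: real
          using that by (simp add: power2_eq_square flip: powr_add)
        then show ?thesis using b t' c
          by (simp add: power_mult_distrib K_def E_def p_def c_def)
      qed
      finally show ?thesis by simp
    qed
    show ?thesis using um vb err by (intro exI[of _ u] exI[of _ v] conjI ballI) auto
  qed
  show ?thesis using K main by (intro exI[of _ K] conjI exI[of _ d]) (auto simp: d_def)
qed


text \<open>For fixed t all coefficients of the kernel error are bounded together by Bessel's
  inequality in s, so the bound does not depend on N; then t is integrated. The number b of cells
  and the fineness T of the grid stay free. The system \<open>e\<close> is left general in order to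
  admit the sign changes used later.\<close>

lemma (in iid_normal) remainder_coding:
  fixes \<alpha> :: real
  assumes \<alpha>: "\<alpha> > 1/2"
  shows "\<exists>K>0. \<exists>d\<ge>1. \<forall>b\<ge>1. \<forall>T\<ge>1. \<forall>N e s. orthonormal_on U01 e {..<N} \<longrightarrow> (\<forall>j<N. sq_int U01 (s j)) \<longrightarrow>
    (\<forall>j<N. \<forall>t\<in>{0<..<1}. s j t = (\<integral>x. rem_kernel \<alpha> t x * e j x \<partial>U01)) \<longrightarrow>
    codeable M (\<lambda>w t. \<Sum>j<N. s j t * \<zeta> j w) (real ((2 * T\<^sup>2 + 1) ^ (3 * (b * d))))
      (K * real b powr (- (2 * \<alpha> - 1/2)) + K * real b powr (2 * \<alpha> + 4) / (real T)\<^sup>2)"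
proof -
  interpret U: prob_space U01 by (rule prob_space_U01)
  obtain K d where K: "K > 0" and d: "d \<ge> 1" and ap: "\<And>b. b \<ge> 1 \<Longrightarrow> \<exists>u v :: nat \<times> nat \<times> nat \<Rightarrow> real \<Rightarrow> real.
    (\<forall>i\<in>{..<3} \<times> {..<b} \<times> {..<d}. u i \<in> borel_measurable borel \<and> (\<forall>t. \<bar>u i t\<bar> \<le> 1) \<and>
       v i \<in> borel_measurable borel \<and> (\<forall>s\<in>{0..1}. \<bar>v i s\<bar> \<le> K * real b powr (\<alpha> + 1))) \<and>
    (\<forall>t\<in>{0<..<1}. \<forall>s\<in>{0..<1}. (rem_kernel \<alpha> t s - (\<Sum>i\<in>{..<3} \<times> {..<b} \<times> {..<d}. u i t * v i s))\<^sup>2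
       \<le> K * real b powr (- (2 * \<alpha> - 1/2)) * (t powr (-3/4) * (1 - s) powr (-3/4)))"
    using rem_kernel_approx[OF \<alpha>] by blast
  define K' where "K' = 32 * K + 194 * (3 * d)\<^sup>2 * K\<^sup>2"
  have K': "K' > 0" "32 * K \<le> K'" "194 * (3 * d)\<^sup>2 * K\<^sup>2 \<le> K'"
    using K unfolding K'_def by (auto intro!: add_pos_nonneg)
  have main: "codeable M (\<lambda>w t. \<Sum>j<N. s j t * \<zeta> j w) (real ((2 * T\<^sup>2 + 1) ^ (3 * (b * d))))
      (K' * real b powr (- (2 * \<alpha> - 1/2)) + K' * real b powr (2 * \<alpha> + 4) / (real T)\<^sup>2)"
    if b: "b \<ge> 1" and T: "T \<ge> 1" and e: "orthonormal_on U01 e {..<N}" and s: "\<And>j. j < N \<Longrightarrow> sq_int U01 (s j)"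
      and sk: "\<And>j t. j < N \<Longrightarrow> t \<in> {0<..<1} \<Longrightarrow> s j t = (\<integral>x. rem_kernel \<alpha> t x * e j x \<partial>U01)"
    for b T N :: nat and e s :: "nat \<Rightarrow> real \<Rightarrow> real"
  proof -
    let ?I = "{..<3::nat} \<times> {..<b} \<times> {..<d}"
    let ?B = "K * real b powr (- (2 * \<alpha> - 1/2))"
    obtain u v :: "nat \<times> nat \<times> nat \<Rightarrow> real \<Rightarrow> real" where
      uv: "\<forall>i\<in>?I. u i \<in> borel_measurable borel \<and> (\<forall>t. \<bar>u i t\<bar> \<le> 1) \<and>
        v i \<in> borel_measurable borel \<and> (\<forall>s\<in>{0..1}. \<bar>v i s\<bar> \<le> K * real b powr (\<alpha> + 1))"
      and err0: "\<forall>t\<in>{0<..<1}. \<forall>s\<in>{0..<1}. (rem_kernel \<alpha> t s - (\<Sum>i\<in>?I. u i t * v i s))\<^sup>2 \<le> ?B * (t powr (-3/4) * (1 - s) powr (-3/4))"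
      using ap[OF b] by blast
    have u: "\<And>i. i \<in> ?I \<Longrightarrow> u i \<in> borel_measurable borel" "\<And>i t. i \<in> ?I \<Longrightarrow> \<bar>u i t\<bar> \<le> 1"
      and v: "\<And>i. i \<in> ?I \<Longrightarrow> v i \<in> borel_measurable borel" "\<And>i s. i \<in> ?I \<Longrightarrow> s \<in> {0..1} \<Longrightarrow> \<bar>v i s\<bar> \<le> K * real b powr (\<alpha> + 1)"
      using uv by blast+
    note err = err0[rule_format]
    define V where "V = K * real b powr (\<alpha> + 1)"
    have V: "V > 0" using K b by (simp add: V_def)
    define D where "D = (\<lambda>t x. rem_kernel \<alpha> t x - (\<Sum>i\<in>?I. u i t * v i x))"
    define h where "h = (\<lambda>i j. \<integral>x. v i x * e j x \<partial>U01)"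
    have sqe: "\<And>j. j < N \<Longrightarrow> sq_int U01 (e j)" using e by (auto simp: orthonormal_on_def)
    have sqv: "sq_int U01 (v i)" if "i \<in> ?I" for i
      using v[OF that] by (intro U.sq_int_bounded[where B = V]) (auto simp: V_def intro!: measurable_restrict_space1)
    have hV: "(\<Sum>j<N. (h i j)\<^sup>2) \<le> V\<^sup>2" if i: "i \<in> ?I" for i
    proof -
      have "(\<Sum>j<N. (h i j)\<^sup>2) \<le> (\<integral>x. (v i x)\<^sup>2 \<partial>U01)"
        unfolding h_def by (rule bessel_inequality[OF e _ sqv[OF i]]) simp
      also have "\<dots> \<le> (\<integral>x. V\<^sup>2 \<partial>U01)"
      proof (rule integral_mono[OF sq_int_sq[OF sqv[OF i]]])
        fix x assume "x \<in> space U01"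
        then have "\<bar>v i x\<bar> \<le> V" using v(2)[OF i, of x] by (simp add: V_def)
        then show "(v i x)\<^sup>2 \<le> V\<^sup>2" using power_mono[of "\<bar>v i x\<bar>" V 2] by simp
      qed simp
      also have "\<dots> = V\<^sup>2" using U.prob_space by simp
      finally show ?thesis .
    qed
    have rm: "rem_kernel \<alpha> t \<in> borel_measurable borel" for t
      using measurable_compose[OF measurable_Pair1' rem_kernel_measurable, of t] by simp
    have Dm: "D t \<in> borel_measurable U01" for t
      unfolding D_def using rm v(1) by (intro measurable_restrict_space1) auto
    have AE1: "AE x in U01. (D t x)\<^sup>2 \<le> ?B * t powr (-3/4) * (1 - x) powr (-3/4)" if "t \<in> {0<..<1}" for t
      using AE_U01_ne[of 1] AE_space
    proof eventually_elim
      case (elim x)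
      then show ?case using err[OF that, of x] by (simp add: D_def mult.assoc)
    qed
    have ri: "integrable U01 (\<lambda>x. ?B * t powr (-3/4) * (1 - x) powr (-3/4))" for t
      using U01_powr_reflect(1)[of "-3/4"] by simp
    have sqD: "sq_int U01 (D t)" if t: "t \<in> {0<..<1}" for t
    proof -
      have "integrable U01 (\<lambda>x. (D t x)\<^sup>2)"
        by (rule Bochner_Integration.integrable_bound[OF ri[of t]]) (use Dm AE1[OF t] in \<open>auto intro: AE_mp\<close>)
      then show ?thesis using Dm by (simp add: sq_int_def)
    qed
    have D2: "(\<integral>x. (D t x)\<^sup>2 \<partial>U01) \<le> 4 * ?B * t powr (-3/4)" if t: "t \<in> {0<..<1}" for t
    proof -
      have "(\<integral>x. (D t x)\<^sup>2 \<partial>U01) \<le> (\<integral>x. ?B * t powr (-3/4) * (1 - x) powr (-3/4) \<partial>U01)"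
        by (rule integral_mono_AE[OF sq_int_sq[OF sqD[OF t]] ri AE1[OF t]])
      also have "\<dots> = 4 * ?B * t powr (-3/4)" using U01_powr_reflect(2)[of "-3/4"] by simp
      finally show ?thesis .
    qed
    have diff: "s j t - (\<Sum>i\<in>?I. u i t * h i j) = (\<integral>x. D t x * e j x \<partial>U01)" if j: "j < N" and t: "t \<in> {0<..<1}" for j t
    proof -
      have i1: "integrable U01 (\<lambda>x. D t x * e j x)" using sq_int_mult[OF sqD[OF t] sqe[OF j]] .
      have i2: "integrable U01 (\<lambda>x. u i t * (v i x * e j x))" if "i \<in> ?I" for i
        using sq_int_mult[OF sqv[OF that] sqe[OF j]] by simp
      have "rem_kernel \<alpha> t x * e j x = D t x * e j x + (\<Sum>i\<in>?I. u i t * (v i x * e j x))" for x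
        by (simp add: D_def left_diff_distrib sum_distrib_right mult.assoc)
      then have "s j t = (\<integral>x. D t x * e j x \<partial>U01) + (\<Sum>i\<in>?I. u i t * h i j)"
        unfolding sk[OF j t] h_def using i1 i2 by (simp add: Bochner_Integration.integral_sum)
      then show ?thesis by simp
    qed
    define R where "R = (\<lambda>j t. s j t - (\<Sum>i\<in>?I. u i t * h i j))"
    have squ: "sq_int U01 (u i)" if "i \<in> ?I" for i
      using u[OF that] by (intro U.sq_int_bounded[where B = 1]) (auto intro!: measurable_restrict_space1)
    have sqR: "sq_int U01 (R j)" if "j < N" for j
      unfolding R_def using s[OF that] squ by (intro sq_int_diff sq_int_sum sq_int_multc)
    have "(\<Sum>j<N. \<integral>t. (R j t)\<^sup>2 \<partial>U01) = (\<integral>t. (\<Sum>j<N. (R j t)\<^sup>2) \<partial>U01)"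
      using sqR by (intro Bochner_Integration.integral_sum[symmetric]) (auto intro: sq_int_sq)
    also have "\<dots> \<le> (\<integral>t. 4 * ?B * t powr (-3/4) \<partial>U01)"
    proof (rule integral_mono_AE)
      show "integrable U01 (\<lambda>t. \<Sum>j<N. (R j t)\<^sup>2)" using sqR by (auto intro!: sq_int_sq)
      show "integrable U01 (\<lambda>t. 4 * ?B * t powr (-3/4))" using U01_powr(1)[of "-3/4"] by simp
      show "AE t in U01. (\<Sum>j<N. (R j t)\<^sup>2) \<le> 4 * ?B * t powr (-3/4)"
        using AE_U01_ne[of 1] AE_U01_ne[of 0] AE_space
      proof eventually_elim
        case (elim t)
        then have t: "t \<in> {0<..<1}" by auto
        have "(\<Sum>j<N. (R j t)\<^sup>2) = (\<Sum>j<N. (\<integral>x. D t x * e j x \<partial>U01)\<^sup>2)"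
          unfolding R_def using diff[OF _ t] by simp
        also have "\<dots> \<le> (\<integral>x. (D t x)\<^sup>2 \<partial>U01)" by (rule bessel_inequality[OF e _ sqD[OF t]]) simp
        also note D2[OF t]
        finally show ?case .
      qed
    qed
    \<comment> \<open>16 = 4 * 4: one integral of x^(-3/4) over the unit interval from each
      variable.\<close>
    also have "\<dots> = 16 * ?B" using U01_powr(2)[of "-3/4"] by simp
    finally have RB: "(\<Sum>j<N. \<integral>t. (s j t - (\<Sum>i\<in>?I. u i t * h i j))\<^sup>2 \<partial>U01) \<le> 16 * ?B" by (simp add: R_def)
    have c: "codeable M (\<lambda>w t. \<Sum>j<N. s j t * \<zeta> j w) (real ((2 * T\<^sup>2 + 1) ^ card ?I)) (2 * (16 * ?B) + 194 * (real (card ?I))\<^sup>2 * V\<^sup>2 / (real T)\<^sup>2)"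
      using crude_coding[OF _ s u(1) u(2) V hV T RB] by simp
    have cI: "card ?I = 3 * (b * d)" by (simp add: card_cartesian_product)
    have le: "2 * (16 * ?B) + 194 * (real (3 * (b * d)))\<^sup>2 * V\<^sup>2 / (real T)\<^sup>2
      \<le> K' * real b powr (- (2 * \<alpha> - 1/2)) + K' * real b powr (2 * \<alpha> + 4) / (real T)\<^sup>2"
    proof (intro add_mono divide_right_mono)
      show "2 * (16 * ?B) \<le> K' * real b powr (- (2 * \<alpha> - 1/2))"
        using K'(2) mult_right_mono[OF K'(2), of "real b powr (- (2 * \<alpha> - 1/2))"] by simp
      have "V\<^sup>2 = K\<^sup>2 * real b powr (2 * \<alpha> + 2)"
        using b by (simp add: V_def power_mult_distrib power2_eq_square flip: powr_add)
      \<comment> \<open>The exponent 2 \<alpha> + 4 combines V^2 with the square of the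
        rank.\<close>
      moreover have "(real b)\<^sup>2 * real b powr (2 * \<alpha> + 2) = real b powr (2 * \<alpha> + 4)"
        using b by (simp add: powr_add[of _ "2 * \<alpha>"] powr_numeral flip: power_add)
      ultimately have "194 * (real (3 * (b * d)))\<^sup>2 * V\<^sup>2 = 194 * (3 * d)\<^sup>2 * K\<^sup>2 * real b powr (2 * \<alpha> + 4)"
        by (simp add: power_mult_distrib mult_ac)
      also have "\<dots> \<le> K' * real b powr (2 * \<alpha> + 4)" using K'(3) by (intro mult_right_mono) auto
      finally show "194 * (real (3 * (b * d)))\<^sup>2 * V\<^sup>2 \<le> K' * real b powr (2 * \<alpha> + 4)" .
    qed simp
    show ?thesis by (rule codeable_mono[OF c[unfolded cI] order.refl le])
  qed
  show ?thesis using K' d main by (intro exI[of _ K'] conjI exI[of _ d]) auto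
qed

section \<open>The stationary approximation and its Fourier coefficients\<close>

definition gkp :: "real \<Rightarrow> real \<Rightarrow> real" where "gkp \<alpha> x = indicator {0<..} x * gk \<alpha> x"

lemma gkp_measurable[measurable]: "gkp \<alpha> \<in> borel_measurable borel"
  unfolding gkp_def gk_def by measurable

lemma gkp_nonneg: "gkp \<alpha> x \<ge> 0"
  by (simp add: gkp_def gk_def)

lemma gkp_integral:
  assumes "\<alpha> > 0"
  shows "integrable lborel (gkp \<alpha>)" "(\<integral>x. gkp \<alpha> x \<partial>lborel) = Gamma \<alpha>"
proof -
  have "((\<lambda>t. t powr (\<alpha> - 1) / exp t) has_integral Gamma \<alpha>) {0..}"
    using Gamma_integral_real[OF assms] .
  then have "((\<lambda>t. if t \<in> {0..} then t powr (\<alpha> - 1) / exp t else 0) has_integral Gamma \<alpha>) UNIV"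
    by (simp only: has_integral_restrict_UNIV)
  also have "(\<lambda>t. if t \<in> {0..} then t powr (\<alpha> - 1) / exp t else 0) = gkp \<alpha>"
    by (intro ext) (auto simp: gkp_def gk_def indicator_def exp_minus divide_inverse)
  finally have "(\<integral>\<^sup>+x. ennreal (gkp \<alpha> x) \<partial>lborel) = ennreal (Gamma \<alpha>)"
    by (intro nn_integral_has_integral_lborel) (auto simp: gkp_nonneg)
  then have e: "(\<integral>\<^sup>+x. ennreal (gkp \<alpha> x) \<partial>lborel) = ennreal (Gamma \<alpha>)" .
  show i: "integrable lborel (gkp \<alpha>)"
    using e by (intro integrableI_nonneg) (auto simp: gkp_nonneg)
  have "Gamma \<alpha> \<ge> 0" using Gamma_real_pos[OF assms] by simp
  moreover have "ennreal (\<integral>x. gkp \<alpha> x \<partial>lborel) = ennreal (Gamma \<alpha>)"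
    using nn_integral_eq_integral[OF i] e by (simp add: gkp_nonneg)
  moreover have "(\<integral>x. gkp \<alpha> x \<partial>lborel) \<ge> 0" by (simp add: gkp_nonneg)
  ultimately show "(\<integral>x. gkp \<alpha> x \<partial>lborel) = Gamma \<alpha>" by simp
qed

lemma gkp_mult_bounded:
  fixes f :: "real \<Rightarrow> real"
  assumes "\<alpha> > 0" and [measurable]: "f \<in> borel_measurable borel" and "\<And>x. \<bar>f x\<bar> \<le> B"
  shows "integrable lborel (\<lambda>x. gkp \<alpha> x * f x)"
proof (rule Bochner_Integration.integrable_bound[of _ "\<lambda>x. B * gkp \<alpha> x"])
  show "AE x in lborel. norm (gkp \<alpha> x * f x) \<le> norm (B * gkp \<alpha> x)"
  proof (rule AE_I2)
    fix x
    have "\<bar>f x\<bar> * gkp \<alpha> x \<le> B * gkp \<alpha> x" using assms(3) gkp_nonneg by (rule mult_right_mono)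
    moreover have "B \<ge> 0" using assms(3)[of 0] abs_ge_zero order_trans by blast
    ultimately show "norm (gkp \<alpha> x * f x) \<le> norm (B * gkp \<alpha> x)"
      using gkp_nonneg[of \<alpha> x] by (simp add: abs_mult mult.commute)
  qed
qed (use gkp_integral(1)[OF assms(1)] in auto)

text \<open>This closes the family under differentiation of the Fourier transform.\<close>

lemma gkp_Suc: "gkp (\<alpha> + 1) x = x * gkp \<alpha> x"
proof (cases "x > 0")
  case True
  then have "x powr \<alpha> = x * x powr (\<alpha> - 1)" by (simp add: powr_diff)
  with True show ?thesis by (simp add: gkp_def gk_def)
qed (simp add: gkp_def)

section \<open>Modulus of the Fourier transform of the gamma density\<close>

definition gcos :: "real \<Rightarrow> real \<Rightarrow> real" where "gcos \<alpha> \<xi> = (\<integral>x. gkp \<alpha> x * cos (\<xi> * x) \<partial>lborel)"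
definition gsin :: "real \<Rightarrow> real \<Rightarrow> real" where "gsin \<alpha> \<xi> = (\<integral>x. gkp \<alpha> x * sin (\<xi> * x) \<partial>lborel)"

lemma gkp_int_cos: "\<alpha> > 0 \<Longrightarrow> integrable lborel (\<lambda>x. gkp \<alpha> x * cos (\<xi> * x + c))"
  by (intro gkp_mult_bounded[where B = 1]) auto

lemma gkp_int_sin: "\<alpha> > 0 \<Longrightarrow> integrable lborel (\<lambda>x. gkp \<alpha> x * sin (\<xi> * x + c))"
  by (intro gkp_mult_bounded[where B = 1]) auto

text \<open>Both derivatives at once: the second is the first with the phase \<open>c = -\<pi>/2\<close>.\<close>

lemma gkp_deriv:
  assumes \<alpha>: "\<alpha> > 0"
  shows "((\<lambda>\<xi>. \<integral>x. gkp \<alpha> x * cos (\<xi> * x + c) \<partial>lborel) has_field_derivative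
    - (\<integral>x. gkp (\<alpha> + 1) x * sin (\<xi> * x + c) \<partial>lborel)) (at \<xi>)"
proof -
  let ?F = "\<lambda>\<xi>. \<integral>x. gkp \<alpha> x * cos (\<xi> * x + c) \<partial>lborel"
  have "((\<lambda>h. (?F (\<xi> + h) - ?F \<xi>) / h) \<longlongrightarrow> - (\<integral>x. gkp (\<alpha> + 1) x * sin (\<xi> * x + c) \<partial>lborel)) (at 0)"
    unfolding tendsto_at_iff_sequentially comp_def
  proof (intro allI impI)
    fix h :: "nat \<Rightarrow> real" assume h: "\<forall>i. h i \<in> UNIV - {0}" "h \<longlonglongrightarrow> 0"
    have h0: "h i \<noteq> 0" for i using h(1) by auto
    define q where "q = (\<lambda>i x. (cos ((\<xi> + h i) * x + c) - cos (\<xi> * x + c)) / h i)"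
    have "(?F (\<xi> + h i) - ?F \<xi>) / h i = (\<integral>x. gkp \<alpha> x * q i x \<partial>lborel)" for i
    proof -
      have "?F (\<xi> + h i) - ?F \<xi> = (\<integral>x. gkp \<alpha> x * cos ((\<xi> + h i) * x + c) - gkp \<alpha> x * cos (\<xi> * x + c) \<partial>lborel)"
        by (rule Bochner_Integration.integral_diff[symmetric]) (intro gkp_int_cos \<alpha>)+
      then have "(?F (\<xi> + h i) - ?F \<xi>) / h i = (\<integral>x. (gkp \<alpha> x * cos ((\<xi> + h i) * x + c) - gkp \<alpha> x * cos (\<xi> * x + c)) / h i \<partial>lborel)"
        by simp
      then show ?thesis by (simp add: q_def right_diff_distrib)
    qed
    moreover have "(\<lambda>i. \<integral>x. gkp \<alpha> x * q i x \<partial>lborel) \<longlonglongrightarrow> (\<integral>x. gkp \<alpha> x * (- sin (\<xi> * x + c) * x) \<partial>lborel)"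
    proof (rule integral_dominated_convergence[where w = "gkp (\<alpha> + 1)"])
      show "integrable lborel (gkp (\<alpha> + 1))" using \<alpha> by (intro gkp_integral) auto
      show "AE x in lborel. (\<lambda>i. gkp \<alpha> x * q i x) \<longlonglongrightarrow> gkp \<alpha> x * (- sin (\<xi> * x + c) * x)"
      proof (rule AE_I2)
        fix x
        have "((\<lambda>\<eta>. cos (\<eta> * x + c)) has_field_derivative (- sin (\<xi> * x + c) * x)) (at \<xi>)"
          by (auto intro!: derivative_eq_intros)
        then have "((\<lambda>h. (cos ((\<xi> + h) * x + c) - cos (\<xi> * x + c)) / h) \<longlongrightarrow> - sin (\<xi> * x + c) * x) (at 0)"
          by (simp add: DERIV_def)
        then have "(\<lambda>i. q i x) \<longlonglongrightarrow> - sin (\<xi> * x + c) * x"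
          unfolding q_def tendsto_at_iff_sequentially comp_def using h by blast
        then show "(\<lambda>i. gkp \<alpha> x * q i x) \<longlonglongrightarrow> gkp \<alpha> x * (- sin (\<xi> * x + c) * x)"
          by (rule tendsto_mult_left)
      qed
      fix i
      show "AE x in lborel. norm (gkp \<alpha> x * q i x) \<le> gkp (\<alpha> + 1) x"
      proof (rule AE_I2)
        fix x
        have "\<bar>cos ((\<xi> + h i) * x + c) - cos (\<xi> * x + c)\<bar> \<le> \<bar>h i * x\<bar>"
        proof -
          have "cos a - cos b = 2 * sin ((a + b) / 2) * sin ((b - a) / 2)" for a b :: real
            by (rule cos_diff_cos)
          then have "\<bar>cos a - cos b\<bar> \<le> \<bar>a - b\<bar>" for a b :: real
          proof -
            have "\<bar>cos a - cos b\<bar> = 2 * \<bar>sin ((a + b) / 2)\<bar> * \<bar>sin ((b - a) / 2)\<bar>" for a b :: real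
              by (simp add: cos_diff_cos abs_mult)
            also have "\<dots> a b \<le> 2 * 1 * \<bar>(b - a) / 2\<bar>" for a b :: real
              by (intro mult_mono abs_sin_x_le_abs_x) auto
            finally show ?thesis by (simp add: abs_minus_commute)
          qed
          from this[of "(\<xi> + h i) * x + c" "\<xi> * x + c"] show ?thesis by (simp add: algebra_simps)
        qed
        then have "\<bar>q i x\<bar> \<le> \<bar>x\<bar>" unfolding q_def using h0[of i] by (simp add: abs_mult abs_divide field_simps)
        then have "gkp \<alpha> x * \<bar>q i x\<bar> \<le> gkp \<alpha> x * \<bar>x\<bar>" using gkp_nonneg by (rule mult_left_mono)
        also have "\<dots> = gkp (\<alpha> + 1) x" unfolding gkp_Suc by (cases "x > 0") (auto simp: gkp_def)
        finally show "norm (gkp \<alpha> x * q i x) \<le> gkp (\<alpha> + 1) x" using gkp_nonneg[of \<alpha> x] by (simp add: abs_mult)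
      qed
    qed (auto simp: q_def)
    moreover have "(\<integral>x. gkp \<alpha> x * (- sin (\<xi> * x + c) * x) \<partial>lborel) = - (\<integral>x. gkp (\<alpha> + 1) x * sin (\<xi> * x + c) \<partial>lborel)"
      unfolding gkp_Suc by (simp flip: Bochner_Integration.integral_minus add: mult_ac)
    ultimately show "(\<lambda>i. (?F (\<xi> + h i) - ?F \<xi>) / h i) \<longlonglongrightarrow> - (\<integral>x. gkp (\<alpha> + 1) x * sin (\<xi> * x + c) \<partial>lborel)"
      by simp
  qed
  then show ?thesis by (simp add: DERIV_def)
qed

lemma gcos_deriv: "\<alpha> > 0 \<Longrightarrow> (gcos \<alpha> has_field_derivative - gsin (\<alpha> + 1) \<xi>) (at \<xi>)"
  using gkp_deriv[of \<alpha> 0 \<xi>] by (simp add: gcos_def[abs_def] gsin_def)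

lemma gsin_deriv: "\<alpha> > 0 \<Longrightarrow> (gsin \<alpha> has_field_derivative gcos (\<alpha> + 1) \<xi>) (at \<xi>)"
proof -
  assume "\<alpha> > 0"
  have "sin (\<xi> * x - pi / 2) = - cos (\<xi> * x)" "cos (\<xi> * x - pi / 2) = sin (\<xi> * x)" for \<xi> x
    by (simp_all add: sin_diff cos_diff)
  with gkp_deriv[OF \<open>\<alpha> > 0\<close>, of "- pi/2" \<xi>] show ?thesis by (simp add: gcos_def[abs_def] gsin_def[abs_def])
qed

text \<open>The derivative of x^\<alpha> e^(-x) cos (\<xi> x + c) integrates to 0 over the
  half-line, since both boundary values vanish for \<alpha> > 0. The phase c again yields the sine
  version as well.\<close>

lemma gkp_by_parts:
  assumes \<alpha>: "\<alpha> > 0"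
  shows "\<alpha> * (\<integral>x. gkp \<alpha> x * cos (\<xi> * x + c) \<partial>lborel) =
    (\<integral>x. gkp (\<alpha> + 1) x * cos (\<xi> * x + c) \<partial>lborel) + \<xi> * (\<integral>x. gkp (\<alpha> + 1) x * sin (\<xi> * x + c) \<partial>lborel)"
proof -
  define F where "F = (\<lambda>x. x powr \<alpha> * exp (- x) * cos (\<xi> * x + c))"
  define f where "f = (\<lambda>x. \<alpha> * (gk \<alpha> x * cos (\<xi> * x + c)) - gk (\<alpha> + 1) x * cos (\<xi> * x + c) - \<xi> * (gk (\<alpha> + 1) x * sin (\<xi> * x + c)))"
  have ei: "einterval 0 \<infinity> = {0<..}" by (auto simp: einterval_def)
  have fg: "indicator {0<..} x *\<^sub>R f x = \<alpha> * (gkp \<alpha> x * cos (\<xi> * x + c)) - gkp (\<alpha> + 1) x * cos (\<xi> * x + c) - \<xi> * (gkp (\<alpha> + 1) x * sin (\<xi> * x + c))" for x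
    by (simp add: f_def gkp_def indicator_def)
  have ints: "integrable lborel (\<lambda>x. gkp \<alpha> x * cos (\<xi> * x + c))" "integrable lborel (\<lambda>x. gkp (\<alpha> + 1) x * cos (\<xi> * x + c))"
    "integrable lborel (\<lambda>x. gkp (\<alpha> + 1) x * sin (\<xi> * x + c))"
    using \<alpha> by (intro gkp_int_cos gkp_int_sin; simp)+
  have "(LBINT x=0..\<infinity>. f x) = 0 - 0"
  proof (rule interval_integral_FTC_integrable)
    show "(F has_vector_derivative f x) (at x)" if "0 < ereal x" "ereal x < \<infinity>" for x
    proof -
      have x: "x > 0" using that by simp
      have "(F has_field_derivative f x) (at x)"
        unfolding F_def f_def gk_def using x
        by (auto intro!: derivative_eq_intros simp: powr_diff field_simps)
      then show ?thesis by (simp add: has_real_derivative_iff_has_vector_derivative)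
    qed
    show "isCont f x" if "0 < ereal x" "ereal x < \<infinity>" for x
      unfolding f_def gk_def using that by (intro continuous_intros) auto
    show "set_integrable lborel (einterval 0 \<infinity>) f"
      unfolding set_integrable_def ei fg using ints by auto
    have bound: "\<bar>F x\<bar> \<le> x powr \<alpha> * exp (- x)" for x
      unfolding F_def abs_mult by (simp add: mult_left_le)
    show "((F \<circ> real_of_ereal) \<longlongrightarrow> 0) (at_right 0)"
    proof -
      have "((\<lambda>x. x powr \<alpha> * exp (- x)) \<longlongrightarrow> 0) (at_right 0)" using \<alpha> by real_asymp
      then have "(F \<longlongrightarrow> 0) (at_right 0)"
        by (rule Lim_null_comparison[rotated]) (auto simp: bound intro!: always_eventually)
      then show ?thesis by (simp add: zero_ereal_def ereal_tendsto_simps)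
    qed
    show "((F \<circ> real_of_ereal) \<longlongrightarrow> 0) (at_left \<infinity>)"
    proof -
      have "((\<lambda>x. x powr \<alpha> * exp (- x)) \<longlongrightarrow> 0) at_top" using \<alpha> by real_asymp
      then have "(F \<longlongrightarrow> 0) at_top"
        by (rule Lim_null_comparison[rotated]) (auto simp: bound intro!: always_eventually)
      then show ?thesis by (simp add: ereal_tendsto_simps)
    qed
  qed simp
  then have "(\<integral>x. \<alpha> * (gkp \<alpha> x * cos (\<xi> * x + c)) - gkp (\<alpha> + 1) x * cos (\<xi> * x + c) - \<xi> * (gkp (\<alpha> + 1) x * sin (\<xi> * x + c)) \<partial>lborel) = 0"
    by (simp add: interval_lebesgue_integral_def set_lebesgue_integral_def ei fg[unfolded real_scaleR_def])
  then show ?thesis using ints by simp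
qed

lemma gcos_gsin_parts:
  assumes "\<alpha> > 0"
  shows "\<alpha> * gcos \<alpha> \<xi> = gcos (\<alpha> + 1) \<xi> + \<xi> * gsin (\<alpha> + 1) \<xi>"
    and "\<alpha> * gsin \<alpha> \<xi> = gsin (\<alpha> + 1) \<xi> - \<xi> * gcos (\<alpha> + 1) \<xi>"
proof -
  show "\<alpha> * gcos \<alpha> \<xi> = gcos (\<alpha> + 1) \<xi> + \<xi> * gsin (\<alpha> + 1) \<xi>"
    using gkp_by_parts[OF assms, of \<xi> 0] by (simp add: gcos_def gsin_def)
  have "sin (\<xi> * x - pi / 2) = - cos (\<xi> * x)" "cos (\<xi> * x - pi / 2) = sin (\<xi> * x)" for \<xi> x
    by (simp_all add: sin_diff cos_diff)
  with gkp_by_parts[OF assms, of \<xi> "- pi / 2"]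
  show "\<alpha> * gsin \<alpha> \<xi> = gsin (\<alpha> + 1) \<xi> - \<xi> * gcos (\<alpha> + 1) \<xi>" by (simp add: gcos_def gsin_def)
qed

text \<open>Only the modulus of \<Gamma>(\<alpha>) (1 - i \<xi>)^(-\<alpha>) is wanted, so no branch
  of a complex power has to be chosen: the derivatives and the integration by parts show that the
  normalised squared modulus \<open>N\<close> is constant in \<xi>, and its value at 0 is the Gamma
  integral squared.\<close>

lemma gamma_fourier_modulus:
  assumes \<alpha>: "\<alpha> > 0"
  shows "(gcos \<alpha> \<xi>)\<^sup>2 + (gsin \<alpha> \<xi>)\<^sup>2 = (Gamma \<alpha>)\<^sup>2 * (1 + \<xi>\<^sup>2) powr (- \<alpha>)"
proof -
  define N where "N = (\<lambda>\<xi>. ((gcos \<alpha> \<xi>)\<^sup>2 + (gsin \<alpha> \<xi>)\<^sup>2) * (1 + \<xi>\<^sup>2) powr \<alpha>)"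
  have pos: "1 + \<xi>\<^sup>2 > 0" for \<xi> :: real by (simp add: add_pos_nonneg)
  have "(N has_field_derivative 0) (at \<xi>)" for \<xi>
  proof -
    let ?C = "gcos \<alpha> \<xi>" and ?S = "gsin \<alpha> \<xi>" and ?C1 = "gcos (\<alpha> + 1) \<xi>" and ?S1 = "gsin (\<alpha> + 1) \<xi>"
    have d: "(N has_field_derivative (2 * ?C * (- ?S1) + 2 * ?S * ?C1) * (1 + \<xi>\<^sup>2) powr \<alpha> + (?C\<^sup>2 + ?S\<^sup>2) * (\<alpha> * (1 + \<xi>\<^sup>2) powr (\<alpha> - 1) * (2 * \<xi>))) (at \<xi>)"
    proof -
      have d1: "((\<lambda>\<xi>. (gcos \<alpha> \<xi>)\<^sup>2 + (gsin \<alpha> \<xi>)\<^sup>2) has_field_derivative 2 * ?C * (- ?S1) + 2 * ?S * ?C1) (at \<xi>)"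
        by (auto intro!: derivative_eq_intros gcos_deriv[OF \<alpha>] gsin_deriv[OF \<alpha>])
      have d2: "((\<lambda>\<xi>. (1 + \<xi>\<^sup>2) powr \<alpha>) has_field_derivative \<alpha> * (1 + \<xi>\<^sup>2) powr (\<alpha> - of_nat 1) * (2 * \<xi>)) (at \<xi>)"
        by (rule DERIV_fun_powr) (auto intro!: derivative_eq_intros simp: pos)
      show ?thesis unfolding N_def using DERIV_mult[OF d1 d2] by (simp add: mult_ac add_ac)
    qed
    have "(2 * ?C * (- ?S1) + 2 * ?S * ?C1) * (1 + \<xi>\<^sup>2) = - 2 * \<xi> * \<alpha> * (?C\<^sup>2 + ?S\<^sup>2)"
    proof -
      \<comment> \<open>The relations from integration by parts form a linear system for the
        transforms at \<alpha> + 1, with determinant 1 + \<xi>^2.\<close>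
      have c1: "?C1 * (1 + \<xi>\<^sup>2) = \<alpha> * ?C - \<xi> * (\<alpha> * ?S)"
        unfolding gcos_gsin_parts[OF \<alpha>] by (simp add: algebra_simps power2_eq_square)
      have s1: "?S1 * (1 + \<xi>\<^sup>2) = \<alpha> * ?S + \<xi> * (\<alpha> * ?C)"
        unfolding gcos_gsin_parts[OF \<alpha>] by (simp add: algebra_simps power2_eq_square)
      have "(2 * ?C * (- ?S1) + 2 * ?S * ?C1) * (1 + \<xi>\<^sup>2) = - 2 * ?C * (?S1 * (1 + \<xi>\<^sup>2)) + 2 * ?S * (?C1 * (1 + \<xi>\<^sup>2))"
        by (simp add: algebra_simps)
      then show ?thesis unfolding c1 s1 by (simp add: algebra_simps power2_eq_square)
    qed
    moreover have "(1 + \<xi>\<^sup>2) powr \<alpha> = (1 + \<xi>\<^sup>2) * (1 + \<xi>\<^sup>2) powr (\<alpha> - 1)"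
      using pos[of \<xi>] by (simp add: powr_diff)
    ultimately have "(2 * ?C * (- ?S1) + 2 * ?S * ?C1) * (1 + \<xi>\<^sup>2) powr \<alpha> = - 2 * \<xi> * \<alpha> * (?C\<^sup>2 + ?S\<^sup>2) * (1 + \<xi>\<^sup>2) powr (\<alpha> - 1)"
      by (simp only: mult.assoc[symmetric])
    then show ?thesis using d by (simp add: algebra_simps)
  qed
  then have "N \<xi> = N 0" by (intro DERIV_isconst_all) blast
  moreover have "N 0 = (Gamma \<alpha>)\<^sup>2" using gkp_integral(2)[OF \<alpha>] by (simp add: N_def gcos_def gsin_def)
  ultimately have "((gcos \<alpha> \<xi>)\<^sup>2 + (gsin \<alpha> \<xi>)\<^sup>2) * (1 + \<xi>\<^sup>2) powr \<alpha> = (Gamma \<alpha>)\<^sup>2" by (simp add: N_def)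
  then show ?thesis using pos[of \<xi>] by (simp add: powr_minus field_simps)
qed

lemma U01_integral_continuous:
  fixes f :: "real \<Rightarrow> real"
  assumes f: "continuous_on {0..1} f" and I: "(f has_integral I) {0..1}"
  shows "(\<integral>x. f x \<partial>U01) = I"
proof -
  have s: "set_integrable lborel {0..1} f" using f by (rule borel_integrable_atLeastAtMost')
  have "(\<integral>x. f x \<partial>U01) = (LINT x:{0..1}|lborel. f x)"
    unfolding set_lebesgue_integral_def by (subst integral_restrict_space) auto
  also have "\<dots> = integral {0..1} f" using s by (rule set_borel_integral_eq_integral)
  also have "\<dots> = I" using I by (rule integral_unique)
  finally show ?thesis .
qed

section \<open>The trigonometric basis with phases\<close>

definition freq :: "nat \<Rightarrow> nat" where "freq j = (j + 1) div 2"

text \<open>Indices 2 l - 1 and 2 l carry the cosine and the sine of frequency l. The phase depends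
  on the frequency only, so it rotates each two-dimensional frequency space.\<close>

definition trigp :: "(nat \<Rightarrow> real) \<Rightarrow> nat \<Rightarrow> real \<Rightarrow> real" where
  "trigp \<phi> j t = (if j = 0 then 1 else if odd j then sqrt 2 * cos (2 * pi * freq j * t + \<phi> (freq j))
     else sqrt 2 * sin (2 * pi * freq j * t + \<phi> (freq j)))"

abbreviation "trig \<equiv> trigp (\<lambda>_. 0)"

definition trig_phase :: "(nat \<Rightarrow> real) \<Rightarrow> nat \<Rightarrow> real" where
  "trig_phase \<phi> j = \<phi> (freq j) - (if odd j then 0 else pi / 2)"

lemma trigp_cos:
  assumes "j \<noteq> 0" shows "trigp \<phi> j t = sqrt 2 * cos (2 * pi * freq j * t + trig_phase \<phi> j)"
proof -
  have "cos (a + (b - pi / 2)) = sin (a + b)" for a b :: real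
    using cos_diff[of "a + b" "pi / 2"] by (simp add: add_diff_eq)
  then show ?thesis using assms by (simp add: trigp_def trig_phase_def)
qed

lemma trigp_bounded: "\<bar>trigp \<phi> j t\<bar> \<le> 2"
proof -
  have "sqrt 2 * \<bar>y\<bar> \<le> 2" if "\<bar>y\<bar> \<le> 1" for y :: real
    using mult_mono[of "sqrt 2" 2 "\<bar>y\<bar>" 1] that real_le_lsqrt[of 2 2] by simp
  then show ?thesis by (simp add: trigp_def abs_mult)
qed

lemma trigp_measurable[measurable]: "trigp \<phi> j \<in> borel_measurable borel"
  unfolding trigp_def by measurable

lemma trigp_continuous[continuous_intros]: "continuous_on A (trigp \<phi> j)"
  unfolding trigp_def by (cases "j = 0"; cases "odd j") (auto intro!: continuous_intros)

lemma trigp_sq_int: "sq_int U01 (trigp \<phi> j)"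
proof -
  interpret prob_space U01 by (rule prob_space_U01)
  show ?thesis by (rule sq_int_bounded[OF _ trigp_bounded]) (rule measurable_restrict_space1, simp)
qed

lemma U01_integral_cos:
  fixes m :: int
  assumes "m \<noteq> 0"
  shows "(\<integral>t. cos (2 * pi * of_int m * t + c) \<partial>U01) = 0"
proof (rule U01_integral_continuous)
  let ?F = "\<lambda>t. sin (2 * pi * of_int m * t + c) / (2 * pi * of_int m)"
  have "((\<lambda>t. cos (2 * pi * of_int m * t + c)) has_integral (?F 1 - ?F 0)) {0..1}"
  proof (rule fundamental_theorem_of_calculus)
    fix t :: real
    have "(?F has_field_derivative cos (2 * pi * of_int m * t + c)) (at t within {0..1})"
      using assms by (auto intro!: derivative_eq_intros)
    then show "(?F has_vector_derivative cos (2 * pi * of_int m * t + c)) (at t within {0..1})"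
      by (simp add: has_real_derivative_iff_has_vector_derivative)
  qed simp
  moreover have "sin (2 * pi * of_int m + c) = sin c"
    using sin_cos_eq_iff sin_add[of "2 * pi * of_int m" c] sin_int_2pin[of m] cos_int_2pin[of m] by simp
  ultimately show "((\<lambda>t. cos (2 * pi * of_int m * t + c)) has_integral 0) {0..1}" by simp
qed (auto intro!: continuous_intros)

text \<open>True for every phase function: product-to-sum leaves only the difference frequency, and
  for equal frequency but different parity the phases differ by \<pi> / 2, whose cosine is
  0.\<close>

lemma trigp_orthonormal: "orthonormal_on U01 (trigp \<phi>) J"
proof -
  interpret prob_space U01 by (rule prob_space_U01)
  have cosi: "integrable U01 (\<lambda>t. cos (a * t + c))" for a c
    by (rule integrable_const_bound[where B = 1]) (auto intro!: measurable_restrict_space1)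
  have fpos: "freq j \<ge> 1" if "j \<noteq> 0" for j using that by (auto simp: freq_def)
  have zero: "(\<integral>t. trigp \<phi> j t \<partial>U01) = 0" if "j \<noteq> 0" for j
    using U01_integral_cos[of "int (freq j)" "trig_phase \<phi> j"] fpos[OF that] that by (simp add: trigp_cos)
  have main: "(\<integral>t. trigp \<phi> i t * trigp \<phi> j t \<partial>U01) = (if i = j then 1 else 0)" for i j
  proof (cases "i = 0 \<or> j = 0")
    case True
    then show ?thesis using zero[of i] zero[of j] prob_space by (cases "i = 0"; cases "j = 0") (auto simp: trigp_def[of _ 0])
  next
    case False
    then have ij: "i \<noteq> 0" "j \<noteq> 0" by auto
    let ?a = "trig_phase \<phi> i" and ?b = "trig_phase \<phi> j"
    define m where "m = int (freq i) - int (freq j)"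
    define p where "p = int (freq i) + int (freq j)"
    have p: "p \<noteq> 0" using fpos[OF ij(1)] by (simp add: p_def)
    have "trigp \<phi> i t * trigp \<phi> j t = cos (2 * pi * of_int m * t + (?a - ?b)) + cos (2 * pi * of_int p * t + (?a + ?b))" for t
    proof -
      have "trigp \<phi> i t * trigp \<phi> j t = 2 * (cos (2 * pi * freq i * t + ?a) * cos (2 * pi * freq j * t + ?b))"
        using ij by (simp add: trigp_cos)
      also have "\<dots> = cos ((2 * pi * freq i * t + ?a) - (2 * pi * freq j * t + ?b)) + cos ((2 * pi * freq i * t + ?a) + (2 * pi * freq j * t + ?b))"
        by (subst cos_times_cos) simp
      finally show ?thesis by (simp add: m_def p_def algebra_simps)
    qed
    then have e: "(\<integral>t. trigp \<phi> i t * trigp \<phi> j t \<partial>U01) = (\<integral>t. cos (2 * pi * of_int m * t + (?a - ?b)) \<partial>U01)"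
      using U01_integral_cos[OF p, of "?a + ?b"] cosi by simp
    show ?thesis
    proof (cases "m = 0")
      case True
      then have f: "freq i = freq j" by (simp add: m_def)
      have "(\<integral>t. trigp \<phi> i t * trigp \<phi> j t \<partial>U01) = cos (?a - ?b)" unfolding e using True prob_space by simp
      moreover have "cos (?a - ?b) = (if i = j then 1 else 0)"
      proof (cases "odd i \<longleftrightarrow> odd j")
        case True
        then have "i = j" using f unfolding freq_def by (cases "odd i") (auto elim!: oddE evenE)
        then show ?thesis by simp
      next
        case False
        then have "i \<noteq> j" by auto
        then show ?thesis using False f by (auto simp: trig_phase_def)
      qed
      ultimately show ?thesis by simp
    next
      case False
      then have "i \<noteq> j" by (auto simp: m_def)
      then show ?thesis unfolding e using U01_integral_cos[OF False] by simp
    qed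
  qed
  show ?thesis unfolding orthonormal_on_def using trigp_sq_int main by auto
qed

lemma trigp_periodic: "trigp \<phi> j (t - real n) = trigp \<phi> j t"
proof (cases "j = 0")
  case False
  have e1: "2 * pi * freq j * (t - real n) + trig_phase \<phi> j = (2 * pi * freq j * t + trig_phase \<phi> j) - 2 * pi * of_int (int (freq j * n))"
    by (simp add: algebra_simps)
  have e2: "cos (x - 2 * pi * of_int m) = cos x" for x and m :: int
    by (simp add: cos_diff cos_int_2pin sin_int_2pin)
  show ?thesis unfolding trigp_cos[OF False] e1 e2 ..
qed (simp add: trigp_def)

section \<open>Periodisation of integrals\<close>

lemma sum_indicator_unit_intervals:
  "(\<Sum>n<k. indicator {- real n<..1 - real n} (y::real)) = (indicator {1 - real k<..1} y :: real)"
proof (induction k)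
  case (Suc k)
  then show ?case by (auto simp: indicator_def)
qed simp

lemma U01_integral_lborel:
  fixes f :: "real \<Rightarrow> real"
  assumes [measurable]: "f \<in> borel_measurable borel"
  shows "(\<integral>x. f x \<partial>U01) = (\<integral>x. indicator {0<..1} x * f x \<partial>lborel)"
    and "integrable U01 f \<longleftrightarrow> integrable lborel (\<lambda>x. indicator {0<..1} x * f x)"
proof -
  have ae: "AE x in lborel. indicator {0..1} x * f x = indicator {0<..1} x * f x"
    using AE_lborel_singleton[of 0] by eventually_elim (auto simp: indicator_def)
  have "(\<integral>x. f x \<partial>U01) = (\<integral>x. indicator {0..1} x * f x \<partial>lborel)" by (subst integral_restrict_space) auto
  also have "\<dots> = (\<integral>x. indicator {0<..1} x * f x \<partial>lborel)" using ae by (intro integral_cong_AE) auto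
  finally show "(\<integral>x. f x \<partial>U01) = (\<integral>x. indicator {0<..1} x * f x \<partial>lborel)" .
  have "integrable U01 f \<longleftrightarrow> integrable lborel (\<lambda>x. indicator {0..1} x * f x)" by (subst integrable_restrict_space) auto
  also have "\<dots> \<longleftrightarrow> integrable lborel (\<lambda>x. indicator {0<..1} x * f x)" using ae by (intro integrable_cong_AE) auto
  finally show "integrable U01 f \<longleftrightarrow> integrable lborel (\<lambda>x. indicator {0<..1} x * f x)" .
qed

lemma integrable_mult_bounded:
  fixes g e :: "'b \<Rightarrow> real"
  assumes g: "integrable M g" and [measurable]: "e \<in> borel_measurable M" and e: "\<And>y. \<bar>e y\<bar> \<le> B"
  shows "integrable M (\<lambda>y. g y * e y)"
proof (rule Bochner_Integration.integrable_bound[of _ "\<lambda>y. B * g y"])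
  show "AE y in M. norm (g y * e y) \<le> norm (B * g y)"
  proof (rule AE_I2)
    fix y
    have "\<bar>g y\<bar> * \<bar>e y\<bar> \<le> \<bar>g y\<bar> * \<bar>B\<bar>" using e[of y] by (intro mult_left_mono) auto
    then show "norm (g y * e y) \<le> norm (B * g y)" by (simp add: abs_mult mult.commute)
  qed
qed (use g in auto)

lemma periodization_partial:
  fixes g e :: "real \<Rightarrow> real"
  assumes [measurable]: "g \<in> borel_measurable borel" "e \<in> borel_measurable borel"
    and g: "integrable lborel g" and e: "\<And>y. \<bar>e y\<bar> \<le> B" "\<And>y n. e (y - real n) = e y"
  shows "integrable U01 (\<lambda>x. g (x - real n) * e x)"
    and "(\<Sum>n<k. \<integral>x. g (x - real n) * e x \<partial>U01) = (\<integral>y. indicator {1 - real k<..1} y * (g y * e y) \<partial>lborel)"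
proof -
  have ge: "integrable lborel (\<lambda>y. g y * e y)"
    using g e by (intro integrable_mult_bounded) auto
  have ig: "integrable lborel (\<lambda>y. indicator A y * (g y * e y))" if "A \<in> sets borel" for A
    using integrable_real_mult_indicator[OF _ ge, of A] that by (simp add: mult.commute)
  have sub: "indicator {0<..1} x * (g (x - real n) * e x) = (\<lambda>y. indicator {- real n<..1 - real n} y * (g y * e y)) (- real n + 1 * x)" for x n
    using e(2)[of x n] by (auto simp: indicator_def algebra_simps)
  have int: "integrable lborel (\<lambda>x. indicator {0<..1} x * (g (x - real n) * e x))" for n
    unfolding sub using lborel_integrable_real_affine[OF ig[of "{- real n<..1 - real n}"], of 1 "- real n"] by simp
  show "integrable U01 (\<lambda>x. g (x - real n) * e x)" using int[of n] by (subst U01_integral_lborel(2)) auto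
  have one: "(\<integral>x. g (x - real n) * e x \<partial>U01) = (\<integral>y. indicator {- real n<..1 - real n} y * (g y * e y) \<partial>lborel)" for n
  proof -
    have "(\<integral>x. g (x - real n) * e x \<partial>U01) = (\<integral>x. indicator {0<..1} x * (g (x - real n) * e x) \<partial>lborel)"
      by (rule U01_integral_lborel(1)) simp
    also have "\<dots> = (\<integral>y. indicator {- real n<..1 - real n} y * (g y * e y) \<partial>lborel)"
      unfolding sub using lborel_integral_real_affine[of 1 "\<lambda>y. indicator {- real n<..1 - real n} y * (g y * e y)" "- real n"] by simp
    finally show ?thesis .
  qed
  have "(\<Sum>n<k. \<integral>x. g (x - real n) * e x \<partial>U01) = (\<integral>y. (\<Sum>n<k. indicator {- real n<..1 - real n} y * (g y * e y)) \<partial>lborel)"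
    unfolding one using ig by (intro Bochner_Integration.integral_sum[symmetric]) auto
  then show "(\<Sum>n<k. \<integral>x. g (x - real n) * e x \<partial>U01) = (\<integral>y. indicator {1 - real k<..1} y * (g y * e y) \<partial>lborel)"
    by (simp add: sum_indicator_unit_intervals flip: sum_distrib_right)
qed

text \<open>As g vanishes beyond 1, its translates by n \<ge> 0 already exhaust the support, and the
  intervals (- n, 1 - n] tile it. Nonnegativity of g gives integrability of the sum before the
  signed factor e enters; then dominated convergence applies on both sides.\<close>

lemma periodization:
  fixes g e :: "real \<Rightarrow> real"
  assumes m[measurable]: "g \<in> borel_measurable borel" "e \<in> borel_measurable borel"
    and g: "integrable lborel g" "\<And>y. g y \<ge> 0" "\<And>y. y > 1 \<Longrightarrow> g y = 0" "\<And>x. summable (\<lambda>n. g (x - real n))"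
    and e: "\<And>y. \<bar>e y\<bar> \<le> B" "\<And>y n. e (y - real n) = e y"
  shows "integrable U01 (\<lambda>x. (\<Sum>n. g (x - real n)) * e x)"
    and "(\<integral>x. (\<Sum>n. g (x - real n)) * e x \<partial>U01) = (\<integral>y. g y * e y \<partial>lborel)"
proof -
  define G where "G = (\<lambda>x. \<Sum>n. g (x - real n))"
  have Gm[measurable]: "G \<in> borel_measurable borel" unfolding G_def by measurable
  have G0: "G x \<ge> 0" for x unfolding G_def using g by (intro suminf_nonneg) auto
  have B0: "B \<ge> 0" using e(1)[of 0] abs_ge_zero order_trans by blast
  have Gi: "integrable U01 G"
  proof (rule integrableI_nonneg)
    show "G \<in> borel_measurable U01" by (rule measurable_restrict_space1) simp
    show "AE x in U01. 0 \<le> G x" using G0 by simp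
    have "(\<integral>\<^sup>+x. ennreal (G x) \<partial>U01) = (\<integral>\<^sup>+x. (\<Sum>n. ennreal (g (x - real n))) \<partial>U01)"
      unfolding G_def using g by (intro nn_integral_cong suminf_ennreal2[symmetric]) auto
    also have "\<dots> = (\<Sum>n. \<integral>\<^sup>+x. ennreal (g (x - real n)) \<partial>U01)"
      by (intro nn_integral_suminf) (auto intro!: measurable_restrict_space1)
    also have "\<dots> \<le> ennreal (\<integral>y. g y \<partial>lborel)"
    proof (rule suminf_le_const)
      fix k
      have "(\<Sum>n<k. \<integral>\<^sup>+x. ennreal (g (x - real n)) \<partial>U01) = (\<Sum>n<k. ennreal (\<integral>x. g (x - real n) * 1 \<partial>U01))"
        using periodization_partial(1)[OF m(1) _ g(1), of "\<lambda>_. 1" 1] g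
        by (intro sum.cong refl) (auto intro!: nn_integral_eq_integral)
      also have "\<dots> = ennreal (\<Sum>n<k. \<integral>x. g (x - real n) * 1 \<partial>U01)" using g by (intro sum_ennreal) auto
      also have "\<dots> = ennreal (\<integral>y. indicator {1 - real k<..1} y * (g y * 1) \<partial>lborel)"
        using periodization_partial(2)[OF m(1) _ g(1), of "\<lambda>_. 1" 1 k] by simp
      also have "\<dots> \<le> ennreal (\<integral>y. g y \<partial>lborel)"
        using g integrable_real_mult_indicator[OF _ g(1), of "{1 - real k<..1}"]
        by (intro ennreal_leI integral_mono) (auto simp: mult.commute indicator_def)
      finally show "(\<Sum>n<k. \<integral>\<^sup>+x. ennreal (g (x - real n)) \<partial>U01) \<le> ennreal (\<integral>y. g y \<partial>lborel)" .
    qed simp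
    finally show "(\<integral>\<^sup>+x. ennreal (G x) \<partial>U01) < \<infinity>" by (rule le_less_trans) simp
  qed
  have em: "e \<in> borel_measurable U01" by (rule measurable_restrict_space1) simp
  show "integrable U01 (\<lambda>x. (\<Sum>n. g (x - real n)) * e x)"
    using integrable_mult_bounded[OF Gi em e(1)] by (simp add: G_def)
  have l1: "(\<lambda>k. \<integral>x. (\<Sum>n<k. g (x - real n) * e x) \<partial>U01) \<longlonglongrightarrow> (\<integral>x. G x * e x \<partial>U01)"
  proof (rule integral_dominated_convergence[where w = "\<lambda>x. B * G x"])
    show "AE x in U01. (\<lambda>k. \<Sum>n<k. g (x - real n) * e x) \<longlonglongrightarrow> G x * e x"
      unfolding G_def using g(4) by (auto intro!: AE_I2 tendsto_mult_right summable_LIMSEQ simp flip: sum_distrib_right)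
    show "AE x in U01. norm (\<Sum>n<k. g (x - real n) * e x) \<le> B * G x" for k
    proof (rule AE_I2)
      fix x
      have "(\<Sum>n<k. g (x - real n)) \<le> G x" unfolding G_def using g by (intro sum_le_suminf) auto
      moreover have "0 \<le> (\<Sum>n<k. g (x - real n))" using g by (intro sum_nonneg) auto
      ultimately have "(\<Sum>n<k. g (x - real n)) * \<bar>e x\<bar> \<le> G x * B" using e(1)[of x] by (intro mult_mono) auto
      then show "norm (\<Sum>n<k. g (x - real n) * e x) \<le> B * G x"
        using \<open>0 \<le> (\<Sum>n<k. g (x - real n))\<close> unfolding sum_distrib_right[symmetric] by (simp add: abs_mult mult.commute)
    qed
  qed (use Gi in \<open>auto intro!: measurable_restrict_space1\<close>)
  have l2: "(\<lambda>k. \<integral>y. indicator {1 - real k<..1} y * (g y * e y) \<partial>lborel) \<longlonglongrightarrow> (\<integral>y. g y * e y \<partial>lborel)"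
  proof (rule integral_dominated_convergence[where w = "\<lambda>y. B * g y"])
    show "AE y in lborel. (\<lambda>k. indicator {1 - real k<..1} y * (g y * e y)) \<longlonglongrightarrow> g y * e y"
    proof (rule AE_I2)
      fix y
      have "eventually (\<lambda>k. indicator {1 - real k<..1} y * (g y * e y) = g y * e y) sequentially"
      proof (rule eventually_sequentiallyI)
        fix k assume "nat \<lceil>2 - y\<rceil> \<le> k"
        then have "2 - y \<le> real k" by linarith
        then show "indicator {1 - real k<..1} y * (g y * e y) = g y * e y"
          using g(3)[of y] by (auto simp: indicator_def)
      qed
      then show "(\<lambda>k. indicator {1 - real k<..1} y * (g y * e y)) \<longlonglongrightarrow> g y * e y" by (rule tendsto_eventually)
    qed
    show "AE y in lborel. norm (indicator {1 - real k<..1} y * (g y * e y)) \<le> B * g y" for k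
    proof (rule AE_I2)
      fix y
      have "g y * \<bar>e y\<bar> \<le> g y * B" using e(1)[of y] g(2)[of y] by (intro mult_left_mono) auto
      then show "norm (indicator {1 - real k<..1} y * (g y * e y)) \<le> B * g y"
        using g(2)[of y] B0 by (auto simp: indicator_def abs_mult mult.commute)
    qed
  qed (use g(1) in auto)
  have "(\<integral>x. (\<Sum>n<k. g (x - real n) * e x) \<partial>U01) = (\<integral>y. indicator {1 - real k<..1} y * (g y * e y) \<partial>lborel)" for k
    using periodization_partial[OF m g(1) e] by (subst Bochner_Integration.integral_sum) auto
  then show "(\<integral>x. (\<Sum>n. g (x - real n)) * e x \<partial>U01) = (\<integral>y. g y * e y \<partial>lborel)"
    using LIMSEQ_unique[OF l1] l2 unfolding G_def by simp
qed

section \<open>The Riemann-Liouville kernel and the diagonal coefficients\<close>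

definition kap :: "real \<Rightarrow> real \<Rightarrow> real \<Rightarrow> real" where
  "kap \<alpha> t s = (if s < t then (t - s) powr (\<alpha> - 1) else 0)"

lemma kap_nonneg: "kap \<alpha> t s \<ge> 0" by (simp add: kap_def)

lemma kap_measurable[measurable]: "(\<lambda>p. kap \<alpha> (fst p) (snd p)) \<in> borel_measurable (borel \<Otimes>\<^sub>M borel)"
  unfolding kap_def by measurable

lemma kap_measurable1[measurable]: "kap \<alpha> t \<in> borel_measurable borel"
  unfolding kap_def by measurable

lemma kap_U01:
  assumes \<alpha>: "\<alpha> > 0" and t: "t \<in> {0..1}"
  shows "integrable U01 (kap \<alpha> t)" "(\<integral>s. kap \<alpha> t s \<partial>U01) = t powr \<alpha> / \<alpha>"
proof -
  have "((\<lambda>x. x powr (\<alpha> - 1)) has_integral (t powr \<alpha> / \<alpha>)) (cbox 0 t)"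
    using has_integral_powr_from_0[of "\<alpha> - 1" t] \<alpha> t by simp
  from has_integral_affinity[OF this, of "-1" t]
  have "((\<lambda>x. (t - x) powr (\<alpha> - 1)) has_integral (t powr \<alpha> / \<alpha>)) {0..t}"
    using t by (simp add: image_affinity_atLeastAtMost)
  then have "(kap \<alpha> t has_integral (t powr \<alpha> / \<alpha>)) {0..t}"
    by (rule has_integral_eq[rotated]) (auto simp: kap_def)
  then have "((\<lambda>x. if x \<in> {0..t} then kap \<alpha> t x else 0) has_integral (t powr \<alpha> / \<alpha>)) {0..1}"
    using t by (subst has_integral_restrict) auto
  then have I: "(kap \<alpha> t has_integral (t powr \<alpha> / \<alpha>)) {0..1}"
    by (rule has_integral_eq[rotated]) (auto simp: kap_def)
  show "integrable U01 (kap \<alpha> t)" "(\<integral>s. kap \<alpha> t s \<partial>U01) = t powr \<alpha> / \<alpha>"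
    by (rule U01_integral_eq_nn[OF _ _ I]; simp add: kap_nonneg)+
qed

lemma kap_square: "(kap \<alpha> t s)\<^sup>2 = kap (2 * \<alpha> - 1) t s"
  by (simp add: kap_def power2_eq_square flip: powr_add)

lemma kap_sq_int:
  assumes "\<alpha> > 1/2" "t \<in> {0..1}"
  shows "sq_int U01 (kap \<alpha> t)" "(\<integral>s. (kap \<alpha> t s)\<^sup>2 \<partial>U01) = t powr (2 * \<alpha> - 1) / (2 * \<alpha> - 1)"
  using kap_U01[of "2 * \<alpha> - 1" t] assms
  by (auto simp: sq_int_def kap_square intro!: measurable_restrict_space1)

text \<open>The modulus of the Fourier transform of \<open>gkp \<alpha>\<close> at 2 \<pi>
  \<open>freq j\<close>. Its square is the eigenvalue of the overview, shared by the cosine and the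
  sine of one frequency.\<close>

definition sig :: "real \<Rightarrow> nat \<Rightarrow> real" where
  "sig \<alpha> j = Gamma \<alpha> * (1 + (2 * pi * freq j)\<^sup>2) powr (- \<alpha> / 2)"

definition phi :: "real \<Rightarrow> nat \<Rightarrow> real" where
  "phi \<alpha> l = - Arg (Complex (gcos \<alpha> (2 * pi * l)) (gsin \<alpha> (2 * pi * l)))"

lemma sig_pos: "\<alpha> > 0 \<Longrightarrow> sig \<alpha> j > 0"
proof -
  assume "\<alpha> > 0"
  have "1 + (2 * pi * freq j)\<^sup>2 > 0" by (simp add: add_pos_nonneg)
  then show ?thesis using Gamma_real_pos[OF \<open>\<alpha> > 0\<close>] by (simp add: sig_def)
qed

text \<open>Convolution acts on each frequency space as a dilation and a rotation: the dilation is
  \<open>sig\<close>, and the rotation goes into the phase \<open>phi\<close>. The shifted system is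
  again orthonormal, so Y is diagonal although the bases in t and in s differ.\<close>

lemma conv_trig:
  assumes \<alpha>: "\<alpha> > 0"
  shows "(\<integral>y. gkp \<alpha> y * trig j (t - y) \<partial>lborel) = sig \<alpha> j * trigp (phi \<alpha>) j t"
proof (cases "j = 0")
  case True
  then show ?thesis using gkp_integral(2)[OF \<alpha>] by (simp add: trigp_def sig_def freq_def)
next
  case False
  define \<xi> where "\<xi> = 2 * pi * freq j"
  define z where "z = Complex (gcos \<alpha> \<xi>) (gsin \<alpha> \<xi>)"
  have ph: "phi \<alpha> (freq j) = - Arg z" by (simp add: phi_def z_def \<xi>_def)
  have mod: "cmod z = sig \<alpha> j"
  proof -
    have "cmod z = sqrt ((Gamma \<alpha>)\<^sup>2 * (1 + \<xi>\<^sup>2) powr (- \<alpha>))"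
      unfolding cmod_def z_def using gamma_fourier_modulus[OF \<alpha>, of \<xi>] by simp
    also have "(1 + \<xi>\<^sup>2) powr (- \<alpha>) = ((1 + \<xi>\<^sup>2) powr (- \<alpha> / 2))\<^sup>2"
      by (simp add: power2_eq_square flip: powr_add)
    finally show ?thesis using Gamma_real_pos[OF \<alpha>] unfolding power_mult_distrib[symmetric]
      by (simp add: sig_def \<xi>_def)
  qed
  have "z = rcis (cmod z) (Arg z)" by (simp add: rcis_cmod_Arg)
  then have C: "gcos \<alpha> \<xi> = sig \<alpha> j * cos (Arg z)" and S: "gsin \<alpha> \<xi> = sig \<alpha> j * sin (Arg z)"
    unfolding mod by (metis Re_rcis z_def complex.sel(1), metis Im_rcis z_def complex.sel(2))
  have i: "integrable lborel (\<lambda>y. gkp \<alpha> y * cos (\<xi> * y))" "integrable lborel (\<lambda>y. gkp \<alpha> y * sin (\<xi> * y))"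
    using gkp_int_cos[OF \<alpha>, of \<xi> 0] gkp_int_sin[OF \<alpha>, of \<xi> 0] by simp_all
  show ?thesis
  proof (cases "odd j")
    case True
    have "gkp \<alpha> y * trig j (t - y) = sqrt 2 * cos (\<xi> * t) * (gkp \<alpha> y * cos (\<xi> * y)) + sqrt 2 * sin (\<xi> * t) * (gkp \<alpha> y * sin (\<xi> * y))" for y
    proof -
      have "trig j (t - y) = sqrt 2 * cos (\<xi> * t - \<xi> * y)" using False True by (simp add: trigp_def \<xi>_def right_diff_distrib)
      then show ?thesis by (simp add: cos_diff algebra_simps)
    qed
    then have "(\<integral>y. gkp \<alpha> y * trig j (t - y) \<partial>lborel) = sqrt 2 * cos (\<xi> * t) * gcos \<alpha> \<xi> + sqrt 2 * sin (\<xi> * t) * gsin \<alpha> \<xi>"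
      using i by (simp add: gcos_def gsin_def)
    also have "\<dots> = sig \<alpha> j * (sqrt 2 * cos (\<xi> * t - Arg z))"
      unfolding C S by (simp add: cos_diff algebra_simps)
    finally show ?thesis using False True by (simp add: trigp_def ph \<xi>_def)
  next
    case even: False
    have "gkp \<alpha> y * trig j (t - y) = sqrt 2 * sin (\<xi> * t) * (gkp \<alpha> y * cos (\<xi> * y)) - sqrt 2 * cos (\<xi> * t) * (gkp \<alpha> y * sin (\<xi> * y))" for y
    proof -
      have "trig j (t - y) = sqrt 2 * sin (\<xi> * t - \<xi> * y)" using False even by (simp add: trigp_def \<xi>_def right_diff_distrib)
      then show ?thesis by (simp only: sin_diff) (simp add: algebra_simps)
    qed
    then have "(\<integral>y. gkp \<alpha> y * trig j (t - y) \<partial>lborel) = sqrt 2 * sin (\<xi> * t) * gcos \<alpha> \<xi> - sqrt 2 * cos (\<xi> * t) * gsin \<alpha> \<xi>"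
      using i by (simp add: gcos_def gsin_def)
    also have "\<dots> = sig \<alpha> j * (sqrt 2 * sin (\<xi> * t - Arg z))"
      unfolding C S by (simp add: sin_diff algebra_simps)
    finally show ?thesis using False even by (simp add: trigp_def ph \<xi>_def)
  qed
qed

lemma summable_gkp: "summable (\<lambda>n. gkp \<alpha> (c + real n))"
proof -
  define m where "m = nat \<lceil>\<bar>c\<bar>\<rceil> + 1"
  have m: "c + real m > 0" unfolding m_def by linarith
  have "(\<lambda>n. gkp \<alpha> (c + real (n + Suc m))) = (\<lambda>n. gk \<alpha> (c + real m + real (Suc n)))"
    using m by (auto simp: gkp_def indicator_def add_ac)
  then have "summable (\<lambda>n. gkp \<alpha> (c + real (n + Suc m)))" using summable_gk[OF m] by simp
  then show ?thesis by (subst (asm) summable_iff_shift)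
qed

text \<open>The exact link between X and Y, coefficient by coefficient: the periodised kernel is
  \<open>kap\<close> plus \<open>rem_kernel\<close>, and unfolding its integral against a basis
  function gives the convolution on the line.\<close>

lemma conv_identity:
  assumes \<alpha>: "\<alpha> > 0" and t: "t \<in> {0<..<1}"
  shows "(\<integral>x. rem_kernel \<alpha> t x * trig j x \<partial>U01) = sig \<alpha> j * trigp (phi \<alpha>) j t - (\<integral>x. kap \<alpha> t x * trig j x \<partial>U01)"
proof -
  define g where "g = (\<lambda>y. gkp \<alpha> (t - y))"
  have gm[measurable]: "g \<in> borel_measurable borel" unfolding g_def by measurable
  have gi: "integrable lborel g"
    using lborel_integrable_real_affine[OF gkp_integral(1)[OF \<alpha>], of "-1" t] by (simp add: g_def)
  have gs: "summable (\<lambda>n. g (x - real n))" for x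
    using summable_gkp[of \<alpha> "t - x"] by (simp add: g_def algebra_simps)
  have g1: "g y = 0" if "y > 1" for y using that t by (simp add: g_def gkp_def)
  have sum: "(\<Sum>n. g (x - real n)) = kap \<alpha> t x + rem_kernel \<alpha> t x" if x: "x \<in> {0..1}" for x
  proof -
    have "(\<Sum>n. g (x - real n)) = (\<Sum>n. g (x - real (n + 2))) + (\<Sum>n<2. g (x - real n))"
      by (rule suminf_split_initial_segment[OF gs])
    also have "(\<Sum>n<2. g (x - real n)) = g x + g (x - 1)" by (simp add: numeral_2_eq_2)
    also have "(\<Sum>n. g (x - real (n + 2))) = (\<Sum>n. gk \<alpha> (t - x + 2 + real n))"
      using x t by (intro suminf_cong) (auto simp: g_def gkp_def indicator_def algebra_simps)
    also have "g (x - 1) = gk \<alpha> (t - x + 1)" using x t by (auto simp: g_def gkp_def indicator_def algebra_simps)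
    also have "g x = kap \<alpha> t x - (if x < t then (t - x) powr (\<alpha> - 1) * (1 - exp (- (t - x))) else 0)"
      by (auto simp: g_def gkp_def kap_def gk_def indicator_def algebra_simps)
    finally show ?thesis by (simp add: rem_kernel_def)
  qed
  note per = periodization[OF gm trigp_measurable gi _ g1 gs trigp_bounded trigp_periodic, of "\<lambda>_. 0" j]
  have g0: "g y \<ge> 0" for y by (simp add: g_def gkp_nonneg)
  have i1: "integrable U01 (\<lambda>x. (kap \<alpha> t x + rem_kernel \<alpha> t x) * trig j x)"
    using per(1)[OF g0] by (rule Bochner_Integration.integrable_cong[THEN iffD1, rotated 2]) (auto simp: sum)
  have i2: "integrable U01 (\<lambda>x. kap \<alpha> t x * trig j x)"
    using t by (intro integrable_mult_bounded[OF kap_U01(1)[OF \<alpha>] _ trigp_bounded]) (auto intro!: measurable_restrict_space1)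
  have i3: "integrable U01 (\<lambda>x. rem_kernel \<alpha> t x * trig j x)"
    using Bochner_Integration.integrable_diff[OF i1 i2] by (simp add: distrib_right)
  have "(\<integral>x. kap \<alpha> t x * trig j x \<partial>U01) + (\<integral>x. rem_kernel \<alpha> t x * trig j x \<partial>U01) = (\<integral>x. (\<Sum>n. g (x - real n)) * trig j x \<partial>U01)"
    unfolding Bochner_Integration.integral_add[OF i2 i3, symmetric]
    by (intro Bochner_Integration.integral_cong) (auto simp: sum distrib_right)
  also have "\<dots> = (\<integral>y. g y * trig j y \<partial>lborel)" by (rule per(2)[OF g0])
  also have "\<dots> = (\<integral>y. gkp \<alpha> y * trig j (t - y) \<partial>lborel)"
    using lborel_integral_real_affine[of "-1" "\<lambda>y. g y * trig j y" t] by (simp add: g_def)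
  also have "\<dots> = sig \<alpha> j * trigp (phi \<alpha>) j t" by (rule conv_trig[OF \<alpha>])
  finally show ?thesis by simp
qed

section \<open>Parseval's identity for the Riemann-Liouville kernel\<close>

text \<open>Membership in the closed span of the basis. It is established along a chain of explicit
  functions: sawtooth, interval, step function, kernel.\<close>

definition trig_dense :: "(real \<Rightarrow> real) \<Rightarrow> bool" where
  "trig_dense f \<longleftrightarrow> sq_int U01 f \<and> (\<forall>\<epsilon>>0. \<exists>N a. (\<integral>t. (f t - (\<Sum>j<N. a j * trig j t))\<^sup>2 \<partial>U01) < \<epsilon>)"

lemma trig_sum_sq_int: "sq_int U01 (\<lambda>t. \<Sum>j\<in>J. a j * trig j t)"
  by (intro sq_int_sum sq_int_cmult trigp_sq_int)

lemma integral_sq_sum_le: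
  assumes "sq_int M f" "sq_int M g"
  shows "(\<integral>t. (f t + g t)\<^sup>2 \<partial>M) \<le> 2 * (\<integral>t. (f t)\<^sup>2 \<partial>M) + 2 * (\<integral>t. (g t)\<^sup>2 \<partial>M)"
proof -
  have "(\<integral>t. (f t + g t)\<^sup>2 \<partial>M) \<le> (\<integral>t. 2 * (f t)\<^sup>2 + 2 * (g t)\<^sup>2 \<partial>M)"
    using assms square_sum_le[of 1] by (intro integral_mono) (auto intro!: sq_int_sq sq_int_add)
  also have "\<dots> = 2 * (\<integral>t. (f t)\<^sup>2 \<partial>M) + 2 * (\<integral>t. (g t)\<^sup>2 \<partial>M)"
    using assms by (simp add: sq_int_sq)
  finally show ?thesis .
qed

lemma trig_dense_limit:
  assumes f: "sq_int U01 f" and g: "\<And>\<epsilon>. \<epsilon> > 0 \<Longrightarrow> \<exists>g. trig_dense g \<and> (\<integral>t. (f t - g t)\<^sup>2 \<partial>U01) < \<epsilon>"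
  shows "trig_dense f"
  unfolding trig_dense_def
proof (intro conjI f allI impI)
  fix \<epsilon> :: real assume "\<epsilon> > 0"
  then obtain g where g: "trig_dense g" "(\<integral>t. (f t - g t)\<^sup>2 \<partial>U01) < \<epsilon> / 4" using g[of "\<epsilon> / 4"] by auto
  then obtain N a where a: "(\<integral>t. (g t - (\<Sum>j<N. a j * trig j t))\<^sup>2 \<partial>U01) < \<epsilon> / 4"
    using \<open>\<epsilon> > 0\<close> unfolding trig_dense_def by (meson divide_pos_pos zero_less_numeral)
  have sg: "sq_int U01 g" using g by (simp add: trig_dense_def)
  have "(\<integral>t. ((f t - g t) + (g t - (\<Sum>j<N. a j * trig j t)))\<^sup>2 \<partial>U01) \<le> 2 * (\<integral>t. (f t - g t)\<^sup>2 \<partial>U01) + 2 * (\<integral>t. (g t - (\<Sum>j<N. a j * trig j t))\<^sup>2 \<partial>U01)"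
    by (intro integral_sq_sum_le sq_int_diff f sg trig_sum_sq_int)
  also have "\<dots> < \<epsilon>" using g a by simp
  finally show "\<exists>N a. (\<integral>t. (f t - (\<Sum>j<N. a j * trig j t))\<^sup>2 \<partial>U01) < \<epsilon>" by auto
qed

lemma trig_dense_trig: "trig_dense (trig j)"
  unfolding trig_dense_def
proof (intro conjI trigp_sq_int allI impI)
  fix \<epsilon> :: real assume "\<epsilon> > 0"
  have "(\<Sum>i<Suc j. (if i = j then 1 else 0) * trig i t) = trig j t" for t
    by (simp add: if_distrib[of "\<lambda>x. x * _"] cong: if_cong)
  with \<open>\<epsilon> > 0\<close> show "\<exists>N a. (\<integral>t. (trig j t - (\<Sum>i<N. a i * trig i t))\<^sup>2 \<partial>U01) < \<epsilon>"
    by (intro exI[of _ "Suc j"] exI[of _ "\<lambda>i. if i = j then 1 else 0"]) simp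
qed

lemma trig_dense_cmult:
  assumes "trig_dense f" shows "trig_dense (\<lambda>t. c * f t)"
  unfolding trig_dense_def
proof (intro conjI allI impI)
  show "sq_int U01 (\<lambda>t. c * f t)" using assms by (auto simp: trig_dense_def intro: sq_int_cmult)
  fix \<epsilon> :: real assume "\<epsilon> > 0"
  \<comment> \<open>c^2 + 1 in place of c^2 covers c = 0.\<close>
  have "\<epsilon> / (c\<^sup>2 + 1) > 0" using \<open>\<epsilon> > 0\<close> by (simp add: add_nonneg_pos)
  then obtain N a where a: "(\<integral>t. (f t - (\<Sum>j<N. a j * trig j t))\<^sup>2 \<partial>U01) < \<epsilon> / (c\<^sup>2 + 1)"
    using assms unfolding trig_dense_def by blast
  have "(c * f t - (\<Sum>j<N. (c * a j) * trig j t))\<^sup>2 = c\<^sup>2 * (f t - (\<Sum>j<N. a j * trig j t))\<^sup>2" for t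
    unfolding power_mult_distrib[symmetric] by (simp add: right_diff_distrib sum_distrib_left mult.assoc)
  then have "(\<integral>t. (c * f t - (\<Sum>j<N. (c * a j) * trig j t))\<^sup>2 \<partial>U01) = c\<^sup>2 * (\<integral>t. (f t - (\<Sum>j<N. a j * trig j t))\<^sup>2 \<partial>U01)"
    by simp
  also have "\<dots> \<le> (c\<^sup>2 + 1) * (\<integral>t. (f t - (\<Sum>j<N. a j * trig j t))\<^sup>2 \<partial>U01)" by (intro mult_right_mono) auto
  also have "\<dots> < \<epsilon>" using a by (simp add: pos_less_divide_eq mult.commute add_nonneg_pos)
  finally show "\<exists>N a. (\<integral>t. (c * f t - (\<Sum>j<N. a j * trig j t))\<^sup>2 \<partial>U01) < \<epsilon>"
    by (intro exI[of _ N] exI[of _ "\<lambda>j. c * a j"])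
qed

lemma trig_dense_add:
  assumes "trig_dense f" "trig_dense g" shows "trig_dense (\<lambda>t. f t + g t)"
  unfolding trig_dense_def
proof (intro conjI allI impI)
  have f: "sq_int U01 f" and g: "sq_int U01 g" using assms by (auto simp: trig_dense_def)
  show "sq_int U01 (\<lambda>t. f t + g t)" using f g by (rule sq_int_add)
  fix \<epsilon> :: real assume "\<epsilon> > 0"
  then have "\<epsilon> / 4 > 0" by simp
  obtain N a where a: "(\<integral>t. (f t - (\<Sum>j<N. a j * trig j t))\<^sup>2 \<partial>U01) < \<epsilon> / 4"
    using assms(1) \<open>\<epsilon> / 4 > 0\<close> unfolding trig_dense_def by blast
  obtain N' b where b: "(\<integral>t. (g t - (\<Sum>j<N'. b j * trig j t))\<^sup>2 \<partial>U01) < \<epsilon> / 4"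
    using assms(2) \<open>\<epsilon> / 4 > 0\<close> unfolding trig_dense_def by blast
  define L where "L = max N N'"
  define c where "c = (\<lambda>j. (if j < N then a j else 0) + (if j < N' then b j else 0))"
  have ext: "(\<Sum>j<L. (if j < K then d j else 0) * trig j t) = (\<Sum>j<K. d j * trig j t)" if "K \<le> L" for K d t
    using that by (intro sum.mono_neutral_cong_right) auto
  have "(\<Sum>j<L. c j * trig j t) = (\<Sum>j<N. a j * trig j t) + (\<Sum>j<N'. b j * trig j t)" for t
    unfolding c_def distrib_right sum.distrib using ext[of N a t] ext[of N' b t] by (simp add: L_def)
  then have "(\<integral>t. ((f t + g t) - (\<Sum>j<L. c j * trig j t))\<^sup>2 \<partial>U01) = (\<integral>t. ((f t - (\<Sum>j<N. a j * trig j t)) + (g t - (\<Sum>j<N'. b j * trig j t)))\<^sup>2 \<partial>U01)"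
    by (simp add: algebra_simps)
  also have "\<dots> \<le> 2 * (\<integral>t. (f t - (\<Sum>j<N. a j * trig j t))\<^sup>2 \<partial>U01) + 2 * (\<integral>t. (g t - (\<Sum>j<N'. b j * trig j t))\<^sup>2 \<partial>U01)"
    by (intro integral_sq_sum_le sq_int_diff f g trig_sum_sq_int)
  also have "\<dots> < \<epsilon>" using a b by simp
  finally show "\<exists>N a. (\<integral>t. ((f t + g t) - (\<Sum>j<N. a j * trig j t))\<^sup>2 \<partial>U01) < \<epsilon>" by blast
qed

lemma trig_dense_zero: "trig_dense (\<lambda>t. 0)"
  using trig_dense_cmult[OF trig_dense_trig[of 0], of 0] by simp

lemma trig_dense_sum: "(\<And>i. i \<in> I \<Longrightarrow> trig_dense (f i)) \<Longrightarrow> trig_dense (\<lambda>t. \<Sum>i\<in>I. f i t)"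
  by (induction I rule: infinite_finite_induct) (auto simp: trig_dense_zero intro: trig_dense_add)

lemma trig_dense_diff: "trig_dense f \<Longrightarrow> trig_dense g \<Longrightarrow> trig_dense (\<lambda>t. f t - g t)"
  using trig_dense_add[of f "\<lambda>t. -1 * g t"] trig_dense_cmult[of g "-1"] by simp

lemma parseval:
  assumes "trig_dense f"
  shows "(\<lambda>N. \<Sum>j<N. (\<integral>x. f x * trig j x \<partial>U01)\<^sup>2) \<longlonglongrightarrow> (\<integral>x. (f x)\<^sup>2 \<partial>U01)"
proof -
  let ?c = "\<lambda>j. \<integral>x. f x * trig j x \<partial>U01" and ?I = "\<integral>x. (f x)\<^sup>2 \<partial>U01"
  have f: "sq_int U01 f" using assms by (simp add: trig_dense_def)
  show ?thesis
  proof (rule LIMSEQ_I)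
    fix \<epsilon> :: real assume "\<epsilon> > 0"
    then obtain N a where a: "(\<integral>t. (f t - (\<Sum>j<N. a j * trig j t))\<^sup>2 \<partial>U01) < \<epsilon>"
      using assms unfolding trig_dense_def by blast
    have "?I - (\<Sum>j<N. (?c j)\<^sup>2) \<le> (\<integral>t. (f t - (\<Sum>j<N. a j * trig j t))\<^sup>2 \<partial>U01)"
      by (subst orthonormal_expand[OF trigp_orthonormal _ f]) (simp_all add: sum_nonneg)
    then have lt: "?I - (\<Sum>j<N. (?c j)\<^sup>2) < \<epsilon>" using a by simp
    show "\<exists>no. \<forall>n\<ge>no. norm ((\<Sum>j<n. (?c j)\<^sup>2) - ?I) < \<epsilon>"
    proof (intro exI[of _ N] allI impI)
      fix n assume "n \<ge> N"
      then have "(\<Sum>j<N. (?c j)\<^sup>2) \<le> (\<Sum>j<n. (?c j)\<^sup>2)" by (intro sum_mono2) auto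
      moreover have "(\<Sum>j<n. (?c j)\<^sup>2) \<le> ?I" by (rule bessel_inequality[OF trigp_orthonormal _ f]) simp
      ultimately show "norm ((\<Sum>j<n. (?c j)\<^sup>2) - ?I) < \<epsilon>" using lt by simp
    qed
  qed
qed

lemma trig_dense_shifted_sin: "trig_dense (\<lambda>s. sqrt 2 * sin (2 * pi * real (Suc l) * (s - x)))"
proof -
  have "freq (2 * l + 2) = Suc l" "freq (2 * l + 1) = Suc l" by (simp_all add: freq_def)
  then have "sqrt 2 * sin (2 * pi * real (Suc l) * (s - x)) =
      cos (2 * pi * real (Suc l) * x) * trig (2 * l + 2) s - sin (2 * pi * real (Suc l) * x) * trig (2 * l + 1) s" for s
    by (simp add: trigp_def right_diff_distrib sin_diff del: of_nat_Suc)
  then show ?thesis by (simp only:) (intro trig_dense_diff trig_dense_cmult trig_dense_trig)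
qed

text \<open>Translation modulo 1 preserves the integral; the fractional part of s - x is written out
  by cases.\<close>

lemma U01_integral_shift:
  fixes h :: "real \<Rightarrow> real"
  assumes h: "continuous_on UNIV h" and x: "x \<in> {0..1}"
  shows "(\<integral>s. h (if s < x then s - x + 1 else s - x) \<partial>U01) = (\<integral>s. h s \<partial>U01)"
proof -
  have int: "h integrable_on {a..b}" for a b by (intro integrable_continuous_interval continuous_on_subset[OF h]) auto
  have hm[measurable]: "h \<in> borel_measurable borel" using h by (rule borel_measurable_continuous_onI)
  have set: "set_integrable lborel {a..b} (\<lambda>s. h (s + c))" for a b c
    by (intro borel_integrable_atLeastAtMost' continuous_on_compose2[OF h]) (auto intro!: continuous_intros)
  have piece: "(\<integral>s. indicator {a..b} s * h (s + c) \<partial>lborel) = integral {a + c..b + c} h" for a b c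
  proof -
    have "(\<integral>s. indicator {a..b} s * h (s + c) \<partial>lborel) = (LINT s:{a..b}|lborel. h (s + c))"
      by (simp add: set_lebesgue_integral_def)
    also have "\<dots> = integral {a..b} (\<lambda>s. h (s + c))" using set by (rule set_borel_integral_eq_integral)
    also have "\<dots> = integral {a + c..b + c} h"
      using integral_shift[of a c b h] h by (simp add: comp_def continuous_on_subset)
    finally show ?thesis .
  qed
  have ii: "integrable lborel (\<lambda>s. indicator {a..b} s * h (s + c))" for a b c
    using set[of a b c] by (simp add: set_integrable_def)
  have "(\<integral>s. h (if s < x then s - x + 1 else s - x) \<partial>U01) = (\<integral>s. indicator {0..1} s * h (if s < x then s - x + 1 else s - x) \<partial>lborel)"
    by (subst integral_restrict_space) auto
  also have "\<dots> = (\<integral>s. indicator {0..x} s * h (s + (1 - x)) + indicator {x..1} s * h (s + (- x)) \<partial>lborel)"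
  proof (rule integral_cong_AE)
    show "AE s in lborel. indicator {0..1} s * h (if s < x then s - x + 1 else s - x) = indicator {0..x} s * h (s + (1 - x)) + indicator {x..1} s * h (s + (- x))"
      using AE_lborel_singleton[of x] by eventually_elim (use x in \<open>auto simp: indicator_def algebra_simps\<close>)
  qed auto
  also have "\<dots> = integral {1 - x..1} h + integral {0..1 - x} h"
    unfolding Bochner_Integration.integral_add[OF ii ii] piece by simp
  also have "\<dots> = integral {0..1} h"
    using Henstock_Kurzweil_Integration.integral_combine[of 0 "1 - x" 1 h] x int by simp
  also have "\<dots> = (\<integral>s. h s \<partial>U01)"
    using piece[of 0 1 0] by (subst integral_restrict_space) auto
  finally show ?thesis .
qed

lemma sawtooth_sin: "(\<integral>s. (s - 1/2) * (sqrt 2 * sin (2 * pi * real (Suc l) * s)) \<partial>U01) = - sqrt 2 / (2 * pi * real (Suc l))"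
proof (rule U01_integral_continuous)
  define k where "k = 2 * pi * real (Suc l)"
  have k: "k > 0" by (simp add: k_def)
  let ?F = "\<lambda>s. sqrt 2 * (- (s - 1/2) * cos (k * s) / k + sin (k * s) / k\<^sup>2)"
  have "((\<lambda>s. (s - 1/2) * (sqrt 2 * sin (k * s))) has_integral (?F 1 - ?F 0)) {0..1}"
  proof (rule fundamental_theorem_of_calculus)
    fix s :: real
    have "(?F has_field_derivative (s - 1/2) * (sqrt 2 * sin (k * s))) (at s within {0..1})"
      using k by (auto intro!: derivative_eq_intros simp: field_simps power2_eq_square)
    then show "(?F has_vector_derivative (s - 1/2) * (sqrt 2 * sin (k * s))) (at s within {0..1})"
      by (simp add: has_real_derivative_iff_has_vector_derivative)
  qed simp
  moreover have "cos k = 1" "sin k = 0" unfolding k_def using cos_int_2pin[of "int (Suc l)"] sin_int_2pin[of "int (Suc l)"] by simp_all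
  moreover from this have "?F 1 - ?F 0 = - sqrt 2 / k" using k by (simp add: field_simps)
  ultimately have "((\<lambda>s. (s - 1/2) * (sqrt 2 * sin (k * s))) has_integral - sqrt 2 / k) {0..1}" by metis
  then show "((\<lambda>s. (s - 1/2) * (sqrt 2 * sin (2 * pi * real (Suc l) * s))) has_integral - sqrt 2 / (2 * pi * real (Suc l))) {0..1}"
    unfolding k_def .
qed (auto intro!: continuous_intros)

lemma sawtooth_sq: "(\<integral>s. (s - 1/2)\<^sup>2 \<partial>U01) = 1/12"
proof (rule U01_integral_continuous)
  let ?F = "\<lambda>s::real. (s - 1/2) ^ 3 / 3"
  have "((\<lambda>s. (s - 1/2)\<^sup>2) has_integral (?F 1 - ?F 0)) {0..1}"
  proof (rule fundamental_theorem_of_calculus)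
    fix s :: real
    have "(?F has_field_derivative (s - 1/2)\<^sup>2) (at s within {0..1})"
      by (auto intro!: derivative_eq_intros)
    then show "(?F has_vector_derivative (s - 1/2)\<^sup>2) (at s within {0..1})"
      by (simp add: has_real_derivative_iff_has_vector_derivative)
  qed simp
  then show "((\<lambda>s::real. (s - 1/2)\<^sup>2) has_integral 1/12) {0..1}" by (simp add: power3_eq_cube)
qed (auto intro!: continuous_intros)

text \<open>Bessel's inequality is an equality here: the squared norm is 1/12, and the squared sine
  coefficients 1 / (2 \<pi>^2 l^2) sum to 1/12 by Euler's series. Equality forces the partial sums
  to converge in L2, so completeness is reached without any summability kernel.\<close>

lemma trig_dense_sawtooth:
  assumes x: "x \<in> {0..1}"
  shows "trig_dense (\<lambda>s. (if s < x then s - x + 1 else s - x) - 1/2)"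
proof -
  interpret prob_space U01 by (rule prob_space_U01)
  define w where "w = (\<lambda>s. if s < x then s - x + 1 else s - x)"
  define f where "f = (\<lambda>s. w s - 1/2)"
  have wm[measurable]: "w \<in> borel_measurable borel" unfolding w_def by measurable
  have sqf: "sq_int U01 f"
    using x by (intro sq_int_bounded[where B = 2]) (auto simp: f_def w_def intro!: measurable_restrict_space1)
  \<comment> \<open>The phase - 2 \<pi> l x turns the even-indexed functions into the sines of s -
    x, an orthonormal system adapted to the shifted wave. Each of these sines is a combination of
    two unshifted basis functions.\<close>
  define e where "e = trigp (\<lambda>l. - 2 * pi * real l * x)"
  define b where "b = (\<lambda>l. - sqrt 2 / (2 * pi * real (Suc l)))"
  have es: "e (2 * l + 2) s = sqrt 2 * sin (2 * pi * real (Suc l) * (s - x))" for l s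
  proof -
    have "freq (2 * l + 2) = Suc l" by (simp add: freq_def)
    then show ?thesis by (simp add: e_def trigp_def algebra_simps del: of_nat_Suc)
  qed
  have sw: "sin (2 * pi * real (Suc l) * (s - x)) = sin (2 * pi * real (Suc l) * w s)" for l s
  proof (cases "s < x")
    case True
    have "2 * pi * real (Suc l) * w s = 2 * pi * real (Suc l) * (s - x) + 2 * pi * of_int (int (Suc l))"
      using True by (simp add: w_def algebra_simps)
    then show ?thesis using sin_int_2pin[of "int (Suc l)"] cos_int_2pin[of "int (Suc l)"] by (simp only: sin_add)
  qed (simp add: w_def)
  have co: "(\<integral>s. f s * e (2 * l + 2) s \<partial>U01) = b l" for l
  proof -
    have "(\<integral>s. f s * e (2 * l + 2) s \<partial>U01) = (\<integral>s. (\<lambda>s. (s - 1/2) * (sqrt 2 * sin (2 * pi * real (Suc l) * s))) (w s) \<partial>U01)"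
      unfolding es sw f_def by simp
    also have "\<dots> = (\<integral>s. (s - 1/2) * (sqrt 2 * sin (2 * pi * real (Suc l) * s)) \<partial>U01)"
      unfolding w_def by (rule U01_integral_shift[OF _ x]) (intro continuous_intros)
    also have "\<dots> = b l" unfolding b_def by (rule sawtooth_sin)
    finally show ?thesis .
  qed
  have sq: "(\<integral>s. (f s)\<^sup>2 \<partial>U01) = 1/12"
  proof -
    have "(\<integral>s. (\<lambda>s. (s - 1/2)\<^sup>2) (w s) \<partial>U01) = (\<integral>s. (s - 1/2)\<^sup>2 \<partial>U01)"
      unfolding w_def by (rule U01_integral_shift[OF _ x]) (intro continuous_intros)
    then have "(\<integral>s. (\<lambda>s. (s - 1/2)\<^sup>2) (w s) \<partial>U01) = 1/12" using sawtooth_sq by simp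
    then show ?thesis by (simp add: f_def)
  qed
  define S where "S = (\<lambda>L s. \<Sum>l<L. b l * (sqrt 2 * sin (2 * pi * real (Suc l) * (s - x))))"
  have err: "(\<integral>s. (f s - S L s)\<^sup>2 \<partial>U01) = 1/12 - (\<Sum>l<L. (b l)\<^sup>2)" for L
  proof -
    let ?J = "(\<lambda>l. 2 * l + 2) ` {..<L}"
    have inj: "inj_on (\<lambda>l. 2 * l + 2) {..<L}" by (auto simp: inj_on_def)
    have "(\<integral>s. (f s - (\<Sum>j\<in>?J. (\<integral>s. f s * e j s \<partial>U01) * e j s))\<^sup>2 \<partial>U01) = (\<integral>s. (f s)\<^sup>2 \<partial>U01) - (\<Sum>j\<in>?J. (\<integral>s. f s * e j s \<partial>U01)\<^sup>2)"
      unfolding e_def by (subst orthonormal_expand[OF trigp_orthonormal _ sqf]) simp_all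
    then show ?thesis unfolding sum.reindex[OF inj] comp_def co sq S_def by (simp only: es)
  qed
  have "(\<lambda>l. (b l)\<^sup>2) sums (1/12)"
  proof -
    have "(\<lambda>l. 1 / (real l + 1)\<^sup>2) sums (pi\<^sup>2 / 6)" using inverse_squares_sums by (simp add: add.commute)
    from sums_mult[OF this, of "1 / (2 * pi\<^sup>2)"]
    have "(\<lambda>l. 1 / (2 * pi\<^sup>2) * (1 / (real l + 1)\<^sup>2)) sums (1 / (2 * pi\<^sup>2) * (pi\<^sup>2 / 6))" .
    moreover have "1 / (2 * pi\<^sup>2) * (pi\<^sup>2 / 6) = 1 / 12" by simp
    moreover have "(b l)\<^sup>2 = 1 / (2 * pi\<^sup>2) * (1 / (real l + 1)\<^sup>2)" for l
    proof -
      have "(b l)\<^sup>2 = 2 / (4 * pi\<^sup>2 * (real (Suc l))\<^sup>2)"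
        by (simp add: b_def power_divide power_mult_distrib del: of_nat_Suc)
      then show ?thesis by (simp add: add.commute)
    qed
    ultimately show ?thesis by (simp only:)
  qed
  then have lim: "(\<lambda>L. 1/12 - (\<Sum>l<L. (b l)\<^sup>2)) \<longlonglongrightarrow> 0"
    using tendsto_diff[OF tendsto_const[of "1/12"]] by (fastforce simp: sums_def)
  have "trig_dense f"
  proof (rule trig_dense_limit[OF sqf])
    fix \<epsilon> :: real assume "\<epsilon> > 0"
    then obtain L where "1/12 - (\<Sum>l<L. (b l)\<^sup>2) < \<epsilon>"
      using order_tendstoD(2)[OF lim] by (auto simp: eventually_sequentially)
    moreover have "trig_dense (S L)"
      unfolding S_def by (intro trig_dense_sum trig_dense_cmult trig_dense_shifted_sin)
    ultimately show "\<exists>g. trig_dense g \<and> (\<integral>t. (f t - g t)\<^sup>2 \<partial>U01) < \<epsilon>"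
      using err[of L] by (intro exI[of _ "S L"]) simp
  qed
  then show ?thesis by (simp add: f_def w_def)
qed

lemma trig_dense_cong_AE:
  assumes "trig_dense f" "g \<in> borel_measurable U01" "AE s in U01. f s = g s"
  shows "trig_dense g"
proof (rule trig_dense_limit)
  have f: "sq_int U01 f" using assms by (simp add: trig_dense_def)
  have "integrable U01 (\<lambda>s. (g s)\<^sup>2) \<longleftrightarrow> integrable U01 (\<lambda>s. (f s)\<^sup>2)"
    using assms f by (intro integrable_cong_AE) (auto simp: sq_int_def)
  then show "sq_int U01 g" using assms f by (simp add: sq_int_def)
  fix \<epsilon> :: real assume "\<epsilon> > 0"
  have "(\<integral>t. (g t - f t)\<^sup>2 \<partial>U01) = (\<integral>t. 0 \<partial>U01)"
    using assms f by (intro integral_cong_AE) (auto simp: sq_int_def)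
  then show "\<exists>h. trig_dense h \<and> (\<integral>t. (g t - h t)\<^sup>2 \<partial>U01) < \<epsilon>" using assms(1) \<open>\<epsilon> > 0\<close> by auto
qed

lemma trig_dense_indicator:
  assumes x: "x \<in> {0..1}" and y: "y \<in> {0..1}" "x \<le> y"
  shows "trig_dense (indicator {x..<y})"
proof -
  have one: "trig_dense (\<lambda>s. if s < x then 1 else 0)" if x: "x \<in> {0..1}" for x
  proof -
    \<comment> \<open>On [0, 1] the sawtooth at x minus the sawtooth at 0 is the indicator of s < x
      minus the constant x.\<close>
    have "trig_dense (\<lambda>s. x * trig 0 s + ((if s < x then s - x + 1 else s - x) - 1/2) - ((if s < 0 then s - 0 + 1 else s - 0) - 1/2))"
      by (intro trig_dense_diff trig_dense_add trig_dense_cmult trig_dense_trig trig_dense_sawtooth x) auto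
    then show ?thesis
      by (rule trig_dense_cong_AE) (auto simp: trigp_def intro!: AE_I2 measurable_restrict_space1)
  qed
  have "trig_dense (\<lambda>s. (if s < y then 1 else 0) - (if s < x then 1 else 0))"
    by (intro trig_dense_diff one x y)
  moreover have "(\<lambda>s. (if s < y then 1 else 0) - (if s < x then 1 else 0 :: real)) = indicator {x..<y}"
    using y by (auto simp: indicator_def)
  ultimately show ?thesis by simp
qed

section \<open>Dyadic step functions approximating the kernel\<close>

definition cell :: "nat \<Rightarrow> nat \<Rightarrow> real set" where "cell r i = {real i / 2 ^ r..<(real i + 1) / 2 ^ r}"

definition dstep :: "nat \<Rightarrow> (nat \<Rightarrow> real) \<Rightarrow> real \<Rightarrow> real" where
  "dstep r a s = (\<Sum>i<2 ^ r. a i * indicator (cell r i) s)"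

definition left_index :: "nat \<Rightarrow> real \<Rightarrow> nat" where "left_index r s = nat \<lfloor>s * 2 ^ r\<rfloor>"

lemma cell_iff: "s \<ge> 0 \<Longrightarrow> s \<in> cell r i \<longleftrightarrow> i = left_index r s"
proof -
  assume s: "s \<ge> 0"
  have "s \<in> cell r i \<longleftrightarrow> real i \<le> s * 2 ^ r \<and> s * 2 ^ r < real i + 1"
    by (simp add: cell_def divide_le_eq less_divide_eq)
  also have "\<dots> \<longleftrightarrow> \<lfloor>s * 2 ^ r\<rfloor> = int i" by (auto simp: floor_eq_iff)
  also have "\<dots> \<longleftrightarrow> i = left_index r s" using s by (auto simp: left_index_def)
  finally show ?thesis .
qed

lemma left_index_less: "s \<in> {0..<1} \<Longrightarrow> left_index r s < 2 ^ r"
proof -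
  assume s: "s \<in> {0..<1}"
  then have "s * 2 ^ r < 2 ^ r" by simp
  then have "\<lfloor>s * 2 ^ r\<rfloor> < 2 ^ r" by (simp add: floor_less_iff)
  then show ?thesis using s by (simp add: left_index_def nat_less_iff)
qed

lemma left_index_bounds:
  assumes "s \<ge> 0" shows "real (left_index r s) / 2 ^ r \<le> s" "s < (real (left_index r s) + 1) / 2 ^ r"
  using cell_iff[OF assms, of r "left_index r s"] by (auto simp: cell_def)

lemma dstep_value: "s \<in> {0..<1} \<Longrightarrow> dstep r a s = a (left_index r s)"
proof -
  assume s: "s \<in> {0..<1}"
  have "dstep r a s = (\<Sum>i<2 ^ r. if i = left_index r s then a i else 0)"
    unfolding dstep_def using s cell_iff[of s r] by (intro sum.cong refl) (auto simp: indicator_def)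
  then show ?thesis using left_index_less[OF s] by simp
qed

lemma dstep_measurable[measurable]: "dstep r a \<in> borel_measurable borel"
  unfolding dstep_def cell_def by measurable

lemma index_less_real: "i < 2 ^ r \<Longrightarrow> real i + 1 \<le> 2 ^ r"
proof -
  assume "i < 2 ^ r"
  then have "real (Suc i) \<le> real (2 ^ r)" unfolding of_nat_le_iff by simp
  then show ?thesis by simp
qed

lemma cell_U01: "i < 2 ^ r \<Longrightarrow> measure U01 (cell r i) = 1 / 2 ^ r" "i < 2 ^ r \<Longrightarrow> cell r i \<subseteq> {0..1}"
proof -
  assume i: "i < 2 ^ r"
  then have "real i + 1 \<le> 2 ^ r" by (rule index_less_real)
  then have "(real i + 1) / 2 ^ r \<le> 1" by simp
  then show sub: "cell r i \<subseteq> {0..1}" 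
  proof (intro subsetI)
    fix s assume "s \<in> cell r i"
    then have "real i / 2 ^ r \<le> s" "s < (real i + 1) / 2 ^ r" by (simp_all add: cell_def)
    moreover have "0 \<le> real i / 2 ^ r" by simp
    ultimately show "s \<in> {0..1}" using \<open>(real i + 1) / 2 ^ r \<le> 1\<close> by (simp only: atLeastAtMost_iff) linarith
  qed
  have "measure U01 (cell r i) = measure lborel (cell r i)"
    using sub by (subst measure_restrict_space) auto
  also have "\<dots> = 1 / 2 ^ r" by (simp add: cell_def divide_right_mono diff_divide_distrib[symmetric])
  finally show "measure U01 (cell r i) = 1 / 2 ^ r" .
qed

lemma AE_U01_interior: "AE s in U01. s \<in> {0..<1}"
  using AE_U01_ne[of 1] AE_space by eventually_elim auto

lemma dstep_square:
  shows "(\<integral>s. (dstep r a s)\<^sup>2 \<partial>U01) = (\<Sum>i<2 ^ r. (a i)\<^sup>2) / 2 ^ r"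
proof -
  interpret prob_space U01 by (rule prob_space_U01)
  have cm: "cell r i \<in> sets U01" if "i < 2 ^ r" for i
    using cell_U01(2)[OF that] by (auto simp: sets_restrict_space_iff cell_def)
  have "(\<integral>s. (dstep r a s)\<^sup>2 \<partial>U01) = (\<integral>s. dstep r (\<lambda>i. (a i)\<^sup>2) s \<partial>U01)"
  proof (rule integral_cong_AE)
    show "AE s in U01. (dstep r a s)\<^sup>2 = dstep r (\<lambda>i. (a i)\<^sup>2) s"
      using AE_U01_interior by eventually_elim (simp add: dstep_value)
  qed (auto intro!: measurable_restrict_space1)
  also have "\<dots> = (\<Sum>i<2 ^ r. \<integral>s. (a i)\<^sup>2 * indicator (cell r i) s \<partial>U01)"
    unfolding dstep_def using cm by (intro Bochner_Integration.integral_sum) (auto simp: emeasure_eq_measure)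
  also have "\<dots> = (\<Sum>i<2 ^ r. (a i)\<^sup>2 * (1 / 2 ^ r))"
    using cm cell_U01(1)[of _ r] cell_U01(2)[of _ r] by (intro sum.cong refl) (simp add: Int_absorb2)
  finally show ?thesis by (simp add: sum_divide_distrib)
qed

lemma left_endpoint_tendsto:
  assumes "s \<ge> 0" shows "(\<lambda>r. real (left_index r s) / 2 ^ r) \<longlonglongrightarrow> s"
proof (rule tendsto_sandwich[of "\<lambda>r. s - (1/2) ^ r" _ _ "\<lambda>r. s"])
  have "s - (1/2) ^ r \<le> real (left_index r s) / 2 ^ r" for r
    using left_index_bounds(2)[OF assms, of r] by (simp add: power_divide add_divide_distrib)
  then show "\<forall>\<^sub>F r in sequentially. s - (1/2) ^ r \<le> real (left_index r s) / 2 ^ r" by simp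
  show "\<forall>\<^sub>F r in sequentially. real (left_index r s) / 2 ^ r \<le> s" using left_index_bounds(1)[OF assms] by simp
  have "(\<lambda>r. s - (1/2) ^ r) \<longlonglongrightarrow> s - 0" by (intro tendsto_intros LIMSEQ_realpow_zero) auto
  then show "(\<lambda>r. s - (1/2) ^ r) \<longlonglongrightarrow> s" by simp
qed simp

text \<open>Only cells that end by t receive a value, so the step function vanishes from t on, and
  the value is taken at the left end, where the kernel is finite.\<close>

definition ck :: "real \<Rightarrow> real \<Rightarrow> nat \<Rightarrow> nat \<Rightarrow> real" where
  "ck \<alpha> t r i = (if (real i + 1) / 2 ^ r \<le> t then (t - real i / 2 ^ r) powr (\<alpha> - 1) else 0)"

text \<open>The left end is the safe sample: for \<alpha> < 1 the kernel increases in s, so the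
  sample lies below \<open>kap \<alpha> t s\<close>; for \<alpha> \<ge> 1 it is at most 1. This
  supplies the dominating function for the limits in r.\<close>

lemma dstep_ck_bound:
  assumes s: "s \<in> {0..<1}" and t: "t \<le> 1"
  shows "0 \<le> dstep r (ck \<alpha> t r) s" "dstep r (ck \<alpha> t r) s \<le> 1 + kap \<alpha> t s"
proof -
  define l where "l = real (left_index r s) / 2 ^ r"
  have v: "dstep r (ck \<alpha> t r) s = (if (real (left_index r s) + 1) / 2 ^ r \<le> t then (t - l) powr (\<alpha> - 1) else 0)"
    unfolding dstep_value[OF s] ck_def l_def ..
  show "0 \<le> dstep r (ck \<alpha> t r) s" unfolding v by simp
  show "dstep r (ck \<alpha> t r) s \<le> 1 + kap \<alpha> t s"
  proof (cases "(real (left_index r s) + 1) / 2 ^ r \<le> t")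
    case True
    have b: "l \<le> s" "s < t" "0 \<le> l" using left_index_bounds[of s r] s True by (auto simp: l_def)
    show ?thesis
    proof (cases "\<alpha> \<ge> 1")
      case True
      have "(t - l) powr (\<alpha> - 1) \<le> 1 powr (\<alpha> - 1)" using b t True by (intro powr_mono2) auto
      then show ?thesis unfolding v using kap_nonneg[of \<alpha> t s] by auto
    next
      case False
      have "(t - l) powr (\<alpha> - 1) \<le> (t - s) powr (\<alpha> - 1)" using b False by (intro powr_mono2') auto
      then show ?thesis unfolding v kap_def using b by auto
    qed
  qed (simp add: v kap_nonneg)
qed

lemma dstep_ck_tendsto:
  assumes s: "s \<in> {0..<1}" and t: "s \<noteq> t"
  shows "(\<lambda>r. dstep r (ck \<alpha> t r) s) \<longlonglongrightarrow> kap \<alpha> t s"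
proof (cases "s < t")
  case True
  have "eventually (\<lambda>r. dstep r (ck \<alpha> t r) s = (t - real (left_index r s) / 2 ^ r) powr (\<alpha> - 1)) sequentially"
  proof -
    have "(\<lambda>r. s + (1/2) ^ r) \<longlonglongrightarrow> s + 0" by (intro tendsto_intros LIMSEQ_realpow_zero) auto
    then have "eventually (\<lambda>r. s + (1/2) ^ r < t) sequentially" using True by (intro order_tendstoD(2)) auto
    then show ?thesis
    proof eventually_elim
      case (elim r)
      have "(real (left_index r s) + 1) / 2 ^ r \<le> s + (1/2) ^ r"
        using left_index_bounds(1)[of s r] s by (simp add: add_divide_distrib power_divide)
      then show ?case using elim unfolding dstep_value[OF s] ck_def by auto
    qed
  qed
  moreover have "(\<lambda>r. (t - real (left_index r s) / 2 ^ r) powr (\<alpha> - 1)) \<longlonglongrightarrow> (t - s) powr (\<alpha> - 1)"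
    using True s by (intro tendsto_powr tendsto_diff tendsto_const left_endpoint_tendsto) auto
  ultimately show ?thesis using True by (subst tendsto_cong) (auto simp: kap_def)
next
  case False
  have "dstep r (ck \<alpha> t r) s = 0" for r
    using left_index_bounds(2)[of s r] s False t unfolding dstep_value[OF s] ck_def by auto
  then show ?thesis using False by (simp add: kap_def)
qed

text \<open>Applied with \<open>g r\<close> the dyadic samples of a trigonometric sum f, so that
  kernel and sum are discretised at the same level.\<close>

lemma dstep_ck_L2:
  assumes \<alpha>: "\<alpha> > 1/2" and t: "t \<in> {0..1}" and f: "sq_int U01 f" and fr: "\<And>r. g r \<in> borel_measurable borel"
    "\<And>s. s \<in> {0..<1} \<Longrightarrow> (\<lambda>r. g r s) \<longlonglongrightarrow> f s" "\<And>r s. \<bar>g r s\<bar> \<le> B"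
  shows "(\<lambda>r. \<integral>s. (dstep r (ck \<alpha> t r) s - g r s)\<^sup>2 \<partial>U01) \<longlonglongrightarrow> (\<integral>s. (kap \<alpha> t s - f s)\<^sup>2 \<partial>U01)"
proof (rule integral_dominated_convergence[where w = "\<lambda>s. (1 + B + kap \<alpha> t s)\<^sup>2"])
  interpret prob_space U01 by (rule prob_space_U01)
  show "integrable U01 (\<lambda>s. (1 + B + kap \<alpha> t s)\<^sup>2)"
    using sq_int_add[OF sq_int_bounded[of "\<lambda>_. 1 + B" "\<bar>1 + B\<bar>"] kap_sq_int(1)[OF \<alpha> t]] by (simp add: sq_int_def)
  show "AE s in U01. (\<lambda>r. (dstep r (ck \<alpha> t r) s - g r s)\<^sup>2) \<longlonglongrightarrow> (kap \<alpha> t s - f s)\<^sup>2"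
    using AE_U01_interior AE_U01_ne[of t]
    by eventually_elim (rule tendsto_power[OF tendsto_diff[OF dstep_ck_tendsto fr(2)]])
  show "AE s in U01. norm ((dstep r (ck \<alpha> t r) s - g r s)\<^sup>2) \<le> (1 + B + kap \<alpha> t s)\<^sup>2" for r
    using AE_U01_interior
  proof eventually_elim
    case (elim s)
    have "\<bar>dstep r (ck \<alpha> t r) s - g r s\<bar> \<le> 1 + B + kap \<alpha> t s"
      using dstep_ck_bound[OF elim, of t r \<alpha>] fr(3)[of r s] t by auto
    then have "\<bar>dstep r (ck \<alpha> t r) s - g r s\<bar>\<^sup>2 \<le> (1 + B + kap \<alpha> t s)\<^sup>2" by (intro power_mono) auto
    then show ?case by simp
  qed
  have [measurable]: "kap \<alpha> t \<in> borel_measurable U01" "f \<in> borel_measurable U01"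
    "\<And>r. g r \<in> borel_measurable U01" "\<And>r. dstep r (ck \<alpha> t r) \<in> borel_measurable U01"
    subgoal by (rule measurable_restrict_space1) simp
    subgoal using f by (simp add: sq_int_def)
    subgoal by (rule measurable_restrict_space1) (use fr(1) in simp)
    subgoal by (rule measurable_restrict_space1) simp
    done
  show "(\<lambda>s. (kap \<alpha> t s - f s)\<^sup>2) \<in> borel_measurable U01"
    "\<And>r. (\<lambda>s. (dstep r (ck \<alpha> t r) s - g r s)\<^sup>2) \<in> borel_measurable U01" by measurable
qed

lemma dstep_ck_L2_zero:
  assumes \<alpha>: "\<alpha> > 1/2" and t: "t \<in> {0..1}"
  shows "(\<lambda>r. \<integral>s. (kap \<alpha> t s - dstep r (ck \<alpha> t r) s)\<^sup>2 \<partial>U01) \<longlonglongrightarrow> 0"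
proof -
  interpret prob_space U01 by (rule prob_space_U01)
  have "(\<lambda>r. \<integral>s. (kap \<alpha> t s - dstep r (ck \<alpha> t r) s)\<^sup>2 \<partial>U01) \<longlonglongrightarrow> (\<integral>s. 0 \<partial>U01)"
  proof (rule integral_dominated_convergence[where w = "\<lambda>s. (1 + kap \<alpha> t s)\<^sup>2"])
    show "integrable U01 (\<lambda>s. (1 + kap \<alpha> t s)\<^sup>2)"
      using sq_int_add[OF sq_int_bounded[of "\<lambda>_. 1" 1] kap_sq_int(1)[OF \<alpha> t]] by (simp add: sq_int_def)
    show "AE s in U01. (\<lambda>r. (kap \<alpha> t s - dstep r (ck \<alpha> t r) s)\<^sup>2) \<longlonglongrightarrow> 0"
      using AE_U01_interior AE_U01_ne[of t]
    proof eventually_elim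
      case (elim s)
      have "(\<lambda>r. (kap \<alpha> t s - dstep r (ck \<alpha> t r) s)\<^sup>2) \<longlonglongrightarrow> (kap \<alpha> t s - kap \<alpha> t s)\<^sup>2"
        by (rule tendsto_power[OF tendsto_diff[OF tendsto_const dstep_ck_tendsto[OF elim]]])
      then show ?case by simp
    qed
    show "AE s in U01. norm ((kap \<alpha> t s - dstep r (ck \<alpha> t r) s)\<^sup>2) \<le> (1 + kap \<alpha> t s)\<^sup>2" for r
      using AE_U01_interior
    proof eventually_elim
      case (elim s)
      have "\<bar>kap \<alpha> t s - dstep r (ck \<alpha> t r) s\<bar> \<le> 1 + kap \<alpha> t s"
        using dstep_ck_bound[OF elim, of t r \<alpha>] t kap_nonneg[of \<alpha> t s] by auto
      then have "\<bar>kap \<alpha> t s - dstep r (ck \<alpha> t r) s\<bar>\<^sup>2 \<le> (1 + kap \<alpha> t s)\<^sup>2" by (intro power_mono) auto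
      then show ?case by simp
    qed
    have m: "kap \<alpha> t \<in> borel_measurable U01" "\<And>r. dstep r (ck \<alpha> t r) \<in> borel_measurable U01"
      by (rule measurable_restrict_space1, simp)+
    then show "\<And>r. (\<lambda>s. (kap \<alpha> t s - dstep r (ck \<alpha> t r) s)\<^sup>2) \<in> borel_measurable U01" by measurable
  qed simp
  then show ?thesis by simp
qed

text \<open>The last link of the chain: dyadic steps are combinations of interval indicators and
  converge to the kernel in L2.\<close>

lemma trig_dense_kap:
  assumes \<alpha>: "\<alpha> > 1/2" and t: "t \<in> {0..1}"
  shows "trig_dense (kap \<alpha> t)"
proof (rule trig_dense_limit[OF kap_sq_int(1)[OF \<alpha> t]])
  interpret prob_space U01 by (rule prob_space_U01)
  fix \<epsilon> :: real assume e: "\<epsilon> > 0"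
  have dens: "trig_dense (dstep r a)" for r a
    unfolding dstep_def
  proof (intro trig_dense_sum trig_dense_cmult)
    fix i :: nat assume "i \<in> {..<2 ^ r}"
    then have i: "real i + 1 \<le> 2 ^ r"
      by (intro index_less_real) simp
    then have "(real i + 1) / 2 ^ r \<le> 1" by simp
    moreover have "real i / 2 ^ r \<le> (real i + 1) / 2 ^ r" by (simp add: divide_right_mono)
    ultimately have "real i / 2 ^ r \<le> 1" "(real i + 1) / 2 ^ r \<le> 1" by linarith+
    then show "trig_dense (indicator (cell r i))" unfolding cell_def
      by (intro trig_dense_indicator) (auto simp: divide_right_mono)
  qed
  have "eventually (\<lambda>r. (\<integral>s. (kap \<alpha> t s - dstep r (ck \<alpha> t r) s)\<^sup>2 \<partial>U01) < \<epsilon>) sequentially"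
    using dstep_ck_L2_zero[OF \<alpha> t] e by (intro order_tendstoD(2)) auto
  then show "\<exists>g. trig_dense g \<and> (\<integral>s. (kap \<alpha> t s - g s)\<^sup>2 \<partial>U01) < \<epsilon>"
    using dens unfolding eventually_sequentially by blast
qed

section \<open>The Brownian coordinates\<close>

text \<open>Levy's uniqueness theorem for the law of Z under the probability with density w / C. The
  weight will carry what is already known about the other coordinates, so a joint law is reached
  through one-dimensional uniqueness.\<close>

lemma (in prob_space) weighted_levy:
  assumes Z[measurable]: "Z \<in> borel_measurable M" and w[measurable]: "w \<in> borel_measurable M"
    and w0: "\<And>z. 0 \<le> w z" and wB: "\<And>z. w z \<le> B"
    and ch: "\<And>u. expectation (\<lambda>z. w z * cos (u * Z z)) = C * exp (- u\<^sup>2 / 2)"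
      "\<And>u. expectation (\<lambda>z. w z * sin (u * Z z)) = 0"
    and A: "A \<in> sets borel"
  shows "expectation (\<lambda>z. w z * indicator A (Z z)) = C * measure std_normal_distribution A"
proof -
  have C: "C = expectation w" using ch(1)[of 0] by simp
  have wi: "integrable M w" using w0 wB by (intro integrable_const_bound[of _ B]) (auto intro!: AE_I2)
  have wb: "integrable M (\<lambda>z. w z * f z)" if [measurable]: "f \<in> borel_measurable M" and "\<And>z. \<bar>f z\<bar> \<le> 1" for f
  proof (rule integrable_const_bound[of _ B])
    show "AE z in M. norm (w z * f z) \<le> B"
    proof (rule AE_I2)
      fix z
      have "w z * \<bar>f z\<bar> \<le> B * 1" using w0[of z] wB[of z] that(2)[of z] by (intro mult_mono) auto
      then show "norm (w z * f z) \<le> B" using w0[of z] by (simp add: abs_mult)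
    qed
  qed simp
  show ?thesis
  proof (cases "C = 0")
    \<comment> \<open>With C = 0 the tilted measure cannot be normalised, but then w vanishes almost
      everywhere and both sides are 0.\<close>
    case True
    then have "AE z in M. w z = 0" using integral_nonneg_eq_0_iff_AE[OF wi] w0 C by auto
    then have "AE z in M. w z * indicator A (Z z) = 0" by eventually_elim simp
    then have "expectation (\<lambda>z. w z * indicator A (Z z)) = 0" using A by (subst integral_cong_AE[where g = "\<lambda>_. 0"]) auto
    then show ?thesis using True by simp
  next
    case False
    have Cp: "C > 0" using False C w0 by (simp add: order_le_neq_trans)
    define D where "D = density M (\<lambda>z. ennreal (w z / C))"
    have "emeasure D (space D) = (\<integral>\<^sup>+z. ennreal (w z / C) \<partial>M)"
      unfolding D_def by (subst emeasure_density) (auto intro!: nn_integral_cong)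
    also have "\<dots> = ennreal (expectation (\<lambda>z. w z / C))"
      using wi w0 Cp by (intro nn_integral_eq_integral) auto
    also have "\<dots> = 1" using C Cp by simp
    finally have "prob_space D" by (rule prob_spaceI)
    then interpret D: prob_space D .
    have ZD[measurable]: "Z \<in> borel_measurable D" by (simp add: D_def)
    have rd: "real_distribution (distr D borel Z)" by (rule D.real_distribution_distr) simp
    have "char (distr D borel Z) = char std_normal_distribution"
    proof (rule ext)
      fix u
      have "char (distr D borel Z) u = (\<integral>z. iexp (u * Z z) \<partial>D)"
        unfolding char_def by (subst integral_distr) auto
      also have "\<dots> = (\<integral>z. (w z / C) *\<^sub>R iexp (u * Z z) \<partial>M)"
        unfolding D_def using w0 Cp by (subst integral_density) auto
      also have "\<dots> = complex_of_real (exp (- u\<^sup>2 / 2))"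
      proof -
        have i: "complex_integrable M (\<lambda>z. (w z / C) *\<^sub>R iexp (u * Z z))"
        proof (rule integrable_const_bound[of _ "B / C"])
          show "AE z in M. norm ((w z / C) *\<^sub>R iexp (u * Z z)) \<le> B / C"
            using w0 wB Cp by (auto intro!: AE_I2 divide_right_mono)
        qed simp
        have re: "Re ((w z / C) *\<^sub>R iexp (u * Z z)) = w z * cos (u * Z z) / C"
          and im: "Im ((w z / C) *\<^sub>R iexp (u * Z z)) = w z * sin (u * Z z) / C" for z
          by (simp_all add: Re_exp Im_exp)
        have "Re (\<integral>z. (w z / C) *\<^sub>R iexp (u * Z z) \<partial>M) = exp (- u\<^sup>2 / 2)"
          unfolding integral_Re[OF i, symmetric] re using ch(1)[of u] Cp by simp
        moreover have "Im (\<integral>z. (w z / C) *\<^sub>R iexp (u * Z z) \<partial>M) = 0"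
          unfolding integral_Im[OF i, symmetric] im using ch(2)[of u] by simp
        ultimately show ?thesis by (intro complex_eqI) simp_all
      qed
      finally show "char (distr D borel Z) u = char std_normal_distribution u"
        by (simp add: char_std_normal_distribution)
    qed
    then have eq: "distr D borel Z = std_normal_distribution"
      by (rule Levy_uniqueness[OF rd real_dist_normal_dist])
    have "measure std_normal_distribution A = (\<integral>z. indicator A (Z z) \<partial>D)"
      unfolding eq[symmetric] using A
      by (subst integral_distr[symmetric, of Z D borel "indicator A"]) auto
    also have "\<dots> = (\<integral>z. (w z / C) *\<^sub>R indicator A (Z z) \<partial>M)"
      unfolding D_def using w0 Cp A by (subst integral_density) auto
    also have "\<dots> = expectation (\<lambda>z. w z * indicator A (Z z)) / C" by simp
    finally show ?thesis using Cp by (simp add: field_simps)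
  qed
qed

text \<open>A cosine with arbitrary phase c encodes both the real and the imaginary part of the
  joint characteristic function. The coordinates are converted one at a time from the characteristic
  function to indicators.\<close>

lemma (in prob_space) iid_normal_of_char:
  fixes Z :: "nat \<Rightarrow> 'a \<Rightarrow> real"
  assumes Z[measurable]: "\<And>j. Z j \<in> borel_measurable M"
    and ch: "\<And>m u c. expectation (\<lambda>z. cos ((\<Sum>j<m. u j * Z j z) + c)) = exp (- (\<Sum>j<m. (u j)\<^sup>2) / 2) * cos c"
  shows "iid_normal M Z"
proof -
  define \<gamma> where "\<gamma> = (\<lambda>A. measure std_normal_distribution A)"
  \<comment> \<open>Mixed form: the first k coordinates appear through indicators, the rest still
    through a cosine.\<close>
  have claim: "expectation (\<lambda>z. (\<Prod>i<k. indicator (A i) (Z i z)) * cos ((\<Sum>j\<in>{k..<m}. u j * Z j z) + c))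
      = (\<Prod>i<k. \<gamma> (A i)) * (exp (- (\<Sum>j\<in>{k..<m}. (u j)\<^sup>2) / 2) * cos c)"
    if "k \<le> m" "\<And>i. i < k \<Longrightarrow> A i \<in> sets borel" for k m :: nat and A :: "nat \<Rightarrow> real set" and u c
    using that
  proof (induction k arbitrary: u c)
    case 0
    then show ?case using ch[of u m c] by (simp add: lessThan_atLeast0)
  next
    case (Suc k)
    define h where "h = (\<lambda>z. \<Prod>i<k. indicator (A i) (Z i z) :: real)"
    define P where "P = (\<Prod>i<k. \<gamma> (A i))"
    define \<Phi> where "\<Phi> = (\<lambda>z. (\<Sum>j\<in>{Suc k..<m}. u j * Z j z) + c)"
    define E where "E = exp (- (\<Sum>j\<in>{Suc k..<m}. (u j)\<^sup>2) / 2)"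
    have [measurable]: "A i \<in> sets borel" if "i < k" for i using Suc.prems that by simp
    have Ak: "A k \<in> sets borel" using Suc.prems by simp
    have hm[measurable]: "h \<in> borel_measurable M" unfolding h_def by measurable
    have \<Phi>m[measurable]: "\<Phi> \<in> borel_measurable M" unfolding \<Phi>_def by measurable
    have h01: "0 \<le> h z" "h z \<le> 1" for z unfolding h_def by (auto intro!: prod_nonneg prod_le_1 simp: indicator_def)
    have hi: "integrable M (\<lambda>z. h z * cos (f z))" if [measurable]: "f \<in> borel_measurable M" for f
    proof (rule integrable_const_bound[of _ 1])
      show "AE z in M. norm (h z * cos (f z)) \<le> 1"
      proof (rule AE_I2)
        fix z show "norm (h z * cos (f z)) \<le> 1"
          using mult_mono[of "h z" 1 "\<bar>cos (f z)\<bar>" 1] h01[of z] by (simp add: abs_mult)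
      qed
    qed simp
    have split: "{k..<m} = insert k {Suc k..<m}" using Suc.prems by auto
    have IH: "expectation (\<lambda>z. h z * cos (v * Z k z + (\<Sum>j\<in>{Suc k..<m}. s * u j * Z j z) + d))
        = P * (exp (- v\<^sup>2 / 2) * exp (- (s\<^sup>2 * (\<Sum>j\<in>{Suc k..<m}. (u j)\<^sup>2)) / 2) * cos d)" for v s d
    proof -
      define u' where "u' = (\<lambda>j. if j = k then v else s * u j)"
      have s1: "(\<Sum>j\<in>{k..<m}. u' j * Z j z) = v * Z k z + (\<Sum>j\<in>{Suc k..<m}. s * u j * Z j z)" for z
      proof -
        have "(\<Sum>j\<in>{Suc k..<m}. u' j * Z j z) = (\<Sum>j\<in>{Suc k..<m}. s * u j * Z j z)"
          by (intro sum.cong) (auto simp: u'_def)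
        then show ?thesis unfolding split by (simp add: u'_def)
      qed
      have s2: "(\<Sum>j\<in>{k..<m}. (u' j)\<^sup>2) = v\<^sup>2 + s\<^sup>2 * (\<Sum>j\<in>{Suc k..<m}. (u j)\<^sup>2)"
      proof -
        have "(\<Sum>j\<in>{Suc k..<m}. (u' j)\<^sup>2) = s\<^sup>2 * (\<Sum>j\<in>{Suc k..<m}. (u j)\<^sup>2)"
          unfolding sum_distrib_left by (intro sum.cong) (auto simp: u'_def power_mult_distrib)
        then show ?thesis unfolding split by (simp add: u'_def)
      qed
      have ex: "exp (- (a + b) / 2) = exp (- a / 2) * exp (- b / 2)" for a b :: real
        by (simp add: diff_divide_distrib flip: exp_add)
      have "expectation (\<lambda>z. (\<Prod>i<k. indicator (A i) (Z i z)) * cos ((\<Sum>j\<in>{k..<m}. u' j * Z j z) + d))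
        = (\<Prod>i<k. \<gamma> (A i)) * (exp (- (\<Sum>j\<in>{k..<m}. (u' j)\<^sup>2) / 2) * cos d)"
        by (rule Suc.IH) (use Suc.prems in auto)
      then show ?thesis unfolding P_def[symmetric] s1 s2 ex h_def .
    qed
    have wh: "expectation (\<lambda>z. h z * indicator (A k) (Z k z)) = P * \<gamma> (A k)"
      unfolding \<gamma>_def
    proof (rule weighted_levy[OF Z hm h01(1) h01(2) _ _ Ak])
      fix v
      show "expectation (\<lambda>z. h z * cos (v * Z k z)) = P * exp (- v\<^sup>2 / 2)"
        using IH[of v 0 0] by simp
      show "expectation (\<lambda>z. h z * sin (v * Z k z)) = 0"
        using IH[of v 0 "- pi / 2"] by (simp add: cos_diff)
    qed
    \<comment> \<open>The factor cos \<Phi> changes sign and cannot serve as a weight;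
      \<open>h\<close> and \<open>h * (1 + cos \<Phi>)\<close> can, and the wanted integrand is
      their difference.\<close>
    define w where "w = (\<lambda>z. h z * (1 + cos (\<Phi> z)))"
    have wm: "w \<in> borel_measurable M" unfolding w_def by measurable
    have c1: "0 \<le> 1 + cos x" "1 + cos x \<le> 2" for x :: real using cos_ge_minus_one[of x] cos_le_one[of x] by linarith+
    have w02: "0 \<le> w z" "w z \<le> 2" for z
      unfolding w_def using h01[of z] c1[of "\<Phi> z"] mult_mono[of "h z" 1 "1 + cos (\<Phi> z)" 2] by auto
    have wcos: "expectation (\<lambda>z. w z * cos (v * Z k z + d)) = P * (1 + E * cos c) * exp (- v\<^sup>2 / 2) * cos d" for v d
    proof -
      have "w z * cos (v * Z k z + d) = h z * cos (v * Z k z + d) + (1/2) * (h z * cos (v * Z k z + (\<Sum>j\<in>{Suc k..<m}. 1 * u j * Z j z) + (d + c)))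
        + (1/2) * (h z * cos (v * Z k z + (\<Sum>j\<in>{Suc k..<m}. (-1) * u j * Z j z) + (d - c)))" for z
      proof -
        have e1: "v * Z k z + (\<Sum>j\<in>{Suc k..<m}. 1 * u j * Z j z) + (d + c) = (v * Z k z + d) + \<Phi> z" by (simp add: \<Phi>_def)
        have e2: "v * Z k z + (\<Sum>j\<in>{Suc k..<m}. (-1) * u j * Z j z) + (d - c) = (v * Z k z + d) - \<Phi> z" by (simp add: \<Phi>_def sum_negf)
        have cc: "cos x * cos y = (1/2) * cos (x + y) + (1/2) * cos (x - y)" for x y :: real
          by (simp add: cos_add cos_diff field_simps)
        have "w z * cos (v * Z k z + d) = h z * cos (v * Z k z + d) + h z * (cos (v * Z k z + d) * cos (\<Phi> z))"
          unfolding w_def by (simp add: distrib_left distrib_right mult_ac)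
        then show ?thesis unfolding e1 e2 cc[of "v * Z k z + d" "\<Phi> z"] by (simp add: distrib_left)
      qed
      then have "expectation (\<lambda>z. w z * cos (v * Z k z + d)) = expectation (\<lambda>z. h z * cos (v * Z k z + d))
        + (1/2) * expectation (\<lambda>z. h z * cos (v * Z k z + (\<Sum>j\<in>{Suc k..<m}. 1 * u j * Z j z) + (d + c)))
        + (1/2) * expectation (\<lambda>z. h z * cos (v * Z k z + (\<Sum>j\<in>{Suc k..<m}. (-1) * u j * Z j z) + (d - c)))"
        by (simp add: hi del: mult_1 mult_minus1)
      also have "\<dots> = P * exp (- v\<^sup>2 / 2) * cos d + (1/2) * (P * (exp (- v\<^sup>2 / 2) * E * cos (d + c))) + (1/2) * (P * (exp (- v\<^sup>2 / 2) * E * cos (d - c)))"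
        unfolding IH[of v 1 "d + c"] IH[of v "-1" "d - c"] using IH[of v 0 d] by (simp add: E_def)
      also have "\<dots> = P * (1 + E * cos c) * exp (- v\<^sup>2 / 2) * cos d"
        by (simp add: cos_add cos_diff algebra_simps)
      finally show ?thesis .
    qed
    have ww: "expectation (\<lambda>z. w z * indicator (A k) (Z k z)) = P * (1 + E * cos c) * \<gamma> (A k)"
      unfolding \<gamma>_def
    proof (rule weighted_levy[OF Z wm w02(1) w02(2) _ _ Ak])
      fix v
      show "expectation (\<lambda>z. w z * cos (v * Z k z)) = P * (1 + E * cos c) * exp (- v\<^sup>2 / 2)"
        using wcos[of v 0] by simp
      show "expectation (\<lambda>z. w z * sin (v * Z k z)) = 0"
        using wcos[of v "- pi / 2"] by (simp add: cos_diff)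
    qed
    have i1: "integrable M (\<lambda>z. h z * indicator (A k) (Z k z))"
      using h01 Ak by (intro integrable_const_bound[of _ 1]) (auto intro!: AE_I2 simp: indicator_def)
    have i2: "integrable M (\<lambda>z. w z * indicator (A k) (Z k z))"
      using w02 wm Ak by (intro integrable_const_bound[of _ 2]) (auto intro!: AE_I2 simp: indicator_def)
    have "(\<Prod>i<Suc k. indicator (A i) (Z i z)) * cos ((\<Sum>j\<in>{Suc k..<m}. u j * Z j z) + c)
      = w z * indicator (A k) (Z k z) - h z * indicator (A k) (Z k z)" for z
      by (simp add: w_def h_def \<Phi>_def algebra_simps)
    then have "expectation (\<lambda>z. (\<Prod>i<Suc k. indicator (A i) (Z i z)) * cos ((\<Sum>j\<in>{Suc k..<m}. u j * Z j z) + c)) = P * (1 + E * cos c) * \<gamma> (A k) - P * \<gamma> (A k)"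
      using i1 i2 ww wh by simp
    then show ?case by (simp add: P_def E_def algebra_simps)
  qed
  have prob: "expectation (\<lambda>z. \<Prod>i<m. indicator (A i) (Z i z)) = (\<Prod>i<m. \<gamma> (A i))" if "\<And>i. i < m \<Longrightarrow> A i \<in> sets borel" for m A
    using claim[of m m A "\<lambda>_. 0" 0] that by simp
  interpret N: real_distribution std_normal_distribution by (rule real_dist_normal_dist)
  have g1: "\<gamma> UNIV = 1" unfolding \<gamma>_def using N.prob_space by simp
  have single: "prob (Z j -` A \<inter> space M) = \<gamma> A" if A: "A \<in> sets borel" for j A
  proof -
    have "(\<Prod>i<Suc j. indicator (if i = j then A else UNIV) (Z i z) :: real) = indicator A (Z j z)" for z
      by (simp add: prod.neutral)
    moreover have "(\<Prod>i<Suc j. \<gamma> (if i = j then A else UNIV)) = \<gamma> A" by (simp add: g1)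
    ultimately have "expectation (\<lambda>z. indicator A (Z j z)) = \<gamma> A"
      using prob[of "Suc j" "\<lambda>i. if i = j then A else UNIV"] A by simp
    also have "expectation (\<lambda>z. indicator A (Z j z)) = expectation (indicator (Z j -` A \<inter> space M))"
      by (intro Bochner_Integration.integral_cong) (auto simp: indicator_def)
    finally show ?thesis using A by (simp add: Int_absorb1)
  qed
  have indep: "indep_vars (\<lambda>_. borel) Z {..<m}" for m
  proof -
    \<comment> \<open>The criterion by finite products is applied to a nonempty index set; the claim
      for m follows by restriction.\<close>
    have "indep_vars (\<lambda>_. borel) Z {..<Suc m}"
    proof (subst indep_vars_finite[where E = "\<lambda>_. sets (borel :: real measure)"])
      show "\<forall>A\<in>{..<Suc m} \<rightarrow> sets (borel :: real measure). prob (\<Inter>j\<in>{..<Suc m}. Z j -` A j \<inter> space M) = (\<Prod>j<Suc m. prob (Z j -` A j \<inter> space M))"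
      proof
        fix A :: "nat \<Rightarrow> real set" assume A: "A \<in> {..<Suc m} \<rightarrow> sets borel"
        have pw: "(\<Prod>i<Suc m. indicator (A i) (Z i z) :: real) = indicator (\<Inter>j\<in>{..<Suc m}. Z j -` A j \<inter> space M) z" if "z \<in> space M" for z
        proof (cases "\<forall>i<Suc m. Z i z \<in> A i")
          case True
          then show ?thesis using that by (auto simp: indicator_def simp del: prod.lessThan_Suc)
        next
          case False
          then obtain i where i: "i < Suc m" "Z i z \<notin> A i" by blast
          then have "(\<Prod>i<Suc m. indicator (A i) (Z i z) :: real) = 0" by (intro prod_zero) (auto simp: indicator_def)
          then show ?thesis using i by (auto simp: indicator_def simp del: prod.lessThan_Suc)
        qed
        have "expectation (\<lambda>z. \<Prod>i<Suc m. indicator (A i) (Z i z) :: real) = expectation (indicator (\<Inter>j\<in>{..<Suc m}. Z j -` A j \<inter> space M))"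
          by (rule Bochner_Integration.integral_cong[OF refl pw])
        also have "\<dots> = prob (\<Inter>j\<in>{..<Suc m}. Z j -` A j \<inter> space M)"
        proof -
          have "(\<Inter>j\<in>{..<Suc m}. Z j -` A j \<inter> space M) \<in> sets M"
            using A by (intro sets.finite_INT measurable_sets[OF Z]) auto
          then show ?thesis by simp
        qed
        finally have fin: "expectation (\<lambda>z. \<Prod>i<Suc m. indicator (A i) (Z i z) :: real) = prob (\<Inter>j\<in>{..<Suc m}. Z j -` A j \<inter> space M)" .
        have "expectation (\<lambda>z. \<Prod>i<Suc m. indicator (A i) (Z i z) :: real) = (\<Prod>j<Suc m. \<gamma> (A j))"
          by (rule prob) (use A in auto)
        with fin have "prob (\<Inter>j\<in>{..<Suc m}. Z j -` A j \<inter> space M) = (\<Prod>j<Suc m. \<gamma> (A j))" by (rule trans[OF sym])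
        also have "\<dots> = (\<Prod>j<Suc m. prob (Z j -` A j \<inter> space M))"
          using A by (intro prod.cong refl single[symmetric]) auto
        finally show "prob (\<Inter>j\<in>{..<Suc m}. Z j -` A j \<inter> space M) = (\<Prod>j<Suc m. prob (Z j -` A j \<inter> space M))" .
      qed
    qed (auto simp: sets.Int_stable sets.sigma_sets_eq[of borel, simplified])
    then show ?thesis by (rule indep_vars_subset) auto
  qed
  have distr: "distr M borel (Z j) = std_normal_distribution" for j
  proof (rule measure_eqI)
    fix A assume "A \<in> sets (distr M borel (Z j))"
    then have A: "A \<in> sets borel" by simp
    then show "emeasure (distr M borel (Z j)) A = emeasure std_normal_distribution A"
      using single[OF A, of j] by (simp add: emeasure_distr emeasure_eq_measure N.emeasure_eq_measure \<gamma>_def)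
  qed simp
  show ?thesis by unfold_locales (auto simp: indep distr)
qed

section \<open>Dyadic Wiener sums and the coordinates as their limits\<close>

locale brownian = prob_space M for M :: "'a measure" +
  fixes W :: "real \<Rightarrow> 'a \<Rightarrow> real"
  assumes bm: "brownian_motion M W"
begin

definition incr :: "nat \<Rightarrow> nat \<Rightarrow> 'a \<Rightarrow> real" where
  "incr r i w = W ((real i + 1) / 2 ^ r) w - W (real i / 2 ^ r) w"

definition rsum :: "nat \<Rightarrow> (nat \<Rightarrow> real) \<Rightarrow> 'a \<Rightarrow> real" where
  "rsum r a w = (\<Sum>i<2 ^ r. a i * incr r i w)"

lemma grid_01: "i \<le> 2 ^ r \<Longrightarrow> real i / 2 ^ r \<in> {0..1}"
proof -
  assume "i \<le> 2 ^ r"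
  then have "real i \<le> real (2 ^ r)" by (simp only: of_nat_le_iff)
  then show ?thesis by simp
qed

lemma W_measurable: "t \<in> {0..1} \<Longrightarrow> W t \<in> borel_measurable M"
  using bm by (simp add: brownian_motion_def)

lemma incr_measurable: "i < 2 ^ r \<Longrightarrow> incr r i \<in> borel_measurable M"
  unfolding incr_def using W_measurable[OF grid_01[of i r]] W_measurable[OF grid_01[of "Suc i" r]]
  by (auto simp: add.commute)

lemma rsum_measurable[measurable]: "rsum r a \<in> borel_measurable M"
  unfolding rsum_def using incr_measurable by (intro borel_measurable_sum borel_measurable_times) auto

lemma incr_indep: "indep_vars (\<lambda>_. borel) (incr r) {..<2 ^ r}"
proof -
  define ts where "ts = map (\<lambda>i. real i / 2 ^ r) [0..<Suc (2 ^ r)]"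
  have len: "length ts = Suc (2 ^ r)" by (simp add: ts_def)
  have nth: "ts ! i = real i / 2 ^ r" if "i \<le> 2 ^ r" for i
    using that by (simp add: ts_def nth_append del: upt_Suc)
  have "sorted_wrt (<) ts"
    unfolding sorted_wrt_iff_nth_less len using nth by (auto simp: divide_strict_right_mono)
  moreover have "set ts \<subseteq> {0..1}" using grid_01 unfolding ts_def by auto
  ultimately have "indep_vars (\<lambda>_. borel) (\<lambda>i w. W (ts ! Suc i) w - W (ts ! i) w) {..<length ts - 1}"
    using bm unfolding brownian_motion_def by blast
  then show ?thesis
    by (rule indep_vars_cong[THEN iffD1, rotated 3]) (auto simp: len nth incr_def add.commute)
qed

lemma incr_std_normal:
  assumes "i < 2 ^ r"
  shows "distr M borel (\<lambda>w. incr r i w * sqrt (2 ^ r)) = std_normal_distribution"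
proof -
  have b: "0 \<le> real i / 2 ^ r" "real i / 2 ^ r < (real i + 1) / 2 ^ r" "(real i + 1) / 2 ^ r \<le> 1"
    using index_less_real[OF assms] by (auto simp: divide_strict_right_mono)
  have d: "(real i + 1) / 2 ^ r - real i / 2 ^ r = 1 / 2 ^ r" by (simp add: add_divide_distrib)
  have "distributed M lborel (incr r i) (\<lambda>x. ennreal (normal_density 0 (sqrt (1 / 2 ^ r)) x))"
  proof -
    have "\<forall>s t. 0 \<le> s \<longrightarrow> s < t \<longrightarrow> t \<le> 1 \<longrightarrow>
        distributed M lborel (\<lambda>w. W t w - W s w) (\<lambda>x. ennreal (normal_density 0 (sqrt (t - s)) x))"
      using bm unfolding brownian_motion_def by (elim conjE)
    from this[rule_format, OF b] show ?thesis unfolding d incr_def[abs_def] .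
  qed
  then have "distributed M lborel (\<lambda>w. (incr r i w - 0) / sqrt (1 / 2 ^ r)) std_normal_density"
    by (subst (asm) normal_standard_normal_convert) auto
  then have "distr M lborel (\<lambda>w. incr r i w * sqrt (2 ^ r)) = std_normal_distribution"
    by (simp add: distributed_def real_sqrt_divide)
  then show ?thesis by (simp cong: distr_cong)
qed

lemma incr_sq_int: "i < 2 ^ r \<Longrightarrow> sq_int M (\<lambda>w. incr r i w * sqrt (2 ^ r))"
proof -
  assume i: "i < 2 ^ r"
  have [measurable]: "incr r i \<in> borel_measurable M" using incr_measurable[OF i] .
  have "integrable (distr M borel (\<lambda>w. incr r i w * sqrt (2 ^ r))) (\<lambda>x. x\<^sup>2)"
    unfolding incr_std_normal[OF i] by (rule integrable_std_normal_distribution_moment)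
  then show ?thesis unfolding sq_int_def by (subst (asm) integrable_distr_eq) auto
qed

lemma incr_moments:
  assumes i: "i < 2 ^ r"
  shows "expectation (\<lambda>w. (incr r i w * sqrt (2 ^ r)) ^ k) = (\<integral>x. x ^ k \<partial>std_normal_distribution)"
proof -
  have [measurable]: "incr r i \<in> borel_measurable M" using incr_measurable[OF i] .
  show ?thesis unfolding incr_std_normal[OF i, symmetric] by (subst integral_distr) auto
qed

lemma incr_orthonormal: "orthonormal_on M (\<lambda>i w. incr r i w * sqrt (2 ^ r)) {..<2 ^ r}"
  unfolding orthonormal_on_def
proof (intro conjI ballI)
  fix i j :: nat assume i: "i \<in> {..<2 ^ r}" and j: "j \<in> {..<2 ^ r}"
  let ?X = "\<lambda>i w. incr r i w * sqrt (2 ^ r)"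
  show "sq_int M (?X i)" using i by (intro incr_sq_int) simp
  show "expectation (\<lambda>w. ?X i w * ?X j w) = (if i = j then 1 else 0)"
  proof (cases "i = j")
    case True
    then show ?thesis using incr_moments[of i r 2] i std_normal_distribution_even_moments(1)[of 1]
      by (simp add: power2_eq_square)
  next
    case False
    have "indep_vars (\<lambda>_. borel) ?X {i, j}"
      using i j by (intro indep_vars_compose2[OF indep_vars_subset[OF incr_indep, of "{i, j}"]]) auto
    then have "expectation (\<lambda>w. \<Prod>k\<in>{i, j}. ?X k w) = (\<Prod>k\<in>{i, j}. expectation (?X k))"
    proof (rule indep_vars_lebesgue_integral[rotated])
      fix k assume "k \<in> {i, j}"
      then have "k < 2 ^ r" using i j by auto
      then show "integrable M (?X k)" by (rule sq_int_integrable[OF incr_sq_int])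
    qed simp
    moreover have "expectation (?X i) = 0"
      using incr_moments[of i r 1] i integral_std_normal_distribution_moment_odd[of 1] by simp
    ultimately show ?thesis using False by simp
  qed
qed

lemma rsum_scaled: "rsum r a w = (\<Sum>i<2 ^ r. (a i / sqrt (2 ^ r)) * (incr r i w * sqrt (2 ^ r)))"
  unfolding rsum_def by (intro sum.cong) auto

lemma rsum_sq_int: "sq_int M (rsum r a)"
  unfolding rsum_scaled[abs_def] by (intro sq_int_sum sq_int_cmult incr_sq_int) simp

text \<open>The Ito isometry for dyadic step functions, from the orthonormality of the rescaled
  increments.\<close>

lemma rsum_square: "expectation (\<lambda>w. (rsum r a w)\<^sup>2) = (\<integral>s. (dstep r a s)\<^sup>2 \<partial>U01)"
proof -
  have "expectation (\<lambda>w. (rsum r a w)\<^sup>2) = (\<Sum>i<2 ^ r. (a i / sqrt (2 ^ r))\<^sup>2)"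
    unfolding rsum_scaled using orthonormal_expand[OF incr_orthonormal _ sq_int_zero, of r "\<lambda>i. a i / sqrt (2 ^ r)"] by simp
  also have "\<dots> = (\<Sum>i<2 ^ r. (a i)\<^sup>2) / 2 ^ r" by (simp add: power_divide sum_divide_distrib)
  finally show ?thesis by (simp add: dstep_square)
qed

lemma rsum_cos: "expectation (\<lambda>w. cos (rsum r a w + c)) = exp (- (\<integral>s. (dstep r a s)\<^sup>2 \<partial>U01) / 2) * cos c"
proof -
  define b where "b = (\<lambda>i. a i / sqrt (2 ^ r))"
  define X where "X = (\<lambda>i w. incr r i w * sqrt (2 ^ r))"
  have Xm: "X i \<in> borel_measurable M" if "i < 2 ^ r" for i
    unfolding X_def using incr_measurable[OF that] by simp
  have one: "(\<integral>w. iexp (b i * X i w) \<partial>M) = complex_of_real (exp (- (b i)\<^sup>2 / 2))" if i: "i < 2 ^ r" for i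
  proof -
    have "char (distr M borel (X i)) (b i) = (\<integral>w. iexp (b i * X i w) \<partial>M)"
      unfolding char_def using Xm[OF i] by (subst integral_distr) auto
    moreover have "distr M borel (X i) = std_normal_distribution" unfolding X_def by (rule incr_std_normal[OF i])
    ultimately show ?thesis by (simp add: char_std_normal_distribution)
  qed
  have ci: "complex_integrable M (\<lambda>w. iexp (f w))" if "f \<in> borel_measurable M" for f
    using that by (intro integrable_const_bound[of _ 1]) auto
  have "(\<integral>w. iexp (rsum r a w) \<partial>M) = (\<integral>w. (\<Prod>i<2 ^ r. iexp (b i * X i w)) \<partial>M)"
    unfolding rsum_scaled by (simp add: b_def X_def exp_sum sum_distrib_left del: times_divide_eq_left)
  also have "\<dots> = (\<Prod>i<2 ^ r. \<integral>w. iexp (b i * X i w) \<partial>M)"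
  proof (rule indep_vars_lebesgue_integral)
    have "indep_vars (\<lambda>_. borel) (\<lambda>i w. (\<lambda>x. iexp (b i * (x * sqrt (2 ^ r)))) (incr r i w)) {..<2 ^ r}"
      by (rule indep_vars_compose2[OF incr_indep]) simp
    then show "indep_vars (\<lambda>_. borel) (\<lambda>i w. iexp (b i * X i w)) {..<2 ^ r}" by (simp only: X_def)
    fix i :: nat assume "i \<in> {..<2 ^ r}"
    then have "X i \<in> borel_measurable M" using Xm by simp
    then show "complex_integrable M (\<lambda>w. iexp (b i * X i w))" by (intro ci) simp
  qed simp
  also have "\<dots> = (\<Prod>i<2 ^ r. complex_of_real (exp (- (b i)\<^sup>2 / 2)))" using one by simp
  also have "\<dots> = complex_of_real (exp (- (\<Sum>i<2 ^ r. (b i)\<^sup>2) / 2))"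
  proof -
    have "- (\<Sum>i<2 ^ r. (b i)\<^sup>2) / 2 = (\<Sum>i<2 ^ r. - (b i)\<^sup>2 / 2)" by (simp add: sum_negf sum_divide_distrib)
    then show ?thesis by (simp only: exp_sum[OF finite_lessThan] of_real_prod)
  qed
  also have "(\<Sum>i<2 ^ r. (b i)\<^sup>2) = (\<integral>s. (dstep r a s)\<^sup>2 \<partial>U01)"
    by (simp add: b_def dstep_square power_divide sum_divide_distrib)
  finally have e: "(\<integral>w. iexp (rsum r a w) \<partial>M) = complex_of_real (exp (- (\<integral>s. (dstep r a s)\<^sup>2 \<partial>U01) / 2))" .
  \<comment> \<open>The phase enters as multiplication by \<open>cis c\<close>, which makes the
    cosine a real part.\<close>
  have "expectation (\<lambda>w. cos (rsum r a w + c)) = Re (\<integral>w. iexp (rsum r a w) * cis c \<partial>M)"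
    by (subst integral_Re[symmetric]) (auto simp: cos_add Re_exp Im_exp intro!: ci integrable_mult_left)
  also have "(\<integral>w. iexp (rsum r a w) * cis c \<partial>M) = (\<integral>w. iexp (rsum r a w) \<partial>M) * cis c"
    by (rule Bochner_Integration.integral_mult_left) (intro ci rsum_measurable)
  finally show ?thesis unfolding e by simp
qed

text \<open>Increments telescope, so repeating a coefficient over its subcells leaves the sum
  unchanged. Sums of different levels can thus be compared at the finer one.\<close>

lemma rsum_refine: "rsum r a w = rsum (r + k) (\<lambda>i. a (i div 2 ^ k)) w"
proof (induction k)
  case (Suc k)
  have "rsum m c w = rsum (Suc m) (\<lambda>i. c (i div 2)) w" for m c
  proof -
    have "rsum (Suc m) (\<lambda>i. c (i div 2)) w = (\<Sum>i<2 ^ m. c i * incr (Suc m) (2 * i) w + c i * incr (Suc m) (2 * i + 1) w)"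
    proof -
      have "(\<Sum>i<2 * n. f i) = (\<Sum>i<n. f (2 * i) + f (2 * i + 1))" for f :: "nat \<Rightarrow> real" and n
        by (induction n) auto
      then show ?thesis unfolding rsum_def by simp
    qed
    also have "\<dots> = rsum m c w" unfolding rsum_def
    proof (rule sum.cong)
      fix i
      have g: "real (2 * i) / 2 ^ Suc m = real i / 2 ^ m" "(real (2 * i + 1) + 1) / 2 ^ Suc m = (real i + 1) / 2 ^ m"
        "(real (2 * i) + 1) / 2 ^ Suc m = real (2 * i + 1) / 2 ^ Suc m" by (simp_all add: field_simps)
      show "c i * incr (Suc m) (2 * i) w + c i * incr (Suc m) (2 * i + 1) w = c i * incr m i w"
        unfolding incr_def g by (simp add: algebra_simps)
    qed simp
    finally show ?thesis by simp
  qed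
  from this[of "r + k" "\<lambda>i. a (i div 2 ^ k)"] Suc show ?case by (simp only: power_Suc div_mult2_eq add_Suc_right)
qed simp

definition samp :: "(real \<Rightarrow> real) \<Rightarrow> nat \<Rightarrow> nat \<Rightarrow> real" where "samp f r i = f (real i / 2 ^ r)"

lemma rsum_linear: "rsum r (\<lambda>i. \<Sum>j\<in>J. u j * a j i) w = (\<Sum>j\<in>J. u j * rsum r (a j) w)"
  unfolding rsum_def by (simp add: sum_distrib_left sum_distrib_right mult.assoc) (rule sum.swap)

lemma rsum_diff: "rsum r a w - rsum r b w = rsum r (\<lambda>i. a i - b i) w"
  unfolding rsum_def by (simp add: left_diff_distrib sum_subtractf)

text \<open>Passing to the next level moves each sample by at most L / 2^r, so the isometry bounds
  the change in L2, and Cauchy-Schwarz in L1. The geometric rate yields almost sure convergence, not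
  only convergence in mean.\<close>

lemma rsum_step_bound:
  assumes L: "\<And>x y. \<bar>f x - f y\<bar> \<le> L * \<bar>x - y\<bar>" "L \<ge> 0"
  shows "expectation (\<lambda>w. \<bar>rsum (Suc r) (samp f (Suc r)) w - rsum r (samp f r) w\<bar>) \<le> L / 2 ^ r"
proof -
  define a where "a = (\<lambda>i. samp f (Suc r) i - samp f r (i div 2))"
  have d: "rsum (Suc r) (samp f (Suc r)) w - rsum r (samp f r) w = rsum (Suc r) a w" for w
    using rsum_refine[of r "samp f r" w 1] unfolding a_def rsum_diff[symmetric] by simp
  have a: "\<bar>a i\<bar> \<le> L / 2 ^ r" for i
  proof -
    have "\<bar>real i / 2 ^ Suc r - real (i div 2) / 2 ^ r\<bar> = \<bar>real i - 2 * real (i div 2)\<bar> / 2 ^ Suc r"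
      by (simp add: field_simps)
    also have "real i - 2 * real (i div 2) = real (i mod 2)"
    proof -
      have "real (2 * (i div 2) + i mod 2) = real i" by (simp only: mult_div_mod_eq)
      then show ?thesis unfolding of_nat_add of_nat_mult of_nat_numeral by linarith
    qed
    also have "\<bar>real (i mod 2)\<bar> / 2 ^ Suc r \<le> 2 / 2 ^ Suc r" by (intro divide_right_mono) auto
    finally have "\<bar>real i / 2 ^ Suc r - real (i div 2) / 2 ^ r\<bar> \<le> 1 / 2 ^ r" by simp
    then have "L * \<bar>real i / 2 ^ Suc r - real (i div 2) / 2 ^ r\<bar> \<le> L * (1 / 2 ^ r)" using L(2) by (rule mult_left_mono)
    then show ?thesis using L(1)[of "real i / 2 ^ Suc r" "real (i div 2) / 2 ^ r"] by (simp add: a_def samp_def)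
  qed
  have sq: "expectation (\<lambda>w. (rsum (Suc r) a w)\<^sup>2) \<le> (L / 2 ^ r)\<^sup>2"
  proof -
    have "(\<Sum>i<2 ^ Suc r. (a i)\<^sup>2) \<le> (\<Sum>i<(2::nat) ^ Suc r. (L / 2 ^ r)\<^sup>2)"
    proof (rule sum_mono)
      fix i have "\<bar>a i\<bar>\<^sup>2 \<le> (L / 2 ^ r)\<^sup>2" using a by (rule power_mono) simp
      then show "(a i)\<^sup>2 \<le> (L / 2 ^ r)\<^sup>2" by simp
    qed
    then have "(\<Sum>i<2 ^ Suc r. (a i)\<^sup>2) / 2 ^ Suc r \<le> (\<Sum>i<(2::nat) ^ Suc r. (L / 2 ^ r)\<^sup>2) / 2 ^ Suc r"
      by (rule divide_right_mono) simp
    also have "(\<Sum>i<(2::nat) ^ Suc r. (L / 2 ^ r)\<^sup>2) = 2 ^ Suc r * (L / 2 ^ r)\<^sup>2" by simp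
    also have "2 ^ Suc r * (L / 2 ^ r)\<^sup>2 / 2 ^ Suc r = (L / 2 ^ r)\<^sup>2" by (rule nonzero_mult_div_cancel_left) simp
    finally show ?thesis unfolding rsum_square dstep_square .
  qed
  have "(expectation (\<lambda>w. \<bar>rsum (Suc r) a w\<bar> * 1))\<^sup>2 \<le> expectation (\<lambda>w. \<bar>rsum (Suc r) a w\<bar>\<^sup>2) * expectation (\<lambda>w. 1\<^sup>2)"
    using rsum_sq_int[of "Suc r" a] by (intro integral_cauchy_schwarz) (auto simp: sq_int_def)
  then have "(expectation (\<lambda>w. \<bar>rsum (Suc r) a w\<bar>))\<^sup>2 \<le> expectation (\<lambda>w. (rsum (Suc r) a w)\<^sup>2)"
    by (simp add: prob_space)
  then have "(expectation (\<lambda>w. \<bar>rsum (Suc r) a w\<bar>))\<^sup>2 \<le> (L / 2 ^ r)\<^sup>2" using sq by (rule order_trans)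
  then have "expectation (\<lambda>w. \<bar>rsum (Suc r) a w\<bar>) \<le> L / 2 ^ r" by (rule power2_le_imp_le) (use L(2) in simp)
  then show ?thesis by (simp only: d)
qed

text \<open>A pathwise limit rather than an L2 class: it is a function on the whole space and
  measurable by construction, whatever \<open>lim\<close> returns off the set of
  convergence.\<close>

definition wint :: "(real \<Rightarrow> real) \<Rightarrow> 'a \<Rightarrow> real" where
  "wint f w = lim (\<lambda>r. rsum r (samp f r) w)"

lemma wint_measurable[measurable]: "wint f \<in> borel_measurable M"
  unfolding wint_def[abs_def] by (rule borel_measurable_lim_metric) simp

lemma wint_AE:
  assumes L: "\<And>x y. \<bar>f x - f y\<bar> \<le> L * \<bar>x - y\<bar>" "L \<ge> 0"
  shows "AE w in M. (\<lambda>r. rsum r (samp f r) w) \<longlonglongrightarrow> wint f w"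
proof -
  define d where "d = (\<lambda>r w. rsum (Suc r) (samp f (Suc r)) w - rsum r (samp f r) w)"
  have [measurable]: "d r \<in> borel_measurable M" for r unfolding d_def by measurable
  have di: "integrable M (\<lambda>w. \<bar>d r w\<bar>)" for r
    unfolding d_def using sq_int_integrable[OF sq_int_diff[OF rsum_sq_int rsum_sq_int]] by simp
  have "(\<integral>\<^sup>+w. (\<Sum>r. ennreal \<bar>d r w\<bar>) \<partial>M) = (\<Sum>r. \<integral>\<^sup>+w. ennreal \<bar>d r w\<bar> \<partial>M)"
    by (rule nn_integral_suminf) measurable
  also have "\<dots> \<le> (\<Sum>r. ennreal (L * (1/2) ^ r))"
  proof (intro suminf_le)
    fix r
    have "(\<integral>\<^sup>+w. ennreal \<bar>d r w\<bar> \<partial>M) = ennreal (expectation (\<lambda>w. \<bar>d r w\<bar>))"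
      using di by (intro nn_integral_eq_integral) auto
    also have "\<dots> \<le> ennreal (L * (1/2) ^ r)"
      using rsum_step_bound[OF L, of r] unfolding d_def by (intro ennreal_leI) (simp add: power_divide)
    finally show "(\<integral>\<^sup>+w. ennreal \<bar>d r w\<bar> \<partial>M) \<le> ennreal (L * (1/2) ^ r)" .
  qed auto
  also have "\<dots> < \<infinity>"
    using L(2) by (subst suminf_ennreal2) (auto intro!: summable_mult summable_geometric)
  finally have "AE w in M. (\<Sum>r. ennreal \<bar>d r w\<bar>) \<noteq> \<infinity>"
    by (intro nn_integral_PInf_AE) auto
  then show ?thesis
  proof eventually_elim
    case (elim w)
    then have "summable (\<lambda>r. \<bar>d r w\<bar>)" by (intro summable_suminf_not_top) auto
    then have "summable (\<lambda>r. d r w)" by (rule summable_rabs_cancel)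
    then have "convergent (\<lambda>n. \<Sum>r<n. d r w)" by (simp add: summable_iff_convergent)
    moreover have "(\<Sum>r<n. d r w) = rsum n (samp f n) w - rsum 0 (samp f 0) w" for n
      unfolding d_def by (rule sum_lessThan_telescope)
    ultimately have "convergent (\<lambda>n. (rsum n (samp f n) w - rsum 0 (samp f 0) w) + rsum 0 (samp f 0) w)"
      by (intro convergent_add convergent_const) simp
    then show ?case unfolding wint_def by (simp add: convergent_LIMSEQ_iff)
  qed
qed

lemma trig_lipschitz: "\<bar>trig j x - trig j y\<bar> \<le> (4 * pi * freq j) * \<bar>x - y\<bar>"
proof (cases "j = 0")
  case False
  let ?k = "2 * pi * real (freq j)"
  have "\<bar>cos a - cos b\<bar> \<le> \<bar>a - b\<bar>" for a b :: real
  proof -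
    have "\<bar>cos a - cos b\<bar> = 2 * \<bar>sin ((a + b) / 2)\<bar> * \<bar>sin ((b - a) / 2)\<bar>"
      by (simp add: cos_diff_cos abs_mult)
    also have "\<dots> \<le> 2 * 1 * \<bar>(b - a) / 2\<bar>" by (intro mult_mono abs_sin_x_le_abs_x) auto
    finally show ?thesis by (simp add: abs_minus_commute)
  qed
  from this[of "?k * x + trig_phase (\<lambda>_. 0) j" "?k * y + trig_phase (\<lambda>_. 0) j"]
  have "\<bar>cos (?k * x + trig_phase (\<lambda>_. 0) j) - cos (?k * y + trig_phase (\<lambda>_. 0) j)\<bar> \<le> ?k * \<bar>x - y\<bar>"
    by (simp add: abs_mult flip: right_diff_distrib)
  then have "sqrt 2 * \<bar>cos (?k * x + trig_phase (\<lambda>_. 0) j) - cos (?k * y + trig_phase (\<lambda>_. 0) j)\<bar> \<le> 2 * (?k * \<bar>x - y\<bar>)"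
    using real_le_lsqrt[of 2 2] by (intro mult_mono) auto
  then show ?thesis unfolding trigp_cos[OF False] by (simp add: abs_mult flip: right_diff_distrib)
qed (simp add: trigp_def)

abbreviation zt :: "nat \<Rightarrow> 'a \<Rightarrow> real" where "zt j \<equiv> wint (trig j)"

lemma zt_AE: "AE w in M. \<forall>j. (\<lambda>r. rsum r (samp (trig j) r) w) \<longlonglongrightarrow> zt j w"
  unfolding AE_all_countable using wint_AE[OF trig_lipschitz] by simp

lemma dstep_samp_L2:
  assumes f: "continuous_on UNIV f" "\<And>x. \<bar>f x\<bar> \<le> B"
  shows "s \<in> {0..<1} \<Longrightarrow> (\<lambda>r. dstep r (samp f r) s) \<longlonglongrightarrow> f s"
    and "\<bar>dstep r (samp f r) s\<bar> \<le> B"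
    and "(\<lambda>r. \<integral>s. (dstep r (samp f r) s)\<^sup>2 \<partial>U01) \<longlonglongrightarrow> (\<integral>s. (f s)\<^sup>2 \<partial>U01)"
proof -
  interpret U: prob_space U01 by (rule prob_space_U01)
  have B0: "B \<ge> 0" using f(2)[of 0] abs_ge_zero order_trans by blast
  have lim: "(\<lambda>r. dstep r (samp f r) s) \<longlonglongrightarrow> f s" if "s \<in> {0..<1}" for s
    unfolding dstep_value[OF that] samp_def
    using continuous_on_tendsto_compose[OF f(1) left_endpoint_tendsto[of s]] that by simp
  have bd: "\<bar>dstep r (samp f r) s\<bar> \<le> B" for r s
  proof (cases "s \<in> {0..<1}")
    case True then show ?thesis by (simp only: dstep_value samp_def f)
  next
    case False
    have "s \<notin> cell r i" if "i < 2 ^ r" for i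
    proof
      assume s: "s \<in> cell r i"
      have "(real i + 1) / 2 ^ r \<le> 1" using index_less_real[OF that] by simp
      moreover have "0 \<le> real i / 2 ^ r" by simp
      moreover have "real i / 2 ^ r \<le> s" "s < (real i + 1) / 2 ^ r" using s by (simp_all add: cell_def)
      ultimately show False using False unfolding atLeastLessThan_iff by linarith
    qed
    then show ?thesis using B0 by (simp add: dstep_def)
  qed
  show "s \<in> {0..<1} \<Longrightarrow> (\<lambda>r. dstep r (samp f r) s) \<longlonglongrightarrow> f s" by (rule lim)
  show "\<bar>dstep r (samp f r) s\<bar> \<le> B" by (rule bd)
  have fm: "f \<in> borel_measurable borel" using f(1) by (rule borel_measurable_continuous_onI)
  show "(\<lambda>r. \<integral>s. (dstep r (samp f r) s)\<^sup>2 \<partial>U01) \<longlonglongrightarrow> (\<integral>s. (f s)\<^sup>2 \<partial>U01)"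
  proof (rule integral_dominated_convergence[where w = "\<lambda>_. B\<^sup>2"])
    show "(\<lambda>s. (f s)\<^sup>2) \<in> borel_measurable U01" by (rule measurable_restrict_space1) (use fm in simp)
    show "(\<lambda>s. (dstep r (samp f r) s)\<^sup>2) \<in> borel_measurable U01" for r by (rule measurable_restrict_space1) simp
    show "AE s in U01. (\<lambda>r. (dstep r (samp f r) s)\<^sup>2) \<longlonglongrightarrow> (f s)\<^sup>2"
      using AE_U01_interior by eventually_elim (rule tendsto_power[OF lim])
    show "AE s in U01. norm ((dstep r (samp f r) s)\<^sup>2) \<le> B\<^sup>2" for r
    proof (rule AE_I2)
      fix s
      have "\<bar>dstep r (samp f r) s\<bar>\<^sup>2 \<le> B\<^sup>2" using bd[of r s] by (rule power_mono) simp
      then show "norm ((dstep r (samp f r) s)\<^sup>2) \<le> B\<^sup>2" by simp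
    qed
  qed simp
qed

definition trigsum :: "nat \<Rightarrow> (nat \<Rightarrow> real) \<Rightarrow> real \<Rightarrow> real" where "trigsum m u s = (\<Sum>j<m. u j * trig j s)"

lemma trigsum_continuous: "continuous_on A (trigsum m u)"
  unfolding trigsum_def by (intro continuous_intros)

lemma trigsum_bounded: "\<bar>trigsum m u s\<bar> \<le> (\<Sum>j<m. \<bar>u j\<bar> * 2)"
  unfolding trigsum_def using trigp_bounded
  by (intro order_trans[OF sum_abs] sum_mono) (auto simp: abs_mult intro!: mult_left_mono)

lemma rsum_trigsum: "rsum r (samp (trigsum m u) r) w = (\<Sum>j<m. u j * rsum r (samp (trig j) r) w)"
  unfolding rsum_linear[symmetric] samp_def[abs_def] trigsum_def ..

lemma zt_sum_AE: "AE w in M. (\<lambda>r. rsum r (samp (trigsum m u) r) w) \<longlonglongrightarrow> (\<Sum>j<m. u j * zt j w)"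
  using zt_AE by eventually_elim (auto simp: rsum_trigsum intro!: tendsto_sum tendsto_mult)

lemma trigsum_square: "(\<integral>s. (trigsum m u s)\<^sup>2 \<partial>U01) = (\<Sum>j<m. (u j)\<^sup>2)"
  unfolding trigsum_def using orthonormal_expand[OF trigp_orthonormal[of "\<lambda>_. 0" "{..<m}"] _ sq_int_zero, of u] by simp

text \<open>The formula \<open>rsum_cos\<close> passes to the limit by bounded convergence. In the
  exponent the squared norm of the step function tends to that of the trigonometric sum, which
  orthonormality turns into the sum of the u_j^2.\<close>

lemma zt_iid: "iid_normal M zt"
proof (rule iid_normal_of_char)
  fix m u c
  let ?f = "trigsum m u"
  have "(\<lambda>r. expectation (\<lambda>z. cos (rsum r (samp ?f r) z + c))) \<longlonglongrightarrow> expectation (\<lambda>z. cos ((\<Sum>j<m. u j * zt j z) + c))"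
  proof (rule integral_dominated_convergence[where w = "\<lambda>_. 1"])
    show "AE z in M. (\<lambda>r. cos (rsum r (samp ?f r) z + c)) \<longlonglongrightarrow> cos ((\<Sum>j<m. u j * zt j z) + c)"
      using zt_sum_AE[of m u] by eventually_elim (intro tendsto_cos tendsto_add tendsto_const)
  qed auto
  moreover have "(\<lambda>r. expectation (\<lambda>z. cos (rsum r (samp ?f r) z + c))) \<longlonglongrightarrow> exp (- (\<Sum>j<m. (u j)\<^sup>2) / 2) * cos c"
    unfolding rsum_cos trigsum_square[symmetric]
    by (intro tendsto_mult tendsto_const tendsto_exp tendsto_divide tendsto_minus dstep_samp_L2(3)[OF trigsum_continuous trigsum_bounded]) simp
  ultimately show "expectation (\<lambda>z. cos ((\<Sum>j<m. u j * zt j z) + c)) = exp (- (\<Sum>j<m. (u j)\<^sup>2) / 2) * cos c"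
    by (rule LIMSEQ_unique)
qed simp

end

section \<open>Identification of the process with its Fourier expansion\<close>

lemma fatou_square:
  fixes D :: "nat \<Rightarrow> 'a \<Rightarrow> real"
  assumes [measurable]: "\<And>r. D r \<in> borel_measurable M"
    and lim: "AE w in M. (\<lambda>r. D r w) \<longlonglongrightarrow> Z w"
    and b: "\<And>r. (\<integral>\<^sup>+w. ennreal ((D r w)\<^sup>2) \<partial>M) \<le> ennreal (b r)" and \<beta>: "b \<longlonglongrightarrow> \<beta>"
  shows "(\<integral>\<^sup>+w. ennreal ((Z w)\<^sup>2) \<partial>M) \<le> ennreal \<beta>"
proof -
  have "(\<integral>\<^sup>+w. ennreal ((Z w)\<^sup>2) \<partial>M) \<le> (\<integral>\<^sup>+w. liminf (\<lambda>r. ennreal ((D r w)\<^sup>2)) \<partial>M)"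
  proof (rule nn_integral_mono_AE)
    show "AE w in M. ennreal ((Z w)\<^sup>2) \<le> liminf (\<lambda>r. ennreal ((D r w)\<^sup>2))"
      using lim
    proof eventually_elim
      case (elim w)
      then have "(\<lambda>r. ennreal ((D r w)\<^sup>2)) \<longlonglongrightarrow> ennreal ((Z w)\<^sup>2)"
        by (intro tendsto_ennrealI tendsto_power)
      from lim_imp_Liminf[OF sequentially_bot this] show ?case by (rule eq_refl[OF sym])
    qed
  qed
  also have "\<dots> \<le> liminf (\<lambda>r. \<integral>\<^sup>+w. ennreal ((D r w)\<^sup>2) \<partial>M)" by (rule nn_integral_liminf) measurable
  also have "\<dots> \<le> liminf (\<lambda>r. ennreal (b r))" using b by (intro Liminf_mono always_eventually) auto
  also have "\<dots> = ennreal \<beta>" by (rule lim_imp_Liminf[OF sequentially_bot tendsto_ennrealI[OF \<beta>]])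
  finally show ?thesis .
qed

text \<open>After the substitution u = t - s the singularity stays at u = 0 while t moves, so one
  dominating function serves for the continuity in t shown next.\<close>

lemma kap_inner_subst:
  fixes f :: "real \<Rightarrow> real"
  assumes [measurable]: "f \<in> borel_measurable borel" and t: "t \<in> {0..1}"
  shows "(\<integral>s. kap \<alpha> t s * f s \<partial>U01) = (\<integral>u. (if u \<le> t then u powr (\<alpha> - 1) * f (t - u) else 0) \<partial>U01)"
proof -
  have "(\<integral>s. kap \<alpha> t s * f s \<partial>U01) = (\<integral>s. indicator {0..1} s * (kap \<alpha> t s * f s) \<partial>lborel)"
    by (subst integral_restrict_space) auto
  also have "\<dots> = (\<integral>u. indicator {0..1} (t - u) * (kap \<alpha> t (t - u) * f (t - u)) \<partial>lborel)"
    using lborel_integral_real_affine[of "-1" "\<lambda>s. indicator {0..1} s * (kap \<alpha> t s * f s)" t] by simp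
  also have "\<dots> = (\<integral>u. indicator {0..1} u * (if u \<le> t then u powr (\<alpha> - 1) * f (t - u) else 0) \<partial>lborel)"
    using t by (intro Bochner_Integration.integral_cong) (auto simp: kap_def indicator_def)
  also have "\<dots> = (\<integral>u. (if u \<le> t then u powr (\<alpha> - 1) * f (t - u) else 0) \<partial>U01)"
    by (subst integral_restrict_space) auto
  finally show ?thesis .
qed

lemma kap_inner_tendsto:
  fixes f :: "real \<Rightarrow> real"
  assumes \<alpha>: "\<alpha> > 0" and f: "continuous_on UNIV f" "\<And>x. \<bar>f x\<bar> \<le> B"
    and t: "\<And>q. tq q \<in> {0..1}" "t \<in> {0..1}" "tq \<longlonglongrightarrow> t"
  shows "(\<lambda>q. \<integral>s. kap \<alpha> (tq q) s * f s \<partial>U01) \<longlonglongrightarrow> (\<integral>s. kap \<alpha> t s * f s \<partial>U01)"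
proof -
  have fm[measurable]: "f \<in> borel_measurable borel" using f(1) by (rule borel_measurable_continuous_onI)
  have "(\<lambda>q. \<integral>u. (if u \<le> tq q then u powr (\<alpha> - 1) * f (tq q - u) else 0) \<partial>U01) \<longlonglongrightarrow> (\<integral>u. (if u \<le> t then u powr (\<alpha> - 1) * f (t - u) else 0) \<partial>U01)"
  proof (rule integral_dominated_convergence[where w = "\<lambda>u. B * u powr (\<alpha> - 1)"])
    show "integrable U01 (\<lambda>u. B * u powr (\<alpha> - 1))" using U01_powr(1)[of "\<alpha> - 1"] \<alpha> by simp
    show "(\<lambda>u. if u \<le> t then u powr (\<alpha> - 1) * f (t - u) else 0) \<in> borel_measurable U01"
      by (rule measurable_restrict_space1) measurable
    show "(\<lambda>u. if u \<le> tq q then u powr (\<alpha> - 1) * f (tq q - u) else 0) \<in> borel_measurable U01" for q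
      by (rule measurable_restrict_space1) measurable
    show "AE u in U01. (\<lambda>q. if u \<le> tq q then u powr (\<alpha> - 1) * f (tq q - u) else 0) \<longlonglongrightarrow> (if u \<le> t then u powr (\<alpha> - 1) * f (t - u) else 0)"
      using AE_U01_ne[of t]
    proof eventually_elim
      case (elim u)
      show ?case
      proof (cases "u < t")
        case True
        then have "eventually (\<lambda>q. u < tq q) sequentially" using t(3) by (rule order_tendstoD(1)[rotated])
        then have "eventually (\<lambda>q. u powr (\<alpha> - 1) * f (tq q - u) = (if u \<le> tq q then u powr (\<alpha> - 1) * f (tq q - u) else 0)) sequentially"
          by eventually_elim auto
        moreover have "(\<lambda>q. u powr (\<alpha> - 1) * f (tq q - u)) \<longlonglongrightarrow> u powr (\<alpha> - 1) * f (t - u)"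
          by (intro tendsto_mult_left continuous_on_tendsto_compose[OF f(1)] tendsto_diff t(3) tendsto_const) auto
        ultimately show ?thesis using True Lim_transform_eventually by force
      next
        case False
        then have "t < u" using elim by simp
        then have "eventually (\<lambda>q. tq q < u) sequentially" using t(3) by (rule order_tendstoD(2)[rotated])
        then have "eventually (\<lambda>q. (if u \<le> tq q then u powr (\<alpha> - 1) * f (tq q - u) else 0) = 0) sequentially"
          by eventually_elim auto
        then show ?thesis using \<open>t < u\<close> tendsto_eventually by force
      qed
    qed
    show "AE u in U01. norm (if u \<le> tq q then u powr (\<alpha> - 1) * f (tq q - u) else 0) \<le> B * u powr (\<alpha> - 1)" for q
    proof (rule AE_I2)
      fix u
      have "u powr (\<alpha> - 1) * \<bar>f (tq q - u)\<bar> \<le> u powr (\<alpha> - 1) * B" using f(2) by (intro mult_left_mono) auto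
      moreover have "0 \<le> B" using f(2)[of 0] abs_ge_zero order_trans by blast
      ultimately show "norm (if u \<le> tq q then u powr (\<alpha> - 1) * f (tq q - u) else 0) \<le> B * u powr (\<alpha> - 1)"
        by (auto simp: abs_mult mult.commute)
    qed
  qed
  then show ?thesis unfolding kap_inner_subst[OF fm t(1)] kap_inner_subst[OF fm t(2)] .
qed

context brownian
begin

lemma trigsum_sq_int: "sq_int U01 (trigsum m u)"
  unfolding trigsum_def by (rule trig_sum_sq_int)

text \<open>At dyadic t the Wiener integral and the coordinates are limits of dyadic sums of one
  common level, so their difference is a limit of sums of differences, to which the isometry
  applies. Along a subsequence the convergence is almost sure, and Fatou's lemma gives the
  inequality in the required direction.\<close>

lemma dyadic_bound:
  fixes p q :: nat
  assumes \<alpha>: "\<alpha> > 1/2" and p: "1 \<le> p" "p \<le> 2 ^ q" and t: "t = real p / 2 ^ q"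
    and wi: "wiener_integral M W (\<lambda>s. (t - s) powr (\<alpha> - 1)) 0 t Y"
  shows "(\<integral>\<^sup>+w. ennreal ((Y w - (\<Sum>j<m. u j * zt j w))\<^sup>2) \<partial>M) \<le> ennreal (\<integral>s. (kap \<alpha> t s - trigsum m u s)\<^sup>2 \<partial>U01)"
proof -
  have t01: "t \<in> {0..1}" using grid_01[OF p(2)] t by simp
  \<comment> \<open>The dyadic points of level r + q up to t. Starting at level q makes t itself a
    grid point, and p \<ge> 1 gives the list the two entries that \<open>is_partition\<close>
    demands.\<close>
  define P where "P = (\<lambda>r. map (\<lambda>i. real i / 2 ^ (r + q)) [0..<Suc (p * 2 ^ r)])"
  define C where "C = (\<lambda>r. ck \<alpha> t (r + q))"
  have len: "length (P r) = Suc (p * 2 ^ r)" for r by (simp add: P_def)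
  have nth: "P r ! i = real i / 2 ^ (r + q)" if "i \<le> p * 2 ^ r" for r i
    using that by (simp add: P_def nth_append del: upt_Suc)
  have tr: "real (p * 2 ^ r) / 2 ^ (r + q) = t" for r by (simp add: t power_add)
  have p2: "p * 2 ^ r \<ge> 1" for r using p by simp
  have part: "is_partition 0 t (P r)" for r
  proof -
    have "sorted (P r)" unfolding sorted_iff_nth_mono len using nth by (auto simp: divide_right_mono)
    moreover have "hd (P r) = 0" using nth[of 0 r] len[of r] by (simp add: hd_conv_nth flip: length_greater_0_conv)
    moreover have "last (P r) = t" using nth[of "p * 2 ^ r" r] tr[of r] len[of r] by (simp add: last_conv_nth flip: length_greater_0_conv)
    ultimately show ?thesis using p2[of r] by (simp add: is_partition_def len)
  qed
  \<comment> \<open>Coefficients beyond t vanish, so sums over the cells of [0, t] extend to all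
    cells of [0, 1].\<close>
  have C0: "C r i = 0" if "p * 2 ^ r \<le> i" for r i
  proof -
    have "real (p * 2 ^ r) < real i + 1" using that by linarith
    then have "real (p * 2 ^ r) / 2 ^ (r + q) < (real i + 1) / 2 ^ (r + q)" by (intro divide_strict_right_mono) auto
    then show ?thesis unfolding C_def ck_def tr by simp
  qed
  have le: "p * 2 ^ r \<le> 2 ^ (r + q)" for r using p(2) by (simp add: power_add)
  have step: "step_fun (P r) (C r) s = dstep (r + q) (C r) s" for r s
  proof -
    have "step_fun (P r) (C r) s = (\<Sum>i<p * 2 ^ r. C r i * indicator (cell (r + q) i) s)"
      unfolding step_fun_def len
    proof (rule sum.cong)
      fix i assume "i \<in> {..<p * 2 ^ r}"
      then have "P r ! i = real i / 2 ^ (r + q)" "P r ! Suc i = (real i + 1) / 2 ^ (r + q)" using nth[of i r] nth[of "Suc i" r] by (auto simp: add.commute)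
      then show "(if P r ! i \<le> s \<and> s < P r ! Suc i then C r i else 0) = C r i * indicator (cell (r + q) i) s"
        by (simp add: cell_def indicator_def)
    qed simp
    also have "\<dots> = dstep (r + q) (C r) s"
      unfolding dstep_def using le[of r] C0[of r] by (intro sum.mono_neutral_left) auto
    finally show ?thesis .
  qed
  have sw: "simple_wiener W (P r) (C r) w = rsum (r + q) (C r) w" for r w
  proof -
    have "simple_wiener W (P r) (C r) w = (\<Sum>i<p * 2 ^ r. C r i * incr (r + q) i w)"
      unfolding simple_wiener_def len
    proof (rule sum.cong)
      fix i assume "i \<in> {..<p * 2 ^ r}"
      then have "P r ! i = real i / 2 ^ (r + q)" "P r ! Suc i = (real i + 1) / 2 ^ (r + q)" using nth[of i r] nth[of "Suc i" r] by (auto simp: add.commute)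
      then show "C r i * (W (P r ! Suc i) w - W (P r ! i) w) = C r i * incr (r + q) i w" by (simp add: incr_def)
    qed simp
    also have "\<dots> = rsum (r + q) (C r) w"
      unfolding rsum_def using le[of r] C0[of r] by (intro sum.mono_neutral_left) auto
    finally show ?thesis .
  qed
  have d0: "dstep (r + q) (C r) s = 0" if "s \<ge> t" for r s
  proof -
    have "C r i * indicator (cell (r + q) i) s = 0" for i
    proof (cases "(real i + 1) / 2 ^ (r + q) \<le> t")
      case True
      then have "s \<notin> cell (r + q) i" using that by (auto simp: cell_def)
      then show ?thesis by simp
    qed (simp add: C_def ck_def)
    then show ?thesis unfolding dstep_def by (intro sum.neutral ballI)
  qed
  have pt: "indicator {0..t} s * ((t - s) powr (\<alpha> - 1) - step_fun (P r) (C r) s)\<^sup>2 = indicator {0..1} s * (kap \<alpha> t s - dstep (r + q) (C r) s)\<^sup>2" for r s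
    unfolding step using t01 d0[of s r] by (auto simp: indicator_def kap_def)
  have sqd: "sq_int U01 (dstep r a)" for r a
    unfolding dstep_def
  proof (intro sq_int_sum sq_int_cmult)
    interpret U: prob_space U01 by (rule prob_space_U01)
    show "sq_int U01 (indicator (cell r i))" for i
      by (rule U.sq_int_bounded[where B = 1]) (auto simp: indicator_def cell_def intro!: measurable_restrict_space1)
  qed
  have si: "set_integrable lborel {0..t} (\<lambda>s. ((t - s) powr (\<alpha> - 1) - step_fun (P r) (C r) s)\<^sup>2)" for r
  proof -
    have "integrable U01 (\<lambda>s. (kap \<alpha> t s - dstep (r + q) (C r) s)\<^sup>2)"
      by (intro sq_int_sq sq_int_diff kap_sq_int(1)[OF \<alpha> t01] sqd)
    then show ?thesis unfolding set_integrable_def real_scaleR_def pt by (subst (asm) integrable_restrict_space) auto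
  qed
  have li: "(LINT s:{0..t}|lborel. ((t - s) powr (\<alpha> - 1) - step_fun (P r) (C r) s)\<^sup>2) = (\<integral>s. (kap \<alpha> t s - dstep (r + q) (C r) s)\<^sup>2 \<partial>U01)" for r
    unfolding set_lebesgue_integral_def real_scaleR_def pt by (subst integral_restrict_space) auto
  have "(\<lambda>r. LINT s:{0..t}|lborel. ((t - s) powr (\<alpha> - 1) - step_fun (P r) (C r) s)\<^sup>2) \<longlonglongrightarrow> 0"
    unfolding li unfolding C_def using LIMSEQ_ignore_initial_segment[OF dstep_ck_L2_zero[OF \<alpha> t01], of q] .
  then have l2: "(\<lambda>r. \<integral>w. (Y w - rsum (r + q) (C r) w)\<^sup>2 \<partial>M) \<longlonglongrightarrow> 0"
    using wi part si unfolding wiener_integral_def sw[symmetric] by blast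
  have Y: "sq_int M Y" using wi by (simp add: wiener_integral_def sq_int_def)
  have "\<exists>k. strict_mono k \<and> (AE w in M. (\<lambda>n. (Y w - rsum (k n + q) (C (k n)) w)\<^sup>2) \<longlonglongrightarrow> 0)"
  proof (rule tendsto_L1_AE_subseq)
    show "integrable M (\<lambda>w. (Y w - rsum (n + q) (C n) w)\<^sup>2)" for n by (intro sq_int_sq sq_int_diff Y rsum_sq_int)
  qed (use l2 in simp)
  then obtain k where k: "strict_mono k" "AE w in M. (\<lambda>n. (Y w - rsum (k n + q) (C (k n)) w)\<^sup>2) \<longlonglongrightarrow> 0" by blast
  define R where "R = (\<lambda>n. k n + q)"
  have R: "filterlim R sequentially sequentially"
  proof -
    have "strict_mono R" using k(1) by (simp add: R_def strict_mono_def)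
    then show ?thesis by (rule filterlim_subseq)
  qed
  let ?f = "trigsum m u"
  define D where "D = (\<lambda>n w. rsum (R n) (ck \<alpha> t (R n)) w - rsum (R n) (samp ?f (R n)) w)"
  show ?thesis
  proof (rule fatou_square[where D = D])
    show "D n \<in> borel_measurable M" for n unfolding D_def by measurable
    show "AE w in M. (\<lambda>n. D n w) \<longlonglongrightarrow> Y w - (\<Sum>j<m. u j * zt j w)"
      using k(2) zt_sum_AE[of m u]
    proof eventually_elim
      case (elim w)
      have "(\<lambda>n. Y w - rsum (R n) (ck \<alpha> t (R n)) w) \<longlonglongrightarrow> 0"
        using tendsto_real_sqrt[OF elim(1)] unfolding R_def C_def by (simp add: tendsto_rabs_zero_iff)
      from tendsto_diff[OF tendsto_const[of "Y w"] this]
      have "(\<lambda>n. rsum (R n) (ck \<alpha> t (R n)) w) \<longlonglongrightarrow> Y w" by simp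
      moreover have "(\<lambda>n. rsum (R n) (samp ?f (R n)) w) \<longlonglongrightarrow> (\<Sum>j<m. u j * zt j w)"
        using filterlim_compose[OF elim(2) R] .
      ultimately show ?case unfolding D_def by (rule tendsto_diff)
    qed
    define b where "b = (\<lambda>r. \<integral>s. (dstep r (ck \<alpha> t r) s - dstep r (samp ?f r) s)\<^sup>2 \<partial>U01)"
    show "(\<integral>\<^sup>+w. ennreal ((D n w)\<^sup>2) \<partial>M) \<le> ennreal (b (R n))" for n
    proof -
      have "(\<integral>\<^sup>+w. ennreal ((D n w)\<^sup>2) \<partial>M) = ennreal (expectation (\<lambda>w. (D n w)\<^sup>2))"
        unfolding D_def by (intro nn_integral_eq_integral sq_int_sq sq_int_diff rsum_sq_int) simp
      also have "expectation (\<lambda>w. (D n w)\<^sup>2) = b (R n)"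
        unfolding D_def rsum_diff rsum_square b_def by (simp add: dstep_def left_diff_distrib sum_subtractf)
      finally show ?thesis by simp
    qed
    have "b \<longlonglongrightarrow> (\<integral>s. (kap \<alpha> t s - ?f s)\<^sup>2 \<partial>U01)"
      unfolding b_def
    proof (rule dstep_ck_L2[OF \<alpha> t01 trigsum_sq_int])
      show "dstep r (samp ?f r) \<in> borel_measurable borel" for r by simp
      show "(\<lambda>r. dstep r (samp ?f r) s) \<longlonglongrightarrow> ?f s" if "s \<in> {0..<1}" for s
        by (rule dstep_samp_L2(1)[OF trigsum_continuous trigsum_bounded that])
      show "\<bar>dstep r (samp ?f r) s\<bar> \<le> (\<Sum>j<m. \<bar>u j\<bar> * 2)" for r s
        by (rule dstep_samp_L2(2)[OF trigsum_continuous trigsum_bounded])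
    qed
    then show "(\<lambda>n. b (R n)) \<longlonglongrightarrow> (\<integral>s. (kap \<alpha> t s - ?f s)\<^sup>2 \<partial>U01)" by (rule filterlim_compose[OF _ R])
  qed
qed

end

definition kcoef :: "real \<Rightarrow> nat \<Rightarrow> real \<Rightarrow> real" where
  "kcoef \<alpha> j t = (\<integral>x. kap \<alpha> t x * trig j x \<partial>U01)"

lemma kcoef_measurable[measurable]: "kcoef \<alpha> j \<in> borel_measurable borel"
proof -
  interpret U: prob_space U01 by (rule prob_space_U01)
  have [measurable]: "(\<lambda>x. x) \<in> measurable U01 borel" by (rule measurable_restrict_space1) simp
  have s[measurable]: "snd \<in> measurable (borel \<Otimes>\<^sub>M U01) (borel :: real measure)"
    using measurable_compose[OF measurable_snd[of "borel :: real measure" U01] \<open>(\<lambda>x. x) \<in> measurable U01 borel\<close>] by simp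
  have k: "(\<lambda>p. kap \<alpha> (fst p) (snd p)) \<in> borel_measurable (borel \<Otimes>\<^sub>M U01)"
    using measurable_compose[OF measurable_Pair[OF measurable_fst s] kap_measurable[of \<alpha>]] by simp
  have tm: "(\<lambda>p. trig j (snd p)) \<in> borel_measurable ((borel :: real measure) \<Otimes>\<^sub>M U01)"
    by (rule measurable_compose[OF s trigp_measurable])
  show ?thesis
    unfolding kcoef_def[abs_def]
    by (rule U.borel_measurable_lebesgue_integral) (use borel_measurable_times[OF k tm] in \<open>simp add: case_prod_unfold\<close>)
qed

lemma kcoef_bessel:
  assumes "\<alpha> > 1/2" "t \<in> {0..1}"
  shows "(\<Sum>j<N. (kcoef \<alpha> j t)\<^sup>2) \<le> t powr (2 * \<alpha> - 1) / (2 * \<alpha> - 1)"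
  using bessel_inequality[OF trigp_orthonormal[of "\<lambda>_. 0" "{..<N}"] _ kap_sq_int(1)[OF assms]]
  by (simp add: kcoef_def kap_sq_int(2)[OF assms])

lemma kap_energy_le: "(\<alpha>::real) > 1/2 \<Longrightarrow> t \<in> {0..1} \<Longrightarrow> t powr (2 * \<alpha> - 1) / (2 * \<alpha> - 1) \<le> 1 / (2 * \<alpha> - 1)"
  by (intro divide_right_mono powr_le1) auto

lemma kcoef_sq_int:
  assumes \<alpha>: "\<alpha> > 1/2" shows "sq_int U01 (kcoef \<alpha> j)"
proof -
  interpret U: prob_space U01 by (rule prob_space_U01)
  show ?thesis
  proof (rule U.sq_int_bounded[where B = "sqrt (1 / (2 * \<alpha> - 1))"])
    show "kcoef \<alpha> j \<in> borel_measurable U01" by (rule measurable_restrict_space1) simp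
    fix t assume "t \<in> space U01"
    then have t: "t \<in> {0..1}" by simp
    have "(kcoef \<alpha> j t)\<^sup>2 \<le> (\<Sum>i<Suc j. (kcoef \<alpha> i t)\<^sup>2)" by (simp add: sum_nonneg)
    also have "\<dots> \<le> 1 / (2 * \<alpha> - 1)" using kcoef_bessel[OF \<alpha> t, of "Suc j"] kap_energy_le[OF \<alpha> t] by linarith
    finally show "\<bar>kcoef \<alpha> j t\<bar> \<le> sqrt (1 / (2 * \<alpha> - 1))" by (intro real_le_rsqrt) simp
  qed
qed

lemma sq_int_continuous:
  fixes x :: "real \<Rightarrow> real"
  assumes "continuous_on {0..1} x" shows "sq_int U01 x"
proof -
  interpret U: prob_space U01 by (rule prob_space_U01)
  have "bounded (x ` {0..1})" using compact_continuous_image[OF assms] by (simp add: compact_imp_bounded)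
  then obtain B where B: "\<And>t. t \<in> {0..1} \<Longrightarrow> \<bar>x t\<bar> \<le> B" unfolding bounded_iff ball_simps real_norm_def by blast
  have "x \<in> borel_measurable (restrict_space borel {0..1})"
    using assms by (rule borel_measurable_continuous_on_restrict)
  then have "x \<in> borel_measurable U01" by (simp add: measurable_def sets_restrict_space space_restrict_space)
  then show ?thesis by (rule U.sq_int_bounded) (use B in simp)
qed

text \<open>The setting of the theorem in terms of \<alpha> = \<rho> + 1/2, the order of the
  fractional integral.\<close>

locale rl_process = brownian M W for M :: "'a measure" and W +
  fixes X :: "real \<Rightarrow> 'a \<Rightarrow> real" and \<alpha> :: real
  assumes \<alpha>: "\<alpha> > 1/2"
    and cont: "\<And>w. w \<in> space M \<Longrightarrow> continuous_on {0..1} (\<lambda>t. X t w)"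
    and wi: "\<And>t. t \<in> {0..1} \<Longrightarrow> wiener_integral M W (\<lambda>s. (t - s) powr (\<alpha> - 1)) 0 t (X t)"
begin

lemma X_measurable: "t \<in> {0..1} \<Longrightarrow> X t \<in> borel_measurable M"
  using wi by (simp add: wiener_integral_def)

text \<open>By path continuity the process is the pointwise limit of its values at left dyadic
  points, each of which is a countable selection among measurable functions.\<close>

lemma X_L2_process: "L2_process M (\<lambda>z t. X t z)"
  unfolding L2_process_def
proof (intro conjI ballI)
  show "sq_int U01 (\<lambda>t. X t z)" if "z \<in> space M" for z by (rule sq_int_continuous[OF cont[OF that]])
  have "(\<lambda>p. X (snd p) (fst p)) \<in> borel_measurable (M \<Otimes>\<^sub>M U01)"
  proof (rule borel_measurable_LIMSEQ_real)
    fix p assume p: "p \<in> space (M \<Otimes>\<^sub>M U01)"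
    then have t: "snd p \<in> {0..1}" and w: "fst p \<in> space M" by (auto simp: space_pair_measure)
    have "(\<lambda>q. min 1 (real (left_index q (snd p)) / 2 ^ q)) \<longlonglongrightarrow> min 1 (snd p)"
      using t by (intro tendsto_min tendsto_const left_endpoint_tendsto) auto
    then have "(\<lambda>q. min 1 (real (left_index q (snd p)) / 2 ^ q)) \<longlonglongrightarrow> snd p" using t by simp
    then show "(\<lambda>q. X (min 1 (real (left_index q (snd p)) / 2 ^ q)) (fst p)) \<longlonglongrightarrow> X (snd p) (fst p)"
      by (rule continuous_on_tendsto_compose[OF cont[OF w]]) (use t in auto)
  next
    fix q
    show "(\<lambda>p. X (min 1 (real (left_index q (snd p)) / 2 ^ q)) (fst p)) \<in> borel_measurable (M \<Otimes>\<^sub>M U01)"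
    \<comment> \<open>The minimum with 1 keeps every index i of the countable family in the range of
      times where \<open>X\<close> is known to be measurable.\<close>
    proof (rule measurable_compose_countable[where f = "\<lambda>i p. X (min 1 (real i / 2 ^ q)) (fst p)" and g = "\<lambda>p. left_index q (snd p)"])
      have X1: "X (min 1 (real i / 2 ^ q)) \<in> borel_measurable M" for i :: nat by (rule X_measurable) simp
      show "(\<lambda>p. X (min 1 (real i / 2 ^ q)) (fst p)) \<in> borel_measurable (M \<Otimes>\<^sub>M U01)" for i :: nat
        by (rule measurable_compose[OF measurable_fst X1])
      have l: "left_index q \<in> measurable U01 (count_space UNIV)"
        unfolding left_index_def by (rule measurable_restrict_space1) measurable
      show "(\<lambda>p. left_index q (snd p)) \<in> measurable (M \<Otimes>\<^sub>M U01) (count_space UNIV)"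
        by (rule measurable_compose[OF measurable_snd l])
    qed
  qed
  then show "(\<lambda>(z, t). X t z) \<in> borel_measurable (M \<Otimes>\<^sub>M U01)" by (simp add: case_prod_unfold)
qed

lemma kap_dist_eq:
  assumes t: "t \<in> {0..1}"
  shows "(\<integral>s. (kap \<alpha> t s - trigsum m u s)\<^sup>2 \<partial>U01) =
    t powr (2 * \<alpha> - 1) / (2 * \<alpha> - 1) - 2 * (\<integral>s. kap \<alpha> t s * trigsum m u s \<partial>U01) + (\<integral>s. (trigsum m u s)\<^sup>2 \<partial>U01)"
proof -
  note k = kap_sq_int[OF \<alpha> t] and T = trigsum_sq_int[of m u]
  have "(\<integral>s. (kap \<alpha> t s - trigsum m u s)\<^sup>2 \<partial>U01) = (\<integral>s. ((kap \<alpha> t s)\<^sup>2 - 2 * (kap \<alpha> t s * trigsum m u s)) + (trigsum m u s)\<^sup>2 \<partial>U01)"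
    by (simp add: power2_diff mult.assoc algebra_simps)
  also have "\<dots> = (\<integral>s. (kap \<alpha> t s)\<^sup>2 - 2 * (kap \<alpha> t s * trigsum m u s) \<partial>U01) + (\<integral>s. (trigsum m u s)\<^sup>2 \<partial>U01)"
    by (intro Bochner_Integration.integral_add Bochner_Integration.integrable_diff integrable_mult_right sq_int_sq sq_int_mult k T)
  also have "(\<integral>s. (kap \<alpha> t s)\<^sup>2 - 2 * (kap \<alpha> t s * trigsum m u s) \<partial>U01) = (\<integral>s. (kap \<alpha> t s)\<^sup>2 \<partial>U01) - (\<integral>s. 2 * (kap \<alpha> t s * trigsum m u s) \<partial>U01)"
    by (intro Bochner_Integration.integral_diff integrable_mult_right sq_int_sq sq_int_mult k T)
  finally show ?thesis unfolding k(2) by simp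
qed

text \<open>t is approached from the right by dyadic points, which are positive as
  \<open>dyadic_bound\<close> requires and stay in [0, 1] because t < 1. Path continuity, Fatou and
  the continuity of the L2 distance in t carry the bound over.\<close>

lemma point_bound:
  assumes t: "t \<in> {0..<1}"
  shows "(\<integral>\<^sup>+w. ennreal ((X t w - (\<Sum>j<m. u j * zt j w))\<^sup>2) \<partial>M) \<le> ennreal (\<integral>s. (kap \<alpha> t s - trigsum m u s)\<^sup>2 \<partial>U01)"
proof -
  define p where "p = (\<lambda>q. Suc (left_index q t))"
  define tq where "tq = (\<lambda>q. real (p q) / 2 ^ q)"
  have p: "p q \<le> 2 ^ q" for q
  proof -
    have "real (left_index q t) / 2 ^ q < 1" using left_index_bounds(1)[of t q] t
      by (auto simp del: divide_less_eq_1 of_nat_less_numeral_power_cancel_iff divide_less_eq_1_pos)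
    then have "real (left_index q t) < real (2 ^ q)" by (simp add: divide_less_eq)
    then show ?thesis unfolding of_nat_less_iff p_def by simp
  qed
  have tq01: "tq q \<in> {0..1}" for q unfolding tq_def by (rule grid_01[OF p])
  have tq: "tq \<longlonglongrightarrow> t"
  proof -
    have "(\<lambda>q. real (left_index q t) / 2 ^ q + (1/2) ^ q) \<longlonglongrightarrow> t + 0"
      using t by (intro tendsto_add left_endpoint_tendsto LIMSEQ_realpow_zero) auto
    moreover have "tq = (\<lambda>q. real (left_index q t) / 2 ^ q + (1/2) ^ q)"
      by (auto simp add: tq_def p_def power_divide add_divide_distrib)
    ultimately show ?thesis by simp
  qed
  have t1: "t \<in> {0..1}" using t by simp
  show ?thesis
  proof (rule fatou_square[where D = "\<lambda>q w. X (tq q) w - (\<Sum>j<m. u j * zt j w)"])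
    show "(\<lambda>w. X (tq q) w - (\<Sum>j<m. u j * zt j w)) \<in> borel_measurable M" for q
      using X_measurable[OF tq01] by measurable
    show "AE w in M. (\<lambda>q. X (tq q) w - (\<Sum>j<m. u j * zt j w)) \<longlonglongrightarrow> X t w - (\<Sum>j<m. u j * zt j w)"
    proof (rule AE_I2)
      fix w assume "w \<in> space M"
      from continuous_on_tendsto_compose[OF cont[OF this] tq t1] tq01
      have "(\<lambda>q. X (tq q) w) \<longlonglongrightarrow> X t w" by simp
      then show "(\<lambda>q. X (tq q) w - (\<Sum>j<m. u j * zt j w)) \<longlonglongrightarrow> X t w - (\<Sum>j<m. u j * zt j w)" by (intro tendsto_intros)
    qed
    show "(\<integral>\<^sup>+w. ennreal ((X (tq q) w - (\<Sum>j<m. u j * zt j w))\<^sup>2) \<partial>M) \<le> ennreal (\<integral>s. (kap \<alpha> (tq q) s - trigsum m u s)\<^sup>2 \<partial>U01)" for q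
      by (rule dyadic_bound[OF \<alpha> _ p _ wi[OF tq01]]) (auto simp: p_def tq_def)
    show "(\<lambda>q. \<integral>s. (kap \<alpha> (tq q) s - trigsum m u s)\<^sup>2 \<partial>U01) \<longlonglongrightarrow> (\<integral>s. (kap \<alpha> t s - trigsum m u s)\<^sup>2 \<partial>U01)"
      unfolding kap_dist_eq[OF tq01] kap_dist_eq[OF t1]
    proof (intro tendsto_add tendsto_diff tendsto_mult tendsto_const tendsto_divide)
      show "(\<lambda>q. tq q powr (2 * \<alpha> - 1)) \<longlonglongrightarrow> t powr (2 * \<alpha> - 1)"
        using \<alpha> tq01 by (intro tendsto_powr2 tq tendsto_const) auto
      show "(\<lambda>q. \<integral>s. kap \<alpha> (tq q) s * trigsum m u s \<partial>U01) \<longlonglongrightarrow> (\<integral>s. kap \<alpha> t s * trigsum m u s \<partial>U01)"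
        using \<alpha> by (intro kap_inner_tendsto[OF _ trigsum_continuous trigsum_bounded tq01 t1 tq]) simp
    qed (use \<alpha> in simp)
  qed
qed

definition rl_trunc :: "nat \<Rightarrow> 'a \<Rightarrow> real \<Rightarrow> real" where
  "rl_trunc N w t = (\<Sum>j<N. kcoef \<alpha> j t * zt j w)"

lemma rl_trunc_L2_process: "L2_process M (rl_trunc N)"
  unfolding rl_trunc_def by (intro L2_process_linear kcoef_sq_int \<alpha>) simp

text \<open>The coefficients in \<open>point_bound\<close> may depend on t; taking those of
  \<open>kap \<alpha> t\<close> makes the squared distance the Bessel defect at t, which is then
  integrated.\<close>

lemma rl_trunc_error:
  "(\<integral>\<^sup>+w. ennreal (\<integral>t. (X t w - rl_trunc N w t)\<^sup>2 \<partial>U01) \<partial>M) \<le>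
    ennreal (\<integral>t. (t powr (2 * \<alpha> - 1) / (2 * \<alpha> - 1) - (\<Sum>j<N. (kcoef \<alpha> j t)\<^sup>2)) \<partial>U01)"
proof -
  interpret U: prob_space U01 by (rule prob_space_U01)
  interpret P: pair_sigma_finite M U01 ..
  let ?g = "\<lambda>t. t powr (2 * \<alpha> - 1) / (2 * \<alpha> - 1) - (\<Sum>j<N. (kcoef \<alpha> j t)\<^sup>2)"
  have D: "L2_process M (\<lambda>w t. X t w - rl_trunc N w t)" by (intro L2_process_diff X_L2_process rl_trunc_L2_process)
  then have Dm: "(\<lambda>(w, t). X t w - rl_trunc N w t) \<in> borel_measurable (M \<Otimes>\<^sub>M U01)"
    and Ds: "\<And>w. w \<in> space M \<Longrightarrow> sq_int U01 (\<lambda>t. X t w - rl_trunc N w t)" by (auto simp: L2_process_def)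
  have "(\<integral>\<^sup>+w. ennreal (\<integral>t. (X t w - rl_trunc N w t)\<^sup>2 \<partial>U01) \<partial>M) = (\<integral>\<^sup>+w. (\<integral>\<^sup>+t. ennreal ((X t w - rl_trunc N w t)\<^sup>2) \<partial>U01) \<partial>M)"
    by (intro nn_integral_cong nn_integral_eq_integral[symmetric] sq_int_sq Ds) auto
  also have "\<dots> = (\<integral>\<^sup>+t. (\<integral>\<^sup>+w. ennreal ((X t w - rl_trunc N w t)\<^sup>2) \<partial>M) \<partial>U01)"
  proof (rule P.Fubini'[symmetric])
    have "(\<lambda>p. X (snd p) (fst p) - rl_trunc N (fst p) (snd p)) \<in> borel_measurable (M \<Otimes>\<^sub>M U01)" using Dm by (simp add: case_prod_unfold)
    then have "(\<lambda>p. ennreal ((X (snd p) (fst p) - rl_trunc N (fst p) (snd p))\<^sup>2)) \<in> borel_measurable (M \<Otimes>\<^sub>M U01)" by measurable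
    then show "(\<lambda>(x, y). ennreal ((X y x - rl_trunc N x y)\<^sup>2)) \<in> borel_measurable (M \<Otimes>\<^sub>M U01)"
      by (simp add: case_prod_unfold)
  qed
  also have "\<dots> \<le> (\<integral>\<^sup>+t. ennreal (?g t) \<partial>U01)"
  proof (rule nn_integral_mono_AE)
    show "AE t in U01. (\<integral>\<^sup>+w. ennreal ((X t w - rl_trunc N w t)\<^sup>2) \<partial>M) \<le> ennreal (?g t)"
      using AE_U01_interior
    proof eventually_elim
      case (elim t)
      then have t: "t \<in> {0..1}" by simp
      have "(\<integral>s. (kap \<alpha> t s - trigsum N (\<lambda>j. kcoef \<alpha> j t) s)\<^sup>2 \<partial>U01) = ?g t"
        unfolding trigsum_def
        by (subst orthonormal_expand[OF trigp_orthonormal _ kap_sq_int(1)[OF \<alpha> t]])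
           (simp_all add: kap_sq_int(2)[OF \<alpha> t] kcoef_def)
      then show ?case using point_bound[OF elim, where m = N and u = "\<lambda>j. kcoef \<alpha> j t"] unfolding rl_trunc_def by simp
    qed
  qed
  also have "\<dots> = ennreal (\<integral>t. ?g t \<partial>U01)"
  proof (rule nn_integral_eq_integral)
    have "integrable U01 (\<lambda>t. t powr (2 * \<alpha> - 1))" using U01_powr(1)[of "2 * \<alpha> - 1"] \<alpha> by simp
    then show "integrable U01 ?g" by (intro Bochner_Integration.integrable_diff Bochner_Integration.integrable_sum integrable_divide sq_int_sq kcoef_sq_int \<alpha>)
    show "AE t in U01. 0 \<le> ?g t" using kcoef_bessel[OF \<alpha>] by (intro AE_I2) simp
  qed
  finally show ?thesis .
qed

text \<open>The Bessel defect tends to 0 at every t by Parseval and is dominated by 1 / (2 \<alpha>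
  - 1).\<close>

lemma rl_trunc_error_small:
  assumes "\<epsilon> > 0"
  shows "\<exists>N0. \<forall>N\<ge>N0. (\<integral>\<^sup>+z. ennreal (\<integral>t. (X t z - rl_trunc N z t)\<^sup>2 \<partial>U01) \<partial>M) \<le> ennreal \<epsilon>"
proof -
  interpret U: prob_space U01 by (rule prob_space_U01)
  let ?g = "\<lambda>N t. t powr (2 * \<alpha> - 1) / (2 * \<alpha> - 1) - (\<Sum>j<N. (kcoef \<alpha> j t)\<^sup>2)"
  have "(\<lambda>N. \<integral>t. ?g N t \<partial>U01) \<longlonglongrightarrow> (\<integral>t. 0 \<partial>U01)"
  proof (rule integral_dominated_convergence[where w = "\<lambda>_. 1 / (2 * \<alpha> - 1)"])
    show "?g N \<in> borel_measurable U01" for N by (rule measurable_restrict_space1) measurable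
    show "AE t in U01. (\<lambda>N. ?g N t) \<longlonglongrightarrow> 0"
    proof (rule AE_I2)
      fix t assume "t \<in> space U01"
      then have t: "t \<in> {0..1}" by simp
      have "(\<lambda>N. \<Sum>j<N. (kcoef \<alpha> j t)\<^sup>2) \<longlonglongrightarrow> t powr (2 * \<alpha> - 1) / (2 * \<alpha> - 1)"
        using parseval[OF trig_dense_kap[OF \<alpha> t]] unfolding kap_sq_int(2)[OF \<alpha> t] kcoef_def .
      from tendsto_diff[OF tendsto_const this]
      show "(\<lambda>N. ?g N t) \<longlonglongrightarrow> 0" by (metis diff_self)
    qed
    show "AE t in U01. norm (?g N t) \<le> 1 / (2 * \<alpha> - 1)" for N
    proof (rule AE_I2)
      fix t assume "t \<in> space U01"
      then have t: "t \<in> {0..1}" by simp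
      have "0 \<le> (\<Sum>j<N. (kcoef \<alpha> j t)\<^sup>2)" by (simp add: sum_nonneg)
      then show "norm (?g N t) \<le> 1 / (2 * \<alpha> - 1)"
        using kcoef_bessel[OF \<alpha> t, of N] kap_energy_le[OF \<alpha> t] unfolding real_norm_def by linarith
    qed
  qed auto
  then have "(\<lambda>N. \<integral>t. ?g N t \<partial>U01) \<longlonglongrightarrow> 0" by simp
  then have "eventually (\<lambda>N. (\<integral>t. ?g N t \<partial>U01) < \<epsilon>) sequentially" using assms by (rule order_tendstoD(2))
  then obtain N0 where "\<And>N. N \<ge> N0 \<Longrightarrow> (\<integral>t. ?g N t \<partial>U01) < \<epsilon>" by (auto simp: eventually_sequentially)
  then show ?thesis using rl_trunc_error by (intro exI[of _ N0] allI impI order_trans[OF rl_trunc_error] ennreal_leI) (simp add: less_imp_le)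
qed

end

section \<open>Asymptotics\<close>

text \<open>The middle term is the integral of the power -b over [x, x + 1], reached through the
  mean value theorem. Telescoping it compares tails of the series with integrals.\<close>

lemma powr_telescope:
  fixes x b :: real
  assumes "x > 0" "b > 1"
  shows "(x + 1) powr (-b) \<le> (x powr (1 - b) - (x + 1) powr (1 - b)) / (b - 1)"
    and "(x powr (1 - b) - (x + 1) powr (1 - b)) / (b - 1) \<le> x powr (-b)"
proof -
  have "\<exists>z. x < z \<and> z < x + 1 \<and> (x + 1) powr (1 - b) - x powr (1 - b) = (x + 1 - x) * ((1 - b) * z powr (-b))"
  proof (rule MVT2)
    fix z assume "x \<le> z"
    then have "z > 0" using assms by simp
    then show "((\<lambda>x. x powr (1 - b)) has_field_derivative (1 - b) * z powr (-b)) (at z)"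
      by (auto intro!: derivative_eq_intros)
  qed simp
  then obtain z where z: "x < z" "z < x + 1" and e: "(x + 1) powr (1 - b) - x powr (1 - b) = (1 - b) * z powr (-b)" by auto
  have "x powr (1 - b) - (x + 1) powr (1 - b) = (b - 1) * z powr (-b)" using e by (simp add: algebra_simps)
  then have eq: "(x powr (1 - b) - (x + 1) powr (1 - b)) / (b - 1) = z powr (-b)" using assms by simp
  show "(x + 1) powr (-b) \<le> (x powr (1 - b) - (x + 1) powr (1 - b)) / (b - 1)"
    and "(x powr (1 - b) - (x + 1) powr (1 - b)) / (b - 1) \<le> x powr (-b)"
    unfolding eq using assms z by (intro powr_mono2'; simp)+
qed

lemma powr_tail_upper:
  fixes b :: real and m N :: nat
  assumes b: "b > 1" and m: "m \<ge> 1"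
  shows "(\<Sum>j = m..<N. real j powr (-b)) \<le> real m powr (-b) + real m powr (1 - b) / (b - 1)"
proof -
  have *: "(\<Sum>j = m..<m + Suc k. real j powr (-b)) \<le> real m powr (-b) + (real m powr (1 - b) - real (m + k) powr (1 - b)) / (b - 1)" for k
  proof (induction k)
    case (Suc k)
    have "real (m + Suc k) powr (-b) \<le> (real (m + k) powr (1 - b) - real (m + Suc k) powr (1 - b)) / (b - 1)"
      using powr_telescope(1)[of "real (m + k)" b] m b by (simp add: add.assoc add.commute)
    then show ?case using Suc by (simp add: diff_divide_distrib)
  qed simp
  show ?thesis
  proof (cases "N \<le> m")
    case True then show ?thesis using b by simp
  next
    case False
    then obtain k where k: "N = m + Suc k" by (metis less_iff_Suc_add not_le add_Suc_right)
    have "(real m powr (1 - b) - real (m + k) powr (1 - b)) / (b - 1) \<le> real m powr (1 - b) / (b - 1)"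
      using b by (intro divide_right_mono) auto
    then show ?thesis using *[of k] unfolding k by linarith
  qed
qed

lemma powr_tail_lower:
  fixes b :: real and d N :: nat
  assumes b: "b > 1" and N: "d \<le> N"
  shows "((real d + 2) powr (1 - b) - (real N + 2) powr (1 - b)) / (b - 1) \<le> (\<Sum>j = d..<N. (real j + 2) powr (-b))"
  using N
proof (induction N rule: dec_induct)
  case (step n)
  have "((real n + 2) powr (1 - b) - (real (Suc n) + 2) powr (1 - b)) / (b - 1) \<le> (real n + 2) powr (-b)"
    using powr_telescope(2)[of "real n + 2" b] b by (simp add: add.assoc add.commute)
  then show ?case using step by (simp add: diff_divide_distrib)
qed simp

lemma ln_fact_lower:
  assumes "m \<ge> 1" shows "real m * ln (real m) - real m \<le> ln (fact m)"
proof -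
  have "real m ^ m / fact m \<le> exp (real m)" by (rule power_div_fact_le_exp) simp
  then have "ln (real m ^ m / fact m) \<le> ln (exp (real m))" using assms by (subst ln_le_cancel_iff) auto
  then show ?thesis using assms by (simp add: ln_div ln_realpow)
qed

lemma ln_fact_upper:
  assumes "m \<ge> 1" shows "ln (fact m) \<le> (real m + 1) * ln (real m) - real m + 1"
  using assms
proof (induction m rule: dec_induct)
  case (step m)
  have m: "real m > 0" using step by simp
  have "ln (real m / (real m + 1)) \<le> real m / (real m + 1) - 1" using m by (intro ln_le_minus_one) simp
  then have "ln (real m) - ln (real m + 1) \<le> - 1 / (real m + 1)" using m by (simp add: ln_div field_simps)
  then have "(real m + 1) * (ln (real m) - ln (real m + 1)) \<le> (real m + 1) * (- 1 / (real m + 1))" using m by (intro mult_left_mono) auto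
  then have *: "(real m + 1) * (ln (real m) - ln (real m + 1)) \<le> - 1" using m by simp
  have "ln (fact (Suc m)) = ln (real m + 1) + ln (fact m)" using m by (simp add: ln_mult add.commute)
  then show ?case using step * by (simp add: algebra_simps)
qed simp

lemma fact_ln_sum: "(\<Sum>j<m. ln (real j + 1)) = ln (fact m)"
  by (induction m) (auto simp: ln_mult add.commute)

lemma eventually_ln_le_linear:
  fixes C p \<delta> :: real
  assumes "\<delta> > 0" shows "eventually (\<lambda>m::nat. C + p * ln (real m) \<le> \<delta> * real m) sequentially"
proof -
  have "(\<lambda>m. C * (1 / real m) + p * (ln (real m) / real m)) \<longlonglongrightarrow> C * 0 + p * 0"
    by (intro tendsto_intros lim_1_over_n lim_ln_over_n)
  then have "eventually (\<lambda>m. C * (1 / real m) + p * (ln (real m) / real m) < \<delta>) sequentially"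
    using assms by (intro order_tendstoD(2)) auto
  with eventually_gt_at_top[of 0] show ?thesis
  proof eventually_elim
    case (elim m)
    then have "(C + p * ln (real m)) / real m < \<delta>" by (simp add: add_divide_distrib)
    then show ?case using elim by (simp add: divide_less_eq)
  qed
qed

lemma eventually_exp_le_powr:
  fixes C p \<delta> :: real
  assumes "\<delta> > 0" "C > 0" shows "eventually (\<lambda>m::nat. C * exp (- \<delta> * real m) \<le> real m powr (- p)) sequentially"
  using eventually_ln_le_linear[OF assms(1), of "ln C" p] eventually_gt_at_top[of 0]
proof eventually_elim
  case (elim m)
  have "C * exp (- \<delta> * real m) = exp (ln C - \<delta> * real m)" using assms by (simp add: exp_diff exp_minus divide_inverse)
  also have "\<dots> \<le> exp (- p * ln (real m))" using elim by simp
  also have "\<dots> = real m powr (-p)" using elim by (simp add: powr_def)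
  finally show ?case .
qed

lemma eventually_ln_powr_le_linear:
  fixes A B \<tau> \<delta> :: real
  assumes "\<delta> > 0" "\<tau> < 1"
  shows "eventually (\<lambda>m::nat. real m powr \<tau> * (A + B * ln (real m)) \<le> \<delta> * real m) sequentially"
proof -
  have "(\<lambda>m. A * (1 / real m powr (1 - \<tau>)) + B * (ln (real m) / real m powr (1 - \<tau>))) \<longlonglongrightarrow> A * 0 + B * 0"
    using assms by (intro tendsto_intros lim_1_over_real_power lim_ln_over_power) auto
  then have "eventually (\<lambda>m. A * (1 / real m powr (1 - \<tau>)) + B * (ln (real m) / real m powr (1 - \<tau>)) < \<delta>) sequentially"
    using assms by (intro order_tendstoD(2)) auto
  with eventually_gt_at_top[of 0] show ?thesis
  proof eventually_elim
    case (elim m)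
    have "(A + B * ln (real m)) / real m powr (1 - \<tau>) < \<delta>" using elim by (simp add: add_divide_distrib)
    then have "A + B * ln (real m) < \<delta> * real m powr (1 - \<tau>)" using elim by (simp add: divide_less_eq)
    then have "real m powr \<tau> * (A + B * ln (real m)) \<le> real m powr \<tau> * (\<delta> * real m powr (1 - \<tau>))" by (intro mult_left_mono) auto
    also have "\<dots> = \<delta> * real m" using elim powr_add[of "real m" \<tau> "1 - \<tau>"] by simp
    finally show ?case .
  qed
qed

section \<open>Asymptotics of the eigenvalues and of the rate\<close>

definition sigc :: "real \<Rightarrow> real" where "sigc \<alpha> = (Gamma \<alpha>)\<^sup>2 * pi powr (- 2 * \<alpha>)"

lemma sigc_pos: "\<alpha> > 0 \<Longrightarrow> sigc \<alpha> > 0"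
  unfolding sigc_def using Gamma_real_pos[of \<alpha>] by (intro mult_pos_pos zero_less_power) auto

lemma sig_sq: "(sig \<alpha> j)\<^sup>2 = (Gamma \<alpha>)\<^sup>2 * (1 + (2 * pi * freq j)\<^sup>2) powr (- \<alpha>)"
  by (simp add: sig_def power_mult_distrib power2_eq_square flip: powr_add)

lemma freq_bounds: "real j \<le> 2 * real (freq j)" "2 * real (freq j) \<le> real j + 1"
proof -
  have "j \<le> 2 * freq j" "2 * freq j \<le> j + 1" unfolding freq_def by auto
  then show "real j \<le> 2 * real (freq j)" "2 * real (freq j) \<le> real j + 1" by linarith+
qed

lemma sq_powr_half: "x \<ge> 0 \<Longrightarrow> (x\<^sup>2) powr (- \<alpha>) = x powr (- 2 * \<alpha>)" for x :: real
  by (simp add: powr_powr flip: powr_numeral)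

text \<open>Pairing the indices costs only a shift: 2 \<open>freq j\<close> lies between j and j +
  1. With the matching lower bound the eigenvalue sits between the power law at j + 2 and at j, and
  such a shift does not affect leading orders.\<close>

lemma sig_sq_upper:
  assumes \<alpha>: "\<alpha> > 0" and j: "j \<ge> 1"
  shows "(sig \<alpha> j)\<^sup>2 \<le> sigc \<alpha> * real j powr (- 2 * \<alpha>)"
proof -
  have "(pi * real j)\<^sup>2 \<le> (2 * pi * freq j)\<^sup>2"
    using freq_bounds(1)[of j] mult_left_mono[of "real j" "2 * real (freq j)" pi] by (intro power_mono) (auto simp: mult_ac)
  then have "(pi * real j)\<^sup>2 \<le> 1 + (2 * pi * freq j)\<^sup>2" by linarith
  then have "(1 + (2 * pi * freq j)\<^sup>2) powr (- \<alpha>) \<le> ((pi * real j)\<^sup>2) powr (- \<alpha>)"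
    using \<alpha> j by (intro powr_mono2') auto
  also have "\<dots> = pi powr (- 2 * \<alpha>) * real j powr (- 2 * \<alpha>)" by (subst sq_powr_half) (auto simp: powr_mult)
  finally show ?thesis unfolding sig_sq sigc_def by (simp add: mult_left_mono mult.assoc)
qed

lemma sig_sq_lower:
  assumes \<alpha>: "\<alpha> > 0"
  shows "sigc \<alpha> * (real j + 2) powr (- 2 * \<alpha>) < (sig \<alpha> j)\<^sup>2"
proof -
  have "(2 * pi * freq j)\<^sup>2 \<le> (pi * (real j + 1))\<^sup>2"
    using freq_bounds(2)[of j] mult_left_mono[of "2 * real (freq j)" "real j + 1" pi] by (intro power_mono) (auto simp: mult_ac)
  moreover have "1 + (pi * (real j + 1))\<^sup>2 < (pi * (real j + 2))\<^sup>2"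
  proof -
    have "pi\<^sup>2 > 1" using pi_gt3 by (simp add: power2_eq_square less_1_mult)
    then have "1 < pi\<^sup>2 * (2 * real j + 3)" by (intro less_1_mult) auto
    then show ?thesis by (simp add: power2_eq_square algebra_simps)
  qed
  ultimately have lt: "1 + (2 * pi * freq j)\<^sup>2 < (pi * (real j + 2))\<^sup>2" by linarith
  have "0 < 1 + (2 * pi * freq j)\<^sup>2" by (simp add: add_pos_nonneg)
  then have "((pi * (real j + 2))\<^sup>2) powr (- \<alpha>) < (1 + (2 * pi * freq j)\<^sup>2) powr (- \<alpha>)"
    using \<alpha> lt by (intro powr_less_mono2_neg) auto
  moreover have "((pi * (real j + 2))\<^sup>2) powr (- \<alpha>) = pi powr (- 2 * \<alpha>) * (real j + 2) powr (- 2 * \<alpha>)"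
    by (subst sq_powr_half) (auto simp: powr_mult)
  ultimately show ?thesis using Gamma_real_pos[OF \<alpha>] unfolding sig_sq sigc_def by (simp add: mult.assoc)
qed

text \<open>The constant function is treated apart, since the power law says nothing at index
  0.\<close>

lemma sig_sq_zero: "(sig \<alpha> 0)\<^sup>2 = sigc \<alpha> * pi powr (2 * \<alpha>)"
proof -
  have "pi powr (- 2 * \<alpha>) * pi powr (2 * \<alpha>) = 1" by (simp flip: powr_add)
  then show ?thesis by (simp add: sig_sq freq_def sigc_def mult.assoc)
qed

lemma sig_sq_tail:
  assumes \<alpha>: "\<alpha> > 1/2" and m: "m \<ge> 1"
  shows "(\<Sum>j = m..<N. (sig \<alpha> j)\<^sup>2) \<le> sigc \<alpha> * (real m powr (- 2 * \<alpha>) + real m powr (1 - 2 * \<alpha>) / (2 * \<alpha> - 1))"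
proof -
  have "(\<Sum>j = m..<N. (sig \<alpha> j)\<^sup>2) \<le> (\<Sum>j = m..<N. sigc \<alpha> * real j powr (- 2 * \<alpha>))"
    using \<alpha> m by (intro sum_mono sig_sq_upper) auto
  also have "\<dots> = sigc \<alpha> * (\<Sum>j = m..<N. real j powr (- 2 * \<alpha>))" by (simp add: sum_distrib_left)
  also have "\<dots> \<le> sigc \<alpha> * (real m powr (- 2 * \<alpha>) + real m powr (1 - 2 * \<alpha>) / (2 * \<alpha> - 1))"
    using powr_tail_upper[of "2 * \<alpha>" m N] sigc_pos[of \<alpha>] \<alpha> m by (intro mult_left_mono) auto
  finally show ?thesis .
qed

lemma sig_sq_total:
  assumes \<alpha>: "\<alpha> > 1/2"
  shows "(\<Sum>j<m. (sig \<alpha> j)\<^sup>2) \<le> sigc \<alpha> * (pi powr (2 * \<alpha>) + (1 + 1 / (2 * \<alpha> - 1)))"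
proof -
  have "(\<Sum>j<m. (sig \<alpha> j)\<^sup>2) \<le> (\<Sum>j<Suc m. (sig \<alpha> j)\<^sup>2)" by simp
  also have "\<dots> = (sig \<alpha> 0)\<^sup>2 + (\<Sum>j = 1..<Suc m. (sig \<alpha> j)\<^sup>2)"
    by (subst sum.lessThan_Suc_shift) (simp only: One_nat_def sum.shift_bounds_Suc_ivl atLeast0LessThan)
  also have "\<dots> \<le> sigc \<alpha> * pi powr (2 * \<alpha>) + sigc \<alpha> * (1 + 1 / (2 * \<alpha> - 1))"
    using sig_sq_tail[OF \<alpha>, of 1 "Suc m"] by (intro add_mono) (auto simp: sig_sq_zero)
  finally show ?thesis by (simp add: distrib_left)
qed

text \<open>The sum is essentially half of 2 \<alpha> (m ln m - ln m!), so Stirling gives \<alpha>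
  nats per kept coordinate. This is the origin of the factor \<alpha> between the rate and the
  dimension.\<close>

lemma sig_rate_upper:
  assumes \<alpha>: "\<alpha> > 1/2" and m: "m \<ge> 1"
  shows "(\<Sum>j<m. ln ((sig \<alpha> j)\<^sup>2 / (sigc \<alpha> * (real m + 1) powr (- 2 * \<alpha>))) / 2) \<le> \<alpha> * (real m + 1 + ln (real m) + ln pi)"
proof -
  obtain k where k: "m = Suc k" using m by (cases m) auto
  let ?\<theta> = "sigc \<alpha> * (real m + 1) powr (- 2 * \<alpha>)"
  have c: "sigc \<alpha> > 0" using \<alpha> by (intro sigc_pos) simp
  then have \<theta>: "?\<theta> > 0" by simp
  have sp: "(sig \<alpha> j)\<^sup>2 > 0" for j using sig_pos[of \<alpha> j] \<alpha> by simp
  have z: "ln ((sig \<alpha> 0)\<^sup>2 / ?\<theta>) = 2 * \<alpha> * (ln pi + ln (real m + 1))"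
    unfolding sig_sq_zero using c by (simp add: ln_div ln_mult ln_powr algebra_simps)
  have s: "ln ((sig \<alpha> (Suc j))\<^sup>2 / ?\<theta>) \<le> 2 * \<alpha> * (ln (real m + 1) - ln (real j + 1))" for j
  proof -
    have "ln ((sig \<alpha> (Suc j))\<^sup>2 / ?\<theta>) \<le> ln (sigc \<alpha> * real (Suc j) powr (- 2 * \<alpha>) / ?\<theta>)"
      using sig_sq_upper[of \<alpha> "Suc j"] \<alpha> \<theta> c sp[of "Suc j"] by (intro ln_mono divide_right_mono) auto
    also have "\<dots> = 2 * \<alpha> * (ln (real m + 1) - ln (real j + 1))"
      using c by (simp add: ln_div ln_mult ln_powr algebra_simps)
    finally show ?thesis .
  qed
  have "(\<Sum>j<m. ln ((sig \<alpha> j)\<^sup>2 / ?\<theta>)) = ln ((sig \<alpha> 0)\<^sup>2 / ?\<theta>) + (\<Sum>j<k. ln ((sig \<alpha> (Suc j))\<^sup>2 / ?\<theta>))"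
    unfolding k by (rule sum.lessThan_Suc_shift)
  also have "\<dots> \<le> 2 * \<alpha> * (ln pi + ln (real m + 1)) + (\<Sum>j<k. 2 * \<alpha> * (ln (real m + 1) - ln (real j + 1)))"
    using s z by (intro add_mono sum_mono) auto
  also have "\<dots> = 2 * \<alpha> * (ln pi + real m * ln (real m + 1) - ln (fact k))"
    unfolding fact_ln_sum[symmetric] by (simp add: k sum_subtractf algebra_simps flip: sum_distrib_left)
  also have "\<dots> \<le> 2 * \<alpha> * (real m + 1 + ln (real m) + ln pi)"
  proof -
    have "ln (fact m) = ln (real m) + ln (fact k)" unfolding k by (simp add: ln_mult)
    moreover have "real m * ln (real m) - real m \<le> ln (fact m)" by (rule ln_fact_lower[OF m])
    moreover have "real m * ln (real m + 1) \<le> real m * ln (real m) + 1"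
    proof -
      have "ln (1 + 1 / real m) \<le> 1 / real m" using m by (intro ln_add_one_self_le_self) simp
      moreover have "ln (1 + 1 / real m) = ln (real m + 1) - ln (real m)"
      proof -
        have "1 + 1 / real m = (real m + 1) / real m" using m by (simp add: field_simps)
        then show ?thesis using m by (simp add: ln_div)
      qed
      ultimately have "real m * (ln (real m + 1) - ln (real m)) \<le> real m * (1 / real m)" by (intro mult_left_mono) auto
      then show ?thesis using m by (simp add: algebra_simps)
    qed
    ultimately show ?thesis using \<alpha> by (intro mult_left_mono) auto
  qed
  finally show ?thesis by (simp flip: sum_divide_distrib)
qed

lemma sig_rate_lower:
  assumes \<alpha>: "\<alpha> > 1/2" and d: "d \<ge> 1"
  shows "2 * \<alpha> * (real d - 1 - ln (real d) - ln (real d + 1)) \<le> (\<Sum>j<d. ln ((sig \<alpha> j)\<^sup>2 / (sigc \<alpha> * real d powr (- 2 * \<alpha>))))"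
proof -
  let ?\<theta> = "sigc \<alpha> * real d powr (- 2 * \<alpha>)"
  have c: "sigc \<alpha> > 0" using \<alpha> by (intro sigc_pos) simp
  then have \<theta>: "?\<theta> > 0" using d by simp
  have s: "2 * \<alpha> * (ln (real d) - ln (real j + 2)) \<le> ln ((sig \<alpha> j)\<^sup>2 / ?\<theta>)" for j
  proof -
    have "ln (sigc \<alpha> * (real j + 2) powr (- 2 * \<alpha>) / ?\<theta>) \<le> ln ((sig \<alpha> j)\<^sup>2 / ?\<theta>)"
      using sig_sq_lower[of \<alpha> j] \<alpha> \<theta> c d by (intro ln_mono divide_right_mono divide_pos_pos) auto
    moreover have "ln (sigc \<alpha> * (real j + 2) powr (- 2 * \<alpha>) / ?\<theta>) = 2 * \<alpha> * (ln (real d) - ln (real j + 2))"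
      using c d by (simp add: ln_div ln_mult ln_powr algebra_simps)
    ultimately show ?thesis by simp
  qed
  have f: "(\<Sum>j<d. ln (real j + 2)) = ln (real d + 1) + ln (fact d)"
  proof -
    have "(\<Sum>j<d. ln (real j + 2)) = (\<Sum>j<Suc d. ln (real j + 1))"
      by (subst sum.lessThan_Suc_shift) (simp add: add.commute)
    also have "\<dots> = (\<Sum>j<d. ln (real j + 1)) + ln (real d + 1)" by simp
    finally show ?thesis unfolding fact_ln_sum by simp
  qed
  have "2 * \<alpha> * (real d - 1 - ln (real d) - ln (real d + 1)) \<le> 2 * \<alpha> * (real d * ln (real d) - (ln (real d + 1) + ln (fact d)))"
  proof (rule mult_left_mono)
    have "ln (fact d) \<le> real d * ln (real d) + ln (real d) - real d + 1" using ln_fact_upper[OF d] by (simp add: distrib_right)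
    then show "real d - 1 - ln (real d) - ln (real d + 1) \<le> real d * ln (real d) - (ln (real d + 1) + ln (fact d))" by linarith
  qed (use \<alpha> in simp)
  also have "\<dots> = (\<Sum>j<d. 2 * \<alpha> * (ln (real d) - ln (real j + 2)))"
    unfolding f[symmetric] by (simp add: sum_subtractf flip: sum_distrib_left)
  also have "\<dots> \<le> (\<Sum>j<d. ln ((sig \<alpha> j)\<^sup>2 / ?\<theta>))" by (intro sum_mono s)
  finally show ?thesis .
qed

text \<open>The kept coordinates contribute d * \<theta> and the tail 1 / (2 \<alpha> - 1) times as
  much, to leading order; the two factors add up to 2 \<alpha> / (2 \<alpha> - 1).\<close>

definition rconst :: "real \<Rightarrow> real" where "rconst \<alpha> = sigc \<alpha> * (2 * \<alpha> / (2 * \<alpha> - 1))"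

lemma rconst_alt: "\<alpha> > 1/2 \<Longrightarrow> rconst \<alpha> = sigc \<alpha> * (1 + 1 / (2 * \<alpha> - 1))"
  by (simp add: rconst_def field_simps)

lemma rconst_pos: "\<alpha> > 1/2 \<Longrightarrow> rconst \<alpha> > 0"
  unfolding rconst_def using sigc_pos[of \<alpha>] by simp

section \<open>Coding the diagonal process\<close>

context rl_process
begin

definition ymain :: "nat \<Rightarrow> 'a \<Rightarrow> real \<Rightarrow> real" where
  "ymain N w t = (\<Sum>j<N. sig \<alpha> j * trigp (phi \<alpha>) j t * zt j w)"

text \<open>The bound is uniform in N \<ge> m because N will be chosen after m.\<close>

lemma ymain_codeable:
  assumes \<epsilon>: "0 < \<epsilon>" "\<epsilon> \<le> 1"
  shows "eventually (\<lambda>m. \<forall>N\<ge>m. codeable M (ymain N) (exp ((\<alpha> + 2 * \<epsilon>) * real m)) ((1 + 3 * \<epsilon>) * rconst \<alpha> * real m powr (1 - 2 * \<alpha>))) sequentially"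
proof -
  interpret I: iid_normal M zt by (rule zt_iid)
  define c where "c = sigc \<alpha>"
  have c: "c > 0" unfolding c_def using \<alpha> by (intro sigc_pos) simp
  define B where "B = c * (pi powr (2 * \<alpha>) + (1 + 1 / (2 * \<alpha> - 1)))"
  \<comment> \<open>Makes \<open>C * \<eta> \<le> m powr (1 - 2 * \<alpha>)\<close> the condition
    under which all exponentially small terms fit into \<epsilon> c m^(1 - 2 \<alpha>).\<close>
  define C where "C = (3 / 2 * B\<^sup>2 + 2) / (\<epsilon> * c)"
  have C: "C > 0" unfolding C_def using \<epsilon> c by (intro divide_pos_pos) (auto intro: add_nonneg_pos)
  have "\<epsilon>\<^sup>2 / 32 > 0" using \<epsilon> by simp
  note ev1 = eventually_exp_le_powr[OF this C, of "2 * \<alpha> - 1"]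
  note ev2 = eventually_ln_le_linear[OF \<epsilon>(1), of "ln 3 + \<alpha> * (1 + ln pi)" "1 + \<alpha>"]
  have ev3: "eventually (\<lambda>m::nat. 1 / \<epsilon> \<le> real m) sequentially"
    using filterlim_real_sequentially by (simp add: filterlim_at_top)
  show ?thesis using ev1 ev2 ev3 eventually_ge_at_top[of 1]
  proof eventually_elim
    case (elim m)
    have m: "m \<ge> 1" "real m \<ge> 1" using elim by auto
    \<comment> \<open>The shift to m + 1 puts the level strictly below the kept eigenvalues, as
      \<open>random_coding\<close> requires: j + 2 \<le> m + 1 for j < m.\<close>
    define \<theta> where "\<theta> = c * (real m + 1) powr (- 2 * \<alpha>)"
    \<comment> \<open>The square root of the Chernoff factor exp (- \<epsilon>^2 m / 16), so that
      \<eta> itself and that factor divided by \<eta> are both exponentially small.\<close>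
    define \<eta> where "\<eta> = exp (- (\<epsilon>\<^sup>2 / 32) * real m)"
    define R where "R = (\<Sum>j<m. ln ((sig \<alpha> j)\<^sup>2 / \<theta>) / 2) + \<epsilon> * real m"
    \<comment> \<open>The factor m above exp R brings the probability that all codewords fail down
      to exp (- m) and costs only ln m in rate.\<close>
    define n where "n = nat \<lceil>real m * exp R\<rceil>"
    have \<theta>: "\<theta> > 0" using c by (simp add: \<theta>_def)
    have \<theta>s: "\<theta> < (sig \<alpha> j)\<^sup>2" if "j < m" for j
    proof -
      have "(real m + 1) powr (- 2 * \<alpha>) \<le> (real j + 2) powr (- 2 * \<alpha>)" using that \<alpha> by (intro powr_mono2') auto
      then have "\<theta> \<le> sigc \<alpha> * (real j + 2) powr (- 2 * \<alpha>)" unfolding \<theta>_def c_def[symmetric] using c by simp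
      then show ?thesis using sig_sq_lower[of \<alpha> j] \<alpha> by simp
    qed
    have R0: "R \<ge> 0" unfolding R_def using \<theta>s \<theta> \<epsilon>
      by (intro add_nonneg_nonneg sum_nonneg divide_nonneg_nonneg ln_ge_zero) (auto simp: le_divide_eq intro: less_imp_le)
    have R1: "R \<le> \<alpha> * (real m + 1 + ln (real m) + ln pi) + \<epsilon> * real m"
      unfolding R_def \<theta>_def c_def using sig_rate_upper[OF \<alpha> m(1)] by simp
    have mR: "real m * exp R \<ge> 1" using m(2) R0 mult_mono[of 1 "real m" 1 "exp R"] by simp
    have nn: "real m * exp R \<le> real n" "real n \<le> real m * exp R + 1" unfolding n_def using mR by linarith+
    have size: "real n + 1 \<le> exp ((\<alpha> + 2 * \<epsilon>) * real m)"
    proof -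
      have "real n + 1 \<le> 3 * (real m * exp R)" using nn mR by linarith
      also have "\<dots> = exp (ln 3 + ln (real m) + R)" using m by (simp add: exp_add)
      also have "\<dots> \<le> exp ((\<alpha> + 2 * \<epsilon>) * real m)"
        unfolding exp_le_cancel_iff using R1 elim(2) by (simp add: algebra_simps)
      finally show ?thesis .
    qed
    show ?case
    proof (intro allI impI)
      fix N assume N: "m \<le> N"
      have "codeable M (ymain N) (real n + 1)
        (m * \<theta> * (1 + \<epsilon>) + (\<Sum>j\<in>{m..<N}. (sig \<alpha> j)\<^sup>2) + (3 / 2 * \<eta> * (\<Sum>j<m. (sig \<alpha> j)\<^sup>2)\<^sup>2 + (3 * exp (- \<epsilon>\<^sup>2 / 16 * m) +
          exp (- (real n * exp (- ((\<Sum>j<m. ln ((sig \<alpha> j)\<^sup>2 / \<theta>) / 2) + \<epsilon> * m))))) / (2 * \<eta>)))"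
        unfolding ymain_def
        by (rule I.random_coding[OF trigp_orthonormal trigp_measurable N \<theta> \<theta>s \<epsilon>]) (auto simp: \<eta>_def)
      then show "codeable M (ymain N) (exp ((\<alpha> + 2 * \<epsilon>) * real m)) ((1 + 3 * \<epsilon>) * rconst \<alpha> * real m powr (1 - 2 * \<alpha>))"
      proof (rule codeable_mono[OF _ size])
        define D where "D = real m powr (1 - 2 * \<alpha>)"
        have D: "D > 0" using m by (simp add: D_def)
        have mD: "real m powr (- 2 * \<alpha>) * real m = D" unfolding D_def using m powr_add[of "real m" "- 2 * \<alpha>" 1] by (simp add: add.commute)
        have t1: "real m * \<theta> * (1 + \<epsilon>) \<le> c * D * (1 + \<epsilon>)"
        proof -
          have "(real m + 1) powr (- 2 * \<alpha>) \<le> real m powr (- 2 * \<alpha>)" using m \<alpha> by (intro powr_mono2') auto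
          then have "real m * \<theta> \<le> real m * (c * real m powr (- 2 * \<alpha>))" unfolding \<theta>_def using c by (intro mult_left_mono) auto
          also have "\<dots> = c * D" using mD by (simp add: mult_ac)
          finally show ?thesis using \<epsilon> by (intro mult_right_mono) auto
        qed
        have t2: "(\<Sum>j\<in>{m..<N}. (sig \<alpha> j)\<^sup>2) \<le> c * D * (\<epsilon> + 1 / (2 * \<alpha> - 1))"
        proof -
          have "1 \<le> \<epsilon> * real m" using elim(3) \<epsilon> by (simp add: divide_le_eq mult.commute)
          then have "real m powr (- 2 * \<alpha>) * 1 \<le> real m powr (- 2 * \<alpha>) * (\<epsilon> * real m)" by (intro mult_left_mono) auto
          then have "real m powr (- 2 * \<alpha>) \<le> D * \<epsilon>" using mD by (simp add: mult_ac)
          then have "c * (real m powr (- 2 * \<alpha>) + D / (2 * \<alpha> - 1)) \<le> c * (D * \<epsilon> + D / (2 * \<alpha> - 1))" using c by (intro mult_left_mono) auto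
          also have "\<dots> = c * D * (\<epsilon> + 1 / (2 * \<alpha> - 1))" by (simp add: algebra_simps)
          finally show ?thesis using sig_sq_tail[OF \<alpha> m(1), of N] unfolding c_def D_def by linarith
        qed
        have t3: "3 / 2 * \<eta> * (\<Sum>j<m. (sig \<alpha> j)\<^sup>2)\<^sup>2 \<le> 3 / 2 * \<eta> * B\<^sup>2"
          unfolding B_def c_def using sig_sq_total[OF \<alpha>, of m] by (intro mult_left_mono power_mono sum_nonneg) (auto simp: \<eta>_def)
        have t4: "3 * exp (- \<epsilon>\<^sup>2 / 16 * m) = 3 * \<eta>\<^sup>2" by (simp add: \<eta>_def power2_eq_square flip: exp_add)
        have t5: "exp (- (real n * exp (- R))) \<le> \<eta>\<^sup>2"
        proof -
          have "real m = real m * exp R * exp (- R)" by (simp add: exp_minus)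
          also have "\<dots> \<le> real n * exp (- R)" using nn by (intro mult_right_mono) auto
          finally have "exp (- (real n * exp (- R))) \<le> exp (- real m)" by simp
          also have "\<dots> \<le> exp (2 * (- (\<epsilon>\<^sup>2 / 32) * real m))"
          proof -
            have "\<epsilon>\<^sup>2 \<le> 1" using \<epsilon> by (simp add: power_le_one)
            then have "\<epsilon>\<^sup>2 / 16 * real m \<le> 1 * real m" by (intro mult_right_mono) auto
            then show ?thesis by (simp add: mult.commute)
          qed
          also have "\<dots> = \<eta>\<^sup>2" unfolding \<eta>_def power2_eq_square by (simp flip: exp_add)
          finally show ?thesis .
        qed
        have \<eta>: "\<eta> > 0" by (simp add: \<eta>_def)
        have t6: "(3 * exp (- \<epsilon>\<^sup>2 / 16 * m) + exp (- (real n * exp (- R)))) / (2 * \<eta>) \<le> 2 * \<eta>"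
        proof -
          have "(3 * exp (- \<epsilon>\<^sup>2 / 16 * m) + exp (- (real n * exp (- R)))) / (2 * \<eta>) \<le> 4 * \<eta>\<^sup>2 / (2 * \<eta>)"
            using t4 t5 \<eta> by (intro divide_right_mono) auto
          also have "\<dots> = 2 * \<eta>" using \<eta> by (simp add: power2_eq_square)
          finally show ?thesis .
        qed
        have t7: "3 / 2 * \<eta> * B\<^sup>2 + 2 * \<eta> \<le> \<epsilon> * c * D"
        proof -
          have "C * \<eta> \<le> D" using elim(1) by (simp add: \<eta>_def D_def)
          then have "\<epsilon> * c * (C * \<eta>) \<le> \<epsilon> * c * D" using \<epsilon> c by (intro mult_left_mono) auto
          moreover have "\<epsilon> * c * (C * \<eta>) = (3 / 2 * B\<^sup>2 + 2) * \<eta>"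
          proof -
            have "\<epsilon> * c * C = 3 / 2 * B\<^sup>2 + 2" using \<epsilon> c by (simp add: C_def)
            then show ?thesis unfolding mult.assoc[symmetric] by (simp only:)
          qed
          ultimately have "(3 / 2 * B\<^sup>2 + 2) * \<eta> \<le> \<epsilon> * c * D" by (simp only:)
          then show ?thesis by (simp add: algebra_simps)
        qed
        have cr: "c \<le> rconst \<alpha>" unfolding rconst_alt[OF \<alpha>] c_def[symmetric] using c \<alpha> by (simp add: distrib_left)
        have "m * \<theta> * (1 + \<epsilon>) + (\<Sum>j\<in>{m..<N}. (sig \<alpha> j)\<^sup>2) + (3 / 2 * \<eta> * (\<Sum>j<m. (sig \<alpha> j)\<^sup>2)\<^sup>2 + (3 * exp (- \<epsilon>\<^sup>2 / 16 * m) +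
          exp (- (real n * exp (- R)))) / (2 * \<eta>)) \<le> c * D * (1 + \<epsilon>) + c * D * (\<epsilon> + 1 / (2 * \<alpha> - 1)) + \<epsilon> * c * D"
          using t1 t2 t3 t6 t7 by linarith
        also have "\<dots> = rconst \<alpha> * D + 3 * \<epsilon> * c * D" unfolding rconst_alt[OF \<alpha>] c_def by (simp add: algebra_simps)
        also have "\<dots> \<le> rconst \<alpha> * D + 3 * \<epsilon> * rconst \<alpha> * D" using cr \<epsilon> D by (intro add_left_mono mult_right_mono mult_left_mono) auto
        also have "\<dots> = (1 + 3 * \<epsilon>) * rconst \<alpha> * D" by (simp add: algebra_simps)
        finally show "m * \<theta> * (1 + \<epsilon>) + (\<Sum>j\<in>{m..<N}. (sig \<alpha> j)\<^sup>2) + (3 / 2 * \<eta> * (\<Sum>j<m. (sig \<alpha> j)\<^sup>2)\<^sup>2 + (3 * exp (- \<epsilon>\<^sup>2 / 16 * m) +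
          exp (- (real n * exp (- ((\<Sum>j<m. ln ((sig \<alpha> j)\<^sup>2 / \<theta>) / 2) + \<epsilon> * m))))) / (2 * \<eta>)) \<le> (1 + 3 * \<epsilon>) * rconst \<alpha> * real m powr (1 - 2 * \<alpha>)"
          unfolding R_def D_def .
      qed
    qed
  qed
qed

text \<open>\<open>N0\<close> depends on d: the part of the tail beyond N must be small against d^(1
  - 2 \<alpha>) before the finite sum can stand for the whole tail.\<close>

lemma ymain_lower:
  assumes \<epsilon>: "0 < \<epsilon>" "\<epsilon> < 1"
  shows "eventually (\<lambda>d. \<exists>N0. \<forall>N\<ge>N0. \<forall>v\<ge>0. codeable M (ymain N) (exp ((\<alpha> - \<epsilon>) * real d)) v \<longrightarrow>
     (1 - \<epsilon>) * rconst \<alpha> * real d powr (1 - 2 * \<alpha>) \<le> v) sequentially"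
proof -
  interpret I: iid_normal M zt by (rule zt_iid)
  define c where "c = sigc \<alpha>"
  have c: "c > 0" unfolding c_def using \<alpha> by (intro sigc_pos) simp
  have a1: "2 * \<alpha> - 1 > 0" using \<alpha> by simp
  have "(\<lambda>d. (1 + 2 * (1 / real d)) powr (1 - 2 * \<alpha>)) \<longlonglongrightarrow> (1 + 2 * 0) powr (1 - 2 * \<alpha>)"
    by (intro tendsto_intros lim_1_over_n) auto
  then have ev1: "eventually (\<lambda>d. 1 - \<epsilon> / 2 < (1 + 2 * (1 / real d)) powr (1 - 2 * \<alpha>)) sequentially"
    using \<epsilon> by (intro order_tendstoD(1)) auto
  note ev2 = eventually_ln_le_linear[OF \<epsilon>(1), of "\<alpha> * (1 + ln 2)" "2 * \<alpha>"]
  show ?thesis using ev1 ev2 eventually_ge_at_top[of 1]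
  proof eventually_elim
    case (elim d)
    have d: "d \<ge> 1" "real d \<ge> 1" using elim by auto
    define D where "D = real d powr (1 - 2 * \<alpha>)"
    have D: "D > 0" using d by (simp add: D_def)
    define \<theta> where "\<theta> = c * real d powr (- 2 * \<alpha>)"
    have \<theta>: "\<theta> > 0" using c d by (simp add: \<theta>_def)
    have dD: "real d * \<theta> = c * D"
      unfolding D_def \<theta>_def using d powr_add[of "real d" "- 2 * \<alpha>" 1] by (simp add: add.commute mult_ac)
    have d2: "(1 - \<epsilon> / 2) * D \<le> (real d + 2) powr (1 - 2 * \<alpha>)"
    proof -
      have "(1 - \<epsilon> / 2) * D \<le> (1 + 2 * (1 / real d)) powr (1 - 2 * \<alpha>) * D" using elim(1) D by (intro mult_right_mono) auto
      also have "\<dots> = ((1 + 2 * (1 / real d)) * real d) powr (1 - 2 * \<alpha>)" unfolding D_def using d by (subst powr_mult) auto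
      also have "(1 + 2 * (1 / real d)) * real d = real d + 2" using d by (simp add: field_simps)
      finally show ?thesis .
    qed
    have rate: "(\<Sum>j<d. ln ((sig \<alpha> j)\<^sup>2 / \<theta>)) / 2 - (\<alpha> - \<epsilon>) * real d \<ge> 0"
    proof -
      have "ln (real d + 1) \<le> ln (2 * real d)" using d by (subst ln_le_cancel_iff) auto
      then have "ln (real d + 1) \<le> ln 2 + ln (real d)" using d by (simp add: ln_mult)
      then have "\<alpha> * (real d - 1 - ln (real d) - (ln 2 + ln (real d))) \<le> \<alpha> * (real d - 1 - ln (real d) - ln (real d + 1))"
        using \<alpha> by (intro mult_left_mono) auto
      also have "\<dots> \<le> (\<Sum>j<d. ln ((sig \<alpha> j)\<^sup>2 / \<theta>)) / 2"
        using sig_rate_lower[OF \<alpha> d(1)] unfolding \<theta>_def c_def by simp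
      finally show ?thesis using elim(2) by (simp add: algebra_simps)
    qed
    have "((\<lambda>N::nat. (real N + 2) powr (1 - 2 * \<alpha>)) \<longlongrightarrow> 0) sequentially"
    proof (rule tendsto_neg_powr)
      show "filterlim (\<lambda>N. real N + 2) at_top sequentially"
        by (rule filterlim_at_top_mono[OF filterlim_real_sequentially]) auto
    qed (use \<alpha> in simp)
    then have "eventually (\<lambda>N::nat. (real N + 2) powr (1 - 2 * \<alpha>) < \<epsilon> / 2 * D) sequentially"
      using \<epsilon> D by (intro order_tendstoD(2)) auto
    then obtain N0 where N0: "\<And>N. N \<ge> N0 \<Longrightarrow> (real N + 2) powr (1 - 2 * \<alpha>) < \<epsilon> / 2 * D" by (auto simp: eventually_sequentially)
    show ?case
    proof (intro exI[of _ "max N0 d"] allI impI)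
      fix N and v :: real assume N: "max N0 d \<le> N" and v: "0 \<le> v" and cd: "codeable M (ymain N) (exp ((\<alpha> - \<epsilon>) * real d)) v"
      have dN: "d \<le> N" using N by simp
      have "real d * \<theta> + (\<Sum>j\<in>{d..<N}. (sig \<alpha> j)\<^sup>2) + 2 * \<theta> * ((\<Sum>j<d. ln ((sig \<alpha> j)\<^sup>2 / \<theta>)) / 2 - ln (exp ((\<alpha> - \<epsilon>) * real d))) \<le> v"
      proof (rule I.water_filling_lower[OF trigp_orthonormal _ dN \<theta> _ cd[unfolded ymain_def] v])
        show "sig \<alpha> j > 0" for j using \<alpha> by (intro sig_pos) simp
        fix j assume j: "d \<le> j" "j < N"
        have "(sig \<alpha> j)\<^sup>2 \<le> c * real j powr (- 2 * \<alpha>)" unfolding c_def using \<alpha> j d by (intro sig_sq_upper) auto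
        also have "\<dots> \<le> \<theta>" unfolding \<theta>_def using c \<alpha> j d by (intro mult_left_mono powr_mono2') auto
        finally show "(sig \<alpha> j)\<^sup>2 \<le> \<theta>" .
      qed
      moreover have "0 \<le> 2 * \<theta> * ((\<Sum>j<d. ln ((sig \<alpha> j)\<^sup>2 / \<theta>)) / 2 - ln (exp ((\<alpha> - \<epsilon>) * real d)))"
        using rate \<theta> by simp
      moreover have "c * D * ((1 - \<epsilon>) / (2 * \<alpha> - 1)) \<le> (\<Sum>j\<in>{d..<N}. (sig \<alpha> j)\<^sup>2)"
      proof -
        have "(1 - \<epsilon>) * D \<le> (real d + 2) powr (1 - 2 * \<alpha>) - (real N + 2) powr (1 - 2 * \<alpha>)"
          using d2 N0[of N] N by (simp add: algebra_simps)
        then have "(1 - \<epsilon>) * D / (2 * \<alpha> - 1) \<le> ((real d + 2) powr (1 - 2 * \<alpha>) - (real N + 2) powr (1 - 2 * \<alpha>)) / (2 * \<alpha> - 1)"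
          using a1 by (intro divide_right_mono) auto
        also have "\<dots> \<le> (\<Sum>j = d..<N. (real j + 2) powr (- 2 * \<alpha>))" using powr_tail_lower[of "2 * \<alpha>" d N] \<alpha> dN by simp
        finally have "c * ((1 - \<epsilon>) * D / (2 * \<alpha> - 1)) \<le> c * (\<Sum>j = d..<N. (real j + 2) powr (- 2 * \<alpha>))" using c by (intro mult_left_mono) auto
        also have "\<dots> = (\<Sum>j = d..<N. c * (real j + 2) powr (- 2 * \<alpha>))" by (rule sum_distrib_left)
        also have "\<dots> \<le> (\<Sum>j = d..<N. (sig \<alpha> j)\<^sup>2)" unfolding c_def using \<alpha> by (intro sum_mono less_imp_le sig_sq_lower) auto
        finally show ?thesis by (simp add: mult_ac)
      qed
      ultimately have "c * D + c * D * ((1 - \<epsilon>) / (2 * \<alpha> - 1)) \<le> v" using dD by linarith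
      moreover have "(1 - \<epsilon>) * rconst \<alpha> * D \<le> c * D + c * D * ((1 - \<epsilon>) / (2 * \<alpha> - 1))"
      proof -
        have "(1 - \<epsilon>) * rconst \<alpha> * D = (1 - \<epsilon>) * (c * D) + c * D * ((1 - \<epsilon>) / (2 * \<alpha> - 1))"
          unfolding rconst_alt[OF \<alpha>] c_def by (simp add: algebra_simps add_divide_distrib)
        moreover have "(1 - \<epsilon>) * (c * D) \<le> 1 * (c * D)" using \<epsilon> c D by (intro mult_right_mono) auto
        ultimately show ?thesis by linarith
      qed
      ultimately show "(1 - \<epsilon>) * rconst \<alpha> * real d powr (1 - 2 * \<alpha>) \<le> v" unfolding D_def by linarith
    qed
  qed
qed

section \<open>The smooth difference and the transfer to the Riemann-Liouville process\<close>

definition rcoef :: "nat \<Rightarrow> real \<Rightarrow> real" where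
  "rcoef j t = sig \<alpha> j * trigp (phi \<alpha>) j t - kcoef \<alpha> j t"

definition smooth :: "nat \<Rightarrow> 'a \<Rightarrow> real \<Rightarrow> real" where
  "smooth N w t = (\<Sum>j<N. rcoef j t * zt j w)"

lemma rcoef_sq_int: "sq_int U01 (rcoef j)"
  unfolding rcoef_def by (intro sq_int_diff sq_int_cmult trigp_sq_int kcoef_sq_int \<alpha>)

lemma ymain_L2_process: "L2_process M (ymain N)"
  unfolding ymain_def by (intro L2_process_linear sq_int_cmult trigp_sq_int) simp

lemma smooth_L2_process: "L2_process M (\<lambda>w t. q * smooth N w t)"
proof -
  have "L2_process M (\<lambda>w t. \<Sum>j<N. (q * rcoef j t) * zt j w)"
    by (intro L2_process_linear sq_int_cmult rcoef_sq_int) simp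
  then show ?thesis by (simp add: smooth_def sum_distrib_left mult.assoc)
qed

lemma rl_trunc_eq: "rl_trunc N w t = ymain N w t - smooth N w t"
  by (simp add: rl_trunc_def ymain_def smooth_def rcoef_def left_diff_distrib sum_subtractf)

text \<open>Both signs of q occur: the difference is subtracted to code X by means of Y, and added
  to code Y by means of X.\<close>

lemma smooth_codeable:
  assumes \<epsilon>: "\<epsilon> > 0" and \<delta>: "\<delta> > 0"
  shows "eventually (\<lambda>m. \<forall>N. \<forall>q\<in>{1, -1}. codeable M (\<lambda>w t. q * smooth N w t) (exp (\<delta> * real m)) (\<epsilon> * real m powr (1 - 2 * \<alpha>))) sequentially"
proof -
  interpret I: iid_normal M zt by (rule zt_iid)
  obtain K d where K: "K > 0" and rem: "\<And>b T N e s. b \<ge> 1 \<Longrightarrow> T \<ge> 1 \<Longrightarrow> orthonormal_on U01 e {..<N} \<Longrightarrow> (\<forall>j<N. sq_int U01 (s j)) \<Longrightarrow>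
    (\<forall>j<N. \<forall>t\<in>{0<..<1}. s j t = (\<integral>x. rem_kernel \<alpha> t x * e j x \<partial>U01)) \<Longrightarrow>
    codeable M (\<lambda>w t. \<Sum>j<N. s j t * zt j w) (real ((2 * T\<^sup>2 + 1) ^ (3 * (b * d))))
      (K * real b powr (- (2 * \<alpha> - 1/2)) + K * real b powr (2 * \<alpha> + 4) / (real T)\<^sup>2)"
    using I.remainder_coding[OF \<alpha>] by blast
  \<comment> \<open>\<tau> < 1 makes the rank m^\<tau>, even times a logarithm, negligible against
    the rate m, while \<tau> (2 \<alpha> - 1/2) = 2 \<alpha> - 3/4 still exceeds 2 \<alpha> - 1 and
    leaves a gain of m^(-1/4).\<close>
  define \<tau> where "\<tau> = (2 * \<alpha> - 3/4) / (2 * \<alpha> - 1/2)"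
  have \<tau>: "0 < \<tau>" "\<tau> < 1" "\<tau> * (2 * \<alpha> - 1/2) = 2 * \<alpha> - 3/4" using \<alpha> by (auto simp: \<tau>_def)
  \<comment> \<open>With T = b^k this k pushes b^(2 \<alpha> + 4) / T^2 below the first error term;
    the finer grid costs only a logarithm in the exponent of the size.\<close>
  define k where "k = nat \<lceil>2 * \<alpha> + 2\<rceil>"
  have k: "real k \<ge> 2 * \<alpha> + 2" unfolding k_def using \<alpha> by linarith
  define C where "C = 2 * K * 2 powr (2 * \<alpha> - 1/2)"
  have "(\<lambda>m. C * (1 / real m powr (1/4))) \<longlonglongrightarrow> C * 0" by (intro tendsto_intros lim_1_over_real_power) auto
  then have ev1: "eventually (\<lambda>m. C * (1 / real m powr (1/4)) < \<epsilon>) sequentially" using \<epsilon> by (intro order_tendstoD(2)) auto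
  note ev2 = eventually_ln_powr_le_linear[OF \<delta> \<tau>(2), of "3 * real d * ln 3" "6 * real d * real k"]
  show ?thesis using ev1 ev2 eventually_ge_at_top[of 1]
  proof eventually_elim
    case (elim m)
    have m: "real m \<ge> 1" using elim by simp
    define x where "x = real m powr \<tau>"
    define b where "b = nat \<lfloor>x\<rfloor>"
    define T where "T = b ^ k"
    have x: "x \<ge> 1" "x \<le> real m"
      unfolding x_def using m \<tau> ge_one_powr_ge_zero[of "real m" \<tau>] powr_mono[of \<tau> 1 "real m"] by auto
    have b1: "b \<ge> 1" "real b \<le> x" "x - 1 \<le> real b" unfolding b_def using x by linarith+
    then have b: "b \<ge> 1" "real b \<le> x" "x / 2 \<le> real b" by linarith+
    have T: "T \<ge> 1" "real T \<ge> 1" unfolding T_def using b by auto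
    have lb: "0 \<le> ln (real b)" "ln (real b) \<le> ln (real m)" using b x by auto
    have size: "real ((2 * T\<^sup>2 + 1) ^ (3 * (b * d))) \<le> exp (\<delta> * real m)"
    proof -
      have "1 \<le> (real T)\<^sup>2" using T by simp
      then have "(2 * (real T)\<^sup>2 + 1) ^ (3 * (b * d)) \<le> (3 * (real T)\<^sup>2) ^ (3 * (b * d))" by (intro power_mono) auto
      then have "real ((2 * T\<^sup>2 + 1) ^ (3 * (b * d))) \<le> (3 * (real T)\<^sup>2) ^ (3 * (b * d))"
        by (simp only: of_nat_power of_nat_add of_nat_mult of_nat_numeral of_nat_1)
      also have "\<dots> = exp (real (3 * (b * d)) * ln (3 * (real T)\<^sup>2))" using T by (subst exp_of_nat_mult) simp
      also have "ln (3 * (real T)\<^sup>2) = ln 3 + 2 * (real k * ln (real b))" using T b by (simp add: ln_mult ln_realpow T_def)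
      also have "real (3 * (b * d)) * (ln 3 + 2 * (real k * ln (real b))) = real b * (3 * real d * ln 3 + 6 * real d * real k * ln (real b))"
        by (simp add: algebra_simps)
      also have "exp \<dots> \<le> exp (x * (3 * real d * ln 3 + 6 * real d * real k * ln (real m)))"
        unfolding exp_le_cancel_iff using b lb x by (intro mult_mono add_mono mult_left_mono add_nonneg_nonneg mult_nonneg_nonneg) auto
      also have "\<dots> \<le> exp (\<delta> * real m)" using elim(2) by (simp add: x_def)
      finally show ?thesis .
    qed
    have val: "K * real b powr (- (2 * \<alpha> - 1/2)) + K * real b powr (2 * \<alpha> + 4) / (real T)\<^sup>2 \<le> \<epsilon> * real m powr (1 - 2 * \<alpha>)"
    proof -
      have "(real T)\<^sup>2 = real b powr (2 * real k)"
        using b by (simp add: T_def powr_realpow[symmetric] power2_eq_square flip: powr_add)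
      then have "real b powr (2 * \<alpha> + 4) / (real T)\<^sup>2 = real b powr (2 * \<alpha> + 4 - 2 * real k)" by (simp add: powr_diff)
      also have "\<dots> \<le> real b powr (- (2 * \<alpha> - 1/2))" using b k by (intro powr_mono) auto
      finally have "K * (real b powr (2 * \<alpha> + 4) / (real T)\<^sup>2) \<le> K * real b powr (- (2 * \<alpha> - 1/2))" using K by (intro mult_left_mono) auto
      then have "K * real b powr (- (2 * \<alpha> - 1/2)) + K * real b powr (2 * \<alpha> + 4) / (real T)\<^sup>2 \<le> 2 * K * real b powr (- (2 * \<alpha> - 1/2))" by simp
      also have "\<dots> \<le> 2 * K * (x / 2) powr (- (2 * \<alpha> - 1/2))" using K b x \<alpha> by (intro mult_left_mono powr_mono2') auto
      also have "(x / 2) powr (- (2 * \<alpha> - 1/2)) = 2 powr (2 * \<alpha> - 1/2) * x powr (- (2 * \<alpha> - 1/2))"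
        using x by (simp only: powr_minus_divide) (simp add: powr_divide)
      also have "x powr (- (2 * \<alpha> - 1/2)) = real m powr (- (2 * \<alpha> - 3/4))"
        unfolding x_def powr_powr mult_minus_right \<tau>(3) ..
      also have "\<dots> = real m powr (1 - 2 * \<alpha>) * (1 / real m powr (1/4))"
      proof -
        have "- (2 * \<alpha> - 3/4) = (1 - 2 * \<alpha>) - 1/4" by simp
        then show ?thesis by (simp only: powr_diff) simp
      qed
      also have "2 * K * (2 powr (2 * \<alpha> - 1/2) * (real m powr (1 - 2 * \<alpha>) * (1 / real m powr (1/4)))) = C * (1 / real m powr (1/4)) * real m powr (1 - 2 * \<alpha>)"
        by (simp add: C_def)
      also have "\<dots> \<le> \<epsilon> * real m powr (1 - 2 * \<alpha>)" using elim(1) by (intro mult_right_mono) auto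
      finally show ?thesis .
    qed
    show ?case
    proof (intro allI ballI)
      fix N :: nat and q :: real assume q: "q \<in> {1, -1}"
      then have qq: "q * q = 1" by auto
      have "orthonormal_on U01 (\<lambda>j t. q * trig j t) {..<N}"
        unfolding orthonormal_on_def
      proof (intro conjI ballI sq_int_cmult trigp_sq_int)
        fix i j assume "i \<in> {..<N}" "j \<in> {..<N}"
        have "(\<integral>t. q * trig i t * (q * trig j t) \<partial>U01) = (\<integral>t. q * q * (trig i t * trig j t) \<partial>U01)" by (simp add: mult_ac)
        also have "\<dots> = (if i = j then 1 else 0)" unfolding qq using trigp_orthonormal[of "\<lambda>_. 0" UNIV] by (simp add: orthonormal_on_def)
        finally show "(\<integral>t. q * trig i t * (q * trig j t) \<partial>U01) = (if i = j then 1 else 0)" .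
      qed
      then have "codeable M (\<lambda>w t. \<Sum>j<N. (q * rcoef j t) * zt j w) (real ((2 * T\<^sup>2 + 1) ^ (3 * (b * d))))
        (K * real b powr (- (2 * \<alpha> - 1/2)) + K * real b powr (2 * \<alpha> + 4) / (real T)\<^sup>2)"
      proof (rule rem[OF b(1) T(1)]; intro allI impI ballI)
        show "sq_int U01 (\<lambda>t. q * rcoef j t)" for j by (intro sq_int_cmult rcoef_sq_int)
        fix j and t :: real assume t: "t \<in> {0<..<1}"
        have "(\<integral>x. rem_kernel \<alpha> t x * (q * trig j x) \<partial>U01) = (\<integral>x. q * (rem_kernel \<alpha> t x * trig j x) \<partial>U01)" by (simp add: mult_ac)
        also have "\<dots> = q * (\<integral>x. rem_kernel \<alpha> t x * trig j x \<partial>U01)" by simp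
        also have "\<dots> = q * rcoef j t" unfolding rcoef_def kcoef_def using conv_identity[of \<alpha> t j] \<alpha> t by simp
        finally show "q * rcoef j t = (\<integral>x. rem_kernel \<alpha> t x * (q * trig j x) \<partial>U01)" ..
      qed
      then have "codeable M (\<lambda>w t. q * smooth N w t) (real ((2 * T\<^sup>2 + 1) ^ (3 * (b * d))))
        (K * real b powr (- (2 * \<alpha> - 1/2)) + K * real b powr (2 * \<alpha> + 4) / (real T)\<^sup>2)"
        by (simp only: smooth_def sum_distrib_left mult.assoc)
      then show "codeable M (\<lambda>w t. q * smooth N w t) (exp (\<delta> * real m)) (\<epsilon> * real m powr (1 - 2 * \<alpha>))"
        by (rule codeable_mono[OF _ size val])
    qed
  qed
qed

text \<open>X is Y minus the smooth part plus a truncation error. The two corrections have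
  distortion \<epsilon>^2 D, which the factor 1 + 1 / \<epsilon> of \<open>codeable_add\<close>
  turns into order \<epsilon> D.\<close>

lemma X_codeable:
  assumes \<kappa>: "\<kappa> > 0"
  shows "eventually (\<lambda>m. codeable M (\<lambda>w t. X t w) (exp ((\<alpha> + \<kappa>) * real m)) ((1 + \<kappa>) * rconst \<alpha> * real m powr (1 - 2 * \<alpha>))) sequentially"
proof -
  let ?K = "rconst \<alpha>"
  have K: "?K > 0" by (rule rconst_pos[OF \<alpha>])
  \<comment> \<open>1 is the limit set by \<open>ymain_codeable\<close>, \<kappa> / 3 pays for the
    three rates \<epsilon>, and the last term absorbs the constants 20 and 6 from expanding the
    distortions.\<close>
  define \<epsilon> where "\<epsilon> = min 1 (min (\<kappa> / 3) (\<kappa> * ?K / (20 * ?K + 6)))"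
  have \<epsilon>: "0 < \<epsilon>" "\<epsilon> \<le> 1" "3 * \<epsilon> \<le> \<kappa>" using \<kappa> K by (auto simp: \<epsilon>_def)
  have \<epsilon>4: "\<epsilon> * (20 * ?K + 6) \<le> \<kappa> * ?K"
  proof -
    have "\<epsilon> \<le> \<kappa> * ?K / (20 * ?K + 6)" by (simp add: \<epsilon>_def)
    then show ?thesis using K by (subst (asm) le_divide_eq) auto
  qed
  have e2: "\<epsilon>\<^sup>2 > 0" using \<epsilon> by simp
  show ?thesis using ymain_codeable[OF \<epsilon>(1,2)] smooth_codeable[OF e2 \<epsilon>(1)] eventually_ge_at_top[of 1]
  proof eventually_elim
    case (elim m)
    define D where "D = real m powr (1 - 2 * \<alpha>)"
    have D: "D > 0" using elim by (simp add: D_def)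
    obtain N0 where N0: "\<And>N. N \<ge> N0 \<Longrightarrow> (\<integral>\<^sup>+w. ennreal (\<integral>t. (X t w - rl_trunc N w t)\<^sup>2 \<partial>U01) \<partial>M) \<le> ennreal (\<epsilon>\<^sup>2 * D)"
      using rl_trunc_error_small[of "\<epsilon>\<^sup>2 * D"] e2 D by auto
    \<comment> \<open>Fixed only now, because the truncation error has to be small against m^(1 - 2
      \<alpha>).\<close>
    define N where "N = max N0 m"
    have c1: "codeable M (ymain N) (exp ((\<alpha> + 2 * \<epsilon>) * real m)) ((1 + 3 * \<epsilon>) * ?K * D)" using elim(1) by (simp add: N_def D_def)
    have c2: "codeable M (\<lambda>w t. -1 * smooth N w t) (exp (\<epsilon> * real m)) (\<epsilon>\<^sup>2 * D)" using elim(2) unfolding D_def by blast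
    have c3: "codeable M (\<lambda>w t. X t w - rl_trunc N w t) 1 (\<epsilon>\<^sup>2 * D)" using N0[of N] by (intro codeable_zero) (simp add: N_def)
    let ?v1 = "(1 + \<epsilon>) * ((1 + 3 * \<epsilon>) * ?K * D) + (1 + 1 / \<epsilon>) * (\<epsilon>\<^sup>2 * D)"
    have pos: "0 \<le> (1 + 3 * \<epsilon>) * ?K * D" "0 \<le> \<epsilon>\<^sup>2 * D" using \<epsilon> K D by auto
    have c12: "codeable M (\<lambda>w t. ymain N w t + -1 * smooth N w t) (exp ((\<alpha> + 2 * \<epsilon>) * real m) * exp (\<epsilon> * real m)) ?v1"
      by (rule codeable_add[OF ymain_L2_process smooth_L2_process c1 c2 \<epsilon>(1) pos])
    have p1: "0 \<le> ?v1" using pos \<epsilon> K D by (intro add_nonneg_nonneg mult_nonneg_nonneg) auto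
    have "codeable M (\<lambda>w t. (ymain N w t + -1 * smooth N w t) + (X t w - rl_trunc N w t))
      (exp ((\<alpha> + 2 * \<epsilon>) * real m) * exp (\<epsilon> * real m) * 1) ((1 + \<epsilon>) * ?v1 + (1 + 1 / \<epsilon>) * (\<epsilon>\<^sup>2 * D))"
      by (rule codeable_add[OF L2_process_add[OF ymain_L2_process smooth_L2_process] L2_process_diff[OF X_L2_process rl_trunc_L2_process] c12 c3 \<epsilon>(1) p1 pos(2)])
    moreover have "(\<lambda>w t. (ymain N w t + -1 * smooth N w t) + (X t w - rl_trunc N w t)) = (\<lambda>w t. X t w)"
      by (simp add: rl_trunc_eq fun_eq_iff)
    ultimately have "codeable M (\<lambda>w t. X t w) (exp ((\<alpha> + 2 * \<epsilon>) * real m) * exp (\<epsilon> * real m) * 1) ((1 + \<epsilon>) * ?v1 + (1 + 1 / \<epsilon>) * (\<epsilon>\<^sup>2 * D))" by simp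
    then have "codeable M (\<lambda>w t. X t w) (exp ((\<alpha> + \<kappa>) * real m)) ((1 + \<kappa>) * rconst \<alpha> * D)"
    proof (rule codeable_mono)
      have "exp ((\<alpha> + 2 * \<epsilon>) * real m) * exp (\<epsilon> * real m) * 1 = exp ((\<alpha> + 3 * \<epsilon>) * real m)" by (simp add: algebra_simps flip: exp_add)
      also have "\<dots> \<le> exp ((\<alpha> + \<kappa>) * real m)" using \<epsilon> by (simp add: mult_right_mono)
      finally show "exp ((\<alpha> + 2 * \<epsilon>) * real m) * exp (\<epsilon> * real m) * 1 \<le> exp ((\<alpha> + \<kappa>) * real m)" .
      have s: "(1 + 1 / \<epsilon>) * (\<epsilon>\<^sup>2 * D) = (\<epsilon> + \<epsilon>\<^sup>2) * D" using \<epsilon> by (simp add: field_simps power2_eq_square)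
      have e22: "\<epsilon>\<^sup>2 \<le> \<epsilon>" using \<epsilon> by (simp add: power2_eq_square mult_left_le)
      have e3: "\<epsilon> * \<epsilon>\<^sup>2 \<le> \<epsilon>" using mult_mono[of \<epsilon> 1 "\<epsilon>\<^sup>2" \<epsilon>] \<epsilon> e22 by simp
      have "(1 + \<epsilon>) * ?v1 + (1 + 1 / \<epsilon>) * (\<epsilon>\<^sup>2 * D) = (((1 + \<epsilon>) * (1 + \<epsilon>) * (1 + 3 * \<epsilon>)) * ?K + ((1 + \<epsilon>) * (\<epsilon> + \<epsilon>\<^sup>2) + (\<epsilon> + \<epsilon>\<^sup>2))) * D"
        unfolding s by (simp add: algebra_simps)
      also have "\<dots> \<le> ((1 + 20 * \<epsilon>) * ?K + 6 * \<epsilon>) * D"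
      proof (intro mult_right_mono add_mono)
        have "(1 + \<epsilon>) * (1 + \<epsilon>) * (1 + 3 * \<epsilon>) = 1 + 5 * \<epsilon> + 7 * \<epsilon>\<^sup>2 + 3 * (\<epsilon> * \<epsilon>\<^sup>2)" by (simp add: algebra_simps power2_eq_square)
        then show "(1 + \<epsilon>) * (1 + \<epsilon>) * (1 + 3 * \<epsilon>) \<le> 1 + 20 * \<epsilon>" using e22 e3 \<epsilon> by linarith
        have "(1 + \<epsilon>) * (\<epsilon> + \<epsilon>\<^sup>2) + (\<epsilon> + \<epsilon>\<^sup>2) = 2 * \<epsilon> + 3 * \<epsilon>\<^sup>2 + \<epsilon> * \<epsilon>\<^sup>2" by (simp add: algebra_simps power2_eq_square)
        then show "(1 + \<epsilon>) * (\<epsilon> + \<epsilon>\<^sup>2) + (\<epsilon> + \<epsilon>\<^sup>2) \<le> 6 * \<epsilon>" using e22 e3 by linarith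
      qed (use K D in auto)
      also have "\<dots> \<le> (?K + \<kappa> * ?K) * D" using \<epsilon>4 D by (intro mult_right_mono) (auto simp: algebra_simps)
      finally show "(1 + \<epsilon>) * ?v1 + (1 + 1 / \<epsilon>) * (\<epsilon>\<^sup>2 * D) \<le> (1 + \<kappa>) * ?K * D" by (simp add: algebra_simps)
    qed
    then show ?case unfolding D_def .
  qed
qed

text \<open>A code for X yields one for Y of slightly larger size, to which the lower bound for Y
  applies. Half of the slack \<kappa> in the rate pays for the smooth part, the other half is the
  loss in \<open>ymain_lower\<close>.\<close>

lemma X_lower:
  assumes \<kappa>: "0 < \<kappa>" "\<kappa> < 1"
  shows "eventually (\<lambda>d. \<forall>v\<ge>0. codeable M (\<lambda>w t. X t w) (exp ((\<alpha> - \<kappa>) * real d)) v \<longrightarrow>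
    (1 - \<kappa>) * rconst \<alpha> * real d powr (1 - 2 * \<alpha>) \<le> (1 + \<kappa>) * v) sequentially"
proof -
  let ?K = "rconst \<alpha>"
  have K: "?K > 0" by (rule rconst_pos[OF \<alpha>])
  define \<epsilon> where "\<epsilon> = min (\<kappa> / 3) (\<kappa> * ?K / 12)"
  have \<epsilon>: "0 < \<epsilon>" "\<epsilon> \<le> 1" "3 * \<epsilon> \<le> \<kappa>" "6 * \<epsilon> \<le> \<kappa> * ?K / 2" using \<kappa> K by (auto simp: \<epsilon>_def)
  have e2: "\<epsilon>\<^sup>2 > 0" and k2: "\<kappa> / 2 > 0" "\<kappa> / 2 < 1" using \<epsilon> \<kappa> by auto
  show ?thesis using ymain_lower[OF k2] smooth_codeable[OF e2 k2(1)] eventually_ge_at_top[of 1]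
  proof eventually_elim
    case (elim d)
    define D where "D = real d powr (1 - 2 * \<alpha>)"
    have D: "D > 0" using elim by (simp add: D_def)
    obtain N0 where N0: "\<And>N. N \<ge> N0 \<Longrightarrow> (\<integral>\<^sup>+w. ennreal (\<integral>t. (X t w - rl_trunc N w t)\<^sup>2 \<partial>U01) \<partial>M) \<le> ennreal (\<epsilon>\<^sup>2 * D)"
      using rl_trunc_error_small[of "\<epsilon>\<^sup>2 * D"] e2 D by auto
    obtain N1 where N1: "\<And>N v. N \<ge> N1 \<Longrightarrow> v \<ge> 0 \<Longrightarrow> codeable M (ymain N) (exp ((\<alpha> - \<kappa> / 2) * real d)) v \<Longrightarrow> (1 - \<kappa> / 2) * ?K * D \<le> v"
      using elim(1) unfolding D_def by blast
    define N where "N = max N0 N1"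
    show ?case
    proof (intro allI impI)
      fix v :: real assume v: "v \<ge> 0" and c1: "codeable M (\<lambda>w t. X t w) (exp ((\<alpha> - \<kappa>) * real d)) v"
      have c2: "codeable M (\<lambda>w t. 1 * smooth N w t) (exp (\<kappa> / 2 * real d)) (\<epsilon>\<^sup>2 * D)" using elim(2) unfolding D_def by blast
      have c3: "codeable M (\<lambda>w t. rl_trunc N w t - X t w) 1 (\<epsilon>\<^sup>2 * D)"
        using N0[of N] by (intro codeable_zero) (simp add: N_def power2_commute)
      let ?v1 = "(1 + \<epsilon>) * v + (1 + 1 / \<epsilon>) * (\<epsilon>\<^sup>2 * D)"
      have pos: "0 \<le> \<epsilon>\<^sup>2 * D" using D by auto
      have c12: "codeable M (\<lambda>w t. X t w + 1 * smooth N w t) (exp ((\<alpha> - \<kappa>) * real d) * exp (\<kappa> / 2 * real d)) ?v1"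
        by (rule codeable_add[OF X_L2_process smooth_L2_process c1 c2 \<epsilon>(1) v pos])
      have p1: "0 \<le> ?v1" using pos v \<epsilon> D by (intro add_nonneg_nonneg mult_nonneg_nonneg) auto
      let ?v2 = "(1 + \<epsilon>) * ?v1 + (1 + 1 / \<epsilon>) * (\<epsilon>\<^sup>2 * D)"
      have "codeable M (\<lambda>w t. (X t w + 1 * smooth N w t) + (rl_trunc N w t - X t w))
        (exp ((\<alpha> - \<kappa>) * real d) * exp (\<kappa> / 2 * real d) * 1) ?v2"
        by (rule codeable_add[OF L2_process_add[OF X_L2_process smooth_L2_process] L2_process_diff[OF rl_trunc_L2_process X_L2_process] c12 c3 \<epsilon>(1) p1 pos])
      moreover have "(\<lambda>w t. (X t w + 1 * smooth N w t) + (rl_trunc N w t - X t w)) = ymain N"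
        by (simp add: rl_trunc_eq fun_eq_iff)
      moreover have "exp ((\<alpha> - \<kappa>) * real d) * exp (\<kappa> / 2 * real d) * 1 = exp ((\<alpha> - \<kappa> / 2) * real d)" by (simp add: algebra_simps flip: exp_add)
      ultimately have "codeable M (ymain N) (exp ((\<alpha> - \<kappa> / 2) * real d)) ?v2" by simp
      moreover have "0 \<le> ?v2" using pos p1 \<epsilon> by (intro add_nonneg_nonneg mult_nonneg_nonneg[OF _ p1] mult_nonneg_nonneg[OF _ pos]) auto
      ultimately have low: "(1 - \<kappa> / 2) * ?K * D \<le> ?v2" using N1[of N ?v2] by (simp add: N_def)
      have s: "(1 + 1 / \<epsilon>) * (\<epsilon>\<^sup>2 * D) = (\<epsilon> + \<epsilon>\<^sup>2) * D" using \<epsilon> by (simp add: field_simps power2_eq_square)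
      have e22: "\<epsilon>\<^sup>2 \<le> \<epsilon>" using \<epsilon> by (simp add: power2_eq_square mult_left_le)
      have e3: "\<epsilon> * \<epsilon>\<^sup>2 \<le> \<epsilon>" using mult_mono[of \<epsilon> 1 "\<epsilon>\<^sup>2" \<epsilon>] \<epsilon> e22 by simp
      have "?v2 = ((1 + \<epsilon>) * (1 + \<epsilon>)) * v + ((1 + \<epsilon>) * (\<epsilon> + \<epsilon>\<^sup>2) + (\<epsilon> + \<epsilon>\<^sup>2)) * D"
        unfolding s by (simp add: algebra_simps)
      also have "\<dots> \<le> (1 + \<kappa>) * v + (\<kappa> * ?K / 2) * D"
      proof (intro add_mono mult_right_mono)
        have "(1 + \<epsilon>) * (1 + \<epsilon>) = 1 + 2 * \<epsilon> + \<epsilon>\<^sup>2" by (simp add: algebra_simps power2_eq_square)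
        then show "(1 + \<epsilon>) * (1 + \<epsilon>) \<le> 1 + \<kappa>" using e22 \<epsilon> by linarith
        have "(1 + \<epsilon>) * (\<epsilon> + \<epsilon>\<^sup>2) + (\<epsilon> + \<epsilon>\<^sup>2) = 2 * \<epsilon> + 3 * \<epsilon>\<^sup>2 + \<epsilon> * \<epsilon>\<^sup>2" by (simp add: algebra_simps power2_eq_square)
        then show "(1 + \<epsilon>) * (\<epsilon> + \<epsilon>\<^sup>2) + (\<epsilon> + \<epsilon>\<^sup>2) \<le> \<kappa> * ?K / 2" using e22 e3 \<epsilon> by linarith
      qed (use v D in auto)
      finally have "(1 - \<kappa> / 2) * ?K * D - (\<kappa> * ?K / 2) * D \<le> (1 + \<kappa>) * v" using low by linarith
      moreover have "(1 - \<kappa> / 2) * ?K * D - (\<kappa> * ?K / 2) * D = (1 - \<kappa>) * ?K * D" by (simp add: field_simps)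
      ultimately show "(1 - \<kappa>) * ?K * real d powr (1 - 2 * \<alpha>) \<le> (1 + \<kappa>) * v" unfolding D_def by linarith
    qed
  qed
qed

end

section \<open>From codes to the quantisation error\<close>

lemma quant_error_alt:
  "quant_error M X n = sqrt (enn2real (INF A\<in>{A. codebook A \<and> card A \<le> n}. \<integral>\<^sup>+w. ennreal (quant_dist A (\<lambda>t. X t w)) \<partial>M))"
proof -
  have "{A. finite A \<and> A \<noteq> {} \<and> card A \<le> n \<and> A \<subseteq> L2_01} = {A. codebook A \<and> card A \<le> n}" by (auto simp: codebook_def)
  then show ?thesis by (simp add: quant_error_def quant_dist_def)
qed

lemma quant_error_sq:
  "(quant_error M X n)\<^sup>2 = enn2real (INF A\<in>{A. codebook A \<and> card A \<le> n}. \<integral>\<^sup>+w. ennreal (quant_dist A (\<lambda>t. X t w)) \<partial>M)"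
  by (simp add: quant_error_alt)

lemma quant_INF_le:
  assumes "codeable M (\<lambda>w t. X t w) (real n) v"
  shows "(INF A\<in>{A. codebook A \<and> card A \<le> n}. \<integral>\<^sup>+w. ennreal (quant_dist A (\<lambda>t. X t w)) \<partial>M) \<le> ennreal v"
proof -
  obtain A where A: "codebook A" "real (card A) \<le> real n" "(\<integral>\<^sup>+w. ennreal (quant_dist A (\<lambda>t. X t w)) \<partial>M) \<le> ennreal v"
    using assms unfolding codeable_def by blast
  show ?thesis by (rule INF_lower2[where i = A]) (use A in auto)
qed

lemma quant_error_upper:
  assumes "codeable M (\<lambda>w t. X t w) (real n) v" "v \<ge> 0"
  shows "(quant_error M X n)\<^sup>2 \<le> v"
  unfolding quant_error_sq using quant_INF_le[OF assms(1)] assms(2) by (rule enn2real_leI[rotated])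

text \<open>\<open>enn2real\<close> sends the infinite value to 0, so the lower bound has to know
  that some codebook has finite distortion; \<open>fin\<close> supplies one.\<close>

lemma quant_error_lower:
  assumes fin: "codeable M (\<lambda>w t. X t w) (real n) v0" and L: "L \<ge> 0"
    and low: "\<And>v. v \<ge> 0 \<Longrightarrow> codeable M (\<lambda>w t. X t w) (real n) v \<Longrightarrow> L \<le> v"
  shows "L \<le> (quant_error M X n)\<^sup>2"
proof -
  let ?I = "\<lambda>A. \<integral>\<^sup>+w. ennreal (quant_dist A (\<lambda>t. X t w)) \<partial>M"
  have "ennreal L \<le> (INF A\<in>{A. codebook A \<and> card A \<le> n}. ?I A)"
  proof (rule INF_greatest)
    fix A assume A: "A \<in> {A. codebook A \<and> card A \<le> n}"
    show "ennreal L \<le> ?I A"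
    proof (cases "?I A")
      case (real v)
      then have "codeable M (\<lambda>w t. X t w) (real n) v" unfolding codeable_def using A by (intro exI[of _ A]) auto
      then show ?thesis using low[OF real(1)] real by (simp add: ennreal_leI)
    qed simp
  qed
  moreover have "(INF A\<in>{A. codebook A \<and> card A \<le> n}. ?I A) < top"
    using quant_INF_le[OF fin] by (rule le_less_trans) simp
  ultimately have "enn2real (ennreal L) \<le> enn2real (INF A\<in>{A. codebook A \<and> card A \<le> n}. ?I A)" by (rule enn2real_mono)
  then show ?thesis unfolding quant_error_sq using L by simp
qed

lemma ln_over_floor_at_top:
  assumes "(a::real) > 0"
  shows "filterlim (\<lambda>n. nat \<lfloor>ln (real n) / a\<rfloor>) at_top sequentially" "filterlim (\<lambda>n. nat \<lceil>ln (real n) / a\<rceil>) at_top sequentially"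
proof -
  have l: "filterlim (\<lambda>n. ln (real n) * (1 / a)) at_top sequentially"
    using assms by (intro filterlim_at_top_mult_tendsto_pos[OF tendsto_const] filterlim_compose[OF ln_at_top filterlim_real_sequentially]) auto
  show fl: "filterlim (\<lambda>n. nat \<lfloor>ln (real n) / a\<rfloor>) at_top sequentially"
    by (rule filterlim_compose[OF filterlim_nat_sequentially filterlim_compose[OF filterlim_floor_sequentially]]) (use l in simp)
  show "filterlim (\<lambda>n. nat \<lceil>ln (real n) / a\<rceil>) at_top sequentially"
    by (rule filterlim_at_top_mono[OF fl]) (intro always_eventually allI nat_mono, linarith)
qed

lemma inverse_ln_tendsto: "(\<lambda>n. 1 / ln (real n)) \<longlonglongrightarrow> 0"
  using tendsto_inverse_0_at_top[OF filterlim_compose[OF ln_at_top filterlim_real_sequentially]] by (simp add: inverse_eq_divide)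

context rl_process
begin

text \<open>Uses the largest m with exp ((\<alpha> + \<kappa>) m) \<le> n. The rounding stays
  visible as the term 1 / ln n, which disappears in the limit. The existence of some code is
  recorded because the lower bound needs it.\<close>

lemma quant_sq_upper:
  assumes \<kappa>: "\<kappa> > 0"
  shows "eventually (\<lambda>n. (\<exists>v. codeable M (\<lambda>w t. X t w) (real n) v) \<and>
    (quant_error M X n)\<^sup>2 * ln (real n) powr (2 * \<alpha> - 1) \<le> (1 + \<kappa>) * rconst \<alpha> * (1 / (\<alpha> + \<kappa>) - 1 / ln (real n)) powr (1 - 2 * \<alpha>)) sequentially"
proof -
  have a: "\<alpha> + \<kappa> > 0" using \<alpha> \<kappa> by simp
  have K: "rconst \<alpha> > 0" by (rule rconst_pos[OF \<alpha>])
  note ev1 = eventually_compose_filterlim[OF X_codeable[OF \<kappa>] ln_over_floor_at_top(1)[OF a]]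
  have "filterlim (\<lambda>n. ln (real n)) at_top sequentially" by (rule filterlim_compose[OF ln_at_top filterlim_real_sequentially])
  then have ev2: "eventually (\<lambda>n. \<alpha> + \<kappa> < ln (real n)) sequentially" by (simp add: filterlim_at_top_dense)
  show ?thesis using ev1 ev2 eventually_ge_at_top[of 1]
  proof eventually_elim
    case (elim n)
    define l where "l = ln (real n)"
    define m where "m = nat \<lfloor>l / (\<alpha> + \<kappa>)\<rfloor>"
    have l: "l > \<alpha> + \<kappa>" "l > 0" unfolding l_def using elim(2) a by linarith+
    have l1: "l / (\<alpha> + \<kappa>) > 1" using l a by simp
    have m: "real m \<le> l / (\<alpha> + \<kappa>)" "l / (\<alpha> + \<kappa>) - 1 \<le> real m" unfolding m_def using l1 by linarith+
    define y where "y = 1 / (\<alpha> + \<kappa>) - 1 / l"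
    have y: "y > 0" unfolding y_def using l a by (simp add: divide_strict_left_mono)
    have ly: "l / (\<alpha> + \<kappa>) - 1 = l * y" using l by (simp add: y_def right_diff_distrib)
    have "(\<alpha> + \<kappa>) * real m \<le> l" using m(1) a by (simp add: le_divide_eq mult.commute)
    then have "exp ((\<alpha> + \<kappa>) * real m) \<le> exp l" by simp
    also have "exp l = real n" using elim by (simp add: l_def)
    finally have nm: "exp ((\<alpha> + \<kappa>) * real m) \<le> real n" .
    have c: "codeable M (\<lambda>w t. X t w) (real n) ((1 + \<kappa>) * rconst \<alpha> * real m powr (1 - 2 * \<alpha>))"
      using elim(1) unfolding l_def[symmetric] m_def[symmetric] by (rule codeable_mono[OF _ nm order_refl])
    then have "(quant_error M X n)\<^sup>2 \<le> (1 + \<kappa>) * rconst \<alpha> * real m powr (1 - 2 * \<alpha>)" using \<kappa> K by (intro quant_error_upper) auto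
    also have "\<dots> \<le> (1 + \<kappa>) * rconst \<alpha> * (l * y) powr (1 - 2 * \<alpha>)"
      using m(2) ly l y \<alpha> \<kappa> K by (intro mult_left_mono powr_mono2') auto
    also have "(l * y) powr (1 - 2 * \<alpha>) = l powr (1 - 2 * \<alpha>) * y powr (1 - 2 * \<alpha>)" using l y by (simp add: powr_mult)
    finally have "(quant_error M X n)\<^sup>2 * l powr (2 * \<alpha> - 1) \<le> (1 + \<kappa>) * rconst \<alpha> * (l powr (1 - 2 * \<alpha>) * y powr (1 - 2 * \<alpha>)) * l powr (2 * \<alpha> - 1)"
      by (intro mult_right_mono) auto
    also have "\<dots> = (1 + \<kappa>) * rconst \<alpha> * y powr (1 - 2 * \<alpha>) * (l powr (1 - 2 * \<alpha>) * l powr (2 * \<alpha> - 1))" by simp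
    also have "l powr (1 - 2 * \<alpha>) * l powr (2 * \<alpha> - 1) = 1" using l by (simp flip: powr_add)
    finally show ?case using c unfolding l_def y_def by auto
  qed
qed

lemma quant_sq_lower:
  assumes \<kappa>: "0 < \<kappa>" "\<kappa> < 1" "\<kappa> < \<alpha>"
  shows "eventually (\<lambda>n. (1 - \<kappa>) / (1 + \<kappa>) * rconst \<alpha> * (1 / (\<alpha> - \<kappa>) + 1 / ln (real n)) powr (1 - 2 * \<alpha>) \<le>
    (quant_error M X n)\<^sup>2 * ln (real n) powr (2 * \<alpha> - 1)) sequentially"
proof -
  have a: "\<alpha> - \<kappa> > 0" using \<kappa> by simp
  have K: "rconst \<alpha> > 0" by (rule rconst_pos[OF \<alpha>])
  note ev1 = eventually_compose_filterlim[OF X_lower[OF \<kappa>(1,2)] ln_over_floor_at_top(2)[OF a]]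
  have "filterlim (\<lambda>n. ln (real n)) at_top sequentially" by (rule filterlim_compose[OF ln_at_top filterlim_real_sequentially])
  then have ev2: "eventually (\<lambda>n. 0 < ln (real n)) sequentially" by (simp add: filterlim_at_top_dense)
  show ?thesis using ev1 ev2 quant_sq_upper[OF \<kappa>(1)] eventually_ge_at_top[of 1]
  proof eventually_elim
    case (elim n)
    define l where "l = ln (real n)"
    \<comment> \<open>Rounded up, so that a codebook of size n also has size at most exp ((\<alpha>
      - \<kappa>) d).\<close>
    define d where "d = nat \<lceil>l / (\<alpha> - \<kappa>)\<rceil>"
    have l: "l > 0" using elim by (simp add: l_def)
    have l1: "l / (\<alpha> - \<kappa>) > 0" using l a by simp
    have d: "l / (\<alpha> - \<kappa>) \<le> real d" "real d \<le> l / (\<alpha> - \<kappa>) + 1" unfolding d_def using l1 by linarith+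
    have d0: "real d > 0" using d l1 by linarith
    define y where "y = 1 / (\<alpha> - \<kappa>) + 1 / l"
    have y: "y > 0" unfolding y_def using l a by (simp add: add_pos_pos)
    have ly: "l / (\<alpha> - \<kappa>) + 1 = l * y" using l by (simp add: y_def distrib_left)
    have "l \<le> (\<alpha> - \<kappa>) * real d" using d(1) a by (simp add: divide_le_eq mult.commute)
    then have "exp l \<le> exp ((\<alpha> - \<kappa>) * real d)" by simp
    moreover have "exp l = real n" using elim by (simp add: l_def)
    ultimately have n: "real n \<le> exp ((\<alpha> - \<kappa>) * real d)" by simp
    have q: "(1 - \<kappa>) / (1 + \<kappa>) * rconst \<alpha> * real d powr (1 - 2 * \<alpha>) \<le> (quant_error M X n)\<^sup>2"
    proof -
      obtain v0 where v0: "codeable M (\<lambda>w t. X t w) (real n) v0" using elim(3) by blast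
      show ?thesis
      proof (rule quant_error_lower[OF v0])
        show "0 \<le> (1 - \<kappa>) / (1 + \<kappa>) * rconst \<alpha> * real d powr (1 - 2 * \<alpha>)" using \<kappa> K by auto
        fix v :: real assume v: "v \<ge> 0" "codeable M (\<lambda>w t. X t w) (real n) v"
        have "codeable M (\<lambda>w t. X t w) (exp ((\<alpha> - \<kappa>) * real d)) v" using v(2) n by (rule codeable_mono) simp
        then have "(1 - \<kappa>) * rconst \<alpha> * real d powr (1 - 2 * \<alpha>) \<le> (1 + \<kappa>) * v" using elim(1) v(1) unfolding d_def l_def by blast
        then show "(1 - \<kappa>) / (1 + \<kappa>) * rconst \<alpha> * real d powr (1 - 2 * \<alpha>) \<le> v" using \<kappa> by (simp add: divide_le_eq mult.commute)
      qed
    qed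
    have "(1 - \<kappa>) / (1 + \<kappa>) * rconst \<alpha> * (l * y) powr (1 - 2 * \<alpha>) \<le> (1 - \<kappa>) / (1 + \<kappa>) * rconst \<alpha> * real d powr (1 - 2 * \<alpha>)"
      using d ly d0 \<alpha> \<kappa> K by (intro mult_left_mono powr_mono2') auto
    also note q
    also have "(l * y) powr (1 - 2 * \<alpha>) = l powr (1 - 2 * \<alpha>) * y powr (1 - 2 * \<alpha>)" using l y by (simp add: powr_mult)
    finally have "(1 - \<kappa>) / (1 + \<kappa>) * rconst \<alpha> * (l powr (1 - 2 * \<alpha>) * y powr (1 - 2 * \<alpha>)) * l powr (2 * \<alpha> - 1) \<le> (quant_error M X n)\<^sup>2 * l powr (2 * \<alpha> - 1)"
      by (intro mult_right_mono) auto
    also have "(1 - \<kappa>) / (1 + \<kappa>) * rconst \<alpha> * (l powr (1 - 2 * \<alpha>) * y powr (1 - 2 * \<alpha>)) * l powr (2 * \<alpha> - 1) =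
      (1 - \<kappa>) / (1 + \<kappa>) * rconst \<alpha> * y powr (1 - 2 * \<alpha>) * (l powr (1 - 2 * \<alpha>) * l powr (2 * \<alpha> - 1))" by simp
    also have "l powr (1 - 2 * \<alpha>) * l powr (2 * \<alpha> - 1) = 1" using l by (simp flip: powr_add)
    finally show ?case unfolding l_def y_def by simp
  qed
qed

text \<open>For a given strict bound a, one fixed \<kappa> near 0 suffices: the limiting constants
  of the two estimates are continuous in \<kappa> and agree at \<kappa> = 0. Then n tends to
  infinity with this \<kappa> held fixed.\<close>

lemma quant_sq_tendsto: "(\<lambda>n. (quant_error M X n)\<^sup>2 * ln (real n) powr (2 * \<alpha> - 1)) \<longlonglongrightarrow> rconst \<alpha> * \<alpha> powr (2 * \<alpha> - 1)"
proof (rule order_tendstoI)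
  have inv: "(1 / x) powr (1 - 2 * \<alpha>) = x powr (2 * \<alpha> - 1)" if "x > 0" for x
    using that powr_minus_divide[of x "1 - 2 * \<alpha>"] by (simp add: powr_divide)
  fix a assume a: "rconst \<alpha> * \<alpha> powr (2 * \<alpha> - 1) < a"
  have "((\<lambda>\<kappa>. (1 + \<kappa>) * rconst \<alpha> * (\<alpha> + \<kappa>) powr (2 * \<alpha> - 1)) \<longlongrightarrow> (1 + 0) * rconst \<alpha> * (\<alpha> + 0) powr (2 * \<alpha> - 1)) (at_right 0)"
    using \<alpha> by (intro tendsto_intros) auto
  then have "eventually (\<lambda>\<kappa>. (1 + \<kappa>) * rconst \<alpha> * (\<alpha> + \<kappa>) powr (2 * \<alpha> - 1) < a) (at_right 0)"
    using a by (intro order_tendstoD(2)) auto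
  moreover have "eventually (\<lambda>\<kappa>::real. 0 < \<kappa>) (at_right 0)" by (rule eventually_at_right_less)
  ultimately have "eventually (\<lambda>\<kappa>. 0 < \<kappa> \<and> (1 + \<kappa>) * rconst \<alpha> * (\<alpha> + \<kappa>) powr (2 * \<alpha> - 1) < a) (at_right 0)" by eventually_elim simp
  then obtain \<kappa> where \<kappa>: "0 < \<kappa>" "(1 + \<kappa>) * rconst \<alpha> * (\<alpha> + \<kappa>) powr (2 * \<alpha> - 1) < a"
    using eventually_happens'[OF trivial_limit_at_right_real] by blast
  have "(\<lambda>n. (1 + \<kappa>) * rconst \<alpha> * (1 / (\<alpha> + \<kappa>) - 1 / ln (real n)) powr (1 - 2 * \<alpha>)) \<longlonglongrightarrow> (1 + \<kappa>) * rconst \<alpha> * (1 / (\<alpha> + \<kappa>) - 0) powr (1 - 2 * \<alpha>)"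
    using \<alpha> \<kappa> by (intro tendsto_intros inverse_ln_tendsto) auto
  then have "eventually (\<lambda>n. (1 + \<kappa>) * rconst \<alpha> * (1 / (\<alpha> + \<kappa>) - 1 / ln (real n)) powr (1 - 2 * \<alpha>) < a) sequentially"
    using \<kappa> \<alpha> inv[of "\<alpha> + \<kappa>"] by (intro order_tendstoD(2)) auto
  with quant_sq_upper[OF \<kappa>(1)] show "eventually (\<lambda>n. (quant_error M X n)\<^sup>2 * ln (real n) powr (2 * \<alpha> - 1) < a) sequentially"
    by eventually_elim linarith
next
  have inv: "(1 / x) powr (1 - 2 * \<alpha>) = x powr (2 * \<alpha> - 1)" if "x > 0" for x
    using that powr_minus_divide[of x "1 - 2 * \<alpha>"] by (simp add: powr_divide)
  fix a assume a: "a < rconst \<alpha> * \<alpha> powr (2 * \<alpha> - 1)"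
  have "((\<lambda>\<kappa>. (1 - \<kappa>) / (1 + \<kappa>) * rconst \<alpha> * (\<alpha> - \<kappa>) powr (2 * \<alpha> - 1)) \<longlongrightarrow> (1 - 0) / (1 + 0) * rconst \<alpha> * (\<alpha> - 0) powr (2 * \<alpha> - 1)) (at_right 0)"
    using \<alpha> by (intro tendsto_intros) auto
  then have "eventually (\<lambda>\<kappa>. a < (1 - \<kappa>) / (1 + \<kappa>) * rconst \<alpha> * (\<alpha> - \<kappa>) powr (2 * \<alpha> - 1)) (at_right 0)"
    using a by (intro order_tendstoD(1)) auto
  moreover have "eventually (\<lambda>\<kappa>::real. \<kappa> \<in> {0<..<min 1 \<alpha>}) (at_right 0)" using \<alpha> by (intro eventually_at_right_real) simp
  ultimately have "eventually (\<lambda>\<kappa>. 0 < \<kappa> \<and> \<kappa> < 1 \<and> \<kappa> < \<alpha> \<and> a < (1 - \<kappa>) / (1 + \<kappa>) * rconst \<alpha> * (\<alpha> - \<kappa>) powr (2 * \<alpha> - 1)) (at_right 0)"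
    by eventually_elim simp
  then obtain \<kappa> where \<kappa>: "0 < \<kappa>" "\<kappa> < 1" "\<kappa> < \<alpha>" "a < (1 - \<kappa>) / (1 + \<kappa>) * rconst \<alpha> * (\<alpha> - \<kappa>) powr (2 * \<alpha> - 1)"
    using eventually_happens'[OF trivial_limit_at_right_real] by blast
  have "(\<lambda>n. (1 - \<kappa>) / (1 + \<kappa>) * rconst \<alpha> * (1 / (\<alpha> - \<kappa>) + 1 / ln (real n)) powr (1 - 2 * \<alpha>)) \<longlonglongrightarrow> (1 - \<kappa>) / (1 + \<kappa>) * rconst \<alpha> * (1 / (\<alpha> - \<kappa>) + 0) powr (1 - 2 * \<alpha>)"
    using \<alpha> \<kappa> by (intro tendsto_intros inverse_ln_tendsto) auto
  then have "eventually (\<lambda>n. a < (1 - \<kappa>) / (1 + \<kappa>) * rconst \<alpha> * (1 / (\<alpha> - \<kappa>) + 1 / ln (real n)) powr (1 - 2 * \<alpha>)) sequentially"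
    using \<kappa> \<alpha> inv[of "\<alpha> - \<kappa>"] by (intro order_tendstoD(1)) auto
  with quant_sq_lower[OF \<kappa>(1-3)] show "eventually (\<lambda>n. a < (quant_error M X n)\<^sup>2 * ln (real n) powr (2 * \<alpha> - 1)) sequentially"
    by eventually_elim linarith
qed

lemma quant_error_tendsto:
  "(\<lambda>n. quant_error M X n * ln (real n) powr (\<alpha> - 1/2)) \<longlonglongrightarrow> pi powr (- \<alpha>) * \<alpha> powr (\<alpha> - 1/2) * sqrt (2 * \<alpha> / (2 * \<alpha> - 1)) * Gamma \<alpha>"
proof -
  have G: "Gamma \<alpha> > 0" using \<alpha> by (intro Gamma_real_pos) simp
  have sp: "sqrt (x powr (2 * \<alpha> - 1)) = x powr (\<alpha> - 1/2)" if "x \<ge> 0" for x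
  proof -
    have "(x powr (\<alpha> - 1/2))\<^sup>2 = x powr (2 * \<alpha> - 1)" by (simp add: power2_eq_square flip: powr_add)
    then show ?thesis by (metis abs_of_nonneg powr_ge_zero real_sqrt_abs)
  qed
  have "(\<lambda>n. sqrt ((quant_error M X n)\<^sup>2 * ln (real n) powr (2 * \<alpha> - 1))) \<longlonglongrightarrow> sqrt (rconst \<alpha> * \<alpha> powr (2 * \<alpha> - 1))"
    by (intro tendsto_real_sqrt quant_sq_tendsto)
  moreover have "sqrt (rconst \<alpha> * \<alpha> powr (2 * \<alpha> - 1)) = pi powr (- \<alpha>) * \<alpha> powr (\<alpha> - 1/2) * sqrt (2 * \<alpha> / (2 * \<alpha> - 1)) * Gamma \<alpha>"
  proof -
    have p: "(pi powr (- \<alpha>))\<^sup>2 = pi powr (- 2 * \<alpha>)" "(\<alpha> powr (\<alpha> - 1/2))\<^sup>2 = \<alpha> powr (2 * \<alpha> - 1)"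
      by (simp_all add: power2_eq_square flip: powr_add)
    have r: "(sqrt (2 * \<alpha> / (2 * \<alpha> - 1)))\<^sup>2 = 2 * \<alpha> / (2 * \<alpha> - 1)" using \<alpha> by (intro real_sqrt_pow2) simp
    have "(pi powr (- \<alpha>) * \<alpha> powr (\<alpha> - 1/2) * sqrt (2 * \<alpha> / (2 * \<alpha> - 1)) * Gamma \<alpha>)\<^sup>2 = rconst \<alpha> * \<alpha> powr (2 * \<alpha> - 1)"
      unfolding power_mult_distrib p r rconst_def sigc_def by (simp only: mult_ac)
    then show ?thesis by (rule real_sqrt_unique) (use G \<alpha> in auto)
  qed
  moreover have "sqrt ((quant_error M X n)\<^sup>2 * ln (real n) powr (2 * \<alpha> - 1)) = quant_error M X n * ln (real n) powr (\<alpha> - 1/2)" for n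
  proof -
    have "ln (real n) \<ge> 0" by (cases n) auto
    moreover have "quant_error M X n \<ge> 0" by (simp add: quant_error_def)
    ultimately show ?thesis by (simp add: real_sqrt_mult sp)
  qed
  ultimately show ?thesis by simp
qed

end

theorem theorem3:
  fixes M :: "'a measure" and W X :: "real \<Rightarrow> 'a \<Rightarrow> real" and \<rho> :: real
  assumes "prob_space M"
    and "\<rho> > 0"
    and "brownian_motion M W"
    and "\<forall>\<omega>\<in>space M. continuous_on {0..1} (\<lambda>t. X t \<omega>)"
    and "\<forall>t\<in>{0..1}. wiener_integral M W (\<lambda>s. (t - s) powr (\<rho> - 1/2)) 0 t (X t)"
  shows "(\<lambda>n. quant_error M X n) \<sim>[at_top]
    (\<lambda>n. pi powr (-(\<rho> + 1/2)) * (\<rho> + 1/2) powr \<rho> * sqrt ((2*\<rho> + 1) / (2*\<rho>))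
          * Gamma (\<rho> + 1/2) * ln (real n) powr (-\<rho>))"
proof (rule asymp_equivI')
  \<comment> \<open>With \<alpha> = \<rho> + 1/2 the kernel exponent \<alpha> - 1 is \<rho> - 1/2,
    the power \<alpha> - 1/2 of the logarithm is \<rho>, and 2 \<alpha> / (2 \<alpha> - 1) is (2
    \<rho> + 1) / (2 \<rho>).\<close>
  have e: "\<rho> + 1/2 - 1 = \<rho> - 1/2" "\<rho> + 1/2 - 1/2 = \<rho>" "2 * (\<rho> + 1/2) = 2 * \<rho> + 1" "2 * \<rho> + 1 - 1 = 2 * \<rho>" by auto
  interpret prob_space M by fact
  interpret rl_process M W X "\<rho> + 1/2"
    by unfold_locales (use assms in \<open>auto simp only: e add_pos_pos\<close>)
  define C where "C = pi powr (-(\<rho> + 1/2)) * (\<rho> + 1/2) powr \<rho> * sqrt ((2*\<rho> + 1) / (2*\<rho>)) * Gamma (\<rho> + 1/2)"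
  have "Gamma (\<rho> + 1/2) > 0" using assms by (intro Gamma_real_pos) simp
  then have C: "C > 0" unfolding C_def using assms by (intro mult_pos_pos) auto
  have "(\<lambda>n. quant_error M X n * ln (real n) powr \<rho>) \<longlonglongrightarrow> C"
    using quant_error_tendsto unfolding C_def e .
  then have "(\<lambda>n. quant_error M X n * ln (real n) powr \<rho> / C) \<longlonglongrightarrow> C / C" using C by (intro tendsto_divide tendsto_const) auto
  then have "(\<lambda>n. quant_error M X n / (C * ln (real n) powr (-\<rho>))) \<longlonglongrightarrow> 1" using C by (simp add: powr_minus field_simps)
  then show "(\<lambda>n. quant_error M X n / (pi powr (-(\<rho> + 1/2)) * (\<rho> + 1/2) powr \<rho> * sqrt ((2*\<rho> + 1) / (2*\<rho>))
          * Gamma (\<rho> + 1/2) * ln (real n) powr (-\<rho>))) \<longlonglongrightarrow> 1" unfolding C_def .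
qed

end
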